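(* Let $t>0$, suppose that the unperturbed Markov jump process is stationary with initial (invariant) distribution $\pi$, and that the bounded measurable function $g:[0,t]\times\mathcal X\times\mathcal X\to\mathbb R$ satisfies Condition $C[\pi,t]$. Then the following holds. (1) If $v:\mathcal X\to\mathbb R$ is measurable with $v(X_t)\in L^p(\mathbb P_\pi)$ for some $p\in(1,+\infty]$, then $$\partial_{\lambda=0}\mathbb E_\pi[v(X^\lambda_t)]=\int_0^tds\,\mathbb E_\pi[v(X_t)\psi_{t-s}(X_{t-s})]=\int_0^tds\,\mathbb E_\pi[v(X_s)\psi_{t-s}(X_0)].$$ (2) If $v:[0,t]\times\mathcal X\to\mathbb R$ is measurable with $\int_0^t\|v(s,X_s)\|_{L^p(\mathbb P_\pi)}ds<+\infty$ for some $p\in(1,+\infty]$, then $$\partial_{\lambda=0}\mathbb E_\pi\Big[\int_0^tv(s,X^\lambda_s)ds\Big]=\int_0^tds\int_0^sdu\,\mathbb E_\pi[v(s,X_s)\psi_{s-u}(X_{s-u})].$$ (3) If $F(\xi_{[0,t]})=\sum_{s\in(0,t]}\alpha(s,\xi_{s-},\xi_s)$ with $\alpha:[0,t]\times\mathcal X\times\mathcal X\to\mathbb R$ measurable and such that $\sum_{s\in(0,t]}|\alpha(s,X_{s-},X_s)|$ and $\int_0^t|\alpha|_r(s,X_s)ds$ belong to $L^p(\mathbb P_\pi)$ for some $p\in(1,+\infty]$, then $$\partial_{\lambda=0}\mathbb E_\pi[F(X^\lambda_{[0,t]})]=\int_0^t\mathbb E_\pi[(\alpha g)_r(s,X_s)]ds+\int_0^tds\int_0^sdu\,\mathbb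 E_\pi[\alpha_r(s,X_s)\psi_{s-u}(X_{s-u})].$$ If, in particular, $g(s,x,y)=\tau(s)E(x,y)$ (decoupled case), then, with $E^*(x,y):=E(y,x)$ and under the corresponding hypotheses of (1), (2), (3), $$\partial_{\lambda=0}\mathbb E_\pi[v(X^\lambda_t)]=\int_0^tds\,\tau(t-s)\,\mathbb E_\pi\big[v(X_s)\big(E^*_{r^*}(X_0)-E_r(X_0)\big)\big],$$ $$\partial_{\lambda=0}\mathbb E_\pi\Big[\int_0^tv(s,X^\lambda_s)ds\Big]=\int_0^tds\int_0^sdu\,\tau(s-u)\,\mathbb E_\pi\big[v(s,X_u)\big(E^*_{r^*}(X_0)-E_r(X_0)\big)\big],$$ $$\partial_{\lambda=0}\mathbb E_\pi[F(X^\lambda_{[0,t]})]=\int_0^tds\,\tau(s)\,\mathbb E_\pi[(\alpha E)_r(s,X_s)]+\int_0^tds\int_0^sdu\,\tau(s-u)\,\mathbb E_\pi\big[\alpha_r(s,X_u)\big(E^*_{r^*}(X_0)-E_r(X_0)\big)\big].$$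
   Context: Unperturbed process. $(\mathcal X,\mathcal B)$ is a measurable space whose singletons are measurable. $r(x,dy)$ is a transition kernel: for every $x\in\mathcal X$, $r(x,\cdot)$ is a measure on $(\mathcal X,\mathcal B)$ with total mass $\hat r(x):=r(x,\mathcal X)\in(0,+\infty)$ and $r(x,\{x\})=0$; for every $B\in\mathcal B$ the map $x\mapsto r(x,B)$ is measurable. The unperturbed Markov jump process $(X_s)_{s\ge0}$, once at $x$, waits an exponential time of parameter $\hat r(x)$ (independently from the rest) and then jumps to a point chosen with law $r(x,dy)/\hat r(x)$. Its initial distribution is a probability $\pi$ on $\mathcal X$ which is invariant, i.e. $(X_{s+T})_{s\ge0}$ has the same law as $(X_s)_{s\ge0}$ for all $T>0$. Standing assumption: the unperturbed process started from $\pi$ almost surely does not explode (no accumulation of jumps in finite time). $\mathbb P_\pi,\mathbb E_\pi$ denote probability and expectation with initial distribution $\pi$ (same symbols for the perturbed process). Time reversal. The stationary time-reversed process is again a non-explosive Markov jump process with initial distribution $\pi$ and transition kernel $r^*$ satisfying $\pi(dx)r(x,dy)=\pi(dy)r^*(y,dx)$ as measures on $\mathcal X\times\mathcal X$. Perturbed process. For $\lambda\in\mathbb R$ let $r^\lambda_s(x,dy):=e^{\lambda g(s,x,y)}r(x,dy)$ and $\hat r^\lambda_s(x):=r^\lambda_s(x,\mathcal X)$. The process $X^\lambda$ (on $[0,t]$) has $X^\lambda_0\sim\pi$; if it arrives at $x$ at time $s$ (or starts there, $s=0$), it stays at $x$ until a random time $\tau'$ with $P(\tau'>u)=\exp\{-\int_s^u\hat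 r^\lambda_w(x)\,dw\}$, $u\ge s$; given $\tau'=u$ it jumps at time $u$ to a point with law $r^\lambda_u(x,dy)/\hat r^\lambda_u(x)$, and so on. Under Condition $C[\pi,t]$ for $g$ it almost surely does not explode in $[0,t]$ for $\lambda$ close to $0$. Notation. For measurable $\alpha:[0,t]\times\mathcal X\times\mathcal X\to\mathbb R$, $\alpha_r(s,x):=\int_{\mathcal X}\alpha(s,x,y)r(x,dy)$, and $\alpha_{r^*}$ is defined in the same way with $r^*$ in place of $r$; $|\alpha|_r,(\alpha g)_r,(\alpha E)_r$ are contractions of $|\alpha|$, $\alpha g$, $\alpha E$; for a time-independent function $E(x,y)$ one writes $E_r(x)$, $E^*_{r^*}(x)$. $\alpha$ satisfies Condition $C[\pi,t]$ if $\mathbb E_\pi[\exp\{\theta\int_0^t|\alpha|_r(s,X_s)ds\}]<+\infty$ for some $\theta>0$. Sums $\sum_{s\in(0,t]}\alpha(s,\xi_{s-},\xi_s)$ run over the jump times of the path (those $s\in(0,t]$ with $\xi_{s-}\neq\xi_s$). Set $g^*(s,x,y):=g(s,y,x)$ and $$\psi_s(x):=\int_{\mathcal X}g(s,y,x)r^*(x,dy)-\int_{\mathcal X}g(s,x,y)r(x,dy)=g^*_{r^*}(s,x)-g_r(s,x).$$ $\partial_{\lambda=0}$ is the derivative in $\lambda$ at $\lambda=0$. *)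

theory Defs
  imports "HOL-Probability.Probability"
begin

section \<open>Kernels and contractions\<close>

definition jump_kernel :: "'a measure \<Rightarrow> ('a \<Rightarrow> 'a measure) \<Rightarrow> bool" where
  "jump_kernel S r \<longleftrightarrow>
     (\<forall>x\<in>space S. sets (r x) = sets S \<and> 0 < emeasure (r x) (space S) \<and>
        emeasure (r x) (space S) < \<top> \<and> emeasure (r x) {x} = 0) \<and>
     (\<forall>B\<in>sets S. (\<lambda>x. emeasure (r x) B) \<in> borel_measurable S)"

text \<open>Time reversal of kernels: \<open>\<pi>(dx) r(x,dy) = \<pi>(dy) r\<^sup>*(y,dx)\<close> as measures on the
  product space.\<close>

definition reversed_kernel ::
  "'a measure \<Rightarrow> 'a measure \<Rightarrow> ('a \<Rightarrow> 'a measure) \<Rightarrow> ('a \<Rightarrow> 'a measure) \<Rightarrow> bool" where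
  "reversed_kernel S \<pi> r rstar \<longleftrightarrow>
     (\<forall>A\<in>sets (S \<Otimes>\<^sub>M S).
        (\<integral>\<^sup>+x. (\<integral>\<^sup>+y. indicator A (x, y) \<partial>r x) \<partial>\<pi>) =
        (\<integral>\<^sup>+y. (\<integral>\<^sup>+x. indicator A (x, y) \<partial>rstar y) \<partial>\<pi>))"

text \<open>The contraction \<open>\<alpha>\<^sub>r(s,x)\<close> is \<open>contract r (\<alpha> s) x\<close>; \<open>abs_contract\<close> is
  \<open>|\<alpha>|\<^sub>r\<close>, with values in \<open>[0,\<infinity>]\<close>.\<close>

definition contract :: "('a \<Rightarrow> 'a measure) \<Rightarrow> ('a \<Rightarrow> 'a \<Rightarrow> real) \<Rightarrow> 'a \<Rightarrow> real" where
  "contract r f x = (\<integral>y. f x y \<partial>r x)"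

definition abs_contract :: "('a \<Rightarrow> 'a measure) \<Rightarrow> ('a \<Rightarrow> 'a \<Rightarrow> real) \<Rightarrow> 'a \<Rightarrow> ennreal" where
  "abs_contract r f x = (\<integral>\<^sup>+y. ennreal \<bar>f x y\<bar> \<partial>r x)"

definition psi :: "('a \<Rightarrow> 'a measure) \<Rightarrow> ('a \<Rightarrow> 'a measure) \<Rightarrow> (real \<Rightarrow> 'a \<Rightarrow> 'a \<Rightarrow> real) \<Rightarrow>
    real \<Rightarrow> 'a \<Rightarrow> real" where
  "psi r rstar g s x = contract rstar (\<lambda>x y. g s y x) x - contract r (g s) x"

definition tilted_kernel :: "('a \<Rightarrow> 'a measure) \<Rightarrow> (real \<Rightarrow> 'a \<Rightarrow> 'a \<Rightarrow> real) \<Rightarrow> real \<Rightarrow>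
    real \<Rightarrow> 'a \<Rightarrow> 'a measure" where
  "tilted_kernel r g lam s x = density (r x) (\<lambda>y. ennreal (exp (lam * g s x y)))"


section \<open>Jump processes\<close>

text \<open>A jump process is given by its jump times \<open>T\<close> (with \<open>T 0 = 0\<close>) and the states
  \<open>Z n\<close> occupied on \<open>[T n, T (n+1))\<close>. The \<open>\<sigma>\<close>-algebras below are generated by
  \<open>(T\<^sub>0, Z\<^sub>0), \<dots>, (T\<^sub>n, Z\<^sub>n)\<close>, and by these together with \<open>T\<^sub>n\<^sub>+\<^sub>1\<close>.\<close>

definition history :: "'w measure \<Rightarrow> 'a measure \<Rightarrow> (nat \<Rightarrow> 'w \<Rightarrow> real) \<Rightarrow> (nat \<Rightarrow> 'w \<Rightarrow> 'a) \<Rightarrow>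
    nat \<Rightarrow> 'w measure" where
  "history M S T Z n = vimage_algebra (space M)
     (\<lambda>\<omega>. \<lambda>i\<in>{..n}. (T i \<omega>, Z i \<omega>)) (\<Pi>\<^sub>M i\<in>{..n}. borel \<Otimes>\<^sub>M S)"

definition pre_jump_history :: "'w measure \<Rightarrow> 'a measure \<Rightarrow> (nat \<Rightarrow> 'w \<Rightarrow> real) \<Rightarrow>
    (nat \<Rightarrow> 'w \<Rightarrow> 'a) \<Rightarrow> nat \<Rightarrow> 'w measure" where
  "pre_jump_history M S T Z n = vimage_algebra (space M)
     (\<lambda>\<omega>. (\<lambda>i\<in>{..n}. (T i \<omega>, Z i \<omega>), T (Suc n) \<omega>)) ((\<Pi>\<^sub>M i\<in>{..n}. borel \<Otimes>\<^sub>M S) \<Otimes>\<^sub>M borel)"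

text \<open>\<open>I\<close> is the time window, \<open>{0..}\<close> or \<open>{0..t}\<close>, on which the process is observed: the rates
  \<open>q s x\<close> matter only for \<open>s \<in> I\<close>, and nothing is prescribed about jumps outside \<open>I\<close>; for
  \<open>I = {0..t}\<close>, \<open>T n > t\<close> just means that at most \<open>n - 1\<close> jumps occur in \<open>[0,t]\<close>.
  Explosion is allowed. The jump times are those of genuine jumps, \<open>Z n \<noteq> Z (n+1)\<close>; this has
  to be part of the notion of a path, because when the diagonal of \<open>S \<Otimes>\<^sub>M S\<close> is not measurable
  it is not implied by \<open>r(x,{x}) = 0\<close>.\<close>

locale jump_process = prob_space M
  for M :: "'w measure"
    and S :: "'a measure"
    and I :: "real set"
    and q :: "real \<Rightarrow> 'a \<Rightarrow> 'a measure"
    and \<pi> :: "'a measure"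
    and T :: "nat \<Rightarrow> 'w \<Rightarrow> real"
    and Z :: "nat \<Rightarrow> 'w \<Rightarrow> 'a" +
  assumes measurable_T: "\<And>n. T n \<in> borel_measurable M"
    and measurable_Z: "\<And>n. Z n \<in> measurable M S"
    and T_0: "\<And>\<omega>. \<omega> \<in> space M \<Longrightarrow> T 0 \<omega> = 0"
    and T_Suc: "\<And>n \<omega>. \<omega> \<in> space M \<Longrightarrow> T n \<omega> < T (Suc n) \<omega>"
    and Z_Suc: "\<And>n \<omega>. \<omega> \<in> space M \<Longrightarrow> T (Suc n) \<omega> \<in> I \<Longrightarrow> Z (Suc n) \<omega> \<noteq> Z n \<omega>"
    and initial_law: "distr M S (Z 0) = \<pi>"
    and waiting_time: "\<And>n u. u \<in> I \<Longrightarrow>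
      AE \<omega> in M. T n \<omega> \<le> u \<longrightarrow>
        real_cond_exp M (history M S T Z n) (indicator {\<omega>\<in>space M. u < T (Suc n) \<omega>}) \<omega> =
        exp (- (LINT w:{T n \<omega>..u}|lborel. measure (q w (Z n \<omega>)) (space S)))"
    and jump_law: "\<And>n C. C \<in> sets S \<Longrightarrow>
      AE \<omega> in M. T (Suc n) \<omega> \<in> I \<longrightarrow>
        real_cond_exp M (pre_jump_history M S T Z n) (indicator {\<omega>\<in>space M. Z (Suc n) \<omega> \<in> C}) \<omega> =
        measure (q (T (Suc n) \<omega>) (Z n \<omega>)) C / measure (q (T (Suc n) \<omega>) (Z n \<omega>)) (space S)"

text \<open>After an explosion the path is put at \<open>Z 0\<close>, an arbitrary choice that keeps it in the state
  space.\<close>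

definition jump_path :: "(nat \<Rightarrow> 'w \<Rightarrow> real) \<Rightarrow> (nat \<Rightarrow> 'w \<Rightarrow> 'a) \<Rightarrow> real \<Rightarrow> 'w \<Rightarrow> 'a" where
  "jump_path T Z s \<omega> =
     (if \<exists>n. s < T (Suc n) \<omega> then Z (LEAST n. s < T (Suc n) \<omega>) \<omega> else Z 0 \<omega>)"

definition nonexplosive :: "'w measure \<Rightarrow> (nat \<Rightarrow> 'w \<Rightarrow> real) \<Rightarrow> bool" where
  "nonexplosive M T \<longleftrightarrow> (AE \<omega> in M. filterlim (\<lambda>n. T n \<omega>) at_top sequentially)"

definition stationary :: "'w measure \<Rightarrow> 'a measure \<Rightarrow> (real \<Rightarrow> 'w \<Rightarrow> 'a) \<Rightarrow> bool" where
  "stationary M S X \<longleftrightarrow> (\<forall>h>0.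
     distr M (\<Pi>\<^sub>M s\<in>{0..}. S) (\<lambda>\<omega>. \<lambda>s\<in>{0..}. X (s + h) \<omega>) =
     distr M (\<Pi>\<^sub>M s\<in>{0..}. S) (\<lambda>\<omega>. \<lambda>s\<in>{0..}. X s \<omega>))"

text \<open>No topology on the state space is involved: a path of a jump process is eventually constant
  to the left of each time, and \<open>\<xi>\<^sub>s\<^sub>-\<close> is that constant. A sum over an infinite set of jump times
  (explosion in \<open>[0,t]\<close>) is \<open>0\<close> by convention.\<close>

definition left_value :: "(real \<Rightarrow> 'a) \<Rightarrow> real \<Rightarrow> 'a" where
  "left_value \<xi> s = (THE x. eventually (\<lambda>u. \<xi> u = x) (at_left s))"

definition jump_sum :: "real \<Rightarrow> (real \<Rightarrow> 'a \<Rightarrow> 'a \<Rightarrow> real) \<Rightarrow> (real \<Rightarrow> 'a) \<Rightarrow> real" where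
  "jump_sum t \<alpha> \<xi> = (\<Sum>s\<in>{s\<in>{0<..t}. left_value \<xi> s \<noteq> \<xi> s}. \<alpha> s (left_value \<xi> s) (\<xi> s))"


section \<open>Integrability\<close>

text \<open>\<open>E[exp(\<theta> \<integral>\<^sub>0\<^sup>t |\<alpha>|\<^sub>r(s,X\<^sub>s) ds)] < \<infinity>\<close> for some \<open>\<theta> > 0\<close>. The exponent takes values in
  \<open>[0,\<infinity>]\<close>, and \<open>exp \<infinity> = \<infinity>\<close>; hence the separate requirement that it is a.s. finite.\<close>

definition condition_C :: "'w measure \<Rightarrow> (real \<Rightarrow> 'w \<Rightarrow> 'a) \<Rightarrow> ('a \<Rightarrow> 'a measure) \<Rightarrow> real \<Rightarrow>
    (real \<Rightarrow> 'a \<Rightarrow> 'a \<Rightarrow> real) \<Rightarrow> bool" where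
  "condition_C M X r t \<alpha> \<longleftrightarrow>
     (let A = (\<lambda>\<omega>. \<integral>\<^sup>+s\<in>{0..t}. abs_contract r (\<alpha> s) (X s \<omega>) \<partial>lborel) in
      (AE \<omega> in M. A \<omega> < \<top>) \<and>
      (\<exists>\<theta>>0. (\<integral>\<^sup>+\<omega>. ennreal (exp (\<theta> * enn2real (A \<omega>))) \<partial>M) < \<top>))"

definition ennreal_powr :: "ennreal \<Rightarrow> real \<Rightarrow> ennreal" where
  "ennreal_powr x a = (if x = \<top> then \<top> else ennreal (enn2real x powr a))"

text \<open>The \<open>L\<^sup>p\<close> norm of a nonnegative function; it is applied to absolute values.\<close>

definition Lp_norm :: "'w measure \<Rightarrow> ennreal \<Rightarrow> ('w \<Rightarrow> ennreal) \<Rightarrow> ennreal" where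
  "Lp_norm M p f =
     (if p = \<top> then esssup M f
      else ennreal_powr (\<integral>\<^sup>+\<omega>. ennreal_powr (f \<omega>) (enn2real p) \<partial>M) (1 / enn2real p))"

text \<open>Absolute convergence of the iterated integrals \<open>\<integral>\<^sub>0\<^sup>t ds E[f(s)]\<close> and
  \<open>\<integral>\<^sub>0\<^sup>t ds \<integral>\<^sub>0\<^sup>s du E[f(s,u)]\<close>. It is asserted along with each formula, since the Bochner
  integral of a non-integrable function is \<open>0\<close>.\<close>

definition time_integrable :: "real \<Rightarrow> 'w measure \<Rightarrow> (real \<Rightarrow> 'w \<Rightarrow> real) \<Rightarrow> bool" where
  "time_integrable t M f \<longleftrightarrow>
     integrable (restrict_space lborel {0..t} \<Otimes>\<^sub>M M) (\<lambda>(s, \<omega>). f s \<omega>)"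

definition triangle_integrable :: "real \<Rightarrow> 'w measure \<Rightarrow> (real \<Rightarrow> real \<Rightarrow> 'w \<Rightarrow> real) \<Rightarrow> bool" where
  "triangle_integrable t M f \<longleftrightarrow>
     integrable (restrict_space (lborel \<Otimes>\<^sub>M lborel) {(s, u). 0 \<le> u \<and> u \<le> s \<and> s \<le> t} \<Otimes>\<^sub>M M)
       (\<lambda>((s, u), \<omega>). f s u \<omega>)"

text \<open>\<open>\<partial>\<^sub>\<lambda>\<^sub>=\<^sub>0 E[Y\<^sup>\<lambda>] = D\<close> (\<open>lam\<close> stands for \<open>\<lambda>\<close>), where \<open>Y lam\<close> lives on
  the space \<open>M lam\<close>; it includes that the expectation exists for \<open>\<lambda>\<close> close to \<open>0\<close>.\<close>

definition has_linear_response ::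
  "(real \<Rightarrow> 'w measure) \<Rightarrow> (real \<Rightarrow> 'w \<Rightarrow> real) \<Rightarrow> real \<Rightarrow> bool" where
  "has_linear_response M Y D \<longleftrightarrow>
     (\<forall>\<^sub>F lam in nhds 0. integrable (M lam) (Y lam)) \<and>
     ((\<lambda>lam. \<integral>\<omega>. Y lam \<omega> \<partial>M lam) has_real_derivative D) (at 0)"

end

theory Submission
  imports Defs
begin

text \<open>On \<open>[0,s]\<close> the law of the perturbed process has a density \<open>D\<^sub>\<lambda>(s)\<close> with respect to that of the
  unperturbed one, namely the exponential of \<open>\<lambda>\<close> times the sum of \<open>g\<close> over the jumps minus the
  integrated excess rate \<open>\<integral>(e\<^sup>\<lambda>\<^sup>g - 1) dr\<close>. Condition C and the supermartingale bound
  \<open>E[D] \<le> 1\<close>, applied with \<open>|g|\<close> in place of \<open>g\<close>, give exponential moments of the sum of \<open>|g|\<close>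
  over the jumps, hence a dominating variable with finite moments of any prescribed order. This
  rules out explosions for small \<open>\<lambda>\<close> and allows differentiation under the expectation: the
  derivative of \<open>D\<^sub>\<lambda>(s)\<close> at \<open>0\<close> is the sum of \<open>g\<close> over the jumps minus \<open>\<integral>\<^sub>0\<^sup>s g\<^sub>r(u, X\<^sub>u) du\<close>. Given
  \<open>X\<^sub>s\<close>, the jumps before \<open>s\<close> are compensated by the reversed kernel, so the sum can be replaced by
  \<open>\<integral>\<^sub>0\<^sup>s g\<^sup>*\<^sub>r\<^sub>*(u, X\<^sub>u) du\<close>, and \<open>\<psi>\<close> appears. The sum over the jumps of the perturbed path in (3)
  has the same expectation as the time integral of \<open>\<alpha>\<close> contracted with the perturbed rates, so (3)
  is (2) with an integrand depending on \<open>\<lambda>\<close>.\<close>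

section \<open>Calculus and integration\<close>

text \<open>The processes are given only through conditional laws of the next jump, each valid
  almost surely for one fixed time or one fixed set. They are therefore turned into identities
  between integrals of nonnegative functions over a single step (\<open>one_step\<close>). Such
  identities need no integrability and, as they concern finitely many jumps, no absence of
  explosion. Statements about paths are sums of them over the number of jumps, restricted to paths
  that are \<open>alive\<close>.

  Neither the reversed process nor the process started from a point is constructed. The identity
  between the kernels is combined with \<open>semigroup\<close>, a series over the number of jumps,
  and with stationarity, which moves any time to 0.

  An observable in L^p has to be paired with a dominating variable that has a moment of conjugate
  order q. So the range |lambda| \<le> l on which the densities are dominated depends on p: l is
  chosen with 2 l q = \<theta>, where exp(\<theta> R) is the integrable variable of
  \<open>exponential_moment\<close>.\<close>

lemma borel_measurable_indicator_interval [measurable (raw)]: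
  fixes a b f :: "'x \<Rightarrow> real"
  assumes [measurable]: "a \<in> borel_measurable N" "b \<in> borel_measurable N" "f \<in> borel_measurable N"
  shows "(\<lambda>x. indicator {a x..b x} (f x) :: real) \<in> borel_measurable N"
    "(\<lambda>x. indicator {a x..b x} (f x) :: ennreal) \<in> borel_measurable N"
    "(\<lambda>x. indicator {a x..<b x} (f x) :: real) \<in> borel_measurable N"
    "(\<lambda>x. indicator {a x..<b x} (f x) :: ennreal) \<in> borel_measurable N"
    "(\<lambda>x. indicator {a x<..b x} (f x) :: ennreal) \<in> borel_measurable N"
    "(\<lambda>x. indicator {..b x} (f x) :: real) \<in> borel_measurable N"
    "(\<lambda>x. indicator {..b x} (f x) :: ennreal) \<in> borel_measurable N"
    "(\<lambda>x. indicator {b x<..} (f x) :: ennreal) \<in> borel_measurable N"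
  by (simp_all add: indicator_def)

text \<open>Rectangles are closed under intersection and include the whole space, so finiteness of
  \<open>\<mu>\<close> alone makes the generator argument work. This identifies joint laws of a
  history with the next jump time or the next state.\<close>

lemma measure_eqI_rectangles:
  assumes sets: "sets \<mu> = sets (N1 \<Otimes>\<^sub>M N2)" "sets \<nu> = sets (N1 \<Otimes>\<^sub>M N2)"
    and fin: "finite_measure \<mu>"
    and eq: "\<And>A B. A \<in> sets N1 \<Longrightarrow> B \<in> sets N2 \<Longrightarrow> emeasure \<mu> (A \<times> B) = emeasure \<nu> (A \<times> B)"
  shows "\<mu> = \<nu>"
proof (rule measure_eqI_generator_eq[OF Int_stable_pair_measure_generator,
      of N1 N2 "space N1 \<times> space N2" \<mu> \<nu> "\<lambda>_. space N1 \<times> space N2"])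
  show "{a \<times> b |a b. a \<in> sets N1 \<and> b \<in> sets N2} \<subseteq> Pow (space N1 \<times> space N2)"
    by (auto dest: sets.sets_into_space)
  show "emeasure \<mu> (space N1 \<times> space N2) \<noteq> \<infinity>" for i :: nat
    using finite_measure.emeasure_finite[OF fin] by simp
qed (use sets eq in \<open>auto simp: sets_pair_measure\<close>)

text \<open>As \<open>h\<close> is only measurable, differentiability is not available; but the sum of the survival
  function and the integral changes by \<open>O((s' - s)\<^sup>2)\<close> between \<open>s\<close> and \<open>s'\<close>, so it is constant.\<close>

lemma hazard_integral:
  fixes h :: "real \<Rightarrow> real"
  assumes [measurable]: "h \<in> borel_measurable borel"
    and h0: "\<And>s. 0 \<le> h s" and hC: "\<And>s. h s \<le> C" and ab: "a \<le> b"
  shows "(\<integral>\<^sup>+s. indicator {a..b} s * ennreal (h s * exp (- (LINT w:{a..s}|lborel. h w))) \<partial>lborel) =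
    ennreal (1 - exp (- (LINT w:{a..b}|lborel. h w)))"
proof -
  have C0: "0 \<le> C" using h0[of 0] hC[of 0] by linarith
  define H where "H u s = (LINT w:{u..s}|lborel. h w)" for u s
  have int: "set_integrable lborel {u..s} (\<lambda>w. h w * k w)"
    if [measurable]: "k \<in> borel_measurable borel" and k: "\<And>w. \<bar>k w\<bar> \<le> B" for u s B and k :: "real \<Rightarrow> real"
    unfolding set_integrable_def
  proof (rule integrableI_bounded_set_indicator[where B = "C * B"])
    have "\<bar>h x * k x\<bar> \<le> C * B" for x
      unfolding abs_mult using h0[of x] hC[of x] k[of x] by (intro mult_mono) auto
    then show "AE x in lborel. x \<in> {u..s} \<longrightarrow> norm (h x * k x) \<le> C * B" by auto
  qed (auto simp: emeasure_lborel_Icc_eq)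
  have inth: "set_integrable lborel {u..s} h" for u s
    using int[of "\<lambda>_. 1" 1 u s] by simp
  have intc: "set_integrable lborel {u..s} (\<lambda>_. c)" for u s c :: real
    unfolding set_integrable_def
    by (rule integrableI_bounded_set_indicator[where B = "\<bar>c\<bar>"]) (auto simp: emeasure_lborel_Icc_eq)
  have split: "(LINT w:{u..s'}|lborel. f w) = (LINT w:{u..s}|lborel. f w) + (LINT w:{s..s'}|lborel. f w)"
    if "u \<le> s" "s \<le> s'" and f: "\<And>u s. set_integrable lborel {u..s} f" for u s s' and f :: "real \<Rightarrow> real"
  proof -
    have "{u..s'} = {u..s} \<union> {s..s'}" using that by auto
    moreover have "AE x in lborel. \<not> (x \<in> {u..s} \<and> x \<in> {s..s'})"
      using AE_lborel_singleton[of s] by eventually_elim auto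
    ultimately show ?thesis
      using set_integral_Un_AE[of "{u..s}" "{s..s'}" lborel f] f by auto
  qed
  have H_bound: "0 \<le> H u s \<and> H u s \<le> C * (s - u)" if "u \<le> s" for u s
  proof
    show "0 \<le> H u s" unfolding H_def set_lebesgue_integral_def
      by (intro integral_nonneg_AE) (auto simp: h0)
    have "H u s \<le> (LINT w:{u..s}|lborel. C)" unfolding H_def
      by (intro set_integral_mono inth intc) (auto simp: hC)
    then show "H u s \<le> C * (s - u)" using that by (simp add: set_lebesgue_integral_def mult.commute)
  qed
  have H_nonneg: "0 \<le> H u s" for u s
    unfolding H_def set_lebesgue_integral_def by (intro integral_nonneg_AE) (auto simp: h0)
  have Hm[measurable]: "H u \<in> borel_measurable borel" for u
    unfolding H_def set_lebesgue_integral_def by measurable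
  define E where "E s = exp (- H a s)" for s
  have Em[measurable]: "E \<in> borel_measurable borel" unfolding E_def by measurable
  have E1: "0 \<le> E s \<and> E s \<le> 1" for s unfolding E_def using H_nonneg by auto
  have intE: "set_integrable lborel {u..s} (\<lambda>w. h w * E w)" for u s
    by (rule int[of _ 1]) (use E1 in auto)
  define J where "J s = E s + (LINT w:{a..s}|lborel. h w * E w)" for s
  have quad: "\<bar>J s' - J s\<bar> \<le> 2 * C^2 * (s' - s)^2" if "a \<le> s" "s \<le> s'" for s s'
  proof -
    define d where "d = H s s'"
    have d: "0 \<le> d" "d \<le> C * (s' - s)" using H_bound that by (auto simp: d_def)
    have Hs': "H a s' = H a s + d"
      unfolding H_def d_def using split[of a s s' h] that inth by auto
    have 0: "J s' - J s = E s' - E s + (LINT w:{s..s'}|lborel. h w * E w)"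
      unfolding J_def using split[of a s s' "\<lambda>w. h w * E w"] that intE by auto
    have 1: "(LINT w:{s..s'}|lborel. h w * E w) =
        (LINT w:{s..s'}|lborel. h w * (E w - E s)) + E s * d"
    proof -
      have "(LINT w:{s..s'}|lborel. h w * (E w - E s)) =
          (LINT w:{s..s'}|lborel. h w * E w) - (LINT w:{s..s'}|lborel. h w * E s)"
        unfolding right_diff_distrib
        by (rule set_integral_diff) (auto intro!: intE set_integrable_mult_left inth)
      then show ?thesis by (simp add: d_def H_def mult.commute)
    qed
    have 2: "E s' = E s * exp (- d)" unfolding E_def Hs' minus_add_distrib exp_add by (rule refl)
    have "j = e0 * (w - 1 + d) + y" if "j = e1 - e0 + x" "x = y + e0 * d" "e1 = e0 * w"
      for j e0 e1 x y w d :: real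
      using that by (simp add: algebra_simps)
    \<comment> \<open>With \<open>d\<close> the hazard accumulated on \<open>{s..s'}\<close>, both
      summands are of second order: the first is a Taylor remainder in \<open>d\<close>, the second
      contains the variation of \<open>E\<close> over the interval as a factor.\<close>
    from this[OF 0 1 2] have eq: "J s' - J s = E s * (exp (- d) - 1 + d) + (LINT w:{s..s'}|lborel. h w * (E w - E s))" .
    have ed: "\<bar>exp (- d) - 1 + d\<bar> \<le> d^2"
    proof -
      have "1 - d \<le> exp (- d)" using exp_ge_add_one_self[of "- d"] by simp
      moreover have "exp (- d) \<le> 1 - d + d^2"
      proof (cases "d \<le> 1")
        case True
        have "exp (- d) \<le> 1 / (1 + d)"
          using exp_ge_add_one_self[of d] d by (simp add: exp_minus field_simps)
        \<comment> \<open>Because (1 + d)(1 - d + d^2) = 1 + d^3.\<close>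
        also have "\<dots> \<le> 1 - d + d^2"
          using d by (simp add: field_simps power2_eq_square)
        finally show ?thesis .
      next
        case False
        then have "d \<le> d^2" by (simp add: power2_eq_square)
        moreover have "exp (- d) \<le> 1" using d by simp
        ultimately show ?thesis by linarith
      qed
      ultimately show ?thesis by (simp add: abs_le_iff)
    qed
    have "\<bar>LINT w:{s..s'}|lborel. h w * (E w - E s)\<bar> \<le> (LINT w:{s..s'}|lborel. C * (C * (s' - s)))"
    proof -
      have i: "set_integrable lborel {s..s'} (\<lambda>w. h w * (E w - E s))"
      proof (rule int[of _ 1])
        show "\<bar>E w - E s\<bar> \<le> 1" for w using E1[of w] E1[of s] by auto
      qed simp
      have "\<bar>LINT w:{s..s'}|lborel. h w * (E w - E s)\<bar> \<le> (LINT w:{s..s'}|lborel. \<bar>h w * (E w - E s)\<bar>)"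
        using set_integral_norm_bound[OF i] by simp
      also have "\<dots> \<le> (LINT w:{s..s'}|lborel. C * (C * (s' - s)))"
      proof (rule set_integral_mono)
        show "set_integrable lborel {s..s'} (\<lambda>w. \<bar>h w * (E w - E s)\<bar>)"
          using i by (rule set_integrable_abs)
        show "set_integrable lborel {s..s'} (\<lambda>w. C * (C * (s' - s)))" by (rule intc)
        fix w assume w: "w \<in> {s..s'}"
        have "H a w = H a s + H s w" unfolding H_def using split[of a s w h] that w inth by auto
        then have "E w = E s * exp (- H s w)" by (simp only: E_def minus_add_distrib exp_add)
        then have "E s - E w = E s * (1 - exp (- H s w))" by (simp add: right_diff_distrib)
        moreover have "1 - exp (- H s w) \<le> H s w" using exp_ge_add_one_self[of "- H s w"] by simp
        moreover have hb: "0 \<le> H s w" "H s w \<le> C * (w - s)" using H_bound[of s w] w by auto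
        moreover have "C * (w - s) \<le> C * (s' - s)" using w C0 by (intro mult_left_mono) auto
        ultimately have "\<bar>E w - E s\<bar> \<le> 1 * (C * (s' - s))"
        proof -
          assume a: "E s - E w = E s * (1 - exp (- H s w))" "1 - exp (- H s w) \<le> H s w"
            "0 \<le> H s w" "H s w \<le> C * (w - s)" "C * (w - s) \<le> C * (s' - s)"
          have "0 \<le> 1 - exp (- H s w)" using a by simp
          then have "E s * (1 - exp (- H s w)) \<le> 1 * (C * (s' - s))"
            using E1[of s] a by (intro mult_mono) auto
          moreover have "0 \<le> E s * (1 - exp (- H s w))"
            using E1[of s] \<open>0 \<le> 1 - exp (- H s w)\<close> by simp
          ultimately show ?thesis using a(1) by (simp add: abs_le_iff)
        qed
        then show "\<bar>h w * (E w - E s)\<bar> \<le> C * (C * (s' - s))"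
          unfolding abs_mult using h0[of w] hC[of w] by (intro mult_mono) auto
      qed
      finally show ?thesis .
    qed
    also have "\<dots> = C^2 * (s' - s)^2"
      using that by (simp add: set_lebesgue_integral_def power2_eq_square algebra_simps)
    finally have 2: "\<bar>LINT w:{s..s'}|lborel. h w * (E w - E s)\<bar> \<le> C^2 * (s' - s)^2" .
    have "\<bar>E s * (exp (- d) - 1 + d)\<bar> \<le> 1 * d^2"
      unfolding abs_mult using E1[of s] ed by (intro mult_mono) auto
    also have "d^2 \<le> (C * (s' - s))^2" using d by (intro power_mono) auto
    finally have "\<bar>E s * (exp (- d) - 1 + d)\<bar> \<le> C^2 * (s' - s)^2" by (simp add: power_mult_distrib)
    then show ?thesis using 2 unfolding eq by linarith
  qed
  \<comment> \<open>The quadratic bound makes every difference quotient of \<open>J\<close> tend to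
    0, so \<open>J\<close> does have a derivative, namely 0, even if its two summands have
    none.\<close>
  have "J constant_on {a..b}"
  proof -
    have "(J has_field_derivative 0) (at x within {a..b})" if x: "x \<in> {a..b}" for x
      unfolding has_field_derivative_iff
    proof (rule Lim_null_comparison)
      show "\<forall>\<^sub>F y in at x within {a..b}. norm ((J y - J x) / (y - x)) \<le> 2 * C^2 * \<bar>y - x\<bar>"
        unfolding eventually_at_filter
      proof (rule always_eventually, intro allI impI)
        fix y assume y: "y \<noteq> x" "y \<in> {a..b}"
        have "\<bar>J y - J x\<bar> \<le> 2 * C^2 * (y - x)^2"
        proof (cases "x \<le> y")
          case False
          then have "\<bar>J x - J y\<bar> \<le> 2 * C^2 * (x - y)^2" using quad[of y x] x y by simp
          then show ?thesis by (simp only: abs_minus_commute[of "J y"] power2_commute[of y])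
        qed (use quad[of x y] x y in simp)
        also have "(y - x)^2 = \<bar>y - x\<bar> * \<bar>y - x\<bar>" by (simp add: power2_eq_square)
        finally show "norm ((J y - J x) / (y - x)) \<le> 2 * C^2 * \<bar>y - x\<bar>"
          using y by (simp add: pos_divide_le_eq mult.assoc)
      qed
      show "((\<lambda>y. 2 * C^2 * \<bar>y - x\<bar>) \<longlongrightarrow> 0) (at x within {a..b})"
        by (auto intro!: tendsto_eq_intros)
    qed
    then show ?thesis
      using has_field_derivative_zero_constant[of "{a..b}" J] by (auto simp: constant_on_def)
  qed
  then have "J b = J a" using ab by (auto simp: constant_on_def)
  moreover have "(LINT w:{a..a}|lborel. f w) = 0" for f :: "real \<Rightarrow> real"
    unfolding set_lebesgue_integral_def
    by (rule integral_eq_zero_AE) (rule AE_mp[OF AE_lborel_singleton[of a]], auto)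
  ultimately have fin: "(LINT w:{a..b}|lborel. h w * E w) = 1 - E b"
    by (simp add: J_def E_def H_def)
  have "(\<integral>\<^sup>+s. indicator {a..b} s * ennreal (h s * E s) \<partial>lborel) =
      (\<integral>\<^sup>+s. ennreal (indicator {a..b} s * (h s * E s)) \<partial>lborel)"
    by (intro nn_integral_cong) (auto split: split_indicator)
  also have "\<dots> = ennreal (\<integral>s. indicator {a..b} s * (h s * E s) \<partial>lborel)"
    using intE[of a b] h0 E1 by (intro nn_integral_eq_integral) (auto simp: set_integrable_def)
  also have "\<dots> = ennreal (1 - E b)" using fin by (simp add: set_lebesgue_integral_def)
  finally show ?thesis by (simp add: E_def H_def)
qed

text \<open>Conditional probabilities are prescribed only almost surely and only on an event
  \<open>B\<close>. Testing them against a weight that vanishes off \<open>B\<close> gives an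
  identity valid for all weights with values in [0, infinity].\<close>

lemma (in finite_measure) nn_integral_cond_indicator:
  assumes sub: "subalgebra M F" and W: "W \<in> borel_measurable F" and E: "E \<in> sets M"
    and B: "\<And>\<omega>. \<omega> \<in> space M \<Longrightarrow> \<omega> \<notin> B \<Longrightarrow> W \<omega> = 0"
    and c: "AE \<omega> in M. \<omega> \<in> B \<longrightarrow> real_cond_exp M F (indicator E) \<omega> = c \<omega>"
  shows "(\<integral>\<^sup>+\<omega>. W \<omega> * indicator E \<omega> \<partial>M) = (\<integral>\<^sup>+\<omega>. W \<omega> * ennreal (c \<omega>) \<partial>M)"
proof -
  interpret F: finite_measure_subalgebra M F by unfold_locales (rule sub)
  \<comment> \<open>A conditional probability is at most 1 and its negative part is 0, so the
    conversions to reals inside \<open>real_cond_exp\<close> lose nothing.\<close>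
  have nn: "AE \<omega> in M. nn_cond_exp M F (indicator E) \<omega> = ennreal (real_cond_exp M F (indicator E) \<omega>)"
  proof -
    have le: "AE \<omega> in M. nn_cond_exp M F (indicator E) \<omega> \<le> nn_cond_exp M F (\<lambda>_. 1) \<omega>"
      using E by (intro F.nn_cond_exp_mono) (auto split: split_indicator)
    have 1: "AE \<omega> in M. 1 = nn_cond_exp M F (\<lambda>_. 1) \<omega>"
      by (rule F.nn_cond_exp_F_meas) simp
    have 0: "AE \<omega> in M. 0 = nn_cond_exp M F (\<lambda>_. 0) \<omega>"
      by (rule F.nn_cond_exp_F_meas) simp
    have neg: "(\<lambda>\<omega>. ennreal (- indicator E \<omega>)) = (\<lambda>_. 0::ennreal)"
      by (auto split: split_indicator simp: ennreal_neg)
    have pos: "(\<lambda>\<omega>. ennreal (indicator E \<omega>)) = (indicator E :: _ \<Rightarrow> ennreal)"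
      by (auto split: split_indicator)
    show ?thesis
      using le 1 0
    proof eventually_elim
      case (elim \<omega>)
      have "nn_cond_exp M F (indicator E) \<omega> < \<top>"
        using elim(1) unfolding elim(2)[symmetric] by (simp add: order_le_less_trans[OF _ ennreal_one_less_top])
      then show ?case
        unfolding real_cond_exp_def neg pos elim(3)[symmetric] by simp
    qed
  qed
  have "(\<integral>\<^sup>+\<omega>. W \<omega> * indicator E \<omega> \<partial>M) = (\<integral>\<^sup>+\<omega>. W \<omega> * nn_cond_exp M F (indicator E) \<omega> \<partial>M)"
    using W E by (intro F.nn_cond_exp_intg[symmetric]) auto
  also have "\<dots> = (\<integral>\<^sup>+\<omega>. W \<omega> * ennreal (c \<omega>) \<partial>M)"
  proof (rule nn_integral_cong_AE)
    show "AE \<omega> in M. W \<omega> * nn_cond_exp M F (indicator E) \<omega> = W \<omega> * ennreal (c \<omega>)"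
      using nn c AE_space
    proof eventually_elim
      case (elim \<omega>)
      then show ?case using B by (cases "\<omega> \<in> B") auto
    qed
  qed
  finally show ?thesis .
qed

section \<open>Differentiation under the integral at one point\<close>

text \<open>The integrand is differentiable at 0 only, so the mean value theorem cannot produce a
  bound. The Lipschitz estimate at 0 takes its place: it bounds the difference quotients by
  \<open>w\<close>, and dominated convergence is applied along every sequence tending to 0.\<close>

lemma has_derivative_integral_dominated:
  fixes f :: "real \<Rightarrow> 'x \<Rightarrow> real"
  assumes l0: "0 < l0"
    and f: "\<And>l. \<bar>l\<bar> \<le> l0 \<Longrightarrow> f l \<in> borel_measurable N" and f0: "integrable N (f 0)"
    and w: "integrable N w"
    and bound: "\<And>l. \<bar>l\<bar> \<le> l0 \<Longrightarrow> AE x in N. \<bar>f l x - f 0 x\<bar> \<le> \<bar>l\<bar> * w x"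
    and deriv: "AE x in N. ((\<lambda>l. f l x) has_real_derivative f' x) (at 0)"
    and f': "f' \<in> borel_measurable N"
  shows "\<And>l. \<bar>l\<bar> \<le> l0 \<Longrightarrow> integrable N (f l)" "integrable N f'"
    "((\<lambda>l. \<integral>x. f l x \<partial>N) has_real_derivative (\<integral>x. f' x \<partial>N)) (at 0)"
proof -
  show int: "integrable N (f l)" if l: "\<bar>l\<bar> \<le> l0" for l
  proof -
    have "integrable N (\<lambda>x. f l x - f 0 x)"
      using bound[OF l]
      by (intro Bochner_Integration.integrable_bound[OF integrable_mult_right[OF w, of "\<bar>l\<bar>"]])
        (auto intro: borel_measurable_diff f l borel_measurable_integrable[OF f0])
    from Bochner_Integration.integrable_add[OF this f0] show ?thesis by simp
  qed
  have main: "integrable N f' \<and> (\<lambda>i. \<integral>x. (f (X i) x - f 0 x) / X i \<partial>N) \<longlonglongrightarrow> (\<integral>x. f' x \<partial>N)"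
    if X: "\<And>i. X i \<in> {-l0<..<l0} - {0}" "X \<longlonglongrightarrow> 0" for X :: "nat \<Rightarrow> real"
  proof
    have lim: "AE x in N. (\<lambda>i. (f (X i) x - f 0 x) / X i) \<longlonglongrightarrow> f' x"
      using deriv
    proof eventually_elim
      case (elim x)
      then have "((\<lambda>h. (f h x - f 0 x) / h) \<longlongrightarrow> f' x) (at 0)"
        by (simp add: DERIV_def)
      then show ?case
        using X by (auto simp: tendsto_at_iff_sequentially comp_def)
    qed
    have b: "AE x in N. norm ((f (X i) x - f 0 x) / X i) \<le> w x" for i
    proof -
      have "\<bar>X i\<bar> \<le> l0" using X(1)[of i] by auto
      from bound[OF this] show ?thesis
      proof eventually_elim
        case (elim x)
        then show ?case using X(1)[of i] by (auto simp: divide_le_eq mult.commute)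
      qed
    qed
    have m: "(\<lambda>x. (f (X i) x - f 0 x) / X i) \<in> borel_measurable N" for i
      using X(1)[of i] by (intro borel_measurable_divide borel_measurable_diff f) (auto simp: l0 less_imp_le)
    show "integrable N f'"
      by (rule integrable_dominated_convergence[OF f' m w lim b])
    show "(\<lambda>i. \<integral>x. (f (X i) x - f 0 x) / X i \<partial>N) \<longlonglongrightarrow> (\<integral>x. f' x \<partial>N)"
      by (rule integral_dominated_convergence[OF f' m w lim b])
  qed
  \<comment> \<open>Integrability of \<open>f'\<close> needs one explicit null sequence inside the
    punctured interval; the 2 keeps every term strictly below \<open>l0\<close>.\<close>
  have "(\<lambda>i. l0 / (real i + 2)) \<longlonglongrightarrow> 0"
    by real_asymp
  moreover have "l0 / (real i + 2) < l0" for i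
    using l0 by (simp add: divide_less_eq)
  ultimately show "integrable N f'"
    using main[of "\<lambda>i. l0 / (real i + 2)"] l0 by (simp add: order_less_trans[of "- l0" 0])
  have "((\<lambda>h. ((\<integral>x. f h x \<partial>N) - (\<integral>x. f 0 x \<partial>N)) / h) \<longlongrightarrow> (\<integral>x. f' x \<partial>N)) (at 0 within {-l0<..<l0})"
    unfolding tendsto_at_iff_sequentially
  proof (intro allI impI)
    fix X :: "nat \<Rightarrow> real" assume X: "\<forall>i. X i \<in> {-l0<..<l0} - {0}" "X \<longlonglongrightarrow> 0"
    have "((\<lambda>h. ((\<integral>x. f h x \<partial>N) - (\<integral>x. f 0 x \<partial>N)) / h) \<circ> X) =
        (\<lambda>i. \<integral>x. (f (X i) x - f 0 x) / X i \<partial>N)"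
    proof
      fix i
      have "\<bar>X i\<bar> \<le> l0" using X(1) by (auto simp: less_le abs_le_iff) (meson greaterThanLessThan_iff less_eq_real_def neg_le_iff_le minus_less_iff)+
      from int[OF this] f0 show "((\<lambda>h. ((\<integral>x. f h x \<partial>N) - (\<integral>x. f 0 x \<partial>N)) / h) \<circ> X) i =
          (\<integral>x. (f (X i) x - f 0 x) / X i \<partial>N)" by simp
    qed
    then show "((\<lambda>h. ((\<integral>x. f h x \<partial>N) - (\<integral>x. f 0 x \<partial>N)) / h) \<circ> X) \<longlonglongrightarrow> (\<integral>x. f' x \<partial>N)"
      using main[of X] X by auto
  qed
  then show "((\<lambda>l. \<integral>x. f l x \<partial>N) has_real_derivative (\<integral>x. f' x \<partial>N)) (at 0)"
    using l0 by (simp add: DERIV_def at_within_open[of 0 "{-l0<..<l0}"])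
qed

section \<open>A substitute for Hoelder's inequality\<close>

lemma ennreal_powr_measurable [measurable]: "(\<lambda>x. ennreal_powr x a) \<in> borel_measurable borel"
  unfolding ennreal_powr_def by measurable

text \<open>Scaling \<open>f\<close> to norm \<open>1\<close> turns the crude Young bound \<open>y w \<le> y\<^sup>p + w\<^sup>q\<close> into a substitute for
  Hoelder's inequality.\<close>

lemma nn_integral_Lp_bound:
  assumes p: "(1::ennreal) < p"
  obtains q :: real where "1 \<le> q"
    "\<And>(N :: 'x measure) (f :: 'x \<Rightarrow> ennreal) W. f \<in> borel_measurable N \<Longrightarrow> W \<in> borel_measurable N \<Longrightarrow> (\<And>x. 0 \<le> W x) \<Longrightarrow>
      (\<integral>\<^sup>+x. f x * ennreal (W x) \<partial>N) \<le> Lp_norm N p f * (1 + (\<integral>\<^sup>+x. ennreal (W x powr q) \<partial>N))"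
proof (cases "p = \<top>")
  case True
  show ?thesis
  proof (rule that[of 1])
    fix N :: "'x measure" and f :: "'x \<Rightarrow> ennreal" and W assume [measurable]: "f \<in> borel_measurable N" "W \<in> borel_measurable N"
      and W: "\<And>x. 0 \<le> (W x :: real)"
    have "(\<integral>\<^sup>+x. f x * ennreal (W x) \<partial>N) \<le> (\<integral>\<^sup>+x. esssup N f * ennreal (W x) \<partial>N)"
      using esssup_AE[where f = f and M = N]
      by (intro nn_integral_mono_AE) (auto elim!: eventually_mono intro: mult_right_mono)
    also have "\<dots> = esssup N f * (\<integral>\<^sup>+x. ennreal (W x) \<partial>N)" by (simp add: nn_integral_cmult)
    also have "\<dots> \<le> esssup N f * (1 + (\<integral>\<^sup>+x. ennreal (W x powr 1) \<partial>N))"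
      using W by (intro mult_left_mono) auto
    finally show "(\<integral>\<^sup>+x. f x * ennreal (W x) \<partial>N) \<le> Lp_norm N p f * (1 + (\<integral>\<^sup>+x. ennreal (W x powr 1) \<partial>N))"
      by (simp add: Lp_norm_def True)
  qed simp
next
  case False
  then obtain a where a: "p = ennreal a" "1 < a"
    using p by (cases p) (auto simp: ennreal_less_iff simp flip: ennreal_1)
  \<comment> \<open>The conjugate exponent of \<open>a\<close>.\<close>
  define q where "q = a / (a - 1)"
  have q: "1 \<le> q" using a by (simp add: q_def field_simps)
  have young: "y * w \<le> y powr a + w powr q" if "0 \<le> y" "0 \<le> w" for y w :: real
  proof (cases "y = 0 \<or> w = 0")
    case True then show ?thesis using that by auto
  next
    case False
    then have yw: "0 < y" "0 < w" using that by auto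
    show ?thesis
    \<comment> \<open>Below this threshold the product is at most y^a; above it, it is at most w^q,
      because 1 + 1/(a - 1) = q.\<close>
    proof (cases "w \<le> y powr (a - 1)")
      case True
      then have "y * w \<le> y * y powr (a - 1)" using yw by simp
      also have "\<dots> = y powr a" using yw by (simp add: powr_mult_base)
      finally show ?thesis by (rule order_trans) simp
    next
      case False
      then have "(y powr (a - 1)) powr (1 / (a - 1)) \<le> w powr (1 / (a - 1))"
        using a yw by (intro powr_mono2) auto
      then have "y \<le> w powr (1 / (a - 1))" using a yw by (simp add: powr_powr)
      then have "y * w \<le> w * w powr (1 / (a - 1))" using yw by (simp add: mult.commute)
      also have "\<dots> = w powr q" using yw a by (simp add: powr_mult_base q_def field_simps)
      finally show ?thesis by (rule order_trans) simp
    qed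
  qed
  show ?thesis
  proof (rule that[OF q])
    fix N :: "'x measure" and f :: "'x \<Rightarrow> ennreal" and W assume [measurable]: "f \<in> borel_measurable N" "W \<in> borel_measurable N"
      and W: "\<And>x. 0 \<le> (W x :: real)"
    define I where "I = (\<integral>\<^sup>+x. ennreal_powr (f x) a \<partial>N)"
    have L: "Lp_norm N p f = ennreal_powr I (1 / a)"
      using a by (simp add: Lp_norm_def I_def)
    show "(\<integral>\<^sup>+x. f x * ennreal (W x) \<partial>N) \<le> Lp_norm N p f * (1 + (\<integral>\<^sup>+x. ennreal (W x powr q) \<partial>N))"
    proof (cases "I = \<top> \<or> I = 0")
      case True
      then show ?thesis
      proof
        \<comment> \<open>The summand 1 in the bound keeps the right-hand side infinite here even if
          \<open>W\<close> vanishes.\<close>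
        assume "I = \<top>"
        then show ?thesis by (simp add: L ennreal_powr_def ennreal_top_mult)
      next
        assume "I = 0"
        then have "AE x in N. ennreal_powr (f x) a = 0"
          unfolding I_def by (subst (asm) nn_integral_0_iff_AE) auto
        then have "AE x in N. f x * ennreal (W x) = 0"
        proof eventually_elim
          case (elim x)
          then have "f x \<noteq> \<top>" "enn2real (f x) powr a = 0" 
            by (auto simp: ennreal_powr_def split: if_splits)
          then have "f x = 0" by (cases "f x") auto
          then show ?case by simp
        qed
        then have "(\<integral>\<^sup>+x. f x * ennreal (W x) \<partial>N) = 0" by (subst nn_integral_0_iff_AE) auto
        then show ?thesis by simp
      qed
    next
      case False
      then obtain i where i: "I = ennreal i" "0 < i" by (cases I) (auto simp: less_le)
      \<comment> \<open>\<open>n\<close> is the norm of \<open>f\<close>. The Young bound for f / n,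
        multiplied back by \<open>n\<close>, has n^(1 - a) times the integral of f^a as its first
        term, and this is again \<open>n\<close>; hence a bound linear in the norm.\<close>
      define n where "n = i powr (1 / a)"
      have n: "0 < n" using i by (simp add: n_def)
      have na: "n powr a = i" using a i by (simp add: n_def powr_powr)
      have Ln: "Lp_norm N p f = ennreal n" using i by (simp add: L ennreal_powr_def n_def)
      have "(\<integral>\<^sup>+x. f x * ennreal (W x) \<partial>N) \<le>
          (\<integral>\<^sup>+x. ennreal (n powr (1 - a)) * ennreal_powr (f x) a + ennreal n * ennreal (W x powr q) \<partial>N)"
      proof (rule nn_integral_mono)
        fix x
        show "f x * ennreal (W x) \<le> ennreal (n powr (1 - a)) * ennreal_powr (f x) a + ennreal n * ennreal (W x powr q)"
        proof (cases "f x")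
          case (real y)
          have "y * W x = n * ((y / n) * W x)" using n by simp
          also have "\<dots> \<le> n * ((y / n) powr a + W x powr q)"
            using young[of "y / n" "W x"] real n W[of x] by (intro mult_left_mono) auto
          also have "\<dots> = n powr (1 - a) * y powr a + n * W x powr q"
            using n real by (simp add: powr_divide powr_diff field_simps)
          finally show ?thesis
            using real n W[of x] 
            by (simp add: ennreal_powr_def ennreal_mult[symmetric] ennreal_plus[symmetric] del: ennreal_plus)
        next
          case top
          then show ?thesis using n by (simp add: ennreal_powr_def ennreal_mult_top)
        qed
      qed
      also have "\<dots> = ennreal (n powr (1 - a)) * I + ennreal n * (\<integral>\<^sup>+x. ennreal (W x powr q) \<partial>N)"
        by (simp add: nn_integral_add nn_integral_cmult I_def)
      also have "ennreal (n powr (1 - a)) * I = ennreal n"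
        unfolding i(1) na[symmetric] using n by (simp add: ennreal_mult[symmetric] powr_add[symmetric])
      finally show ?thesis by (simp add: Ln distrib_left)
    qed
  qed
qed

section \<open>Kernels and the one-step laws of a jump process\<close>

text \<open>The total mass of the kernel exp(\<gamma>) r at time \<open>s\<close>; with \<gamma> = 0
  it is the exit rate of the unperturbed process.\<close>

definition rate :: "('a \<Rightarrow> 'a measure) \<Rightarrow> (real \<Rightarrow> 'a \<Rightarrow> 'a \<Rightarrow> real) \<Rightarrow> real \<Rightarrow> 'a \<Rightarrow> real" where
  "rate r \<gamma> s x = contract r (\<lambda>x y. exp (\<gamma> s x y)) x"

text \<open>For a process that enters \<open>x\<close> at time \<open>a\<close> and has rates tilted
  by \<open>\<gamma>\<close>: the probability of not having jumped by time \<open>u\<close>.\<close>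

definition surv :: "('a \<Rightarrow> 'a measure) \<Rightarrow> (real \<Rightarrow> 'a \<Rightarrow> 'a \<Rightarrow> real) \<Rightarrow> 'a \<Rightarrow> real \<Rightarrow> real \<Rightarrow> real" where
  "surv r \<gamma> x a u = exp (- (LINT w:{a..u}|lborel. rate r \<gamma> w x))"

locale rate_kernel =
  fixes S :: "'a measure" and r :: "'a \<Rightarrow> 'a measure"
  assumes kernel: "jump_kernel S r"
begin

lemma sets_r [simp]: "x \<in> space S \<Longrightarrow> sets (r x) = sets S"
  using kernel by (auto simp: jump_kernel_def)

lemma space_r [simp]: "x \<in> space S \<Longrightarrow> space (r x) = space S"
  by (rule sets_eq_imp_space_eq) simp

lemma measurable_r: "x \<in> space S \<Longrightarrow> f \<in> measurable S N \<Longrightarrow> f \<in> measurable (r x) N"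
  by (simp cong: measurable_cong_sets)

lemma emeasure_r: "x \<in> space S \<Longrightarrow> 0 < emeasure (r x) (space S)"
  "x \<in> space S \<Longrightarrow> emeasure (r x) (space S) < \<top>"
  using kernel by (auto simp: jump_kernel_def)

lemma finite_measure_r: "x \<in> space S \<Longrightarrow> finite_measure (r x)"
  by (rule finite_measureI) (use emeasure_r(2)[of x] in simp)

text \<open>The total mass of \<open>r x\<close> may be unbounded in \<open>x\<close>. Being
  positive and finite at each point, it can be divided out, which leaves a subprobability kernel,
  and multiplied back as a measurable function.\<close>

lemma borel_measurable_kernel_nn_integral [measurable (raw)]:
  assumes F[measurable]: "(\<lambda>(w, y). F w y) \<in> borel_measurable (N \<Otimes>\<^sub>M S)" and X[measurable]: "X \<in> measurable N S"
  shows "(\<lambda>w. \<integral>\<^sup>+y. F w y \<partial>r (X w)) \<in> borel_measurable N"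
proof -
  define m where "m x = emeasure (r x) (space S)" for x
  define k where "k x = scale_measure (inverse (m x)) (r x)" for x
  have m_meas[measurable]: "m \<in> borel_measurable S"
    using kernel unfolding m_def by (auto simp: jump_kernel_def)
  have m: "0 < m x" "m x < \<top>" if "x \<in> space S" for x
    using emeasure_r[OF that] by (auto simp: m_def)
  have inv: "inverse (m x) * m x = 1" if "x \<in> space S" for x
    using m[OF that] by (metis ennreal_divide_self less_irrefl mult_divide_eq_ennreal divide_ennreal_def ennreal_times_divide mult.commute mult.right_neutral)
  have [measurable]: "k \<in> measurable S (subprob_algebra S)"
  proof (rule measurable_subprob_algebra)
    fix x assume x: "x \<in> space S"
    then show "sets (k x) = sets S" by (simp add: k_def)
    show "subprob_space (k x)"
    proof
      show "emeasure (k x) (space (k x)) \<le> 1"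
        using inv[OF x] x by (simp add: k_def space_scale_measure) (simp add: m_def)
      show "space (k x) \<noteq> {}" using x by (auto simp: k_def space_scale_measure)
    qed
  next
    fix A assume "A \<in> sets S"
    then have "(\<lambda>x. emeasure (r x) A) \<in> borel_measurable S"
      using kernel by (auto simp: jump_kernel_def)
    then show "(\<lambda>x. emeasure (k x) A) \<in> borel_measurable S"
      by (simp add: k_def)
  qed
  have [measurable]: "(\<lambda>w. \<integral>\<^sup>+y. F w y \<partial>k (X w)) \<in> borel_measurable N"
    by (rule nn_integral_measurable_subprob_algebra2[OF F]) measurable
  have "(\<lambda>w. m (X w) * (\<integral>\<^sup>+y. F w y \<partial>k (X w))) \<in> borel_measurable N"
    by measurable
  also have "?this \<longleftrightarrow> ?thesis"
  proof (rule measurable_cong)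
    fix w assume w: "w \<in> space N"
    then have X: "X w \<in> space S" by (rule measurable_space[OF assms(2)])
    have "(\<lambda>y. F w y) \<in> borel_measurable S"
      using measurable_Pair2[OF F w] by simp
    then have "(\<lambda>y. F w y) \<in> borel_measurable (r (X w))" using X by (rule measurable_r[rotated])
    then have "(\<integral>\<^sup>+y. F w y \<partial>k (X w)) = inverse (m (X w)) * (\<integral>\<^sup>+y. F w y \<partial>r (X w))"
      unfolding k_def by (rule nn_integral_scale_measure)
    then show "m (X w) * (\<integral>\<^sup>+y. F w y \<partial>k (X w)) = (\<integral>\<^sup>+y. F w y \<partial>r (X w))"
      using inv[OF X] by (metis mult.assoc mult.commute mult.left_neutral)
  qed
  finally show ?thesis .
qed

text \<open>The Bochner integral is 0 where the integrand is not integrable. The explicit expression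
  therefore switches on the measurable set where the integral of the absolute value is
  finite.\<close>

lemma borel_measurable_kernel_integral [measurable (raw)]:
  fixes F :: "'w \<Rightarrow> 'a \<Rightarrow> real"
  assumes F[measurable]: "(\<lambda>(w, y). F w y) \<in> borel_measurable (N \<Otimes>\<^sub>M S)" and X[measurable]: "X \<in> measurable N S"
  shows "(\<lambda>w. \<integral>y. F w y \<partial>r (X w)) \<in> borel_measurable N"
proof -
  have "(\<lambda>w. if (\<integral>\<^sup>+y. ennreal \<bar>F w y\<bar> \<partial>r (X w)) < \<top> then
      enn2real (\<integral>\<^sup>+y. ennreal (F w y) \<partial>r (X w)) - enn2real (\<integral>\<^sup>+y. ennreal (- F w y) \<partial>r (X w))
      else 0) \<in> borel_measurable N"
    by measurable
  also have "?this \<longleftrightarrow> ?thesis"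
  proof (rule measurable_cong)
    fix w assume w: "w \<in> space N"
    then have X: "X w \<in> space S" by (rule measurable_space[OF assms(2)])
    have "(\<lambda>y. F w y) \<in> borel_measurable S"
      using measurable_Pair2[OF F w] by simp
    then have [measurable]: "(\<lambda>y. F w y) \<in> borel_measurable (r (X w))" using X by (rule measurable_r[rotated])
    have "integrable (r (X w)) (F w) \<longleftrightarrow> (\<integral>\<^sup>+y. ennreal \<bar>F w y\<bar> \<partial>r (X w)) < \<top>"
      by (simp add: integrable_iff_bounded)
    then show "(if (\<integral>\<^sup>+y. ennreal \<bar>F w y\<bar> \<partial>r (X w)) < \<top> then
      enn2real (\<integral>\<^sup>+y. ennreal (F w y) \<partial>r (X w)) - enn2real (\<integral>\<^sup>+y. ennreal (- F w y) \<partial>r (X w))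
      else 0) = (\<integral>y. F w y \<partial>r (X w))"
      using real_lebesgue_integral_def[of "r (X w)" "F w"] not_integrable_integral_eq[of "r (X w)" "F w"] by auto
  qed
  finally show ?thesis .
qed

lemma borel_measurable_contract [measurable (raw)]:
  assumes "(\<lambda>(w, y). F w (X w) y) \<in> borel_measurable (N \<Otimes>\<^sub>M S)" "X \<in> measurable N S"
  shows "(\<lambda>w. contract r (F w) (X w)) \<in> borel_measurable N"
  unfolding contract_def using assms by (rule borel_measurable_kernel_integral)

lemma borel_measurable_abs_contract [measurable (raw)]:
  assumes [measurable]: "(\<lambda>(w, y). F w (X w) y) \<in> borel_measurable (N \<Otimes>\<^sub>M S)" "X \<in> measurable N S"
  shows "(\<lambda>w. abs_contract r (F w) (X w)) \<in> borel_measurable N"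
  unfolding abs_contract_def by measurable

end

text \<open>A bounded exponent defined at all times. It will be 0 for the unperturbed process,
  lambda g for the perturbed ones and a multiple of |g| for exponential moments. The locale also
  serves as the class of bounded measurable functions of a jump, such as the positive and negative
  parts of g.\<close>

locale tilt = rate_kernel +
  fixes \<gamma> :: "real \<Rightarrow> 'a \<Rightarrow> 'a \<Rightarrow> real" and K :: real
  assumes tilt_measurable: "(\<lambda>(s, x, y). \<gamma> s x y) \<in> borel_measurable (borel \<Otimes>\<^sub>M S \<Otimes>\<^sub>M S)"
    and tilt_bound: "x \<in> space S \<Longrightarrow> y \<in> space S \<Longrightarrow> \<bar>\<gamma> s x y\<bar> \<le> K"
begin

lemma measurable_tilt [measurable (raw)]:
  assumes [measurable]: "f \<in> borel_measurable N" "g \<in> measurable N S" "h \<in> measurable N S"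
  shows "(\<lambda>w. \<gamma> (f w) (g w) (h w)) \<in> borel_measurable N"
proof -
  have "(\<lambda>w. (f w, g w, h w)) \<in> N \<rightarrow>\<^sub>M borel \<Otimes>\<^sub>M S \<Otimes>\<^sub>M S" by measurable
  from measurable_compose[OF this tilt_measurable] show ?thesis by simp
qed

lemma measurable_tilt_r: "x \<in> space S \<Longrightarrow> \<gamma> s x \<in> borel_measurable (r x)"
  by (rule measurable_r) measurable

lemma integrable_exp_tilt: "x \<in> space S \<Longrightarrow> integrable (r x) (\<lambda>y. exp (\<gamma> s x y))"
  using tilt_bound[of x]
  by (intro finite_measure.integrable_const_bound[OF finite_measure_r, where B = "exp K"])
    (auto intro!: borel_measurable_exp[THEN measurable_compose[rotated]] measurable_tilt_r AE_I2 simp: abs_le_iff)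

lemma nn_integral_exp_tilt: "x \<in> space S \<Longrightarrow> (\<integral>\<^sup>+y. ennreal (exp (\<gamma> s x y)) \<partial>r x) = ennreal (rate r \<gamma> s x)"
  unfolding rate_def contract_def by (rule nn_integral_eq_integral) (auto intro: integrable_exp_tilt)

lemma measurable_rate [measurable (raw)]:
  assumes [measurable]: "f \<in> borel_measurable N" "g \<in> measurable N S"
  shows "(\<lambda>w. rate r \<gamma> (f w) (g w)) \<in> borel_measurable N"
  unfolding rate_def by measurable

lemma rate_le: "x \<in> space S \<Longrightarrow> rate r \<gamma> s x \<le> exp K * measure (r x) (space S)"
  and rate_pos: "x \<in> space S \<Longrightarrow> 0 < rate r \<gamma> s x"
proof -
  assume x: "x \<in> space S"
  interpret finite_measure "r x" using x by (rule finite_measure_r)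
  have m: "0 < measure (r x) (space S)"
    using emeasure_r[OF x] by (simp add: emeasure_eq_measure)
  have c: "integrable (r x) (\<lambda>_. c::real)" for c by simp
  have "rate r \<gamma> s x \<le> (\<integral>y. exp K \<partial>r x)"
    unfolding rate_def contract_def using x tilt_bound[of x]
    by (intro integral_mono integrable_exp_tilt c) (auto simp: abs_le_iff)
  then show "rate r \<gamma> s x \<le> exp K * measure (r x) (space S)" using x by (simp add: mult.commute)
  have "(\<integral>y. exp (- K) \<partial>r x) \<le> rate r \<gamma> s x"
    unfolding rate_def contract_def using x tilt_bound[of x]
    by (intro integral_mono integrable_exp_tilt c) (auto simp: abs_le_iff minus_le_iff)
  moreover have "0 < (\<integral>y. exp (- K) \<partial>r x)" using m x by simp
  ultimately show "0 < rate r \<gamma> s x" by linarith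
qed

lemma measurable_surv [measurable (raw)]:
  assumes [measurable]: "f \<in> borel_measurable N" "g \<in> measurable N S" "h \<in> borel_measurable N"
  shows "(\<lambda>w. surv r \<gamma> (g w) (f w) (h w)) \<in> borel_measurable N"
  unfolding surv_def set_lebesgue_integral_def by measurable

text \<open>Rate times survival is the density of the jump time. At a fixed state the rate is
  bounded in time, as \<open>hazard_integral\<close> requires.\<close>

lemma surv_hazard: "x \<in> space S \<Longrightarrow> a \<le> b \<Longrightarrow>
    (\<integral>\<^sup>+s. indicator {a..b} s * ennreal (rate r \<gamma> s x * surv r \<gamma> x a s) \<partial>lborel) = ennreal (1 - surv r \<gamma> x a b)"
  unfolding surv_def
  by (rule hazard_integral[where C = "exp K * measure (r x) (space S)"]) (auto simp: rate_le less_imp_le[OF rate_pos])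

lemma set_integrable_rate: "x \<in> space S \<Longrightarrow> set_integrable lborel {a..b} (\<lambda>s. rate r \<gamma> s x)"
  unfolding set_integrable_def
  by (rule integrableI_bounded_set_indicator[where B = "exp K * measure (r x) (space S)"])
    (auto simp: emeasure_lborel_Icc_eq rate_le abs_of_pos[OF rate_pos])

lemma surv_le_1: "x \<in> space S \<Longrightarrow> surv r \<gamma> x a b \<le> 1"
  unfolding surv_def set_lebesgue_integral_def
  by (auto intro!: integral_nonneg_AE AE_I2 simp: less_imp_le[OF rate_pos])

lemma surv_pos: "0 < surv r \<gamma> x a b" by (simp add: surv_def)

lemma nn_integral_tilted:
  assumes "x \<in> space S" and f: "f \<in> borel_measurable S"
  shows "(\<integral>\<^sup>+y. f y \<partial>tilted_kernel r \<gamma> 1 s x) = (\<integral>\<^sup>+y. ennreal (exp (\<gamma> s x y)) * f y \<partial>r x)"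
proof -
  have [measurable]: "\<gamma> s x \<in> borel_measurable (r x)" "f \<in> borel_measurable (r x)"
    using measurable_tilt_r measurable_r assms by auto
  show ?thesis by (simp add: tilted_kernel_def nn_integral_density)
qed

lemma sets_tilted [simp]: "x \<in> space S \<Longrightarrow> sets (tilted_kernel r \<gamma> 1 s x) = sets S"
  by (simp add: tilted_kernel_def)

lemma emeasure_tilted:
  assumes "x \<in> space S" and C: "C \<in> sets S"
  shows "emeasure (tilted_kernel r \<gamma> 1 s x) C = (\<integral>\<^sup>+y. ennreal (exp (\<gamma> s x y)) * indicator C y \<partial>r x)"
  using nn_integral_tilted[of x "indicator C"] assms by simp

lemma measure_tilted_space: "x \<in> space S \<Longrightarrow> measure (tilted_kernel r \<gamma> 1 s x) (space S) = rate r \<gamma> s x"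
proof -
  assume x: "x \<in> space S"
  have "emeasure (tilted_kernel r \<gamma> 1 s x) (space S) = (\<integral>\<^sup>+y. ennreal (exp (\<gamma> s x y)) \<partial>r x)"
    using x by (subst emeasure_tilted) (auto intro!: nn_integral_cong)
  then show ?thesis
    using nn_integral_exp_tilt[OF x] rate_pos[OF x, of s] by (simp add: measure_def)
qed

text \<open>\<open>jump_law\<close> prescribes a quotient of masses of sets; here it becomes a
  density with respect to \<open>r x\<close>, against which functions can be integrated.\<close>

lemma measure_tilted:
  assumes x: "x \<in> space S" and C: "C \<in> sets S"
  shows "ennreal (measure (tilted_kernel r \<gamma> 1 s x) C / rate r \<gamma> s x) =
    (\<integral>\<^sup>+y. ennreal (exp (\<gamma> s x y) / rate r \<gamma> s x) * indicator C y \<partial>r x)"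
proof -
  have le: "emeasure (tilted_kernel r \<gamma> 1 s x) C \<le> ennreal (rate r \<gamma> s x)"
    unfolding nn_integral_exp_tilt[OF x, symmetric] emeasure_tilted[OF x C]
    by (intro nn_integral_mono) (auto split: split_indicator)
  then have "emeasure (tilted_kernel r \<gamma> 1 s x) C = ennreal (measure (tilted_kernel r \<gamma> 1 s x) C)"
    by (intro emeasure_eq_ennreal_measure) (auto simp: top_unique)
  then have "ennreal (measure (tilted_kernel r \<gamma> 1 s x) C / rate r \<gamma> s x) =
      (\<integral>\<^sup>+y. ennreal (exp (\<gamma> s x y)) * indicator C y \<partial>r x) * ennreal (1 / rate r \<gamma> s x)"
    unfolding emeasure_tilted[OF x C] using rate_pos[OF x, of s]
    by (simp add: ennreal_mult[symmetric] divide_inverse)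
  also have "\<dots> = (\<integral>\<^sup>+y. ennreal (exp (\<gamma> s x y)) * indicator C y * ennreal (1 / rate r \<gamma> s x) \<partial>r x)"
  proof -
    have [measurable]: "\<gamma> s x \<in> borel_measurable (r x)" "C \<in> sets (r x)"
      using measurable_tilt_r x C by auto
    show ?thesis by (rule nn_integral_multc[symmetric]) measurable
  qed
  also have "\<dots> = (\<integral>\<^sup>+y. ennreal (exp (\<gamma> s x y) / rate r \<gamma> s x) * indicator C y \<partial>r x)"
    using rate_pos[OF x, of s]
    by (intro nn_integral_cong) (auto split: split_indicator simp: ennreal_mult[symmetric])
  finally show ?thesis .
qed

end

text \<open>The composition of \<open>M\<close> with a kernel, mapped by \<open>\<tau>\<close>. It
  is defined by its values on sets and needs only measurability of the resulting integrals, so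
  kernels of unbounded mass such as \<open>r\<close> are covered.\<close>

lemma mixture_measure:
  fixes k :: "'w \<Rightarrow> 'y measure" and N :: "'z measure"
  assumes \<tau>: "\<And>\<omega>. \<omega> \<in> space M \<Longrightarrow> \<tau> \<omega> \<in> measurable (k \<omega>) N"
    and m: "\<And>f :: 'z \<Rightarrow> ennreal. f \<in> borel_measurable N \<Longrightarrow> (\<lambda>\<omega>. \<integral>\<^sup>+y. f (\<tau> \<omega> y) \<partial>k \<omega>) \<in> borel_measurable M"
  obtains \<nu> where "sets \<nu> = sets N"
    "\<And>f :: 'z \<Rightarrow> ennreal. f \<in> borel_measurable N \<Longrightarrow> (\<integral>\<^sup>+z. f z \<partial>\<nu>) = (\<integral>\<^sup>+\<omega>. \<integral>\<^sup>+y. f (\<tau> \<omega> y) \<partial>k \<omega> \<partial>M)"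
proof -
  define J where "J f = (\<integral>\<^sup>+\<omega>. \<integral>\<^sup>+y. f (\<tau> \<omega> y) \<partial>k \<omega> \<partial>M)" for f :: "'z \<Rightarrow> ennreal"
  define \<nu> where "\<nu> = measure_of (space N) (sets N) (\<lambda>A. J (indicator A))"
  have sets: "sets \<nu> = sets N" and sp: "space \<nu> = space N" by (auto simp: \<nu>_def)
  have km: "(\<lambda>y. f (\<tau> \<omega> y)) \<in> borel_measurable (k \<omega>)"
    if "\<omega> \<in> space M" "f \<in> borel_measurable N" for \<omega> and f :: "'z \<Rightarrow> ennreal"
    using measurable_compose[OF \<tau> that(2)] that by auto
  have suminf: "J (\<lambda>z. \<Sum>i. f i z) = (\<Sum>i. J (f i))" if f: "\<And>i. f i \<in> borel_measurable N" for f :: "nat \<Rightarrow> 'z \<Rightarrow> ennreal"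
  proof -
    have "J (\<lambda>z. \<Sum>i. f i z) = (\<integral>\<^sup>+\<omega>. (\<Sum>i. \<integral>\<^sup>+y. f i (\<tau> \<omega> y) \<partial>k \<omega>) \<partial>M)"
      unfolding J_def by (intro nn_integral_cong nn_integral_suminf km f)
    also have "\<dots> = (\<Sum>i. J (f i))"
      unfolding J_def by (intro nn_integral_suminf m f)
    finally show ?thesis .
  qed
  have em: "emeasure \<nu> A = J (indicator A)" if A: "A \<in> sets N" for A
    unfolding \<nu>_def
  proof (rule emeasure_measure_of_sigma)
    show "sigma_algebra (space N) (sets N)" by (rule sets.sigma_algebra_axioms)
    show "positive (sets N) (\<lambda>A. J (indicator A))" by (simp add: positive_def J_def)
    show "countably_additive (sets N) (\<lambda>A. J (indicator A))"
    proof (rule countably_additiveI)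
      fix A :: "nat \<Rightarrow> 'z set" assume A: "range A \<subseteq> sets N" "disjoint_family A"
      have "(\<lambda>z. \<Sum>i. indicator (A i) z :: ennreal) = indicator (\<Union>i. A i)"
        using suminf_indicator[OF A(2)] by auto
      then show "(\<Sum>i. J (indicator (A i))) = J (indicator (\<Union>i. A i))"
        using suminf[of "\<lambda>i. indicator (A i)"] A(1) by auto
    qed
  qed (fact A)
  have "(\<integral>\<^sup>+z. f z \<partial>\<nu>) = J f" if f: "f \<in> borel_measurable N" for f :: "'z \<Rightarrow> ennreal"
    using f
  proof induct
    case (cong f g)
    have "J f = J g"
      unfolding J_def using \<tau> cong(3)
      by (intro nn_integral_cong) (auto dest: measurable_space)
    moreover have "(\<integral>\<^sup>+z. f z \<partial>\<nu>) = (\<integral>\<^sup>+z. g z \<partial>\<nu>)"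
      using cong(3) by (intro nn_integral_cong) (auto simp: sp)
    ultimately show ?case using cong by simp
  next
    case (set A)
    then show ?case using em[of A] by (simp add: sets)
  next
    case (mult u c)
    have "J (\<lambda>x. c * u x) = c * J u"
    proof -
      have "J (\<lambda>x. c * u x) = (\<integral>\<^sup>+\<omega>. c * (\<integral>\<^sup>+y. u (\<tau> \<omega> y) \<partial>k \<omega>) \<partial>M)"
        unfolding J_def by (intro nn_integral_cong nn_integral_cmult km mult)
      also have "\<dots> = c * J u" unfolding J_def by (intro nn_integral_cmult m mult)
      finally show ?thesis .
    qed
    then show ?case using mult by (simp add: nn_integral_cmult sets cong: measurable_cong_sets)
  next
    case (add u v)
    have "J (\<lambda>x. v x + u x) = J v + J u"
    proof -
      have "J (\<lambda>x. v x + u x) = (\<integral>\<^sup>+\<omega>. (\<integral>\<^sup>+y. v (\<tau> \<omega> y) \<partial>k \<omega>) + (\<integral>\<^sup>+y. u (\<tau> \<omega> y) \<partial>k \<omega>) \<partial>M)"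
        unfolding J_def by (intro nn_integral_cong nn_integral_add km add)
      also have "\<dots> = J v + J u" unfolding J_def by (intro nn_integral_add m add)
      finally show ?thesis .
    qed
    then show ?case using add by (simp add: nn_integral_add sets cong: measurable_cong_sets)
  next
    case (seq U)
    have eq: "(SUP i. U i) = (\<lambda>x. SUP i. U i x)" by (auto simp: fun_eq_iff image_comp)
    have inc: "incseq (\<lambda>i. U i x)" for x using \<open>incseq U\<close> by (auto simp: incseq_def le_fun_def)
    have "J (SUP i. U i) = (\<integral>\<^sup>+\<omega>. (SUP i. \<integral>\<^sup>+y. U i (\<tau> \<omega> y) \<partial>k \<omega>) \<partial>M)"
      unfolding J_def eq using \<open>incseq U\<close>
      by (intro nn_integral_cong nn_integral_monotone_convergence_SUP km seq) (auto simp: incseq_def le_fun_def)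
    also have "\<dots> = (SUP i. J (U i))"
      unfolding J_def using \<open>incseq U\<close>
      by (intro nn_integral_monotone_convergence_SUP m seq) (auto simp: incseq_def le_fun_def intro!: nn_integral_mono)
    also have "\<dots> = (SUP i. \<integral>\<^sup>+z. U i z \<partial>\<nu>)" using seq by simp
    also have "\<dots> = (\<integral>\<^sup>+z. (SUP i. U i) z \<partial>\<nu>)"
      unfolding eq using seq
      by (intro nn_integral_monotone_convergence_SUP[symmetric]) (auto simp: sets cong: measurable_cong_sets)
    finally show ?case by (rule sym)
  qed
  with sets show ?thesis by (intro that[of \<nu>]) (auto simp: J_def)
qed

section \<open>One-step laws of a jump process with tilted rates\<close>

text \<open>Both kinds of process are instances: the unperturbed one with tilt 0 and the perturbed
  one with tilt lambda g. Everything proved here can thus be used on either side of the change of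
  measure.\<close>

locale tilted_jump = jump_process M S "{0..t}" "tilted_kernel r \<gamma> 1" \<pi> T Z + tilt S r \<gamma> K
  for M :: "'w measure" and S :: "'a measure" and t :: real and r \<gamma> K \<pi>
    and T :: "nat \<Rightarrow> 'w \<Rightarrow> real" and Z :: "nat \<Rightarrow> 'w \<Rightarrow> 'a"
begin

declare measurable_T [measurable] measurable_Z [measurable]

abbreviation "hist n \<equiv> history M S T Z n"
abbreviation "pre n \<equiv> pre_jump_history M S T Z n"

lemma Z_space: "\<omega> \<in> space M \<Longrightarrow> Z n \<omega> \<in> space S"
  using measurable_Z by (rule measurable_space)

lemma space_hist [simp]: "space (hist n) = space M"
  by (simp add: history_def)

lemma space_pre [simp]: "space (pre n) = space M"
  by (simp add: pre_jump_history_def)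

lemma hist_measurable:
  assumes "i \<le> n"
  shows "T i \<in> borel_measurable (hist n)" "Z i \<in> measurable (hist n) S"
proof -
  have "(\<lambda>\<omega>. \<lambda>i\<in>{..n}. (T i \<omega>, Z i \<omega>)) \<in> hist n \<rightarrow>\<^sub>M (\<Pi>\<^sub>M i\<in>{..n}. borel \<Otimes>\<^sub>M S)"
    unfolding history_def
    by (rule measurable_vimage_algebra1) (auto simp: space_PiM space_pair_measure Z_space)
  from measurable_compose[OF this measurable_component_singleton[of i]] assms
  have "(\<lambda>\<omega>. (T i \<omega>, Z i \<omega>)) \<in> hist n \<rightarrow>\<^sub>M borel \<Otimes>\<^sub>M S" by simp
  from measurable_compose[OF this measurable_fst] measurable_compose[OF this measurable_snd]
  show "T i \<in> borel_measurable (hist n)" "Z i \<in> measurable (hist n) S" by simp_all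
qed

lemma pre_measurable:
  shows "i \<le> n \<Longrightarrow> T i \<in> borel_measurable (pre n)" "i \<le> n \<Longrightarrow> Z i \<in> measurable (pre n) S"
    "T (Suc n) \<in> borel_measurable (pre n)"
proof -
  have *: "(\<lambda>\<omega>. (\<lambda>i\<in>{..n}. (T i \<omega>, Z i \<omega>), T (Suc n) \<omega>)) \<in> pre n \<rightarrow>\<^sub>M (\<Pi>\<^sub>M i\<in>{..n}. borel \<Otimes>\<^sub>M S) \<Otimes>\<^sub>M borel"
    unfolding pre_jump_history_def
    by (rule measurable_vimage_algebra1) (auto simp: space_PiM space_pair_measure Z_space)
  from measurable_compose[OF * measurable_snd] show "T (Suc n) \<in> borel_measurable (pre n)" by simp
  assume "i \<le> n"
  with measurable_compose[OF measurable_compose[OF * measurable_fst] measurable_component_singleton[of i]]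
  have "(\<lambda>\<omega>. (T i \<omega>, Z i \<omega>)) \<in> pre n \<rightarrow>\<^sub>M borel \<Otimes>\<^sub>M S" by simp
  from measurable_compose[OF this measurable_fst] measurable_compose[OF this measurable_snd]
  show "T i \<in> borel_measurable (pre n)" "Z i \<in> measurable (pre n) S" by simp_all
qed

text \<open>Composition with the identity carries measurability from \<open>hist n\<close> to any
  \<sigma>-algebra that knows the first jumps. The transfer lemmas below are instances.\<close>

lemma measurable_id_hist:
  assumes "space N = space M" and [measurable]: "\<And>i. i \<le> n \<Longrightarrow> T i \<in> borel_measurable N"
    "\<And>i. i \<le> n \<Longrightarrow> Z i \<in> measurable N S"
  shows "(\<lambda>\<omega>. \<omega>) \<in> measurable N (hist n)"
  unfolding history_def
  by (rule measurable_vimage_algebra2) (auto simp: assms(1) intro!: measurable_restrict assms)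

lemma measurable_id_pre: "(\<lambda>\<omega>. \<omega>) \<in> measurable M (pre n)"
  unfolding pre_jump_history_def
  by (rule measurable_vimage_algebra2) (auto intro!: measurable_restrict measurable_Pair)

lemma hist_mono:
  assumes "n \<le> m" "f \<in> measurable (hist n) N"
  shows "f \<in> measurable (hist m) N"
proof -
  have "(\<lambda>\<omega>. \<omega>) \<in> measurable (hist m) (hist n)"
    by (rule measurable_id_hist) (use hist_measurable assms(1) in \<open>auto intro: order_trans\<close>)
  from measurable_compose[OF this assms(2)] show ?thesis by simp
qed

lemma hist_M:
  assumes "f \<in> measurable (hist n) N" shows "f \<in> measurable M N"
  using measurable_compose[OF measurable_id_hist[OF refl measurable_T measurable_Z] assms] by simp

lemma hist_pre:
  assumes "f \<in> measurable (hist n) N" shows "f \<in> measurable (pre n) N"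
  using measurable_compose[OF measurable_id_hist[OF space_pre pre_measurable(1,2)] assms] by simp

lemma subalgebra_hist: "subalgebra M (hist n)" and subalgebra_pre: "subalgebra M (pre n)"
proof -
  have *: "subalgebra M N" if "space N = space M" "(\<lambda>\<omega>. \<omega>) \<in> measurable M N" for N
    unfolding subalgebra_def
  proof (intro conjI subsetI)
    fix A assume A: "A \<in> sets N"
    then have "(\<lambda>\<omega>. \<omega>) -` A \<inter> space M \<in> sets M" using that(2) by (rule measurable_sets[rotated])
    moreover have "(\<lambda>\<omega>. \<omega>) -` A \<inter> space M = A" using sets.sets_into_space[OF A] that(1) by auto
    ultimately show "A \<in> sets M" by simp
  qed (rule that)
  show "subalgebra M (hist n)"
    by (rule *[OF space_hist measurable_id_hist[OF refl measurable_T measurable_Z]])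
  show "subalgebra M (pre n)" by (rule *[OF space_pre measurable_id_pre])
qed

text \<open>\<open>waiting_time\<close> tested against weights that depend on the history. The
  cut-off \<open>T n \<omega> \<le> u\<close> restricts to the event on which the conditional law is
  prescribed.\<close>

lemma survival:
  assumes W: "W \<in> borel_measurable (hist n)" and u: "u \<in> {0..t}"
  shows "(\<integral>\<^sup>+\<omega>. W \<omega> * indicator {..u} (T n \<omega>) * indicator {u<..} (T (Suc n) \<omega>) \<partial>M) =
    (\<integral>\<^sup>+\<omega>. W \<omega> * indicator {..u} (T n \<omega>) * ennreal (surv r \<gamma> (Z n \<omega>) (T n \<omega>) u) \<partial>M)"
proof -
  let ?E = "{\<omega>\<in>space M. u < T (Suc n) \<omega>}"
  have "(\<integral>\<^sup>+\<omega>. (W \<omega> * indicator {..u} (T n \<omega>)) * indicator ?E \<omega> \<partial>M) =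
      (\<integral>\<^sup>+\<omega>. (W \<omega> * indicator {..u} (T n \<omega>)) * ennreal (surv r \<gamma> (Z n \<omega>) (T n \<omega>) u) \<partial>M)"
  proof (rule nn_integral_cond_indicator[OF subalgebra_hist, where B = "{\<omega>. T n \<omega> \<le> u}"])
    have [measurable]: "T n \<in> borel_measurable (hist n)" by (simp add: hist_measurable)
    show "(\<lambda>\<omega>. W \<omega> * indicator {..u} (T n \<omega>)) \<in> borel_measurable (hist n)"
      using W by measurable
    show "AE \<omega> in M. \<omega> \<in> {\<omega>. T n \<omega> \<le> u} \<longrightarrow> real_cond_exp M (hist n) (indicator ?E) \<omega> = surv r \<gamma> (Z n \<omega>) (T n \<omega>) u"
      using waiting_time[OF u, of n] AE_space
    proof eventually_elim
      case (elim \<omega>)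
      then show ?case by (simp add: surv_def measure_tilted_space Z_space)
    qed
  qed auto
  then show ?thesis by (subst (asm) nn_integral_cong[where v = "\<lambda>\<omega>. W \<omega> * indicator {..u} (T n \<omega>) * indicator {u<..} (T (Suc n) \<omega>)"]) (auto split: split_indicator)
qed

lemma T_nonneg: "\<omega> \<in> space M \<Longrightarrow> 0 \<le> T n \<omega>"
proof (induction n)
  case (Suc n) then show ?case using T_Suc[of \<omega> n] by simp
qed (simp add: T_0)

text \<open>\<open>jump_law\<close> speaks of one set \<open>C\<close> at a time, while a test
  function may couple the new state with the past and with the jump time. The two joint laws agree
  on rectangles, hence as measures.\<close>

lemma jump_step:
  assumes \<phi>: "\<phi> \<in> borel_measurable (pre n \<Otimes>\<^sub>M S)"
  shows "(\<integral>\<^sup>+\<omega>. indicator {..t} (T (Suc n) \<omega>) * \<phi> (\<omega>, Z (Suc n) \<omega>) \<partial>M) =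
    (\<integral>\<^sup>+\<omega>. indicator {..t} (T (Suc n) \<omega>) * (\<integral>\<^sup>+y. ennreal (exp (\<gamma> (T (Suc n) \<omega>) (Z n \<omega>) y) / rate r \<gamma> (T (Suc n) \<omega>) (Z n \<omega>)) * \<phi> (\<omega>, y) \<partial>r (Z n \<omega>)) \<partial>M)"
proof -
  note [measurable] = pre_measurable(3)[of n] pre_measurable(2)[of n n, OF order_refl]
  define d where "d \<omega> y = ennreal (indicator {..t} (T (Suc n) \<omega>) * (exp (\<gamma> (T (Suc n) \<omega>) (Z n \<omega>) y) / rate r \<gamma> (T (Suc n) \<omega>) (Z n \<omega>)))" for \<omega> y
  have dm: "d \<omega> \<in> borel_measurable (r (Z n \<omega>))" if "\<omega> \<in> space M" for \<omega>
    unfolding d_def using that Z_space by (intro measurable_r) auto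
  have pm: "(\<lambda>y. f (\<omega>, y)) \<in> borel_measurable (r (Z n \<omega>))" if "\<omega> \<in> space M" "f \<in> borel_measurable (pre n \<Otimes>\<^sub>M S)"
    for \<omega> and f :: "_ \<Rightarrow> ennreal"
    by (rule measurable_r[OF Z_space[OF that(1)]], rule measurable_Pair2[OF that(2)]) (simp add: that)
  have dmp: "(\<lambda>(\<omega>, y). d \<omega> y) \<in> borel_measurable (pre n \<Otimes>\<^sub>M S)"
    unfolding d_def by measurable
  obtain \<nu> where \<nu>: "sets \<nu> = sets (pre n \<Otimes>\<^sub>M S)"
    "\<And>f :: _ \<Rightarrow> ennreal. f \<in> borel_measurable (pre n \<Otimes>\<^sub>M S) \<Longrightarrow>
      (\<integral>\<^sup>+z. f z \<partial>\<nu>) = (\<integral>\<^sup>+\<omega>. \<integral>\<^sup>+y. f (\<omega>, y) \<partial>density (r (Z n \<omega>)) (d \<omega>) \<partial>M)"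
  proof (rule mixture_measure[of M "\<lambda>\<omega> y. (\<omega>, y)" "\<lambda>\<omega>. density (r (Z n \<omega>)) (d \<omega>)" "pre n \<Otimes>\<^sub>M S"])
    fix \<omega> assume "\<omega> \<in> space M"
    then show "Pair \<omega> \<in> density (r (Z n \<omega>)) (d \<omega>) \<rightarrow>\<^sub>M pre n \<Otimes>\<^sub>M S"
      using Z_space by (simp cong: measurable_cong_sets)
  next
    fix f :: "_ \<Rightarrow> ennreal" assume f: "f \<in> borel_measurable (pre n \<Otimes>\<^sub>M S)"
    have "(\<lambda>\<omega>. \<integral>\<^sup>+y. d \<omega> y * f (\<omega>, y) \<partial>r (Z n \<omega>)) \<in> borel_measurable (pre n)"
      using f dmp by measurable
    then have "(\<lambda>\<omega>. \<integral>\<^sup>+y. d \<omega> y * f (\<omega>, y) \<partial>r (Z n \<omega>)) \<in> borel_measurable M"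
      using measurable_compose[OF measurable_id_pre] by blast
    then show "(\<lambda>\<omega>. \<integral>\<^sup>+y. f (\<omega>, y) \<partial>density (r (Z n \<omega>)) (d \<omega>)) \<in> borel_measurable M"
      by (rule measurable_cong[THEN iffD1, rotated]) (auto simp: nn_integral_density dm pm f)
  qed blast
  have [measurable]: "(\<lambda>\<omega>. (\<omega>, Z (Suc n) \<omega>)) \<in> M \<rightarrow>\<^sub>M pre n \<Otimes>\<^sub>M S"
    using measurable_id_pre by (intro measurable_Pair) auto
  let ?\<mu> = "distr (density M (\<lambda>\<omega>. indicator {..t} (T (Suc n) \<omega>))) (pre n \<Otimes>\<^sub>M S) (\<lambda>\<omega>. (\<omega>, Z (Suc n) \<omega>))"
  have \<mu>: "(\<integral>\<^sup>+z. f z \<partial>?\<mu>) = (\<integral>\<^sup>+\<omega>. indicator {..t} (T (Suc n) \<omega>) * f (\<omega>, Z (Suc n) \<omega>) \<partial>M)"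
    if [measurable]: "f \<in> borel_measurable (pre n \<Otimes>\<^sub>M S)" for f :: "_ \<Rightarrow> ennreal"
    by (simp add: nn_integral_distr nn_integral_density)
  have \<nu>': "(\<integral>\<^sup>+z. f z \<partial>\<nu>) = (\<integral>\<^sup>+\<omega>. indicator {..t} (T (Suc n) \<omega>) * (\<integral>\<^sup>+y. ennreal (exp (\<gamma> (T (Suc n) \<omega>) (Z n \<omega>) y) / rate r \<gamma> (T (Suc n) \<omega>) (Z n \<omega>)) * f (\<omega>, y) \<partial>r (Z n \<omega>)) \<partial>M)"
    if f: "f \<in> borel_measurable (pre n \<Otimes>\<^sub>M S)" for f :: "_ \<Rightarrow> ennreal"
    unfolding \<nu>(2)[OF f]
    by (intro nn_integral_cong) (auto simp: nn_integral_density dm pm f d_def split: split_indicator)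
  \<comment> \<open>On a rectangle with \<open>A\<close> in \<open>pre n\<close>, the identity is
    \<open>jump_law\<close> for \<open>C\<close> integrated over \<open>A\<close>.\<close>
  have "?\<mu> = \<nu>"
  proof (rule measure_eqI_rectangles[of _ "pre n" S])
    show "finite_measure ?\<mu>"
    proof (rule finite_measureI)
      have "emeasure ?\<mu> (space ?\<mu>) = (\<integral>\<^sup>+z. 1 \<partial>?\<mu>)" by simp
      also have "\<dots> = (\<integral>\<^sup>+\<omega>. indicator {..t} (T (Suc n) \<omega>) \<partial>M)" by (subst \<mu>) auto
      also have "\<dots> \<le> (\<integral>\<^sup>+\<omega>. 1 \<partial>M)" by (intro nn_integral_mono) (auto split: split_indicator)
      finally have "emeasure ?\<mu> (space ?\<mu>) \<le> 1" by (simp add: emeasure_space_1)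
      then show "emeasure ?\<mu> (space ?\<mu>) \<noteq> \<infinity>"
        using ennreal_one_less_top by (metis infinity_ennreal_def leD)
    qed
    fix A C assume A: "A \<in> sets (pre n)" and C: "C \<in> sets S"
    let ?W = "\<lambda>\<omega>. indicator {..t} (T (Suc n) \<omega>) * indicator A \<omega> :: ennreal"
    have "(\<integral>\<^sup>+\<omega>. ?W \<omega> * indicator {\<omega>\<in>space M. Z (Suc n) \<omega> \<in> C} \<omega> \<partial>M) =
       (\<integral>\<^sup>+\<omega>. ?W \<omega> * ennreal (measure (tilted_kernel r \<gamma> 1 (T (Suc n) \<omega>) (Z n \<omega>)) C / rate r \<gamma> (T (Suc n) \<omega>) (Z n \<omega>)) \<partial>M)"
    proof (rule nn_integral_cond_indicator[OF subalgebra_pre[of n], where B = "{\<omega>. T (Suc n) \<omega> \<in> {0..t}}"])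
      show "?W \<in> borel_measurable (pre n)" using A by measurable
      show "{\<omega> \<in> space M. Z (Suc n) \<omega> \<in> C} \<in> sets M" using C by measurable
      show "AE \<omega> in M. \<omega> \<in> {\<omega>. T (Suc n) \<omega> \<in> {0..t}} \<longrightarrow>
         real_cond_exp M (pre n) (indicator {\<omega> \<in> space M. Z (Suc n) \<omega> \<in> C}) \<omega> =
         measure (tilted_kernel r \<gamma> 1 (T (Suc n) \<omega>) (Z n \<omega>)) C / rate r \<gamma> (T (Suc n) \<omega>) (Z n \<omega>)"
        using jump_law[OF C, of n] AE_space
      proof eventually_elim
        case (elim \<omega>)
        then show ?case by (simp add: measure_tilted_space Z_space)
      qed
    qed (use T_nonneg[of _ "Suc n"] in auto)
    also have "\<dots> = (\<integral>\<^sup>+\<omega>. indicator {..t} (T (Suc n) \<omega>) * (\<integral>\<^sup>+y. ennreal (exp (\<gamma> (T (Suc n) \<omega>) (Z n \<omega>) y) / rate r \<gamma> (T (Suc n) \<omega>) (Z n \<omega>)) * indicator (A \<times> C) (\<omega>, y) \<partial>r (Z n \<omega>)) \<partial>M)"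
      by (intro nn_integral_cong) (auto simp: measure_tilted Z_space C indicator_times split: split_indicator)
    also have "\<dots> = emeasure \<nu> (A \<times> C)"
      using A C \<nu>'[of "indicator (A \<times> C)"] by (simp add: \<nu>(1))
    also have "(\<integral>\<^sup>+\<omega>. ?W \<omega> * indicator {\<omega>\<in>space M. Z (Suc n) \<omega> \<in> C} \<omega> \<partial>M) =
        (\<integral>\<^sup>+\<omega>. indicator {..t} (T (Suc n) \<omega>) * indicator (A \<times> C) (\<omega>, Z (Suc n) \<omega>) \<partial>M)"
      by (intro nn_integral_cong) (auto split: split_indicator)
    also have "\<dots> = emeasure ?\<mu> (A \<times> C)"
      using A C \<mu>[of "indicator (A \<times> C)"] by simp
    finally show "emeasure ?\<mu> (A \<times> C) = emeasure \<nu> (A \<times> C)" .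
  qed (auto simp: \<nu>)
  then show ?thesis using \<mu>[OF \<phi>] \<nu>'[OF \<phi>] by simp
qed

end

section \<open>Holding intervals, paths and the Levy system\<close>

text \<open>The indicator of being in the \<open>n\<close>-th holding interval at time
  \<open>s\<close>. It has values in [0, infinity] because it is summed over \<open>n\<close> inside
  nonnegative integrals.\<close>

definition slot :: "(nat \<Rightarrow> 'w \<Rightarrow> real) \<Rightarrow> nat \<Rightarrow> real \<Rightarrow> 'w \<Rightarrow> ennreal" where
  "slot T n s \<omega> = indicator {..s} (T n \<omega>) * indicator {s<..} (T (Suc n) \<omega>)"

text \<open>No explosion up to and including time \<open>s\<close>. Keeping this as an event,
  instead of assuming it, lets the same identities hold for perturbed processes before their
  explosion is excluded.\<close>

definition alive :: "(nat \<Rightarrow> 'w \<Rightarrow> real) \<Rightarrow> real \<Rightarrow> 'w \<Rightarrow> bool" where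
  "alive T s \<omega> \<longleftrightarrow> (\<exists>n. s < T (Suc n) \<omega>)"

context tilted_jump
begin

sublocale lborel_M: pair_sigma_finite lborel M ..

lemma T_less: "\<omega> \<in> space M \<Longrightarrow> i < j \<Longrightarrow> T i \<omega> < T j \<omega>"
  by (rule lift_Suc_mono_less[of "\<lambda>i. T i \<omega>"]) (use T_Suc in auto)

lemma T_less_iff: "\<omega> \<in> space M \<Longrightarrow> T i \<omega> < T j \<omega> \<longleftrightarrow> i < j"
  using T_less[of \<omega> i j] T_less[of \<omega> j i] by (cases i j rule: linorder_cases) auto

lemma T_le_iff: "\<omega> \<in> space M \<Longrightarrow> T i \<omega> \<le> T j \<omega> \<longleftrightarrow> i \<le> j"
  using T_less_iff[of \<omega> j i] by (simp add: not_less[symmetric])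

lemma alive_obtain:
  assumes \<omega>: "\<omega> \<in> space M" and s: "0 \<le> s" and a: "alive T s \<omega>"
  obtains n where "T n \<omega> \<le> s" "s < T (Suc n) \<omega>"
proof -
  define n where "n = (LEAST n. s < T (Suc n) \<omega>)"
  have "s < T (Suc n) \<omega>" using a unfolding n_def alive_def by (rule LeastI_ex)
  moreover have "T n \<omega> \<le> s"
  proof (cases n)
    case (Suc m)
    then show ?thesis using not_less_Least[of m "\<lambda>n. s < T (Suc n) \<omega>"] by (simp add: n_def)
  qed (use T_0[OF \<omega>] s in simp)
  ultimately show ?thesis using that by blast
qed

lemma jump_path_eq:
  assumes \<omega>: "\<omega> \<in> space M" and n: "T n \<omega> \<le> s" "s < T (Suc n) \<omega>"
  shows "jump_path T Z s \<omega> = Z n \<omega>"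
proof -
  have "(LEAST m. s < T (Suc m) \<omega>) = n"
  proof (rule Least_equality)
    fix m assume "s < T (Suc m) \<omega>"
    then have "T n \<omega> < T (Suc m) \<omega>" using n by simp
    then show "n \<le> m" using T_less_iff[OF \<omega>] by simp
  qed (rule n)
  then show ?thesis using n by (auto simp: jump_path_def)
qed

lemma slot_eq: 
  assumes \<omega>: "\<omega> \<in> space M" and n: "T n \<omega> \<le> s" "s < T (Suc n) \<omega>"
  shows "slot T m s \<omega> = (if m = n then 1 else 0)"
proof -
  have "m = n" if "T m \<omega> \<le> s" "s < T (Suc m) \<omega>"
  proof -
    have "T n \<omega> < T (Suc m) \<omega>" "T m \<omega> < T (Suc n) \<omega>" using that n by auto
    then show ?thesis using T_less_iff[OF \<omega>] by simp
  qed
  then have "\<not> (T m \<omega> \<le> s \<and> s < T (Suc m) \<omega>)" if "m \<noteq> n" using that by blast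
  then show ?thesis using n by (cases "m = n") (auto simp: slot_def indicator_def)
qed

lemma suminf_slot:
  assumes \<omega>: "\<omega> \<in> space M" and n: "T n \<omega> \<le> s" "s < T (Suc n) \<omega>"
  shows "(\<Sum>m. F m * slot T m s \<omega>) = F n"
proof -
  have "(\<Sum>m. F m * slot T m s \<omega>) = (\<Sum>m\<in>{n}. F m * slot T m s \<omega>)"
    by (rule suminf_finite) (auto simp: slot_eq[OF \<omega> n])
  then show ?thesis by (simp add: slot_eq[OF \<omega> n])
qed

text \<open>The decomposition by the number of jumps. An exploded path lies in no holding interval,
  so the arbitrary state assigned to it by \<open>jump_path\<close> never enters.\<close>

lemma suminf_slot_path:
  assumes \<omega>: "\<omega> \<in> space M" and s: "0 \<le> s"
  shows "(\<Sum>n. f (Z n \<omega>) * slot T n s \<omega>) = (if alive T s \<omega> then f (jump_path T Z s \<omega>) else 0)"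
proof (cases "alive T s \<omega>")
  case True
  obtain n where n: "T n \<omega> \<le> s" "s < T (Suc n) \<omega>" by (rule alive_obtain[OF \<omega> s True])
  show ?thesis using suminf_slot[OF \<omega> n, of "\<lambda>n. f (Z n \<omega>)"] True by (simp only: jump_path_eq[OF \<omega> n] if_True)
next
  case False
  then have "\<not> s < T (Suc n) \<omega>" for n by (simp add: alive_def)
  then have "slot T n s \<omega> = 0" for n by (simp add: slot_def)
  then show ?thesis using False by simp
qed

lemma measurable_slot [measurable]:
  assumes [measurable]: "f \<in> borel_measurable N" "g \<in> measurable N M"
  shows "(\<lambda>w. slot T n (f w) (g w)) \<in> borel_measurable N"
  unfolding slot_def by measurable

lemma measurable_alive [measurable]:
  assumes [measurable]: "f \<in> borel_measurable N" "g \<in> measurable N M"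
  shows "Measurable.pred N (\<lambda>w. alive T (f w) (g w))"
  unfolding alive_def by measurable

lemma measurable_jump_path [measurable (raw)]:
  assumes [measurable]: "f \<in> borel_measurable N" "g \<in> measurable N M"
  shows "(\<lambda>w. jump_path T Z (f w) (g w)) \<in> measurable N S"
proof -
  have L: "(\<lambda>w. LEAST n. f w < T (Suc n) (g w)) \<in> measurable N (count_space UNIV)" by measurable
  have Zg: "(\<lambda>w. Z n (g w)) \<in> measurable N S" for n by measurable
  have [measurable]: "(\<lambda>w. Z (LEAST n. f w < T (Suc n) (g w)) (g w)) \<in> measurable N S"
    by (rule measurable_compose_countable[OF Zg L])
  show ?thesis unfolding jump_path_def by measurable
qed

lemma jump_path_space: "\<omega> \<in> space M \<Longrightarrow> jump_path T Z s \<omega> \<in> space S"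
  unfolding jump_path_def using Z_space by auto

text \<open>\<open>survival\<close> gives, for each fixed \<open>u\<close> and each event of the
  history, the distribution function of the next jump time. Finite measures on the line with equal
  distribution functions agree, and rectangles then give the joint law with the history.\<close>

lemma waiting_step:
  assumes \<eta>: "\<eta> \<in> borel_measurable (hist n \<Otimes>\<^sub>M borel)"
  shows "(\<integral>\<^sup>+\<omega>. indicator {..t} (T (Suc n) \<omega>) * \<eta> (\<omega>, T (Suc n) \<omega>) \<partial>M) =
    (\<integral>\<^sup>+\<omega>. \<integral>\<^sup>+s. indicator {T n \<omega>..t} s * ennreal (rate r \<gamma> s (Z n \<omega>) * surv r \<gamma> (Z n \<omega>) (T n \<omega>) s) * \<eta> (\<omega>, s) \<partial>lborel \<partial>M)"
proof -
  note [measurable] = hist_measurable[of n n, OF order_refl]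
  define d where "d \<omega> s = indicator {T n \<omega>..t} s * ennreal (rate r \<gamma> s (Z n \<omega>) * surv r \<gamma> (Z n \<omega>) (T n \<omega>) s)" for \<omega> s
  have dm[measurable]: "(\<lambda>(\<omega>, s). d \<omega> s) \<in> borel_measurable (hist n \<Otimes>\<^sub>M borel)"
    unfolding d_def by measurable
  have dms: "d \<omega> \<in> borel_measurable borel" if "\<omega> \<in> space M" for \<omega>
    using measurable_Pair2[OF dm, of \<omega>] that by simp
  have fms: "(\<lambda>s. f (\<omega>, s)) \<in> borel_measurable borel"
    if "\<omega> \<in> space M" "f \<in> borel_measurable (hist n \<Otimes>\<^sub>M borel)" for \<omega> and f :: "_ \<times> real \<Rightarrow> ennreal"
    by (rule measurable_Pair2[OF that(2)]) (simp add: that)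
  obtain \<nu> where \<nu>: "sets \<nu> = sets (hist n \<Otimes>\<^sub>M borel)"
    "\<And>f :: _ \<times> real \<Rightarrow> ennreal. f \<in> borel_measurable (hist n \<Otimes>\<^sub>M borel) \<Longrightarrow>
      (\<integral>\<^sup>+z. f z \<partial>\<nu>) = (\<integral>\<^sup>+\<omega>. \<integral>\<^sup>+s. f (\<omega>, s) \<partial>density lborel (d \<omega>) \<partial>M)"
  proof (rule mixture_measure[of M "\<lambda>\<omega> s. (\<omega>, s)" "\<lambda>\<omega>. density lborel (d \<omega>)" "hist n \<Otimes>\<^sub>M borel"])
    fix \<omega> assume "\<omega> \<in> space M"
    then show "Pair \<omega> \<in> density lborel (d \<omega>) \<rightarrow>\<^sub>M hist n \<Otimes>\<^sub>M borel" by simp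
  next
    fix f :: "_ \<times> real \<Rightarrow> ennreal" assume f: "f \<in> borel_measurable (hist n \<Otimes>\<^sub>M borel)"
    have "(\<lambda>\<omega>. \<integral>\<^sup>+s. d \<omega> s * f (\<omega>, s) \<partial>lborel) \<in> borel_measurable (hist n)"
      using f by measurable
    then have "(\<lambda>\<omega>. \<integral>\<^sup>+s. d \<omega> s * f (\<omega>, s) \<partial>lborel) \<in> borel_measurable M"
      by (rule hist_M)
    then show "(\<lambda>\<omega>. \<integral>\<^sup>+s. f (\<omega>, s) \<partial>density lborel (d \<omega>)) \<in> borel_measurable M"
      by (rule measurable_cong[THEN iffD1, rotated]) (simp add: nn_integral_density dms fms f)
  qed blast
  have \<nu>': "(\<integral>\<^sup>+z. f z \<partial>\<nu>) = (\<integral>\<^sup>+\<omega>. \<integral>\<^sup>+s. d \<omega> s * f (\<omega>, s) \<partial>lborel \<partial>M)"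
    if f: "f \<in> borel_measurable (hist n \<Otimes>\<^sub>M borel)" for f :: "_ \<times> real \<Rightarrow> ennreal"
    unfolding \<nu>(2)[OF f] by (intro nn_integral_cong) (simp add: nn_integral_density dms fms f)
  have idm: "(\<lambda>\<omega>. \<omega>) \<in> measurable M (hist n)"
    by (rule measurable_id_hist[OF refl measurable_T measurable_Z])
  have [measurable]: "(\<lambda>\<omega>. (\<omega>, T (Suc n) \<omega>)) \<in> M \<rightarrow>\<^sub>M hist n \<Otimes>\<^sub>M borel"
    using idm measurable_T by (rule measurable_Pair)
  let ?\<mu> = "distr (density M (\<lambda>\<omega>. indicator {..t} (T (Suc n) \<omega>))) (hist n \<Otimes>\<^sub>M borel) (\<lambda>\<omega>. (\<omega>, T (Suc n) \<omega>))"
  have \<mu>: "(\<integral>\<^sup>+z. f z \<partial>?\<mu>) = (\<integral>\<^sup>+\<omega>. indicator {..t} (T (Suc n) \<omega>) * f (\<omega>, T (Suc n) \<omega>) \<partial>M)"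
    if [measurable]: "f \<in> borel_measurable (hist n \<Otimes>\<^sub>M borel)" for f :: "_ \<times> real \<Rightarrow> ennreal"
    by (simp add: nn_integral_distr nn_integral_density)
  have fin\<mu>: "finite_measure ?\<mu>"
  proof (rule finite_measureI)
    have "emeasure ?\<mu> (space ?\<mu>) = (\<integral>\<^sup>+z. 1 \<partial>?\<mu>)" by simp
    also have "\<dots> = (\<integral>\<^sup>+\<omega>. indicator {..t} (T (Suc n) \<omega>) \<partial>M)" by (subst \<mu>) auto
    also have "\<dots> \<le> (\<integral>\<^sup>+\<omega>. 1 \<partial>M)" by (intro nn_integral_mono) (auto split: split_indicator)
    finally have "emeasure ?\<mu> (space ?\<mu>) \<le> 1" by (simp add: emeasure_space_1)
    then show "emeasure ?\<mu> (space ?\<mu>) \<noteq> \<infinity>"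
      using ennreal_one_less_top by (metis infinity_ennreal_def leD)
  qed
  have spaces: "space ?\<mu> = space M \<times> UNIV" "space \<nu> = space M \<times> UNIV"
    using sets_eq_imp_space_eq[OF \<nu>(1)] by (simp_all add: space_pair_measure)
  have cdf_eq: "emeasure ?\<mu> (H \<times> {..u}) = emeasure \<nu> (H \<times> {..u})" if H: "H \<in> sets (hist n)" for H u
  proof -
    \<comment> \<open>Survival probabilities are known only inside the window, and both measures
      charge only jump times up to \<open>t\<close>.\<close>
    define u' where "u' = min u t"
    have HM: "H \<in> sets M" using H subalgebra_hist[of n] by (auto simp: subalgebra_def)
    have Hu: "H \<times> {..u} \<in> sets (hist n \<Otimes>\<^sub>M borel)" using H by simp
    have L: "emeasure ?\<mu> (H \<times> {..u}) = (\<integral>\<^sup>+\<omega>. indicator H \<omega> * indicator {..u'} (T (Suc n) \<omega>) \<partial>M)"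
    proof -
      have "emeasure ?\<mu> (H \<times> {..u}) = (\<integral>\<^sup>+z. indicator (H \<times> {..u}) z \<partial>?\<mu>)" using Hu by simp
      also have "\<dots> = (\<integral>\<^sup>+\<omega>. indicator {..t} (T (Suc n) \<omega>) * indicator (H \<times> {..u}) (\<omega>, T (Suc n) \<omega>) \<partial>M)"
        using Hu by (intro \<mu>) simp
      also have "\<dots> = (\<integral>\<^sup>+\<omega>. indicator H \<omega> * indicator {..u'} (T (Suc n) \<omega>) \<partial>M)"
        by (intro nn_integral_cong) (auto simp: u'_def split: split_indicator)
      finally show ?thesis .
    qed
    have R: "emeasure \<nu> (H \<times> {..u}) = (\<integral>\<^sup>+\<omega>. indicator H \<omega> * (\<integral>\<^sup>+s. indicator {T n \<omega>..u'} s * ennreal (rate r \<gamma> s (Z n \<omega>) * surv r \<gamma> (Z n \<omega>) (T n \<omega>) s) \<partial>lborel) \<partial>M)"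
    proof -
      have "emeasure \<nu> (H \<times> {..u}) = (\<integral>\<^sup>+z. indicator (H \<times> {..u}) z \<partial>\<nu>)" using Hu by (simp add: \<nu>(1))
      also have "\<dots> = (\<integral>\<^sup>+\<omega>. \<integral>\<^sup>+s. d \<omega> s * indicator (H \<times> {..u}) (\<omega>, s) \<partial>lborel \<partial>M)"
        using Hu by (intro \<nu>') simp
      also have "\<dots> = (\<integral>\<^sup>+\<omega>. indicator H \<omega> * (\<integral>\<^sup>+s. indicator {T n \<omega>..u'} s * ennreal (rate r \<gamma> s (Z n \<omega>) * surv r \<gamma> (Z n \<omega>) (T n \<omega>) s) \<partial>lborel) \<partial>M)"
      proof (rule nn_integral_cong)
        fix \<omega> assume "\<omega> \<in> space M"
        show "(\<integral>\<^sup>+s. d \<omega> s * indicator (H \<times> {..u}) (\<omega>, s) \<partial>lborel) =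
          indicator H \<omega> * (\<integral>\<^sup>+s. indicator {T n \<omega>..u'} s * ennreal (rate r \<gamma> s (Z n \<omega>) * surv r \<gamma> (Z n \<omega>) (T n \<omega>) s) \<partial>lborel)"
        proof (cases "\<omega> \<in> H")
          case True
          have "(\<integral>\<^sup>+s. d \<omega> s * indicator (H \<times> {..u}) (\<omega>, s) \<partial>lborel) =
            (\<integral>\<^sup>+s. indicator {T n \<omega>..u'} s * ennreal (rate r \<gamma> s (Z n \<omega>) * surv r \<gamma> (Z n \<omega>) (T n \<omega>) s) \<partial>lborel)"
            using True by (intro nn_integral_cong) (auto simp: d_def u'_def split: split_indicator)
          then show ?thesis using True by simp
        next
          case False
          then have "(\<integral>\<^sup>+s. d \<omega> s * indicator (H \<times> {..u}) (\<omega>, s) \<partial>lborel) = (\<integral>\<^sup>+s. 0 \<partial>(lborel::real measure))"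
            by (intro nn_integral_cong) auto
          then show ?thesis using False by simp
        qed
      qed
      finally show ?thesis .
    qed
    show ?thesis
    proof (cases "u' < 0")
      case True
      have "(\<integral>\<^sup>+\<omega>. indicator H \<omega> * indicator {..u'} (T (Suc n) \<omega>) \<partial>M) = (\<integral>\<^sup>+\<omega>. 0 \<partial>M)"
      proof (rule nn_integral_cong)
        fix \<omega> assume "\<omega> \<in> space M"
        then have "u' < T (Suc n) \<omega>" using T_nonneg[of \<omega> "Suc n"] True by simp
        then show "indicator H \<omega> * indicator {..u'} (T (Suc n) \<omega>) = (0::ennreal)" by simp
      qed
      moreover have "(\<integral>\<^sup>+\<omega>. indicator H \<omega> * (\<integral>\<^sup>+s. indicator {T n \<omega>..u'} s * ennreal (rate r \<gamma> s (Z n \<omega>) * surv r \<gamma> (Z n \<omega>) (T n \<omega>) s) \<partial>lborel) \<partial>M) = (\<integral>\<^sup>+\<omega>. 0 \<partial>M)"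
      proof (rule nn_integral_cong)
        fix \<omega> assume "\<omega> \<in> space M"
        then have "{T n \<omega>..u'} = {}" using T_nonneg[of \<omega> n] True by simp
        then show "indicator H \<omega> * (\<integral>\<^sup>+s. indicator {T n \<omega>..u'} s * ennreal (rate r \<gamma> s (Z n \<omega>) * surv r \<gamma> (Z n \<omega>) (T n \<omega>) s) \<partial>lborel) = 0" by simp
      qed
      ultimately show ?thesis unfolding L R by simp
    next
      case False
      then have u': "u' \<in> {0..t}" by (auto simp: u'_def)
      \<comment> \<open>The mass that has not jumped by \<open>u'\<close>. Added to either side it
        gives the mass of \<open>T n \<omega> \<le> u'\<close>; being finite, it can be
        cancelled.\<close>
      let ?X = "\<integral>\<^sup>+\<omega>. indicator H \<omega> * indicator {..u'} (T n \<omega>) * indicator {u'<..} (T (Suc n) \<omega>) \<partial>M"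
      have X: "?X = (\<integral>\<^sup>+\<omega>. indicator H \<omega> * indicator {..u'} (T n \<omega>) * ennreal (surv r \<gamma> (Z n \<omega>) (T n \<omega>) u') \<partial>M)"
        using H u' by (intro survival) auto
      have hm: "(\<lambda>\<omega>. \<integral>\<^sup>+s. indicator {T n \<omega>..u'} s * ennreal (rate r \<gamma> s (Z n \<omega>) * surv r \<gamma> (Z n \<omega>) (T n \<omega>) s) \<partial>lborel) \<in> borel_measurable M"
        by (rule hist_M[of _ n]) measurable
      have "emeasure ?\<mu> (H \<times> {..u}) + ?X = (\<integral>\<^sup>+\<omega>. indicator H \<omega> * indicator {..u'} (T n \<omega>) \<partial>M)"
        unfolding L
      proof (subst nn_integral_add[symmetric])
        show "(\<integral>\<^sup>+\<omega>. indicator H \<omega> * indicator {..u'} (T (Suc n) \<omega>) + indicator H \<omega> * indicator {..u'} (T n \<omega>) * indicator {u'<..} (T (Suc n) \<omega>) \<partial>M)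
          = (\<integral>\<^sup>+\<omega>. indicator H \<omega> * indicator {..u'} (T n \<omega>) \<partial>M)"
        proof (rule nn_integral_cong)
          fix \<omega> assume "\<omega> \<in> space M"
          then have "T n \<omega> < T (Suc n) \<omega>" by (rule T_Suc)
          then show "indicator H \<omega> * indicator {..u'} (T (Suc n) \<omega>) + indicator H \<omega> * indicator {..u'} (T n \<omega>) * indicator {u'<..} (T (Suc n) \<omega>)
            = (indicator H \<omega> * indicator {..u'} (T n \<omega>) :: ennreal)" by (auto split: split_indicator)
        qed
      qed (use HM in measurable)
      also have "\<dots> = (\<integral>\<^sup>+\<omega>. indicator H \<omega> * (\<integral>\<^sup>+s. indicator {T n \<omega>..u'} s * ennreal (rate r \<gamma> s (Z n \<omega>) * surv r \<gamma> (Z n \<omega>) (T n \<omega>) s) \<partial>lborel)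
          + indicator H \<omega> * indicator {..u'} (T n \<omega>) * ennreal (surv r \<gamma> (Z n \<omega>) (T n \<omega>) u') \<partial>M)"
      proof (rule nn_integral_cong)
        fix \<omega> assume \<omega>: "\<omega> \<in> space M"
        show "indicator H \<omega> * indicator {..u'} (T n \<omega>) = indicator H \<omega> * (\<integral>\<^sup>+s. indicator {T n \<omega>..u'} s * ennreal (rate r \<gamma> s (Z n \<omega>) * surv r \<gamma> (Z n \<omega>) (T n \<omega>) s) \<partial>lborel)
          + indicator H \<omega> * indicator {..u'} (T n \<omega>) * ennreal (surv r \<gamma> (Z n \<omega>) (T n \<omega>) u')"
        proof (cases "T n \<omega> \<le> u'")
          case True
          then show ?thesis
            using surv_le_1[OF Z_space[OF \<omega>], of n "T n \<omega>" u'] surv_pos[of "Z n \<omega>" "T n \<omega>" u']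
            by (simp add: surv_hazard[OF Z_space[OF \<omega>] True] distrib_left[symmetric] ennreal_plus[symmetric] mult.assoc del: ennreal_plus split: split_indicator)
        next
          case False
          then have "{T n \<omega>..u'} = {}" by simp
          then show ?thesis using False by simp
        qed
      qed
      also have "\<dots> = emeasure \<nu> (H \<times> {..u}) + ?X"
        unfolding R X
      proof (rule nn_integral_add)
        show "(\<lambda>\<omega>. indicator H \<omega> * (\<integral>\<^sup>+s. indicator {T n \<omega>..u'} s * ennreal (rate r \<gamma> s (Z n \<omega>) * surv r \<gamma> (Z n \<omega>) (T n \<omega>) s) \<partial>lborel)) \<in> borel_measurable M"
          using HM hm by simp
        show "(\<lambda>\<omega>. indicator H \<omega> * indicator {..u'} (T n \<omega>) * ennreal (surv r \<gamma> (Z n \<omega>) (T n \<omega>) u')) \<in> borel_measurable M"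
          using HM by measurable
      qed
      finally have eq: "emeasure ?\<mu> (H \<times> {..u}) + ?X = emeasure \<nu> (H \<times> {..u}) + ?X" .
      have "?X \<le> (\<integral>\<^sup>+\<omega>. 1 \<partial>M)" by (intro nn_integral_mono) (auto split: split_indicator)
      then have "?X \<noteq> \<top>" using ennreal_one_less_top by (auto simp: emeasure_space_1 top_unique)
      with eq show ?thesis by (simp add: ennreal_add_left_cancel add.commute[of _ ?X])
    qed
  qed
  have "?\<mu> = \<nu>"
  proof (rule measure_eqI_rectangles[of _ "hist n" borel, OF _ _ fin\<mu>])
    fix H B assume H: "H \<in> sets (hist n)" and B: "B \<in> sets (borel :: real measure)"
    have HM: "H \<in> sets M" using H subalgebra_hist[of n] by (auto simp: subalgebra_def)
    \<comment> \<open>With the event \<open>H\<close> of the history fixed, two measures on the line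
      remain to be compared.\<close>
    let ?\<mu>H = "distr (density ?\<mu> (indicator (H \<times> UNIV))) borel snd"
    let ?\<nu>H = "distr (density \<nu> (indicator (H \<times> UNIV))) borel snd"
    have HU: "H \<times> UNIV \<in> sets (hist n \<Otimes>\<^sub>M borel)" using H by simp
    have im: "(indicator (H \<times> UNIV) :: _ \<Rightarrow> ennreal) \<in> borel_measurable (hist n \<Otimes>\<^sub>M borel)"
      by (rule borel_measurable_indicator[OF HU])
    have SB: "space (hist n) \<times> B \<in> sets (hist n \<Otimes>\<^sub>M borel)" if "B \<in> sets borel" for B
      by (rule pair_measureI[OF sets.top that])
    have snd\<nu>: "snd \<in> measurable \<nu> borel" using measurable_snd by (simp add: \<nu>(1) cong: measurable_cong_sets)
    have snd\<nu>': "snd \<in> measurable (density \<nu> (indicator (H \<times> UNIV))) borel" using snd\<nu> by simp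
    have em\<mu>: "emeasure ?\<mu>H B = emeasure ?\<mu> (H \<times> B)" if B: "B \<in> sets borel" for B
    proof -
      have "emeasure ?\<mu>H B = emeasure (density ?\<mu> (indicator (H \<times> UNIV))) (snd -` B \<inter> space (density ?\<mu> (indicator (H \<times> UNIV))))"
        using B by (intro emeasure_distr) auto
      also have "snd -` B \<inter> space (density ?\<mu> (indicator (H \<times> UNIV))) = space (hist n) \<times> B" by (auto simp: space_pair_measure)
      also have "emeasure (density ?\<mu> (indicator (H \<times> UNIV))) (space (hist n) \<times> B) = (\<integral>\<^sup>+z. indicator (H \<times> UNIV) z * indicator (space (hist n) \<times> B) z \<partial>?\<mu>)"
        by (rule emeasure_density) (simp_all only: sets_distr measurable_distr_eq1 im SB[OF B])
      also have "\<dots> = (\<integral>\<^sup>+z. indicator (H \<times> B) z \<partial>?\<mu>)"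
        using sets.sets_into_space[OF H] by (intro nn_integral_cong) (auto split: split_indicator)
      also have "\<dots> = emeasure ?\<mu> (H \<times> B)" using H B by (intro nn_integral_indicator) auto
      finally show ?thesis .
    qed
    have em\<nu>: "emeasure ?\<nu>H B = emeasure \<nu> (H \<times> B)" if B: "B \<in> sets borel" for B
    proof -
      have "emeasure ?\<nu>H B = emeasure (density \<nu> (indicator (H \<times> UNIV))) (snd -` B \<inter> space (density \<nu> (indicator (H \<times> UNIV))))"
        using B snd\<nu>' by (intro emeasure_distr) auto
      also have "snd -` B \<inter> space (density \<nu> (indicator (H \<times> UNIV))) = space (hist n) \<times> B" using spaces by auto
      also have "emeasure (density \<nu> (indicator (H \<times> UNIV))) (space (hist n) \<times> B) = (\<integral>\<^sup>+z. indicator (H \<times> UNIV) z * indicator (space (hist n) \<times> B) z \<partial>\<nu>)"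
        by (rule emeasure_density) (simp_all only: \<nu>(1) measurable_cong_sets[OF \<nu>(1) refl] im SB[OF B])
      also have "\<dots> = (\<integral>\<^sup>+z. indicator (H \<times> B) z \<partial>\<nu>)"
        using sets.sets_into_space[OF H] by (intro nn_integral_cong) (auto split: split_indicator)
      also have "\<dots> = emeasure \<nu> (H \<times> B)" using H B by (intro nn_integral_indicator) (auto simp: \<nu>(1))
      finally show ?thesis .
    qed
    have eqc: "emeasure ?\<mu>H {..u} = emeasure ?\<nu>H {..u}" for u
      using em\<mu>[of "{..u}"] em\<nu>[of "{..u}"] cdf_eq[OF H, of u] by simp
    have fb1: "finite_borel_measure ?\<mu>H"
    proof (intro finite_borel_measure.intro finite_borel_measure_axioms.intro finite_measureI)
      show "emeasure ?\<mu>H (space ?\<mu>H) \<noteq> \<infinity>"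
        using em\<mu>[of UNIV] finite_measure.emeasure_finite[OF fin\<mu>, of "H \<times> UNIV"] by simp
    qed simp
    \<comment> \<open>Finiteness of the second measure is not known beforehand; it follows because
      both total masses are limits of the same values of the distribution functions.\<close>
    have lim: "emeasure N UNIV = (SUP i::nat. emeasure N {..real i})" if "sets N = sets (borel :: real measure)" for N
    proof -
      have "(\<Union>i::nat. {..real i}) = UNIV" by (auto intro: real_arch_simple)
      moreover have "(SUP i::nat. emeasure N {..real i}) = emeasure N (\<Union>i::nat. {..real i})"
        by (rule SUP_emeasure_incseq) (auto simp: that incseq_def)
      ultimately show ?thesis by simp
    qed
    have eqU: "emeasure ?\<mu>H UNIV = emeasure ?\<nu>H UNIV"
      using lim[of ?\<mu>H] lim[of ?\<nu>H] eqc by simp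
    have fb2: "finite_borel_measure ?\<nu>H"
    proof (intro finite_borel_measure.intro finite_borel_measure_axioms.intro finite_measureI)
      show "emeasure ?\<nu>H (space ?\<nu>H) \<noteq> \<infinity>"
        using eqU em\<mu>[of UNIV] finite_measure.emeasure_finite[OF fin\<mu>, of "H \<times> UNIV"] by simp
    qed simp
    have "?\<mu>H = ?\<nu>H"
    proof (rule cdf_unique'[OF fb1 fb2])
      show "cdf ?\<mu>H = cdf ?\<nu>H" using eqc by (simp add: cdf_def measure_def fun_eq_iff)
    qed
    then show "emeasure ?\<mu> (H \<times> B) = emeasure \<nu> (H \<times> B)"
      using em\<mu>[OF B] em\<nu>[OF B] by simp
  qed (simp_all add: \<nu>(1))
  then show ?thesis using \<mu>[OF \<eta>] \<nu>'[OF \<eta>] by (simp add: d_def mult.assoc)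
qed


text \<open>\<open>waiting_step\<close> followed by \<open>jump_step\<close>: the rate in the
  density of the jump time cancels the normalisation of the jump law. What remains is survival up to
  \<open>s\<close> times the tilted kernel at \<open>s\<close>.\<close>

lemma one_step:
  assumes \<phi>: "\<phi> \<in> borel_measurable (hist n \<Otimes>\<^sub>M borel \<Otimes>\<^sub>M S)" and u: "u \<le> t"
  shows "(\<integral>\<^sup>+\<omega>. indicator {..u} (T (Suc n) \<omega>) * \<phi> (\<omega>, T (Suc n) \<omega>, Z (Suc n) \<omega>) \<partial>M) =
    (\<integral>\<^sup>+\<omega>. \<integral>\<^sup>+s. indicator {T n \<omega>..u} s * ennreal (surv r \<gamma> (Z n \<omega>) (T n \<omega>) s) *
      (\<integral>\<^sup>+y. ennreal (exp (\<gamma> s (Z n \<omega>) y)) * \<phi> (\<omega>, s, y) \<partial>r (Z n \<omega>)) \<partial>lborel \<partial>M)"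
proof -
  note [measurable] = hist_measurable[of n n, OF order_refl] \<phi>
  note pm = pre_measurable(3)[of n] pre_measurable(2)[of n n, OF order_refl]
  have "(\<lambda>\<omega>. \<omega>) \<in> measurable (hist n) (hist n)" by simp
  from hist_pre[OF this] have idp: "(\<lambda>\<omega>. \<omega>) \<in> measurable (pre n) (hist n)" .
  define \<eta> where "\<eta> = (\<lambda>(\<omega>, s). indicator {..u} s * (\<integral>\<^sup>+y. ennreal (exp (\<gamma> s (Z n \<omega>) y) / rate r \<gamma> s (Z n \<omega>)) * \<phi> (\<omega>, s, y) \<partial>r (Z n \<omega>)))"
  have \<eta>m: "\<eta> \<in> borel_measurable (hist n \<Otimes>\<^sub>M borel)" unfolding \<eta>_def by measurable
  have "(\<integral>\<^sup>+\<omega>. indicator {..u} (T (Suc n) \<omega>) * \<phi> (\<omega>, T (Suc n) \<omega>, Z (Suc n) \<omega>) \<partial>M) =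
      (\<integral>\<^sup>+\<omega>. indicator {..t} (T (Suc n) \<omega>) * (\<lambda>(\<omega>, y). indicator {..u} (T (Suc n) \<omega>) * \<phi> (\<omega>, T (Suc n) \<omega>, y)) (\<omega>, Z (Suc n) \<omega>) \<partial>M)"
    using u by (intro nn_integral_cong) (auto split: split_indicator)
  also have "\<dots> = (\<integral>\<^sup>+\<omega>. indicator {..t} (T (Suc n) \<omega>) * \<eta> (\<omega>, T (Suc n) \<omega>) \<partial>M)"
  proof (subst jump_step)
    have *: "(\<lambda>x. (fst x, T (Suc n) (fst x), snd x)) \<in> pre n \<Otimes>\<^sub>M S \<rightarrow>\<^sub>M hist n \<Otimes>\<^sub>M borel \<Otimes>\<^sub>M S"
      using pm(1) measurable_compose[OF measurable_fst idp] by measurable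
    have "(\<lambda>x. indicator {..u} (T (Suc n) (fst x)) * \<phi> (fst x, T (Suc n) (fst x), snd x)) \<in> borel_measurable (pre n \<Otimes>\<^sub>M S)"
      using measurable_compose[OF * \<phi>] pm(1) by measurable
    then show "(\<lambda>(\<omega>, y). indicator {..u} (T (Suc n) \<omega>) * \<phi> (\<omega>, T (Suc n) \<omega>, y)) \<in> borel_measurable (pre n \<Otimes>\<^sub>M S)"
      by (simp only: case_prod_unfold)
    show "(\<integral>\<^sup>+\<omega>. indicator {..t} (T (Suc n) \<omega>) * (\<integral>\<^sup>+y. ennreal (exp (\<gamma> (T (Suc n) \<omega>) (Z n \<omega>) y) / rate r \<gamma> (T (Suc n) \<omega>) (Z n \<omega>)) *
        (case (\<omega>, y) of (\<omega>, y) \<Rightarrow> indicator {..u} (T (Suc n) \<omega>) * \<phi> (\<omega>, T (Suc n) \<omega>, y)) \<partial>r (Z n \<omega>)) \<partial>M) =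
      (\<integral>\<^sup>+\<omega>. indicator {..t} (T (Suc n) \<omega>) * \<eta> (\<omega>, T (Suc n) \<omega>) \<partial>M)"
    proof (rule nn_integral_cong)
      fix \<omega>
      show "indicator {..t} (T (Suc n) \<omega>) * (\<integral>\<^sup>+y. ennreal (exp (\<gamma> (T (Suc n) \<omega>) (Z n \<omega>) y) / rate r \<gamma> (T (Suc n) \<omega>) (Z n \<omega>)) *
        (case (\<omega>, y) of (\<omega>, y) \<Rightarrow> indicator {..u} (T (Suc n) \<omega>) * \<phi> (\<omega>, T (Suc n) \<omega>, y)) \<partial>r (Z n \<omega>)) =
        indicator {..t} (T (Suc n) \<omega>) * \<eta> (\<omega>, T (Suc n) \<omega>)"
        by (cases "T (Suc n) \<omega> \<le> u") (simp_all add: \<eta>_def)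
    qed
  qed
  also have "\<dots> = (\<integral>\<^sup>+\<omega>. \<integral>\<^sup>+s. indicator {T n \<omega>..t} s * ennreal (rate r \<gamma> s (Z n \<omega>) * surv r \<gamma> (Z n \<omega>) (T n \<omega>) s) * \<eta> (\<omega>, s) \<partial>lborel \<partial>M)"
    by (rule waiting_step[OF \<eta>m])
  also have "\<dots> = (\<integral>\<^sup>+\<omega>. \<integral>\<^sup>+s. indicator {T n \<omega>..u} s * ennreal (surv r \<gamma> (Z n \<omega>) (T n \<omega>) s) *
      (\<integral>\<^sup>+y. ennreal (exp (\<gamma> s (Z n \<omega>) y)) * \<phi> (\<omega>, s, y) \<partial>r (Z n \<omega>)) \<partial>lborel \<partial>M)"
  proof (intro nn_integral_cong)
    fix \<omega> and s :: real assume \<omega>: "\<omega> \<in> space M"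
    let ?x = "Z n \<omega>"
    have x: "?x \<in> space S" using Z_space[OF \<omega>] .
    note rp = rate_pos[OF x, of s]
    have "(\<lambda>y. (\<omega>, s, y)) \<in> S \<rightarrow>\<^sub>M hist n \<Otimes>\<^sub>M borel \<Otimes>\<^sub>M S" using \<omega> by simp
    from measurable_r[OF x measurable_compose[OF this \<phi>]]
    have [measurable]: "(\<lambda>y. \<phi> (\<omega>, s, y)) \<in> borel_measurable (r ?x)" .
    have [measurable]: "\<gamma> s ?x \<in> borel_measurable (r ?x)" by (rule measurable_tilt_r[OF x])
    have "ennreal (rate r \<gamma> s ?x) * (\<integral>\<^sup>+y. ennreal (exp (\<gamma> s ?x y) / rate r \<gamma> s ?x) * \<phi> (\<omega>, s, y) \<partial>r ?x) =
        (\<integral>\<^sup>+y. ennreal (rate r \<gamma> s ?x) * (ennreal (exp (\<gamma> s ?x y) / rate r \<gamma> s ?x) * \<phi> (\<omega>, s, y)) \<partial>r ?x)"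
      by (rule nn_integral_cmult[symmetric]) measurable
    also have "\<dots> = (\<integral>\<^sup>+y. ennreal (exp (\<gamma> s ?x y)) * \<phi> (\<omega>, s, y) \<partial>r ?x)"
      using rp by (intro nn_integral_cong) (simp add: mult.assoc[symmetric] ennreal_mult[symmetric])
    finally have J: "ennreal (rate r \<gamma> s ?x) * (\<integral>\<^sup>+y. ennreal (exp (\<gamma> s ?x y) / rate r \<gamma> s ?x) * \<phi> (\<omega>, s, y) \<partial>r ?x) =
        (\<integral>\<^sup>+y. ennreal (exp (\<gamma> s ?x y)) * \<phi> (\<omega>, s, y) \<partial>r ?x)" .
    have rs: "ennreal (rate r \<gamma> s ?x * surv r \<gamma> ?x (T n \<omega>) s) = ennreal (surv r \<gamma> ?x (T n \<omega>) s) * ennreal (rate r \<gamma> s ?x)"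
      using rp surv_pos[of ?x "T n \<omega>" s] by (simp add: ennreal_mult[symmetric] mult.commute)
    have I: "indicator {T n \<omega>..t} s * indicator {..u} s = (indicator {T n \<omega>..u} s :: ennreal)"
      using u by (auto split: split_indicator)
    show "indicator {T n \<omega>..t} s * ennreal (rate r \<gamma> s ?x * surv r \<gamma> ?x (T n \<omega>) s) * \<eta> (\<omega>, s) =
        indicator {T n \<omega>..u} s * ennreal (surv r \<gamma> ?x (T n \<omega>) s) * (\<integral>\<^sup>+y. ennreal (exp (\<gamma> s ?x y)) * \<phi> (\<omega>, s, y) \<partial>r ?x)"
      unfolding \<eta>_def prod.case rs J[symmetric] I[symmetric] by (simp only: ac_simps)
  qed
  finally show ?thesis .
qed

text \<open>The expected sum over the jumps is the time integral of the expected jump intensity.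
  Both sides register only what happens before an explosion, which is why \<open>alive\<close>
  appears and nothing is assumed about explosions.\<close>

lemma levy_system:
  assumes [measurable]: "\<phi> \<in> borel_measurable (borel \<Otimes>\<^sub>M S \<Otimes>\<^sub>M S)" and u: "u \<in> {0..t}"
  shows "(\<Sum>n. \<integral>\<^sup>+\<omega>. indicator {..u} (T (Suc n) \<omega>) * \<phi> (T (Suc n) \<omega>, Z n \<omega>, Z (Suc n) \<omega>) \<partial>M) =
    (\<integral>\<^sup>+s. indicator {0..u} s * (\<integral>\<^sup>+\<omega>. (if alive T s \<omega> then
      \<integral>\<^sup>+y. ennreal (exp (\<gamma> s (jump_path T Z s \<omega>) y)) * \<phi> (s, jump_path T Z s \<omega>, y) \<partial>r (jump_path T Z s \<omega>) else 0) \<partial>M) \<partial>lborel)"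
proof -
  define \<Phi> where "\<Phi> s x = (\<integral>\<^sup>+y. ennreal (exp (\<gamma> s x y)) * \<phi> (s, x, y) \<partial>r x)" for s x
  have \<Phi>m[measurable (raw)]: "(\<lambda>w. \<Phi> (f w) (g w)) \<in> borel_measurable N"
    if [measurable]: "f \<in> borel_measurable N" "g \<in> measurable N S" for f g and N :: "'z measure"
    unfolding \<Phi>_def by measurable
  have \<Phi>s[measurable]: "\<Phi> s \<in> borel_measurable S" for s unfolding \<Phi>_def by measurable
  have "(\<integral>\<^sup>+\<omega>. indicator {..u} (T (Suc n) \<omega>) * \<phi> (T (Suc n) \<omega>, Z n \<omega>, Z (Suc n) \<omega>) \<partial>M) =
      (\<integral>\<^sup>+s. indicator {0..u} s * (\<integral>\<^sup>+\<omega>. \<Phi> s (Z n \<omega>) * slot T n s \<omega> \<partial>M) \<partial>lborel)" for n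
  proof -
    note [measurable] = hist_measurable[of n n, OF order_refl]
    have "(\<integral>\<^sup>+\<omega>. indicator {..u} (T (Suc n) \<omega>) * \<phi> (T (Suc n) \<omega>, Z n \<omega>, Z (Suc n) \<omega>) \<partial>M) =
        (\<integral>\<^sup>+\<omega>. indicator {..u} (T (Suc n) \<omega>) * (\<lambda>(\<omega>, s, y). \<phi> (s, Z n \<omega>, y)) (\<omega>, T (Suc n) \<omega>, Z (Suc n) \<omega>) \<partial>M)"
      by simp
    also have "\<dots> = (\<integral>\<^sup>+\<omega>. \<integral>\<^sup>+s. indicator {T n \<omega>..u} s * ennreal (surv r \<gamma> (Z n \<omega>) (T n \<omega>) s) * \<Phi> s (Z n \<omega>) \<partial>lborel \<partial>M)"
      using u by (subst one_step) (auto simp: \<Phi>_def)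
    also have "\<dots> = (\<integral>\<^sup>+s. \<integral>\<^sup>+\<omega>. indicator {T n \<omega>..u} s * ennreal (surv r \<gamma> (Z n \<omega>) (T n \<omega>) s) * \<Phi> s (Z n \<omega>) \<partial>M \<partial>lborel)"
      by (rule lborel_M.Fubini') measurable
    also have "\<dots> = (\<integral>\<^sup>+s. indicator {0..u} s * (\<integral>\<^sup>+\<omega>. \<Phi> s (Z n \<omega>) * slot T n s \<omega> \<partial>M) \<partial>lborel)"
    proof (rule nn_integral_cong)
      fix s
      show "(\<integral>\<^sup>+\<omega>. indicator {T n \<omega>..u} s * ennreal (surv r \<gamma> (Z n \<omega>) (T n \<omega>) s) * \<Phi> s (Z n \<omega>) \<partial>M) =
          indicator {0..u} s * (\<integral>\<^sup>+\<omega>. \<Phi> s (Z n \<omega>) * slot T n s \<omega> \<partial>M)"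
      proof (cases "s \<in> {0..u}")
        case True
        then have s: "s \<in> {0..t}" using u by auto
        \<comment> \<open>\<open>survival\<close> read backwards: the survival factor produced by
          \<open>one_step\<close> becomes the indicator of the \<open>n\<close>-th holding interval
          at the deterministic time \<open>s\<close>.\<close>
        have "(\<integral>\<^sup>+\<omega>. \<Phi> s (Z n \<omega>) * slot T n s \<omega> \<partial>M) =
            (\<integral>\<^sup>+\<omega>. \<Phi> s (Z n \<omega>) * indicator {..s} (T n \<omega>) * ennreal (surv r \<gamma> (Z n \<omega>) (T n \<omega>) s) \<partial>M)"
          unfolding slot_def mult.assoc[symmetric] by (rule survival[OF _ s]) measurable
        also have "\<dots> = (\<integral>\<^sup>+\<omega>. indicator {T n \<omega>..u} s * ennreal (surv r \<gamma> (Z n \<omega>) (T n \<omega>) s) * \<Phi> s (Z n \<omega>) \<partial>M)"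
          using True by (intro nn_integral_cong) (auto simp: ac_simps split: split_indicator)
        finally show ?thesis using True by simp
      next
        case False
        have "(\<integral>\<^sup>+\<omega>. indicator {T n \<omega>..u} s * ennreal (surv r \<gamma> (Z n \<omega>) (T n \<omega>) s) * \<Phi> s (Z n \<omega>) \<partial>M) = (\<integral>\<^sup>+\<omega>. 0 \<partial>M)"
        proof (rule nn_integral_cong)
          fix \<omega> assume "\<omega> \<in> space M"
          then have "s \<notin> {T n \<omega>..u}" using T_nonneg[of \<omega> n] False by auto
          then show "indicator {T n \<omega>..u} s * ennreal (surv r \<gamma> (Z n \<omega>) (T n \<omega>) s) * \<Phi> s (Z n \<omega>) = 0" by simp
        qed
        then show ?thesis using False by simp
      qed
    qed
    finally show ?thesis .
  qed
  then have "(\<Sum>n. \<integral>\<^sup>+\<omega>. indicator {..u} (T (Suc n) \<omega>) * \<phi> (T (Suc n) \<omega>, Z n \<omega>, Z (Suc n) \<omega>) \<partial>M) =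
      (\<Sum>n. \<integral>\<^sup>+s. indicator {0..u} s * (\<integral>\<^sup>+\<omega>. \<Phi> s (Z n \<omega>) * slot T n s \<omega> \<partial>M) \<partial>lborel)" by simp
  also have "\<dots> = (\<integral>\<^sup>+s. (\<Sum>n. indicator {0..u} s * (\<integral>\<^sup>+\<omega>. \<Phi> s (Z n \<omega>) * slot T n s \<omega> \<partial>M)) \<partial>lborel)"
    by (rule nn_integral_suminf[symmetric]) measurable
  also have "\<dots> = (\<integral>\<^sup>+s. indicator {0..u} s * (\<integral>\<^sup>+\<omega>. (if alive T s \<omega> then \<Phi> s (jump_path T Z s \<omega>) else 0) \<partial>M) \<partial>lborel)"
  proof (rule nn_integral_cong)
    fix s
    show "(\<Sum>n. indicator {0..u} s * (\<integral>\<^sup>+\<omega>. \<Phi> s (Z n \<omega>) * slot T n s \<omega> \<partial>M)) =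
        indicator {0..u} s * (\<integral>\<^sup>+\<omega>. (if alive T s \<omega> then \<Phi> s (jump_path T Z s \<omega>) else 0) \<partial>M)"
    proof (cases "s \<in> {0..u}")
      case True
      have "(\<Sum>n. (\<integral>\<^sup>+\<omega>. \<Phi> s (Z n \<omega>) * slot T n s \<omega> \<partial>M)) = (\<integral>\<^sup>+\<omega>. (\<Sum>n. \<Phi> s (Z n \<omega>) * slot T n s \<omega>) \<partial>M)"
        by (rule nn_integral_suminf[symmetric]) measurable
      also have "\<dots> = (\<integral>\<^sup>+\<omega>. (if alive T s \<omega> then \<Phi> s (jump_path T Z s \<omega>) else 0) \<partial>M)"
        using True by (intro nn_integral_cong suminf_slot_path) auto
      finally show ?thesis using True by simp
    qed simp
  qed
  finally show ?thesis unfolding \<Phi>_def .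
qed

end

section \<open>Change of measure\<close>

lemma set_integral_Icc_combine:
  fixes f :: "real \<Rightarrow> real"
  assumes "a \<le> b" "b \<le> c" and f: "set_integrable lborel {a..b} f" "set_integrable lborel {b..c} f"
  shows "set_integrable lborel {a..c} f"
    "(LINT w:{a..c}|lborel. f w) = (LINT w:{a..b}|lborel. f w) + (LINT w:{b..c}|lborel. f w)"
proof -
  have eq: "{a..c} = {a..b} \<union> {b..c}" using assms by auto
  have "AE x in lborel. \<not> (x \<in> {a..b} \<and> x \<in> {b..c})"
    using AE_lborel_singleton[of b] by eventually_elim auto
  then show "(LINT w:{a..c}|lborel. f w) = (LINT w:{a..b}|lborel. f w) + (LINT w:{b..c}|lborel. f w)"
    unfolding eq using f by (intro set_integral_Un_AE) auto
  show "set_integrable lborel {a..c} f"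
    unfolding eq using f by (intro set_integrable_Un) auto
qed

definition excess_rate :: "('a \<Rightarrow> 'a measure) \<Rightarrow> (real \<Rightarrow> 'a \<Rightarrow> 'a \<Rightarrow> real) \<Rightarrow> real \<Rightarrow> 'a \<Rightarrow> real" where
  "excess_rate r \<gamma> s x = rate r \<gamma> s x - rate r (\<lambda>_ _ _. 0) s x"

text \<open>Meaningful for finitely many jumps up to \<open>s\<close>. Elsewhere the series need not
  converge, and such paths are cut off by \<open>alive\<close>.\<close>

definition log_density :: "('a \<Rightarrow> 'a measure) \<Rightarrow> (real \<Rightarrow> 'a \<Rightarrow> 'a \<Rightarrow> real) \<Rightarrow> (nat \<Rightarrow> 'w \<Rightarrow> real) \<Rightarrow>
    (nat \<Rightarrow> 'w \<Rightarrow> 'a) \<Rightarrow> real \<Rightarrow> 'w \<Rightarrow> real" where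
  "log_density r \<gamma> T Z s \<omega> =
     (\<Sum>n. indicator {..s} (T (Suc n) \<omega>) * \<gamma> (T (Suc n) \<omega>) (Z n \<omega>) (Z (Suc n) \<omega>)) -
     (LINT w:{0..s}|lborel. excess_rate r \<gamma> w (jump_path T Z w \<omega>))"

section \<open>Density along the chain of jumps and along the path\<close>

text \<open>The unperturbed process together with a tilt. A process that really has the tilted rates
  enters only as a hypothesis of the lemmas that compare two laws.\<close>

locale girsanov = P: tilted_jump P S t r "\<lambda>_ _ _. 0" 0 \<pi> T Z + G: tilt S r \<gamma> K
  for P :: "'w measure" and S :: "'a measure" and t :: real and r \<pi>
    and T :: "nat \<Rightarrow> 'w \<Rightarrow> real" and Z :: "nat \<Rightarrow> 'w \<Rightarrow> 'a" and \<gamma> K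
begin

definition drift :: "'a \<Rightarrow> real \<Rightarrow> real \<Rightarrow> real" where
  "drift x a b = exp (- (LINT w:{a..b}|lborel. excess_rate r \<gamma> w x))"

text \<open>The density of the tilted law with respect to the unperturbed one on the history up to
  the \<open>n\<close>-th jump: each step contributes exp(\<gamma>) for its jump and
  \<open>drift\<close> for the holding interval before it.\<close>

definition dens :: "nat \<Rightarrow> 'w \<Rightarrow> ennreal" where
  "dens n \<omega> = (\<Prod>i<n. ennreal (exp (\<gamma> (T (Suc i) \<omega>) (Z i \<omega>) (Z (Suc i) \<omega>)) * drift (Z i \<omega>) (T i \<omega>) (T (Suc i) \<omega>)))"

lemma measurable_excess_rate [measurable (raw)]:
  assumes [measurable]: "f \<in> borel_measurable N" "h \<in> measurable N S"
  shows "(\<lambda>w. excess_rate r \<gamma> (f w) (h w)) \<in> borel_measurable N"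
  unfolding excess_rate_def by (intro borel_measurable_diff G.measurable_rate P.measurable_rate assms)

lemma measurable_drift [measurable (raw)]:
  assumes [measurable]: "f \<in> borel_measurable N" "h \<in> measurable N S" "k \<in> borel_measurable N"
  shows "(\<lambda>w. drift (h w) (f w) (k w)) \<in> borel_measurable N"
  unfolding drift_def set_lebesgue_integral_def by measurable

lemma measurable_log_density [measurable (raw)]:
  assumes [measurable]: "f \<in> borel_measurable N" "h \<in> measurable N P"
  shows "(\<lambda>w. log_density r \<gamma> T Z (f w) (h w)) \<in> borel_measurable N"
  unfolding log_density_def set_lebesgue_integral_def by measurable

lemma set_integrable_excess: "x \<in> space S \<Longrightarrow> set_integrable lborel {a..b} (\<lambda>s. excess_rate r \<gamma> s x)"
  unfolding excess_rate_def by (intro set_integral_diff G.set_integrable_rate P.set_integrable_rate)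

lemma drift_surv: "x \<in> space S \<Longrightarrow> drift x a b * surv r (\<lambda>_ _ _. 0) x a b = surv r \<gamma> x a b"
proof -
  assume x: "x \<in> space S"
  have "(LINT w:{a..b}|lborel. excess_rate r \<gamma> w x) =
      (LINT w:{a..b}|lborel. rate r \<gamma> w x) - (LINT w:{a..b}|lborel. rate r (\<lambda>_ _ _. 0) w x)"
    unfolding excess_rate_def by (intro set_integral_diff G.set_integrable_rate P.set_integrable_rate x)
  then show ?thesis by (simp add: drift_def surv_def exp_add[symmetric])
qed

lemma drift_pos: "0 < drift x a b" by (simp add: drift_def)

lemma drift_surv_ennreal: "x \<in> space S \<Longrightarrow>
    ennreal (drift x a b) * ennreal (surv r (\<lambda>_ _ _. 0) x a b) = ennreal (surv r \<gamma> x a b)"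
  by (simp only: ennreal_mult[symmetric] less_imp_le[OF drift_pos] less_imp_le[OF P.surv_pos] drift_surv)

lemma measurable_dens [measurable]: "dens n \<in> borel_measurable (P.hist n)"
proof -
  have "(\<lambda>\<omega>. ennreal (exp (\<gamma> (T (Suc i) \<omega>) (Z i \<omega>) (Z (Suc i) \<omega>)) * drift (Z i \<omega>) (T i \<omega>) (T (Suc i) \<omega>)))
      \<in> borel_measurable (P.hist n)" if i: "i < n" for i
  proof -
    have [measurable]: "T i \<in> borel_measurable (P.hist n)" "Z i \<in> measurable (P.hist n) S"
      "T (Suc i) \<in> borel_measurable (P.hist n)" "Z (Suc i) \<in> measurable (P.hist n) S"
      using i by (auto intro!: P.hist_measurable)
    show ?thesis by measurable
  qed
  then show ?thesis unfolding dens_def by (intro borel_measurable_prod_ennreal) auto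
qed

lemma measurable_dens_P [measurable]: "dens n \<in> borel_measurable P"
  by (rule P.hist_M[OF measurable_dens])

text \<open>The transition operator of the chain of pairs (jump time, new state) under the tilted
  rates, killed when a jump time exceeds \<open>u\<close>.\<close>

definition tilted_step :: "real \<Rightarrow> (real \<times> 'a \<Rightarrow> ennreal) \<Rightarrow> real \<times> 'a \<Rightarrow> ennreal" where
  "tilted_step u f = (\<lambda>(a, x). \<integral>\<^sup>+s. indicator {a..u} s * ennreal (surv r \<gamma> x a s) *
      (\<integral>\<^sup>+y. ennreal (exp (\<gamma> s x y)) * f (s, y) \<partial>r x) \<partial>lborel)"

lemma measurable_tilted_step [measurable]:
  assumes [measurable]: "f \<in> borel_measurable (borel \<Otimes>\<^sub>M S)"
  shows "tilted_step u f \<in> borel_measurable (borel \<Otimes>\<^sub>M S)"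
  unfolding tilted_step_def by measurable

text \<open>For \<open>a\<close> beyond \<open>u\<close> the interval of integration is empty. So
  the cut-off on \<open>T n\<close> can be inserted or dropped between two steps of a
  recursion.\<close>

lemma tilted_step_indicator: "indicator {..u} a * tilted_step u f (a, x) = tilted_step u f (a, x)"
proof (cases "a \<le> u")
  case False
  then have "{a..u} = {}" by simp
  then show ?thesis by (simp add: tilted_step_def)
qed simp

text \<open>The new factor of the density turns an unperturbed step into a tilted one:
  \<open>drift\<close> converts the unperturbed survival factor into the tilted one, and
  exp(\<gamma>) tilts the kernel of the jump.\<close>

lemma dens_step:
  assumes [measurable]: "f \<in> borel_measurable (borel \<Otimes>\<^sub>M S)" and u: "u \<le> t"
  shows "(\<integral>\<^sup>+\<omega>. indicator {..u} (T (Suc n) \<omega>) * (dens (Suc n) \<omega> * f (T (Suc n) \<omega>, Z (Suc n) \<omega>)) \<partial>P) =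
    (\<integral>\<^sup>+\<omega>. dens n \<omega> * tilted_step u f (T n \<omega>, Z n \<omega>) \<partial>P)"
proof -
  note [measurable] = P.hist_measurable[of n n, OF order_refl]
  define \<phi> where "\<phi> = (\<lambda>(\<omega>, s, y). dens n \<omega> * ennreal (exp (\<gamma> s (Z n \<omega>) y) * drift (Z n \<omega>) (T n \<omega>) s) * f (s, y))"
  have \<phi>m: "\<phi> \<in> borel_measurable (P.hist n \<Otimes>\<^sub>M borel \<Otimes>\<^sub>M S)"
    unfolding \<phi>_def by measurable
  have "(\<integral>\<^sup>+\<omega>. indicator {..u} (T (Suc n) \<omega>) * (dens (Suc n) \<omega> * f (T (Suc n) \<omega>, Z (Suc n) \<omega>)) \<partial>P) =
      (\<integral>\<^sup>+\<omega>. indicator {..u} (T (Suc n) \<omega>) * \<phi> (\<omega>, T (Suc n) \<omega>, Z (Suc n) \<omega>) \<partial>P)"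
    by (simp add: dens_def \<phi>_def)
  also have "\<dots> = (\<integral>\<^sup>+\<omega>. \<integral>\<^sup>+s. indicator {T n \<omega>..u} s * ennreal (surv r (\<lambda>_ _ _. 0) (Z n \<omega>) (T n \<omega>) s) *
      (\<integral>\<^sup>+y. ennreal (exp 0) * \<phi> (\<omega>, s, y) \<partial>r (Z n \<omega>)) \<partial>lborel \<partial>P)"
    by (rule P.one_step[OF \<phi>m u])
  also have "\<dots> = (\<integral>\<^sup>+\<omega>. dens n \<omega> * tilted_step u f (T n \<omega>, Z n \<omega>) \<partial>P)"
  proof (rule nn_integral_cong)
    fix \<omega> assume \<omega>: "\<omega> \<in> space P"
    let ?x = "Z n \<omega>"
    have x: "?x \<in> space S" using P.Z_space[OF \<omega>] .
    have "(\<integral>\<^sup>+s. indicator {T n \<omega>..u} s * ennreal (surv r (\<lambda>_ _ _. 0) ?x (T n \<omega>) s) *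
        (\<integral>\<^sup>+y. ennreal (exp 0) * \<phi> (\<omega>, s, y) \<partial>r ?x) \<partial>lborel) =
      (\<integral>\<^sup>+s. dens n \<omega> * (indicator {T n \<omega>..u} s * ennreal (surv r \<gamma> ?x (T n \<omega>) s) *
        (\<integral>\<^sup>+y. ennreal (exp (\<gamma> s ?x y)) * f (s, y) \<partial>r ?x)) \<partial>lborel)"
    proof (rule nn_integral_cong)
      fix s
      have [measurable]: "(\<lambda>y. f (s, y)) \<in> borel_measurable (r ?x)" "\<gamma> s ?x \<in> borel_measurable (r ?x)"
        using x by (auto intro!: P.measurable_r G.measurable_tilt_r)
      have "(\<integral>\<^sup>+y. ennreal (exp 0) * \<phi> (\<omega>, s, y) \<partial>r ?x) =
          (\<integral>\<^sup>+y. (dens n \<omega> * ennreal (drift ?x (T n \<omega>) s)) * (ennreal (exp (\<gamma> s ?x y)) * f (s, y)) \<partial>r ?x)"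
        unfolding \<phi>_def by (intro nn_integral_cong) (simp add: ennreal_mult less_imp_le[OF drift_pos] ac_simps)
      also have "\<dots> = (dens n \<omega> * ennreal (drift ?x (T n \<omega>) s)) * (\<integral>\<^sup>+y. ennreal (exp (\<gamma> s ?x y)) * f (s, y) \<partial>r ?x)"
        by (rule nn_integral_cmult) measurable
      finally have *: "(\<integral>\<^sup>+y. ennreal (exp 0) * \<phi> (\<omega>, s, y) \<partial>r ?x) =
        (dens n \<omega> * ennreal (drift ?x (T n \<omega>) s)) * (\<integral>\<^sup>+y. ennreal (exp (\<gamma> s ?x y)) * f (s, y) \<partial>r ?x)" .
      show "indicator {T n \<omega>..u} s * ennreal (surv r (\<lambda>_ _ _. 0) ?x (T n \<omega>) s) *
          (\<integral>\<^sup>+y. ennreal (exp 0) * \<phi> (\<omega>, s, y) \<partial>r ?x) =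
        dens n \<omega> * (indicator {T n \<omega>..u} s * ennreal (surv r \<gamma> ?x (T n \<omega>) s) *
          (\<integral>\<^sup>+y. ennreal (exp (\<gamma> s ?x y)) * f (s, y) \<partial>r ?x))"
        unfolding * drift_surv_ennreal[OF x, symmetric] by (simp only: ac_simps)
    qed
    also have "\<dots> = dens n \<omega> * tilted_step u f (T n \<omega>, ?x)"
      unfolding tilted_step_def prod.case using x by (intro nn_integral_cmult) measurable
    finally show "(\<integral>\<^sup>+s. indicator {T n \<omega>..u} s * ennreal (surv r (\<lambda>_ _ _. 0) ?x (T n \<omega>) s) *
        (\<integral>\<^sup>+y. ennreal (exp 0) * \<phi> (\<omega>, s, y) \<partial>r ?x) \<partial>lborel) = dens n \<omega> * tilted_step u f (T n \<omega>, ?x)" .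
  qed
  finally show ?thesis .
qed

text \<open>Both sides obey the recursion given by \<open>tilted_step\<close>, on the left by
  \<open>one_step\<close> and on the right by \<open>dens_step\<close>, and both chains start at
  time 0 with law \<open>\<pi>\<close>.\<close>

lemma girsanov_chain:
  assumes M: "tilted_jump M S t r \<gamma> K \<pi> T' Z'" and f: "f \<in> borel_measurable (borel \<Otimes>\<^sub>M S)" and u: "u \<le> t"
  shows "(\<integral>\<^sup>+\<omega>. indicator {..u} (T' n \<omega>) * f (T' n \<omega>, Z' n \<omega>) \<partial>M) =
    (\<integral>\<^sup>+\<omega>. indicator {..u} (T n \<omega>) * (dens n \<omega> * f (T n \<omega>, Z n \<omega>)) \<partial>P)"
  using f
proof (induction n arbitrary: f)
  case 0
  note [measurable] = 0
  interpret M: tilted_jump M S t r \<gamma> K \<pi> T' Z' by (rule M)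
  have "(\<integral>\<^sup>+\<omega>. indicator {..u} (T' 0 \<omega>) * f (T' 0 \<omega>, Z' 0 \<omega>) \<partial>M) = (\<integral>\<^sup>+\<omega>. indicator {..u} 0 * f (0, Z' 0 \<omega>) \<partial>M)"
    by (intro nn_integral_cong) (simp add: M.T_0)
  also have "\<dots> = (\<integral>\<^sup>+x. indicator {..u} 0 * f (0, x) \<partial>distr M S (Z' 0))"
    by (rule nn_integral_distr[symmetric]) measurable
  also have "\<dots> = (\<integral>\<^sup>+x. indicator {..u} 0 * f (0, x) \<partial>distr P S (Z 0))"
    by (simp add: M.initial_law P.initial_law)
  also have "\<dots> = (\<integral>\<^sup>+\<omega>. indicator {..u} 0 * f (0, Z 0 \<omega>) \<partial>P)"
    by (rule nn_integral_distr) measurable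
  also have "\<dots> = (\<integral>\<^sup>+\<omega>. indicator {..u} (T 0 \<omega>) * (dens 0 \<omega> * f (T 0 \<omega>, Z 0 \<omega>)) \<partial>P)"
    by (intro nn_integral_cong) (simp add: P.T_0 dens_def)
  finally show ?case .
next
  case (Suc n)
  note [measurable] = Suc.prems
  interpret M: tilted_jump M S t r \<gamma> K \<pi> T' Z' by (rule M)
  have "(\<integral>\<^sup>+\<omega>. indicator {..u} (T' (Suc n) \<omega>) * f (T' (Suc n) \<omega>, Z' (Suc n) \<omega>) \<partial>M) =
      (\<integral>\<^sup>+\<omega>. indicator {..u} (T' (Suc n) \<omega>) * (\<lambda>(\<omega>, z). f z) (\<omega>, T' (Suc n) \<omega>, Z' (Suc n) \<omega>) \<partial>M)"
    by simp
  also have "\<dots> = (\<integral>\<^sup>+\<omega>. tilted_step u f (T' n \<omega>, Z' n \<omega>) \<partial>M)"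
    using u by (subst M.one_step) (auto simp: tilted_step_def)
  also have "\<dots> = (\<integral>\<^sup>+\<omega>. indicator {..u} (T' n \<omega>) * tilted_step u f (T' n \<omega>, Z' n \<omega>) \<partial>M)"
    by (simp only: tilted_step_indicator)
  also have "\<dots> = (\<integral>\<^sup>+\<omega>. indicator {..u} (T n \<omega>) * (dens n \<omega> * tilted_step u f (T n \<omega>, Z n \<omega>)) \<partial>P)"
    by (rule Suc.IH) measurable
  also have "\<dots> = (\<integral>\<^sup>+\<omega>. dens n \<omega> * tilted_step u f (T n \<omega>, Z n \<omega>) \<partial>P)"
  proof (rule nn_integral_cong)
    fix \<omega>
    show "indicator {..u} (T n \<omega>) * (dens n \<omega> * tilted_step u f (T n \<omega>, Z n \<omega>)) = dens n \<omega> * tilted_step u f (T n \<omega>, Z n \<omega>)"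
      by (subst mult.left_commute) (simp only: tilted_step_indicator)
  qed
  also have "\<dots> = (\<integral>\<^sup>+\<omega>. indicator {..u} (T (Suc n) \<omega>) * (dens (Suc n) \<omega> * f (T (Suc n) \<omega>, Z (Suc n) \<omega>)) \<partial>P)"
    by (rule dens_step[symmetric]) (use u Suc.prems in auto)
  finally show ?case .
qed

text \<open>On a holding interval the path equals \<open>Z n\<close> except possibly at the right
  end, a null set.\<close>

lemma integral_excess_segment:
  assumes \<omega>: "\<omega> \<in> space P" and ab: "T n \<omega> \<le> a" "b \<le> T (Suc n) \<omega>"
  shows "set_integrable lborel {a..b} (\<lambda>w. excess_rate r \<gamma> w (jump_path T Z w \<omega>))"
    "(LINT w:{a..b}|lborel. excess_rate r \<gamma> w (jump_path T Z w \<omega>)) = (LINT w:{a..b}|lborel. excess_rate r \<gamma> w (Z n \<omega>))"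
proof -
  have eq: "AE w in lborel. indicator {a..b} w *\<^sub>R excess_rate r \<gamma> w (jump_path T Z w \<omega>) = indicator {a..b} w *\<^sub>R excess_rate r \<gamma> w (Z n \<omega>)"
    using AE_lborel_singleton[of b]
  proof eventually_elim
    case (elim w)
    show ?case
    proof (cases "w \<in> {a..b}")
      case True
      then have "T n \<omega> \<le> w" "w < T (Suc n) \<omega>" using ab elim by auto
      from P.jump_path_eq[OF \<omega> this] show ?thesis by simp
    qed simp
  qed
  have m: "(\<lambda>w. indicator {a..b} w *\<^sub>R excess_rate r \<gamma> w (jump_path T Z w \<omega>)) \<in> borel_measurable lborel"
    "(\<lambda>w. indicator {a..b} w *\<^sub>R excess_rate r \<gamma> w (Z n \<omega>)) \<in> borel_measurable lborel"
    using \<omega> P.Z_space[OF \<omega>] by measurable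
  show "set_integrable lborel {a..b} (\<lambda>w. excess_rate r \<gamma> w (jump_path T Z w \<omega>))"
    using set_integrable_excess[OF P.Z_space[OF \<omega>], of a b n] integrable_cong_AE[OF m eq] by (simp add: set_integrable_def)
  show "(LINT w:{a..b}|lborel. excess_rate r \<gamma> w (jump_path T Z w \<omega>)) = (LINT w:{a..b}|lborel. excess_rate r \<gamma> w (Z n \<omega>))"
    unfolding set_lebesgue_integral_def by (rule integral_cong_AE[OF m eq])
qed

text \<open>Induction over the holding intervals. The right end is included, so that the induction
  hypothesis may be used at the next jump time itself. Integrability is part of the claim since the
  integral over the union needs it on both pieces.\<close>

lemma integral_excess_path:
  assumes \<omega>: "\<omega> \<in> space P" and n: "T n \<omega> \<le> s" "s \<le> T (Suc n) \<omega>"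
  shows "set_integrable lborel {0..s} (\<lambda>w. excess_rate r \<gamma> w (jump_path T Z w \<omega>)) \<and>
    exp (- (LINT w:{0..s}|lborel. excess_rate r \<gamma> w (jump_path T Z w \<omega>))) =
      (\<Prod>i<n. drift (Z i \<omega>) (T i \<omega>) (T (Suc i) \<omega>)) * drift (Z n \<omega>) (T n \<omega>) s"
  using n
proof (induction n arbitrary: s)
  case 0
  then show ?case using integral_excess_segment[OF \<omega>, of 0 0 s] by (simp add: P.T_0[OF \<omega>] drift_def)
next
  case (Suc n)
  let ?f = "\<lambda>w. excess_rate r \<gamma> w (jump_path T Z w \<omega>)"
  have T: "T n \<omega> \<le> T (Suc n) \<omega>" using P.T_Suc[OF \<omega>, of n] by simp
  note IH = Suc.IH[OF T order_refl]
  note seg = integral_excess_segment[OF \<omega>, of "Suc n" "T (Suc n) \<omega>" s, OF order_refl Suc.prems(2)]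
  note comb = set_integral_Icc_combine[OF P.T_nonneg[OF \<omega>] Suc.prems(1) conjunct1[OF IH] seg(1)]
  have "exp (- (LINT w:{0..s}|lborel. ?f w)) = exp (- (LINT w:{0..T (Suc n) \<omega>}|lborel. ?f w)) * drift (Z (Suc n) \<omega>) (T (Suc n) \<omega>) s"
    unfolding comb(2) minus_add_distrib exp_add seg(2) drift_def by (rule refl)
  with comb(1) IH show ?case by simp
qed

text \<open>Later jumps lie beyond \<open>s\<close>, so the series is a finite sum. The completed
  holding intervals give \<open>dens n\<close>, and the current, unfinished one gives the separate
  factor \<open>drift\<close>.\<close>

lemma exp_log_density:
  assumes \<omega>: "\<omega> \<in> space P" and n: "T n \<omega> \<le> s" "s < T (Suc n) \<omega>"
  shows "ennreal (exp (log_density r \<gamma> T Z s \<omega>)) = dens n \<omega> * ennreal (drift (Z n \<omega>) (T n \<omega>) s)"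
proof -
  have "(\<Sum>i. indicator {..s} (T (Suc i) \<omega>) * \<gamma> (T (Suc i) \<omega>) (Z i \<omega>) (Z (Suc i) \<omega>)) =
      (\<Sum>i\<in>{..<n}. indicator {..s} (T (Suc i) \<omega>) * \<gamma> (T (Suc i) \<omega>) (Z i \<omega>) (Z (Suc i) \<omega>))"
  proof (rule suminf_finite)
    fix i assume "i \<notin> {..<n}"
    then have "T (Suc n) \<omega> \<le> T (Suc i) \<omega>" by (simp add: P.T_le_iff[OF \<omega>])
    then show "indicator {..s} (T (Suc i) \<omega>) * \<gamma> (T (Suc i) \<omega>) (Z i \<omega>) (Z (Suc i) \<omega>) = 0" using n by simp
  qed simp
  also have "\<dots> = (\<Sum>i<n. \<gamma> (T (Suc i) \<omega>) (Z i \<omega>) (Z (Suc i) \<omega>))"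
  proof (rule sum.cong[OF refl])
    fix i assume "i \<in> {..<n}"
    then have "T (Suc i) \<omega> \<le> T n \<omega>" by (simp add: P.T_le_iff[OF \<omega>])
    then show "indicator {..s} (T (Suc i) \<omega>) * \<gamma> (T (Suc i) \<omega>) (Z i \<omega>) (Z (Suc i) \<omega>) = \<gamma> (T (Suc i) \<omega>) (Z i \<omega>) (Z (Suc i) \<omega>)"
      using n by simp
  qed
  finally have 1: "exp (log_density r \<gamma> T Z s \<omega>) = (\<Prod>i<n. exp (\<gamma> (T (Suc i) \<omega>) (Z i \<omega>) (Z (Suc i) \<omega>))) *
      exp (- (LINT w:{0..s}|lborel. excess_rate r \<gamma> w (jump_path T Z w \<omega>)))"
    unfolding log_density_def by (simp add: exp_diff exp_minus exp_sum field_simps)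
  have 2: "dens n \<omega> = ennreal (\<Prod>i<n. exp (\<gamma> (T (Suc i) \<omega>) (Z i \<omega>) (Z (Suc i) \<omega>)) * drift (Z i \<omega>) (T i \<omega>) (T (Suc i) \<omega>))"
    unfolding dens_def by (rule prod_ennreal) (simp add: less_imp_le[OF drift_pos])
  have 3: "exp (- (LINT w:{0..s}|lborel. excess_rate r \<gamma> w (jump_path T Z w \<omega>))) =
      (\<Prod>i<n. drift (Z i \<omega>) (T i \<omega>) (T (Suc i) \<omega>)) * drift (Z n \<omega>) (T n \<omega>) s"
    using integral_excess_path[OF \<omega> n(1) less_imp_le[OF n(2)]] by simp
  show ?thesis unfolding 1 2 3 prod.distrib
    by (subst ennreal_mult[symmetric]) (auto intro!: mult_nonneg_nonneg prod_nonneg simp: less_imp_le[OF drift_pos] mult.assoc)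
qed

lemma suminf_dens_slot:
  assumes \<omega>: "\<omega> \<in> space P" and s: "0 \<le> s"
  shows "(\<Sum>n. f (Z n \<omega>) * dens n \<omega> * ennreal (drift (Z n \<omega>) (T n \<omega>) s) * slot T n s \<omega>) =
    (if alive T s \<omega> then f (jump_path T Z s \<omega>) * ennreal (exp (log_density r \<gamma> T Z s \<omega>)) else 0)"
proof (cases "alive T s \<omega>")
  case True
  obtain n where n: "T n \<omega> \<le> s" "s < T (Suc n) \<omega>" by (rule P.alive_obtain[OF \<omega> s True])
  show ?thesis
    using True P.suminf_slot[OF \<omega> n, of "\<lambda>n. f (Z n \<omega>) * dens n \<omega> * ennreal (drift (Z n \<omega>) (T n \<omega>) s)"]
    by (simp only: if_True P.jump_path_eq[OF \<omega> n] exp_log_density[OF \<omega> n] mult.assoc)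
next
  case False
  then have "\<not> s < T (Suc n) \<omega>" for n by (simp add: alive_def)
  then have "slot T n s \<omega> = 0" for n by (simp add: slot_def)
  then show ?thesis using False by simp
qed

lemma survival_dens:
  assumes [measurable]: "f \<in> borel_measurable S" and s: "s \<in> {0..t}"
  shows "(\<integral>\<^sup>+\<omega>. f (Z n \<omega>) * dens n \<omega> * ennreal (drift (Z n \<omega>) (T n \<omega>) s) * slot T n s \<omega> \<partial>P) =
    (\<integral>\<^sup>+\<omega>. indicator {..s} (T n \<omega>) * (dens n \<omega> * (f (Z n \<omega>) * ennreal (surv r \<gamma> (Z n \<omega>) (T n \<omega>) s))) \<partial>P)"
proof -
  note [measurable] = P.hist_measurable[of n n, OF order_refl]
  have "(\<integral>\<^sup>+\<omega>. f (Z n \<omega>) * dens n \<omega> * ennreal (drift (Z n \<omega>) (T n \<omega>) s) * slot T n s \<omega> \<partial>P) =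
    (\<integral>\<^sup>+\<omega>. (f (Z n \<omega>) * dens n \<omega> * ennreal (drift (Z n \<omega>) (T n \<omega>) s)) * indicator {..s} (T n \<omega>) * ennreal (surv r (\<lambda>_ _ _. 0) (Z n \<omega>) (T n \<omega>) s) \<partial>P)"
    unfolding slot_def mult.assoc[of _ "indicator {..s} _", symmetric] by (rule P.survival[OF _ s]) measurable
  also have "\<dots> = (\<integral>\<^sup>+\<omega>. indicator {..s} (T n \<omega>) * (dens n \<omega> * (f (Z n \<omega>) * ennreal (surv r \<gamma> (Z n \<omega>) (T n \<omega>) s))) \<partial>P)"
    by (intro nn_integral_cong) (simp only: drift_surv_ennreal[OF P.Z_space, symmetric] ac_simps)
  finally show ?thesis .
qed

text \<open>For each number of jumps, \<open>survival\<close> replaces the holding interval at time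
  \<open>s\<close> by a function of the last jump, to which \<open>girsanov_chain\<close> applies;
  then the way back is taken under \<open>P\<close>. Explosion is permitted on both sides.\<close>

lemma girsanov_path:
  assumes M: "tilted_jump M S t r \<gamma> K \<pi> T' Z'" and f: "f \<in> borel_measurable S" and s: "s \<in> {0..t}"
  shows "(\<integral>\<^sup>+\<omega>. (if alive T' s \<omega> then f (jump_path T' Z' s \<omega>) else 0) \<partial>M) =
    (\<integral>\<^sup>+\<omega>. (if alive T s \<omega> then f (jump_path T Z s \<omega>) * ennreal (exp (log_density r \<gamma> T Z s \<omega>)) else 0) \<partial>P)"
proof -
  note [measurable] = f
  interpret M: tilted_jump M S t r \<gamma> K \<pi> T' Z' by (rule M)
  have s0: "0 \<le> s" "s \<le> t" using s by auto
  have "(\<integral>\<^sup>+\<omega>. (if alive T' s \<omega> then f (jump_path T' Z' s \<omega>) else 0) \<partial>M) =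
      (\<integral>\<^sup>+\<omega>. (\<Sum>n. f (Z' n \<omega>) * slot T' n s \<omega>) \<partial>M)"
    by (intro nn_integral_cong M.suminf_slot_path[symmetric] s0)
  also have "\<dots> = (\<Sum>n. \<integral>\<^sup>+\<omega>. f (Z' n \<omega>) * slot T' n s \<omega> \<partial>M)"
    by (rule nn_integral_suminf) measurable
  also have "\<dots> = (\<Sum>n. \<integral>\<^sup>+\<omega>. f (Z n \<omega>) * dens n \<omega> * ennreal (drift (Z n \<omega>) (T n \<omega>) s) * slot T n s \<omega> \<partial>P)"
  proof (rule suminf_cong)
    fix n
    note [measurable] = M.hist_measurable[of n n, OF order_refl]
    have "(\<integral>\<^sup>+\<omega>. f (Z' n \<omega>) * slot T' n s \<omega> \<partial>M) =
        (\<integral>\<^sup>+\<omega>. f (Z' n \<omega>) * indicator {..s} (T' n \<omega>) * ennreal (surv r \<gamma> (Z' n \<omega>) (T' n \<omega>) s) \<partial>M)"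
      unfolding slot_def mult.assoc[symmetric] by (rule M.survival[OF _ s]) measurable
    also have "\<dots> = (\<integral>\<^sup>+\<omega>. indicator {..s} (T' n \<omega>) * (\<lambda>(a, x). f x * ennreal (surv r \<gamma> x a s)) (T' n \<omega>, Z' n \<omega>) \<partial>M)"
      by (intro nn_integral_cong) (simp only: prod.case ac_simps)
    also have "\<dots> = (\<integral>\<^sup>+\<omega>. indicator {..s} (T n \<omega>) * (dens n \<omega> * (\<lambda>(a, x). f x * ennreal (surv r \<gamma> x a s)) (T n \<omega>, Z n \<omega>)) \<partial>P)"
      by (rule girsanov_chain[OF M _ s0(2)]) measurable
    also have "\<dots> = (\<integral>\<^sup>+\<omega>. f (Z n \<omega>) * dens n \<omega> * ennreal (drift (Z n \<omega>) (T n \<omega>) s) * slot T n s \<omega> \<partial>P)"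
      unfolding prod.case by (rule survival_dens[OF f s, symmetric])
    finally show "(\<integral>\<^sup>+\<omega>. f (Z' n \<omega>) * slot T' n s \<omega> \<partial>M) =
      (\<integral>\<^sup>+\<omega>. f (Z n \<omega>) * dens n \<omega> * ennreal (drift (Z n \<omega>) (T n \<omega>) s) * slot T n s \<omega> \<partial>P)" .
  qed
  also have "\<dots> = (\<integral>\<^sup>+\<omega>. (\<Sum>n. f (Z n \<omega>) * dens n \<omega> * ennreal (drift (Z n \<omega>) (T n \<omega>) s) * slot T n s \<omega>) \<partial>P)"
    by (rule nn_integral_suminf[symmetric]) measurable
  also have "\<dots> = (\<integral>\<^sup>+\<omega>. (if alive T s \<omega> then f (jump_path T Z s \<omega>) * ennreal (exp (log_density r \<gamma> T Z s \<omega>)) else 0) \<partial>P)"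
    by (intro nn_integral_cong suminf_dens_slot s0)
  finally show ?thesis .
qed

text \<open>Only the unperturbed process enters here: the lemma is applied to \<open>\<gamma> = 2\<theta>|g|\<close>, for which
  no perturbed process is given.\<close>

lemma supermartingale:
  assumes t: "0 \<le> t"
  shows "(\<integral>\<^sup>+\<omega>. (if alive T t \<omega> then ennreal (exp (log_density r \<gamma> T Z t \<omega>)) else 0) \<partial>P) \<le> 1"
proof -
  \<comment> \<open>Under the weights of the density, \<open>a n\<close> is the mass of at least n
    jumps up to \<open>t\<close>, and \<open>b n\<close> that of exactly n.\<close>
  define a where "a n = (\<integral>\<^sup>+\<omega>. indicator {..t} (T n \<omega>) * dens n \<omega> \<partial>P)" for n
  define b where "b n = (\<integral>\<^sup>+\<omega>. 1 * dens n \<omega> * ennreal (drift (Z n \<omega>) (T n \<omega>) t) * slot T n t \<omega> \<partial>P)" for n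
  have a0: "a 0 = 1"
  proof -
    have "a 0 = (\<integral>\<^sup>+\<omega>. 1 \<partial>P)"
      unfolding a_def by (intro nn_integral_cong) (simp add: P.T_0 dens_def t)
    then show ?thesis by (simp add: P.emeasure_space_1)
  qed
  have step: "a n = b n + a (Suc n)" for n
  proof -
    have b: "b n = (\<integral>\<^sup>+\<omega>. indicator {..t} (T n \<omega>) * (dens n \<omega> * ennreal (surv r \<gamma> (Z n \<omega>) (T n \<omega>) t)) \<partial>P)"
      unfolding b_def using survival_dens[of "\<lambda>_. 1" t n] t by simp
    have aS: "a (Suc n) = (\<integral>\<^sup>+\<omega>. dens n \<omega> * tilted_step t (\<lambda>_. 1) (T n \<omega>, Z n \<omega>) \<partial>P)"
      unfolding a_def using dens_step[of "\<lambda>_. 1" t n] by simp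
    have "a n = (\<integral>\<^sup>+\<omega>. indicator {..t} (T n \<omega>) * (dens n \<omega> * ennreal (surv r \<gamma> (Z n \<omega>) (T n \<omega>) t)) +
        dens n \<omega> * tilted_step t (\<lambda>_. 1) (T n \<omega>, Z n \<omega>) \<partial>P)"
      unfolding a_def
    proof (rule nn_integral_cong)
      fix \<omega> assume \<omega>: "\<omega> \<in> space P"
      have x: "Z n \<omega> \<in> space S" by (rule P.Z_space[OF \<omega>])
      show "indicator {..t} (T n \<omega>) * dens n \<omega> = indicator {..t} (T n \<omega>) * (dens n \<omega> * ennreal (surv r \<gamma> (Z n \<omega>) (T n \<omega>) t)) +
        dens n \<omega> * tilted_step t (\<lambda>_. 1) (T n \<omega>, Z n \<omega>)"
      proof (cases "T n \<omega> \<le> t")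
        case True
        have "tilted_step t (\<lambda>_. 1) (T n \<omega>, Z n \<omega>) =
            (\<integral>\<^sup>+s. indicator {T n \<omega>..t} s * ennreal (rate r \<gamma> s (Z n \<omega>) * surv r \<gamma> (Z n \<omega>) (T n \<omega>) s) \<partial>lborel)"
          unfolding tilted_step_def prod.case
        proof (rule nn_integral_cong)
          fix s
          have "ennreal (surv r \<gamma> (Z n \<omega>) (T n \<omega>) s) * ennreal (rate r \<gamma> s (Z n \<omega>)) = ennreal (rate r \<gamma> s (Z n \<omega>) * surv r \<gamma> (Z n \<omega>) (T n \<omega>) s)"
            using G.rate_pos[OF x, of s] G.surv_pos[of "Z n \<omega>" "T n \<omega>" s] by (simp add: ennreal_mult[symmetric] mult.commute)
          then show "indicator {T n \<omega>..t} s * ennreal (surv r \<gamma> (Z n \<omega>) (T n \<omega>) s) * (\<integral>\<^sup>+y. ennreal (exp (\<gamma> s (Z n \<omega>) y)) * 1 \<partial>r (Z n \<omega>)) =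
              indicator {T n \<omega>..t} s * ennreal (rate r \<gamma> s (Z n \<omega>) * surv r \<gamma> (Z n \<omega>) (T n \<omega>) s)"
            by (simp only: mult_1_right G.nn_integral_exp_tilt[OF x] mult.assoc)
        qed
        also have "\<dots> = ennreal (1 - surv r \<gamma> (Z n \<omega>) (T n \<omega>) t)" by (rule G.surv_hazard[OF x True])
        finally have ts: "tilted_step t (\<lambda>_. 1) (T n \<omega>, Z n \<omega>) = ennreal (1 - surv r \<gamma> (Z n \<omega>) (T n \<omega>) t)" .
        have "ennreal (surv r \<gamma> (Z n \<omega>) (T n \<omega>) t) + ennreal (1 - surv r \<gamma> (Z n \<omega>) (T n \<omega>) t) = 1"
          using G.surv_le_1[OF x, of "T n \<omega>" t] G.surv_pos[of "Z n \<omega>" "T n \<omega>" t]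
          by (simp add: ennreal_plus[symmetric] del: ennreal_plus)
        then show ?thesis using True by (simp add: ts distrib_left[symmetric])
      next
        case False
        then show ?thesis using tilted_step_indicator[of t "T n \<omega>" "\<lambda>_. 1" "Z n \<omega>"] by simp
      qed
    qed
    also have "\<dots> = b n + a (Suc n)"
      unfolding b aS by (rule nn_integral_add) measurable
    finally show ?thesis .
  qed
  \<comment> \<open>Telescoping from \<open>a 0 = 1\<close>. Only an inequality survives in the
    limit, because \<open>a n\<close> need not tend to 0 when the tilted rates allow
    explosion.\<close>
  have partial: "(\<Sum>i<n. b i) + a n = 1" for n
  proof (induction n)
    case (Suc n)
    then show ?case using step[of n] by (simp add: add.assoc)
  qed (simp add: a0)
  have "(\<integral>\<^sup>+\<omega>. (if alive T t \<omega> then ennreal (exp (log_density r \<gamma> T Z t \<omega>)) else 0) \<partial>P) =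
      (\<integral>\<^sup>+\<omega>. (if alive T t \<omega> then 1 * ennreal (exp (log_density r \<gamma> T Z t \<omega>)) else 0) \<partial>P)" by (simp cong: if_cong)
  also have "\<dots> = (\<integral>\<^sup>+\<omega>. (\<Sum>n. 1 * dens n \<omega> * ennreal (drift (Z n \<omega>) (T n \<omega>) t) * slot T n t \<omega>) \<partial>P)"
    by (intro nn_integral_cong suminf_dens_slot[symmetric] t)
  also have "\<dots> = (\<Sum>n. b n)"
    unfolding b_def by (rule nn_integral_suminf) measurable
  also have "\<dots> \<le> 1"
  proof (rule suminf_le_const)
    show "(\<Sum>i<n. b i) \<le> 1" for n using partial[of n] by (metis le_iff_add)
  qed simp
  finally show ?thesis .
qed

end

section \<open>Time reversal\<close>

locale stationary_jump = tilted_jump P S t r "\<lambda>_ _ _. 0" 0 \<pi> T Z + rev: rate_kernel S rstar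
  for P :: "'w measure" and S :: "'a measure" and t :: real and r \<pi>
    and T :: "nat \<Rightarrow> 'w \<Rightarrow> real" and Z :: "nat \<Rightarrow> 'w \<Rightarrow> 'a" and rstar +
  assumes reversal: "reversed_kernel S \<pi> r rstar"
    and nonexpl: "nonexplosive P T"
    and stat: "stationary P S (jump_path T Z)"
    and t_pos: "0 < t"
begin

abbreviation "X \<equiv> jump_path T Z"

text \<open>The zero tilt does not depend on time, so the time argument 0 is an arbitrary
  choice.\<close>

abbreviation "exit_rate \<equiv> rate r (\<lambda>_ _ _. 0) 0"

lemma surv_exit: "a \<le> b \<Longrightarrow> surv r (\<lambda>_ _ _. 0) x a b = exp (- ((b - a) * exit_rate x))"
  by (simp add: surv_def set_lebesgue_integral_def rate_def contract_def mult.commute)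

lemma AE_alive: "AE \<omega> in P. \<forall>s. alive T s \<omega>"
  using nonexpl unfolding nonexplosive_def
proof eventually_elim
  case (elim \<omega>)
  show ?case
  proof
    fix s
    have "\<forall>\<^sub>F n in sequentially. s < T n \<omega>"
      using elim by (simp add: filterlim_at_top_dense)
    then obtain N where "\<And>n. N \<le> n \<Longrightarrow> s < T n \<omega>" by (auto simp: eventually_sequentially)
    then show "alive T s \<omega>" unfolding alive_def by (intro exI[of _ N]) simp
  qed
qed

lemma sets_\<pi> [measurable_cong]: "sets \<pi> = sets S"
  using initial_law by (metis sets_distr)

lemma measurable_X [measurable]: "X s \<in> measurable P S"
  using measurable_jump_path[of "\<lambda>_. s" P "\<lambda>\<omega>. \<omega>"] by simp

section \<open>Consequences of stationarity and of the kernel identity\<close>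

text \<open>Evaluation at two times is measurable on the product space, so equality of the path laws
  passes to pairs. This is the only form in which stationarity is applied.\<close>

lemma stationary_pair:
  assumes f: "f \<in> borel_measurable (S \<Otimes>\<^sub>M S)" and ab: "0 \<le> a" "0 \<le> b" and h: "0 \<le> h"
  shows "(\<integral>\<^sup>+\<omega>. f (X (a + h) \<omega>, X (b + h) \<omega>) \<partial>P) = (\<integral>\<^sup>+\<omega>. f (X a \<omega>, X b \<omega>) \<partial>P)"
proof (cases "h = 0")
  case False
  let ?Q = "\<Pi>\<^sub>M s\<in>{0::real..}. S"
  have ev: "(\<lambda>\<xi>. \<xi> a) \<in> measurable ?Q S" "(\<lambda>\<xi>. \<xi> b) \<in> measurable ?Q S"
    using ab by (auto intro!: measurable_component_singleton)
  have [measurable]: "(\<lambda>\<xi>. f (\<xi> a, \<xi> b)) \<in> borel_measurable ?Q"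
    by (rule measurable_compose[OF measurable_Pair[OF ev] f])
  have m: "(\<lambda>\<omega>. \<lambda>s\<in>{0..}. X (s + c) \<omega>) \<in> measurable P ?Q" for c
    by (rule measurable_restrict) measurable
  have "(\<integral>\<^sup>+\<omega>. f (X (a + h) \<omega>, X (b + h) \<omega>) \<partial>P) = (\<integral>\<^sup>+\<xi>. f (\<xi> a, \<xi> b) \<partial>distr P ?Q (\<lambda>\<omega>. \<lambda>s\<in>{0..}. X (s + h) \<omega>))"
    using ab by (subst nn_integral_distr[OF m]) auto
  also have "distr P ?Q (\<lambda>\<omega>. \<lambda>s\<in>{0..}. X (s + h) \<omega>) = distr P ?Q (\<lambda>\<omega>. \<lambda>s\<in>{0..}. X s \<omega>)"
    using stat h False by (auto simp: stationary_def)
  also have "(\<integral>\<^sup>+\<xi>. f (\<xi> a, \<xi> b) \<partial>\<dots>) = (\<integral>\<^sup>+\<omega>. f (X a \<omega>, X b \<omega>) \<partial>P)"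
    using ab m[of 0] by (subst nn_integral_distr) auto
  finally show ?thesis .
qed simp

lemma X_0: "\<omega> \<in> space P \<Longrightarrow> X 0 \<omega> = Z 0 \<omega>"
  using jump_path_eq[of \<omega> 0 0] T_Suc[of \<omega> 0] by (simp add: T_0)

lemma nn_integral_X:
  assumes [measurable]: "f \<in> borel_measurable S" and s: "0 \<le> s"
  shows "(\<integral>\<^sup>+\<omega>. f (X s \<omega>) \<partial>P) = (\<integral>\<^sup>+x. f x \<partial>\<pi>)"
proof -
  have "(\<integral>\<^sup>+\<omega>. f (X s \<omega>) \<partial>P) = (\<integral>\<^sup>+\<omega>. f (X 0 \<omega>) \<partial>P)"
    using stationary_pair[of "\<lambda>(x, y). f x" 0 0 s] s by simp
  also have "\<dots> = (\<integral>\<^sup>+\<omega>. f (Z 0 \<omega>) \<partial>P)" by (intro nn_integral_cong) (simp add: X_0)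
  also have "\<dots> = (\<integral>\<^sup>+x. f x \<partial>\<pi>)"
    unfolding initial_law[symmetric] by (rule nn_integral_distr[symmetric]) measurable
  finally show ?thesis .
qed

text \<open>The kernel identity is assumed for sets only. Each side is an integral against a measure
  supplied by \<open>mixture_measure\<close>, and these measures agree on all measurable
  sets.\<close>

lemma reversal_nn:
  assumes F: "F \<in> borel_measurable (S \<Otimes>\<^sub>M S)"
  shows "(\<integral>\<^sup>+x. \<integral>\<^sup>+y. F (x, y) \<partial>r x \<partial>\<pi>) = (\<integral>\<^sup>+y. \<integral>\<^sup>+x. F (x, y) \<partial>rstar y \<partial>\<pi>)"
proof -
  have sp: "space \<pi> = space S" by (rule sets_eq_imp_space_eq[OF sets_\<pi>])
  obtain \<mu> where \<mu>: "sets \<mu> = sets (S \<Otimes>\<^sub>M S)"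
    "\<And>f :: _ \<Rightarrow> ennreal. f \<in> borel_measurable (S \<Otimes>\<^sub>M S) \<Longrightarrow> (\<integral>\<^sup>+z. f z \<partial>\<mu>) = (\<integral>\<^sup>+x. \<integral>\<^sup>+y. f (x, y) \<partial>r x \<partial>\<pi>)"
  proof (rule mixture_measure[of \<pi> "\<lambda>x y. (x, y)" r "S \<Otimes>\<^sub>M S"])
    fix x assume "x \<in> space \<pi>"
    then show "Pair x \<in> r x \<rightarrow>\<^sub>M S \<Otimes>\<^sub>M S" by (intro measurable_r) (simp_all add: sp)
  next
    fix f :: "_ \<Rightarrow> ennreal" assume [measurable]: "f \<in> borel_measurable (S \<Otimes>\<^sub>M S)"
    show "(\<lambda>x. \<integral>\<^sup>+y. f (x, y) \<partial>r x) \<in> borel_measurable \<pi>" by measurable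
  qed blast
  obtain \<nu> where \<nu>: "sets \<nu> = sets (S \<Otimes>\<^sub>M S)"
    "\<And>f :: _ \<Rightarrow> ennreal. f \<in> borel_measurable (S \<Otimes>\<^sub>M S) \<Longrightarrow> (\<integral>\<^sup>+z. f z \<partial>\<nu>) = (\<integral>\<^sup>+y. \<integral>\<^sup>+x. f (x, y) \<partial>rstar y \<partial>\<pi>)"
  proof (rule mixture_measure[of \<pi> "\<lambda>y x. (x, y)" rstar "S \<Otimes>\<^sub>M S"])
    fix y assume "y \<in> space \<pi>"
    then show "(\<lambda>x. (x, y)) \<in> rstar y \<rightarrow>\<^sub>M S \<Otimes>\<^sub>M S" by (intro rev.measurable_r) (simp_all add: sp)
  next
    fix f :: "_ \<Rightarrow> ennreal" assume [measurable]: "f \<in> borel_measurable (S \<Otimes>\<^sub>M S)"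
    show "(\<lambda>y. \<integral>\<^sup>+x. f (x, y) \<partial>rstar y) \<in> borel_measurable \<pi>" by measurable
  qed blast
  have "\<mu> = \<nu>"
  proof (rule measure_eqI)
    show "sets \<mu> = sets \<nu>" by (simp add: \<mu> \<nu>)
    fix A assume "A \<in> sets \<mu>"
    then have A: "A \<in> sets (S \<Otimes>\<^sub>M S)" by (simp add: \<mu>)
    have "emeasure \<mu> A = (\<integral>\<^sup>+z. indicator A z \<partial>\<mu>)" using A by (simp add: \<mu>(1))
    also have "\<dots> = (\<integral>\<^sup>+z. indicator A z \<partial>\<nu>)"
      using A reversal by (simp add: \<mu>(2) \<nu>(2) reversed_kernel_def)
    also have "\<dots> = emeasure \<nu> A" using A by (simp add: \<nu>(1))
    finally show "emeasure \<mu> A = emeasure \<nu> A" .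
  qed
  then show ?thesis using \<mu>(2)[OF F] \<nu>(2)[OF F] by simp
qed

text \<open>\<open>trans v k u x\<close> is \<open>E\<^sub>x[v(X\<^sub>u); exactly k jumps in [0,u]]\<close>.\<close>

primrec trans :: "('a \<Rightarrow> ennreal) \<Rightarrow> nat \<Rightarrow> real \<Rightarrow> 'a \<Rightarrow> ennreal" where
  "trans v 0 u x = ennreal (exp (- (u * exit_rate x))) * v x"
| "trans v (Suc k) u x = (\<integral>\<^sup>+w. indicator {0..u} w * ennreal (exp (- (w * exit_rate x))) *
     (\<integral>\<^sup>+y. trans v k (u - w) y \<partial>r x) \<partial>lborel)"

text \<open>The transition semigroup, written as a series over the number of jumps. The only process
  at hand starts from \<open>\<pi>\<close>, so expectations from a fixed state have to be described
  analytically.\<close>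

definition semigroup :: "('a \<Rightarrow> ennreal) \<Rightarrow> real \<Rightarrow> 'a \<Rightarrow> ennreal" where
  "semigroup v u x = (\<Sum>k. trans v k u x)"

lemma measurable_trans [measurable (raw)]:
  assumes v: "v \<in> borel_measurable S" and [measurable]: "f \<in> borel_measurable N" "h \<in> measurable N S"
  shows "(\<lambda>w. trans v k (f w) (h w)) \<in> borel_measurable N"
proof -
  have "(\<lambda>(u, x). trans v k u x) \<in> borel_measurable (borel \<Otimes>\<^sub>M S)"
  proof (induction k)
    case 0 show ?case using v by simp
  next
    case (Suc k)
    have [measurable]: "(\<lambda>z. trans v k (f z) (h z)) \<in> borel_measurable N"
      if [measurable]: "f \<in> borel_measurable N" "h \<in> measurable N S" for f h and N :: "'z measure"
      using measurable_compose[OF measurable_Pair[OF that] Suc.IH] by simp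
    show ?case unfolding trans.simps by measurable
  qed
  from measurable_compose[OF measurable_Pair[OF assms(2,3)] this] show ?thesis by simp
qed

lemma measurable_semigroup [measurable (raw)]:
  assumes [measurable]: "v \<in> borel_measurable S" "f \<in> borel_measurable N" "h \<in> measurable N S"
  shows "(\<lambda>w. semigroup v (f w) (h w)) \<in> borel_measurable N"
  unfolding semigroup_def by measurable

section \<open>Markov property at jump times and law at two times\<close>

text \<open>Induction on the number \<open>k\<close> of jumps still to come, for all
  \<open>n\<close> and \<open>W\<close> at once: one jump is moved from the future into the history,
  and \<open>one_step\<close> produces exactly the recursion that defines
  \<open>trans\<close>.\<close>

lemma markov_trans:
  assumes v: "v \<in> borel_measurable S" and u: "u \<in> {0..t}" and W: "W \<in> borel_measurable (hist n)"
  shows "(\<integral>\<^sup>+\<omega>. W \<omega> * indicator {..u} (T n \<omega>) * trans v k (u - T n \<omega>) (Z n \<omega>) \<partial>P) =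
    (\<integral>\<^sup>+\<omega>. W \<omega> * indicator {..u} (T n \<omega>) * (v (Z (n + k) \<omega>) * slot T (n + k) u \<omega>) \<partial>P)"
  using W
proof (induction k arbitrary: n W)
  case 0
  note [measurable] = hist_measurable[of n n, OF order_refl] 0 v
  have "(\<integral>\<^sup>+\<omega>. W \<omega> * indicator {..u} (T n \<omega>) * (v (Z (n + 0) \<omega>) * slot T (n + 0) u \<omega>) \<partial>P) =
      (\<integral>\<^sup>+\<omega>. (W \<omega> * v (Z n \<omega>)) * indicator {..u} (T n \<omega>) * indicator {u<..} (T (Suc n) \<omega>) \<partial>P)"
    by (intro nn_integral_cong) (simp add: slot_def ac_simps split: split_indicator)
  also have "\<dots> = (\<integral>\<^sup>+\<omega>. (W \<omega> * v (Z n \<omega>)) * indicator {..u} (T n \<omega>) * ennreal (surv r (\<lambda>_ _ _. 0) (Z n \<omega>) (T n \<omega>) u) \<partial>P)"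
    by (rule survival[OF _ u]) measurable
  also have "\<dots> = (\<integral>\<^sup>+\<omega>. W \<omega> * indicator {..u} (T n \<omega>) * trans v 0 (u - T n \<omega>) (Z n \<omega>) \<partial>P)"
  proof (rule nn_integral_cong)
    fix \<omega>
    show "(W \<omega> * v (Z n \<omega>)) * indicator {..u} (T n \<omega>) * ennreal (surv r (\<lambda>_ _ _. 0) (Z n \<omega>) (T n \<omega>) u) =
        W \<omega> * indicator {..u} (T n \<omega>) * trans v 0 (u - T n \<omega>) (Z n \<omega>)"
      by (cases "T n \<omega> \<le> u") (simp_all add: surv_exit ac_simps)
  qed
  finally show ?case by simp
next
  case (Suc k)
  note [measurable] = hist_measurable[of n n, OF order_refl] Suc.prems v
  have W': "(\<lambda>\<omega>. W \<omega> * indicator {..u} (T n \<omega>)) \<in> borel_measurable (hist (Suc n))"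
    by (rule hist_mono[of n]) (simp, measurable)
  define \<phi> where "\<phi> = (\<lambda>(\<omega>, s, y). W \<omega> * indicator {..u} (T n \<omega>) * trans v k (u - s) y)"
  have \<phi>m: "\<phi> \<in> borel_measurable (hist n \<Otimes>\<^sub>M borel \<Otimes>\<^sub>M S)" unfolding \<phi>_def by measurable
  have "(\<integral>\<^sup>+\<omega>. W \<omega> * indicator {..u} (T n \<omega>) * (v (Z (n + Suc k) \<omega>) * slot T (n + Suc k) u \<omega>) \<partial>P) =
      (\<integral>\<^sup>+\<omega>. (W \<omega> * indicator {..u} (T n \<omega>)) * indicator {..u} (T (Suc n) \<omega>) * (v (Z (Suc n + k) \<omega>) * slot T (Suc n + k) u \<omega>) \<partial>P)"
  proof (rule nn_integral_cong)
    fix \<omega> assume \<omega>: "\<omega> \<in> space P"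
    have "T (Suc n) \<omega> \<le> T (Suc n + k) \<omega>" by (simp add: T_le_iff[OF \<omega>])
    then have "slot T (Suc n + k) u \<omega> = indicator {..u} (T (Suc n) \<omega>) * slot T (Suc n + k) u \<omega>"
      by (auto simp: slot_def indicator_def)
    then show "W \<omega> * indicator {..u} (T n \<omega>) * (v (Z (n + Suc k) \<omega>) * slot T (n + Suc k) u \<omega>) =
      (W \<omega> * indicator {..u} (T n \<omega>)) * indicator {..u} (T (Suc n) \<omega>) * (v (Z (Suc n + k) \<omega>) * slot T (Suc n + k) u \<omega>)"
      by (metis (no_types, lifting) add_Suc_shift mult.assoc mult.left_commute)
  qed
  also have "\<dots> = (\<integral>\<^sup>+\<omega>. (W \<omega> * indicator {..u} (T n \<omega>)) * indicator {..u} (T (Suc n) \<omega>) * trans v k (u - T (Suc n) \<omega>) (Z (Suc n) \<omega>) \<partial>P)"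
    by (rule Suc.IH[OF W', symmetric])
  also have "\<dots> = (\<integral>\<^sup>+\<omega>. indicator {..u} (T (Suc n) \<omega>) * \<phi> (\<omega>, T (Suc n) \<omega>, Z (Suc n) \<omega>) \<partial>P)"
    by (intro nn_integral_cong) (simp add: \<phi>_def ac_simps)
  also have "\<dots> = (\<integral>\<^sup>+\<omega>. \<integral>\<^sup>+s. indicator {T n \<omega>..u} s * ennreal (surv r (\<lambda>_ _ _. 0) (Z n \<omega>) (T n \<omega>) s) *
      (\<integral>\<^sup>+y. ennreal (exp 0) * \<phi> (\<omega>, s, y) \<partial>r (Z n \<omega>)) \<partial>lborel \<partial>P)"
    using u by (intro one_step[OF \<phi>m]) simp
  also have "\<dots> = (\<integral>\<^sup>+\<omega>. W \<omega> * indicator {..u} (T n \<omega>) * trans v (Suc k) (u - T n \<omega>) (Z n \<omega>) \<partial>P)"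
  proof (rule nn_integral_cong)
    fix \<omega> assume \<omega>: "\<omega> \<in> space P"
    let ?x = "Z n \<omega>" and ?a = "T n \<omega>"
    have x: "?x \<in> space S" using Z_space[OF \<omega>] .
    let ?V = "W \<omega> * indicator {..u} ?a"
    have "(\<integral>\<^sup>+s. indicator {?a..u} s * ennreal (surv r (\<lambda>_ _ _. 0) ?x ?a s) * (\<integral>\<^sup>+y. ennreal (exp 0) * \<phi> (\<omega>, s, y) \<partial>r ?x) \<partial>lborel) =
      (\<integral>\<^sup>+s. ?V * (indicator {?a..u} s * ennreal (exp (- ((s - ?a) * exit_rate ?x))) * (\<integral>\<^sup>+y. trans v k (u - s) y \<partial>r ?x)) \<partial>lborel)"
    proof (rule nn_integral_cong)
      fix s
      have "(\<lambda>y. trans v k (u - s) y) \<in> borel_measurable S" by measurable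
      from measurable_r[OF x this]
      have "(\<integral>\<^sup>+y. ennreal (exp 0) * \<phi> (\<omega>, s, y) \<partial>r ?x) = ?V * (\<integral>\<^sup>+y. trans v k (u - s) y \<partial>r ?x)"
        by (simp add: \<phi>_def nn_integral_cmult)
      then show "indicator {?a..u} s * ennreal (surv r (\<lambda>_ _ _. 0) ?x ?a s) * (\<integral>\<^sup>+y. ennreal (exp 0) * \<phi> (\<omega>, s, y) \<partial>r ?x) =
        ?V * (indicator {?a..u} s * ennreal (exp (- ((s - ?a) * exit_rate ?x))) * (\<integral>\<^sup>+y. trans v k (u - s) y \<partial>r ?x))"
        by (cases "s \<in> {?a..u}") (simp_all add: surv_exit ac_simps)
    qed
    also have "\<dots> = ?V * (\<integral>\<^sup>+s. indicator {?a..u} s * ennreal (exp (- ((s - ?a) * exit_rate ?x))) * (\<integral>\<^sup>+y. trans v k (u - s) y \<partial>r ?x) \<partial>lborel)"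
      using x by (intro nn_integral_cmult) measurable
    \<comment> \<open>Time is now counted from \<open>T n\<close>: the substitution s = T n + w
      gives the integral the shape it has in \<open>trans\<close>.\<close>
    also have "(\<integral>\<^sup>+s. indicator {?a..u} s * ennreal (exp (- ((s - ?a) * exit_rate ?x))) * (\<integral>\<^sup>+y. trans v k (u - s) y \<partial>r ?x) \<partial>lborel) =
        (\<integral>\<^sup>+w. indicator {?a..u} (?a + 1 * w) * ennreal (exp (- ((?a + 1 * w - ?a) * exit_rate ?x))) * (\<integral>\<^sup>+y. trans v k (u - (?a + 1 * w)) y \<partial>r ?x) \<partial>lborel)"
    proof -
      have m: "(\<lambda>s. indicator {?a..u} s * ennreal (exp (- ((s - ?a) * exit_rate ?x))) * (\<integral>\<^sup>+y. trans v k (u - s) y \<partial>r ?x)) \<in> borel_measurable borel"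
        using x by measurable
      show ?thesis by (subst nn_integral_real_affine[OF m, of 1 ?a]) simp_all
    qed
    also have "\<dots> = trans v (Suc k) (u - ?a) ?x"
      unfolding trans.simps
    proof (rule nn_integral_cong)
      fix w
      have "indicator {?a..u} (?a + 1 * w) = (indicator {0..u - ?a} w :: ennreal)" by (auto simp: indicator_def)
      moreover have "?a + 1 * w - ?a = w" "u - (?a + 1 * w) = u - ?a - w" by simp_all
      ultimately show "indicator {?a..u} (?a + 1 * w) * ennreal (exp (- ((?a + 1 * w - ?a) * exit_rate ?x))) * (\<integral>\<^sup>+y. trans v k (u - (?a + 1 * w)) y \<partial>r ?x) =
        indicator {0..u - ?a} w * ennreal (exp (- (w * exit_rate ?x))) * (\<integral>\<^sup>+y. trans v k (u - ?a - w) y \<partial>r ?x)"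
        by (simp only:)
    qed
    finally show "(\<integral>\<^sup>+s. indicator {?a..u} s * ennreal (surv r (\<lambda>_ _ _. 0) ?x ?a s) * (\<integral>\<^sup>+y. ennreal (exp 0) * \<phi> (\<omega>, s, y) \<partial>r ?x) \<partial>lborel) =
      ?V * trans v (Suc k) (u - ?a) ?x" .
  qed
  finally show ?case by (rule sym)
qed

lemma suminf_slot_shift:
  assumes \<omega>: "\<omega> \<in> space P" and u: "0 \<le> u" and n: "T n \<omega> \<le> u"
  shows "(\<Sum>k. f (Z (n + k) \<omega>) * slot T (n + k) u \<omega>) = (if alive T u \<omega> then f (X u \<omega>) else 0)"
proof (cases "alive T u \<omega>")
  case True
  obtain m where m: "T m \<omega> \<le> u" "u < T (Suc m) \<omega>" by (rule alive_obtain[OF \<omega> u True])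
  have "T n \<omega> < T (Suc m) \<omega>" using m n by simp
  then have nm: "n \<le> m" by (simp add: T_less_iff[OF \<omega>])
  have "(\<Sum>k. f (Z (n + k) \<omega>) * slot T (n + k) u \<omega>) = (\<Sum>k\<in>{m - n}. f (Z (n + k) \<omega>) * slot T (n + k) u \<omega>)"
    using nm by (intro suminf_finite) (auto simp: slot_eq[OF \<omega> m])
  then show ?thesis using True nm by (simp add: slot_eq[OF \<omega> m] jump_path_eq[OF \<omega> m])
next
  case False
  then have "\<not> u < T (Suc n) \<omega>" for n by (simp add: alive_def)
  then have "slot T n u \<omega> = 0" for n by (simp add: slot_def)
  then show ?thesis using False by simp
qed

text \<open>\<open>markov_trans\<close> summed over \<open>k\<close>. Non-explosion enters here:
  almost surely the holding intervals from the \<open>n\<close>-th on cover all times after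
  \<open>T n\<close>.\<close>

lemma markov:
  assumes v: "v \<in> borel_measurable S" and u: "u \<in> {0..t}" and W: "W \<in> borel_measurable (hist n)"
  shows "(\<integral>\<^sup>+\<omega>. W \<omega> * indicator {..u} (T n \<omega>) * semigroup v (u - T n \<omega>) (Z n \<omega>) \<partial>P) =
    (\<integral>\<^sup>+\<omega>. W \<omega> * indicator {..u} (T n \<omega>) * v (X u \<omega>) \<partial>P)"
proof -
  note [measurable] = v hist_M[OF W]
  have "(\<integral>\<^sup>+\<omega>. W \<omega> * indicator {..u} (T n \<omega>) * semigroup v (u - T n \<omega>) (Z n \<omega>) \<partial>P) =
      (\<Sum>k. \<integral>\<^sup>+\<omega>. W \<omega> * indicator {..u} (T n \<omega>) * trans v k (u - T n \<omega>) (Z n \<omega>) \<partial>P)"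
    unfolding semigroup_def ennreal_suminf_cmult[symmetric] by (rule nn_integral_suminf) measurable
  also have "\<dots> = (\<Sum>k. \<integral>\<^sup>+\<omega>. W \<omega> * indicator {..u} (T n \<omega>) * (v (Z (n + k) \<omega>) * slot T (n + k) u \<omega>) \<partial>P)"
    by (intro suminf_cong markov_trans v u W)
  also have "\<dots> = (\<integral>\<^sup>+\<omega>. W \<omega> * indicator {..u} (T n \<omega>) * (\<Sum>k. v (Z (n + k) \<omega>) * slot T (n + k) u \<omega>) \<partial>P)"
    unfolding ennreal_suminf_cmult[symmetric] by (rule nn_integral_suminf[symmetric]) measurable
  also have "\<dots> = (\<integral>\<^sup>+\<omega>. W \<omega> * indicator {..u} (T n \<omega>) * v (X u \<omega>) \<partial>P)"
  proof (rule nn_integral_cong_AE)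
    show "AE \<omega> in P. W \<omega> * indicator {..u} (T n \<omega>) * (\<Sum>k. v (Z (n + k) \<omega>) * slot T (n + k) u \<omega>) =
        W \<omega> * indicator {..u} (T n \<omega>) * v (X u \<omega>)"
      using AE_alive AE_space
    proof eventually_elim
      case (elim \<omega>)
      have u0: "0 \<le> u" using u by simp
      show ?case
        using suminf_slot_shift[OF elim(2) u0, of n v] elim(1) by (cases "T n \<omega> \<le> u") auto
    qed
  qed
  finally show ?thesis .
qed

text \<open>A Markov property at deterministic times is avoided. Stationarity moves the earlier time
  to 0, which is \<open>T 0\<close>, and \<open>markov\<close> applies with n = 0.\<close>

lemma two_point_law:
  assumes v: "v \<in> borel_measurable S" and f: "f \<in> borel_measurable S" and su: "0 \<le> s" "s \<le> u" "u \<le> t"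
  shows "(\<integral>\<^sup>+\<omega>. f (X s \<omega>) * v (X u \<omega>) \<partial>P) = (\<integral>\<^sup>+x. f x * semigroup v (u - s) x \<partial>\<pi>)"
proof -
  note [measurable] = v f hist_measurable[of 0 0, OF order_refl]
  have "(\<integral>\<^sup>+\<omega>. f (X s \<omega>) * v (X u \<omega>) \<partial>P) = (\<integral>\<^sup>+\<omega>. f (X 0 \<omega>) * v (X (u - s) \<omega>) \<partial>P)"
    using stationary_pair[of "\<lambda>(x, y). f x * v y" 0 "u - s" s] su by simp
  also have "\<dots> = (\<integral>\<^sup>+\<omega>. f (Z 0 \<omega>) * indicator {..u - s} (T 0 \<omega>) * v (X (u - s) \<omega>) \<partial>P)"
    using su by (intro nn_integral_cong) (simp add: X_0 T_0)
  also have "\<dots> = (\<integral>\<^sup>+\<omega>. f (Z 0 \<omega>) * indicator {..u - s} (T 0 \<omega>) * semigroup v (u - s - T 0 \<omega>) (Z 0 \<omega>) \<partial>P)"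
    using su by (intro markov[symmetric]) (auto intro: v)
  also have "\<dots> = (\<integral>\<^sup>+\<omega>. f (Z 0 \<omega>) * semigroup v (u - s) (Z 0 \<omega>) \<partial>P)"
    using su by (intro nn_integral_cong) (simp add: T_0)
  also have "\<dots> = (\<integral>\<^sup>+x. f x * semigroup v (u - s) x \<partial>\<pi>)"
    unfolding initial_law[symmetric] by (rule nn_integral_distr[symmetric]) measurable
  finally show ?thesis .
qed

text \<open>In reversed time the process jumps with kernel \<open>rstar\<close>, which therefore compensates the jumps
  before time \<open>u\<close> given the future \<open>X\<^sub>u\<close>.\<close>

lemma reversed_levy_system:
  assumes \<phi>: "\<phi> \<in> borel_measurable (borel \<Otimes>\<^sub>M S \<Otimes>\<^sub>M S)" and v: "v \<in> borel_measurable S" and u: "u \<in> {0..t}"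
  shows "(\<Sum>n. \<integral>\<^sup>+\<omega>. indicator {..u} (T (Suc n) \<omega>) * \<phi> (T (Suc n) \<omega>, Z n \<omega>, Z (Suc n) \<omega>) * v (X u \<omega>) \<partial>P) =
    (\<integral>\<^sup>+s. indicator {0..u} s * (\<integral>\<^sup>+\<omega>. (\<integral>\<^sup>+x. \<phi> (s, x, X s \<omega>) \<partial>rstar (X s \<omega>)) * v (X u \<omega>) \<partial>P) \<partial>lborel)"
proof -
  note [measurable] = v \<phi>
  \<comment> \<open>The Markov property at the jump replaces \<open>v (X u \<omega>)\<close> by a
    function of the jump time and the new state, so that \<open>levy_system\<close> becomes
    applicable.\<close>
  define \<phi>' where "\<phi>' = (\<lambda>(s, x, y). \<phi> (s, x, y) * semigroup v (u - s) y)"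
  have [measurable]: "\<phi>' \<in> borel_measurable (borel \<Otimes>\<^sub>M S \<Otimes>\<^sub>M S)" unfolding \<phi>'_def by measurable
  have "(\<integral>\<^sup>+\<omega>. indicator {..u} (T (Suc n) \<omega>) * \<phi> (T (Suc n) \<omega>, Z n \<omega>, Z (Suc n) \<omega>) * v (X u \<omega>) \<partial>P) =
      (\<integral>\<^sup>+\<omega>. indicator {..u} (T (Suc n) \<omega>) * \<phi>' (T (Suc n) \<omega>, Z n \<omega>, Z (Suc n) \<omega>) \<partial>P)" for n
  proof -
    have [measurable]: "Z n \<in> measurable (hist (Suc n)) S" "T (Suc n) \<in> borel_measurable (hist (Suc n))"
      "Z (Suc n) \<in> measurable (hist (Suc n)) S" by (auto intro!: hist_measurable)
    have "(\<integral>\<^sup>+\<omega>. indicator {..u} (T (Suc n) \<omega>) * \<phi> (T (Suc n) \<omega>, Z n \<omega>, Z (Suc n) \<omega>) * v (X u \<omega>) \<partial>P) =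
        (\<integral>\<^sup>+\<omega>. \<phi> (T (Suc n) \<omega>, Z n \<omega>, Z (Suc n) \<omega>) * indicator {..u} (T (Suc n) \<omega>) * v (X u \<omega>) \<partial>P)"
      by (simp only: mult.commute[of "indicator _ _"])
    also have "\<dots> = (\<integral>\<^sup>+\<omega>. \<phi> (T (Suc n) \<omega>, Z n \<omega>, Z (Suc n) \<omega>) * indicator {..u} (T (Suc n) \<omega>) * semigroup v (u - T (Suc n) \<omega>) (Z (Suc n) \<omega>) \<partial>P)"
      by (rule markov[OF v u, symmetric]) measurable
    also have "\<dots> = (\<integral>\<^sup>+\<omega>. indicator {..u} (T (Suc n) \<omega>) * \<phi>' (T (Suc n) \<omega>, Z n \<omega>, Z (Suc n) \<omega>) \<partial>P)"
      by (simp add: \<phi>'_def ac_simps)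
    finally show ?thesis .
  qed
  then have "(\<Sum>n. \<integral>\<^sup>+\<omega>. indicator {..u} (T (Suc n) \<omega>) * \<phi> (T (Suc n) \<omega>, Z n \<omega>, Z (Suc n) \<omega>) * v (X u \<omega>) \<partial>P) =
      (\<Sum>n. \<integral>\<^sup>+\<omega>. indicator {..u} (T (Suc n) \<omega>) * \<phi>' (T (Suc n) \<omega>, Z n \<omega>, Z (Suc n) \<omega>) \<partial>P)" by simp
  also have "\<dots> = (\<integral>\<^sup>+s. indicator {0..u} s * (\<integral>\<^sup>+\<omega>. (if alive T s \<omega> then
      \<integral>\<^sup>+y. ennreal (exp 0) * \<phi>' (s, X s \<omega>, y) \<partial>r (X s \<omega>) else 0) \<partial>P) \<partial>lborel)"
    by (rule levy_system[OF _ u]) measurable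
  also have "\<dots> = (\<integral>\<^sup>+s. indicator {0..u} s * (\<integral>\<^sup>+\<omega>. (\<integral>\<^sup>+x. \<phi> (s, x, X s \<omega>) \<partial>rstar (X s \<omega>)) * v (X u \<omega>) \<partial>P) \<partial>lborel)"
  proof (rule nn_integral_cong)
    fix s
    show "indicator {0..u} s * (\<integral>\<^sup>+\<omega>. (if alive T s \<omega> then
        \<integral>\<^sup>+y. ennreal (exp 0) * \<phi>' (s, X s \<omega>, y) \<partial>r (X s \<omega>) else 0) \<partial>P) =
      indicator {0..u} s * (\<integral>\<^sup>+\<omega>. (\<integral>\<^sup>+x. \<phi> (s, x, X s \<omega>) \<partial>rstar (X s \<omega>)) * v (X u \<omega>) \<partial>P)"
    proof (cases "s \<in> {0..u}")
      case True
      then have su: "0 \<le> s" "s \<le> u" "u \<le> t" using u by auto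
      have "(\<integral>\<^sup>+\<omega>. (if alive T s \<omega> then \<integral>\<^sup>+y. ennreal (exp 0) * \<phi>' (s, X s \<omega>, y) \<partial>r (X s \<omega>) else 0) \<partial>P) =
          (\<integral>\<^sup>+\<omega>. \<integral>\<^sup>+y. \<phi>' (s, X s \<omega>, y) \<partial>r (X s \<omega>) \<partial>P)"
        by (rule nn_integral_cong_AE) (use AE_alive in eventually_elim, simp)
      \<comment> \<open>Stationarity replaces the law of \<open>X s\<close> by \<open>\<pi>\<close>;
        the kernel identity exchanges the two ends of the jump; \<open>two_point_law\<close> turns
        the semigroup back into the state at time \<open>u\<close>.\<close>
      also have "\<dots> = (\<integral>\<^sup>+x. \<integral>\<^sup>+y. \<phi>' (s, x, y) \<partial>r x \<partial>\<pi>)"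
        by (rule nn_integral_X[OF _ su(1)]) measurable
      also have "\<dots> = (\<integral>\<^sup>+y. \<integral>\<^sup>+x. \<phi>' (s, x, y) \<partial>rstar y \<partial>\<pi>)"
        using reversal_nn[of "\<lambda>(x, y). \<phi>' (s, x, y)"] by simp
      also have "\<dots> = (\<integral>\<^sup>+y. (\<integral>\<^sup>+x. \<phi> (s, x, y) \<partial>rstar y) * semigroup v (u - s) y \<partial>\<pi>)"
      proof (rule nn_integral_cong)
        fix y assume "y \<in> space \<pi>"
        then have y: "y \<in> space S" using sets_eq_imp_space_eq[OF sets_\<pi>] by simp
        have "(\<lambda>x. \<phi> (s, x, y)) \<in> borel_measurable S" using y by measurable
        from rev.measurable_r[OF y this]
        show "(\<integral>\<^sup>+x. \<phi>' (s, x, y) \<partial>rstar y) = (\<integral>\<^sup>+x. \<phi> (s, x, y) \<partial>rstar y) * semigroup v (u - s) y"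
          by (simp add: \<phi>'_def nn_integral_multc)
      qed
      also have "\<dots> = (\<integral>\<^sup>+\<omega>. (\<integral>\<^sup>+x. \<phi> (s, x, X s \<omega>) \<partial>rstar (X s \<omega>)) * v (X u \<omega>) \<partial>P)"
        by (rule two_point_law[OF v _ su, symmetric]) measurable
      finally show ?thesis by simp
    qed simp
  qed
  finally show ?thesis .
qed

end

section \<open>Domination of the densities\<close>

lemma abs_exp_minus_one_le: "\<bar>exp z - 1\<bar> \<le> \<bar>z\<bar> * exp \<bar>z\<bar>" for z :: real
proof (cases "0 \<le> z")
  case True
  have "1 - z \<le> exp (- z)" using exp_ge_add_one_self[of "- z"] by simp
  then have "(1 - z) * exp z \<le> exp (- z) * exp z" by (intro mult_right_mono) simp_all
  then have "exp z - 1 \<le> z * exp z" by (simp add: exp_minus algebra_simps)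
  then show ?thesis using True by simp
next
  case False
  have "1 - exp z \<le> - z" using exp_ge_add_one_self[of z] by linarith
  also have "- z \<le> - z * exp (- z)" using False by (simp add: mult_le_cancel_left1)
  finally show ?thesis using False by simp
qed

text \<open>The perturbed processes for different lambda live on spaces unrelated to
  \<open>P\<close> and to each other. Only their laws are compared, through densities on
  \<open>P\<close>.\<close>

locale response = stationary_jump P S t r \<pi> T Z rstar + g: tilt S r g K
  for P :: "'w measure" and S :: "'a measure" and t :: real and r \<pi>
    and T :: "nat \<Rightarrow> 'w \<Rightarrow> real" and Z :: "nat \<Rightarrow> 'w \<Rightarrow> 'a" and rstar and g K +
  fixes M :: "real \<Rightarrow> 'v measure" and T' :: "real \<Rightarrow> nat \<Rightarrow> 'v \<Rightarrow> real" and Z' :: "real \<Rightarrow> nat \<Rightarrow> 'v \<Rightarrow> 'a"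
  assumes cond_C: "condition_C P (jump_path T Z) r t g"
    and perturbed: "\<And>lam. jump_process (M lam) S {0..t} (tilted_kernel r g lam) \<pi> (T' lam) (Z' lam)"
begin

abbreviation "X' lam \<equiv> jump_path (T' lam) (Z' lam)"

abbreviation (input) "lg lam \<equiv> (\<lambda>s x y. lam * g s x y)"

lemma K_nonneg: "0 \<le> K"
proof -
  obtain \<omega> where "\<omega> \<in> space P" using not_empty by auto
  then have "Z 0 \<omega> \<in> space S" by (rule Z_space)
  from g.tilt_bound[OF this this, of 0] show ?thesis by simp
qed

lemma tilt_lg: "tilt S r (lg lam) (\<bar>lam\<bar> * K)"
proof
  show "(\<lambda>(s, x, y). lam * g s x y) \<in> borel_measurable (borel \<Otimes>\<^sub>M S \<Otimes>\<^sub>M S)" by measurable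
  show "\<bar>lam * g s x y\<bar> \<le> \<bar>lam\<bar> * K" if "x \<in> space S" "y \<in> space S" for s x y
    using g.tilt_bound[OF that, of s] by (simp add: abs_mult mult_left_mono)
qed

lemma tilt_abs: "0 \<le> \<kappa> \<Longrightarrow> tilt S r (\<lambda>s x y. \<kappa> * \<bar>g s x y\<bar>) (\<kappa> * K)"
proof
  show "(\<lambda>(s, x, y). \<kappa> * \<bar>g s x y\<bar>) \<in> borel_measurable (borel \<Otimes>\<^sub>M S \<Otimes>\<^sub>M S)" by measurable
  show "\<bar>\<kappa> * \<bar>g s x y\<bar>\<bar> \<le> \<kappa> * K" if "0 \<le> \<kappa>" "x \<in> space S" "y \<in> space S" for s x y
    using g.tilt_bound[OF that(2,3), of s] that(1) by (simp add: abs_mult mult_left_mono)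
qed

lemma perturbed_tilted: "tilted_jump (M lam) S t r (lg lam) (\<bar>lam\<bar> * K) \<pi> (T' lam) (Z' lam)"
proof -
  have "tilted_kernel r (lg lam) 1 = tilted_kernel r g lam" by (simp add: tilted_kernel_def fun_eq_iff)
  then show ?thesis
    using perturbed[of lam] tilt_lg[of lam] by (simp add: tilted_jump_def)
qed

lemma girsanov_tilt: "tilt S r h H \<Longrightarrow> girsanov P S t r \<pi> T Z h H"
  using tilted_jump_axioms by (simp add: girsanov_def)

text \<open>A real-valued version of \<open>abs_contract r (g s)\<close>; it is finite since
  \<open>g\<close> is bounded and \<open>r x\<close> has finite mass.\<close>

definition beta :: "real \<Rightarrow> 'a \<Rightarrow> real" where
  "beta s x = contract r (\<lambda>x y. \<bar>g s x y\<bar>) x"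

lemma measurable_beta [measurable (raw)]:
  assumes [measurable]: "f \<in> borel_measurable N" "h \<in> measurable N S"
  shows "(\<lambda>w. beta (f w) (h w)) \<in> borel_measurable N"
  unfolding beta_def by measurable

lemma integrable_bounded_r:
  fixes f :: "'a \<Rightarrow> real"
  assumes x: "x \<in> space S" and f: "f \<in> borel_measurable S" and b: "\<And>y. y \<in> space S \<Longrightarrow> \<bar>f y\<bar> \<le> B"
  shows "integrable (r x) f"
  using x by (intro finite_measure.integrable_const_bound[OF finite_measure_r, where B = B] measurable_r f) (auto intro!: AE_I2 b)

lemma integrable_g: "x \<in> space S \<Longrightarrow> integrable (r x) (g s x)"
  by (rule integrable_bounded_r[where B = K]) (auto intro: g.tilt_bound)

lemma beta_nonneg: "0 \<le> beta s x"
  unfolding beta_def contract_def by (rule integral_nonneg_AE) simp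

lemma abs_contract_g: "x \<in> space S \<Longrightarrow> abs_contract r (g s) x = ennreal (beta s x)"
  unfolding abs_contract_def beta_def contract_def
  by (rule nn_integral_eq_integral) (auto intro: integrable_g)

text \<open>From |e^z - 1| \<le> |z| e^|z|. The tilt \<open>h\<close> stays general because it will
  be lambda g with \<open>\<kappa>\<close> = |lambda|, and also a small multiple of |g|.\<close>

lemma abs_excess_rate_le:
  assumes h: "tilt S r h H" and le: "\<And>y. y \<in> space S \<Longrightarrow> \<bar>h s x y\<bar> \<le> \<kappa> * \<bar>g s x y\<bar>" and x: "x \<in> space S"
    and \<kappa>: "0 \<le> \<kappa>"
  shows "\<bar>excess_rate r h s x\<bar> \<le> \<kappa> * exp (\<kappa> * K) * beta s x"
proof -
  interpret h: tilt S r h H by (rule h)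
  interpret r: finite_measure "r x" using x by (rule finite_measure_r)
  have i: "integrable (r x) (\<lambda>y. exp (h s x y) - 1)" using h.integrable_exp_tilt[OF x] by simp
  have "\<bar>excess_rate r h s x\<bar> = \<bar>\<integral>y. exp (h s x y) - 1 \<partial>r x\<bar>"
    unfolding excess_rate_def rate_def contract_def using h.integrable_exp_tilt[OF x, of s] by simp
  also have "\<dots> \<le> (\<integral>y. \<bar>exp (h s x y) - 1\<bar> \<partial>r x)" by (rule integral_abs_bound)
  also have "\<dots> \<le> (\<integral>y. \<kappa> * exp (\<kappa> * K) * \<bar>g s x y\<bar> \<partial>r x)"
  proof (rule integral_mono)
    show "integrable (r x) (\<lambda>y. \<bar>exp (h s x y) - 1\<bar>)" using i by simp
    show "integrable (r x) (\<lambda>y. \<kappa> * exp (\<kappa> * K) * \<bar>g s x y\<bar>)" using integrable_g[OF x] by simp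
    fix y assume "y \<in> space (r x)"
    then have y: "y \<in> space S" using x by simp
    have g: "\<bar>g s x y\<bar> \<le> K" by (rule g.tilt_bound[OF x y])
    have "\<bar>h s x y\<bar> \<le> \<kappa> * K" using le[OF y] mult_left_mono[OF g \<kappa>] by linarith
    then have "\<bar>h s x y\<bar> * exp \<bar>h s x y\<bar> \<le> (\<kappa> * \<bar>g s x y\<bar>) * exp (\<kappa> * K)"
      using le[OF y] by (intro mult_mono) auto
    then show "\<bar>exp (h s x y) - 1\<bar> \<le> \<kappa> * exp (\<kappa> * K) * \<bar>g s x y\<bar>"
      using abs_exp_minus_one_le[of "h s x y"] by (simp add: ac_simps)
  qed
  also have "\<dots> = \<kappa> * exp (\<kappa> * K) * beta s x" by (simp add: beta_def contract_def)
  finally show ?thesis .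
qed

section \<open>The dominating variable\<close>

text \<open>One event of full measure on which all pathwise estimates hold, simultaneously for every
  time up to \<open>t\<close> and every lambda.\<close>

definition good :: "'w \<Rightarrow> bool" where
  "good \<omega> \<longleftrightarrow> \<omega> \<in> space P \<and> (\<forall>s. alive T s \<omega>) \<and> set_integrable lborel {0..t} (\<lambda>s. beta s (X s \<omega>))"

definition A :: "'w \<Rightarrow> real" where
  "A \<omega> = (LINT s:{0..t}|lborel. beta s (X s \<omega>))"

definition jump_total :: "(real \<Rightarrow> 'a \<Rightarrow> 'a \<Rightarrow> real) \<Rightarrow> real \<Rightarrow> 'w \<Rightarrow> real" where
  "jump_total h s \<omega> = (\<Sum>n. indicator {..s} (T (Suc n) \<omega>) * h (T (Suc n) \<omega>) (Z n \<omega>) (Z (Suc n) \<omega>))"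

abbreviation "Gabs \<equiv> jump_total (\<lambda>s x y. \<bar>g s x y\<bar>) t"

text \<open>|lambda| times \<open>R\<close> bounds the modulus of the logarithm of the density at
  every time up to \<open>t\<close>, for |lambda| \<le> 1. The weight exp K comes from the estimate
  of the excess rate.\<close>

definition R :: "'w \<Rightarrow> real" where
  "R \<omega> = Gabs \<omega> + exp K * A \<omega>"

lemma measurable_A [measurable]: "A \<in> borel_measurable P"
  unfolding A_def set_lebesgue_integral_def by measurable

lemma measurable_jump_total_g [measurable (raw)]:
  assumes [measurable]: "f \<in> borel_measurable N" "h \<in> measurable N P"
  shows "(\<lambda>w. jump_total g (f w) (h w)) \<in> borel_measurable N"
  unfolding jump_total_def by measurable

lemma measurable_Gabs [measurable]: "Gabs \<in> borel_measurable P"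
  unfolding jump_total_def by measurable

lemma measurable_R [measurable]: "R \<in> borel_measurable P"
  unfolding R_def by measurable

lemma abs_contract_path: "\<omega> \<in> space P \<Longrightarrow>
    (\<integral>\<^sup>+s\<in>{0..t}. abs_contract r (g s) (X s \<omega>) \<partial>lborel) = (\<integral>\<^sup>+s. ennreal (indicator {0..t} s * beta s (X s \<omega>)) \<partial>lborel)"
  by (intro nn_integral_cong) (auto simp: abs_contract_g[OF jump_path_space] split: split_indicator)

lemma AE_good: "AE \<omega> in P. good \<omega>"
proof -
  have "AE \<omega> in P. (\<integral>\<^sup>+s\<in>{0..t}. abs_contract r (g s) (X s \<omega>) \<partial>lborel) < \<top>"
    using cond_C by (simp add: condition_C_def Let_def)
  then show ?thesis using AE_alive AE_space
  proof eventually_elim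
    case (elim \<omega>)
    have "integrable lborel (\<lambda>s. indicator {0..t} s * beta s (X s \<omega>))"
    proof (rule integrableI_nonneg)
      show "(\<lambda>s. indicator {0..t} s * beta s (X s \<omega>)) \<in> borel_measurable lborel" using elim(3) by measurable
      show "(\<integral>\<^sup>+s. ennreal (indicator {0..t} s * beta s (X s \<omega>)) \<partial>lborel) < \<infinity>"
        using elim(1) by (simp add: abs_contract_path[OF elim(3)])
    qed (simp add: beta_nonneg)
    then show ?case using elim by (simp add: good_def set_integrable_def)
  qed
qed

lemma goodD: "good \<omega> \<Longrightarrow> \<omega> \<in> space P" by (simp add: good_def)

lemma good_A: "good \<omega> \<Longrightarrow> (\<integral>\<^sup>+s\<in>{0..t}. abs_contract r (g s) (X s \<omega>) \<partial>lborel) = ennreal (A \<omega>)"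
  unfolding A_def set_lebesgue_integral_def
  by (subst abs_contract_path) (auto simp: good_def set_integrable_def beta_nonneg intro!: nn_integral_eq_integral)

lemma A_nonneg: "0 \<le> A \<omega>"
  unfolding A_def set_lebesgue_integral_def by (rule integral_nonneg_AE) (simp add: beta_nonneg)

lemma good_finite_jumps:
  assumes "good \<omega>"
  obtains N where "\<forall>n\<ge>N. t < T (Suc n) \<omega>"
proof -
  obtain N where N: "t < T (Suc N) \<omega>" using assms by (auto simp: good_def alive_def)
  have "t < T (Suc n) \<omega>" if "N \<le> n" for n
    using N T_le_iff[OF goodD[OF assms], of "Suc N" "Suc n"] that by simp
  then show ?thesis using that by blast
qed

lemma jump_total_finite:
  assumes N: "\<forall>n\<ge>N. t < T (Suc n) \<omega>" and s: "s \<le> t"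
  shows "jump_total h s \<omega> = (\<Sum>n<N. indicator {..s} (T (Suc n) \<omega>) * h (T (Suc n) \<omega>) (Z n \<omega>) (Z (Suc n) \<omega>))"
  unfolding jump_total_def
proof (rule suminf_finite)
  fix n assume "n \<notin> {..<N}"
  then have "N \<le> n" by simp
  with N have "t < T (Suc n) \<omega>" by blast
  then have "s < T (Suc n) \<omega>" using s by linarith
  then show "indicator {..s} (T (Suc n) \<omega>) * h (T (Suc n) \<omega>) (Z n \<omega>) (Z (Suc n) \<omega>) = 0" by simp
qed simp

lemma abs_jump_total_le:
  assumes \<omega>: "good \<omega>" and s: "s \<le> t" and le: "\<And>s x y. x \<in> space S \<Longrightarrow> y \<in> space S \<Longrightarrow> \<bar>h s x y\<bar> \<le> \<kappa> * \<bar>g s x y\<bar>"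
  shows "\<bar>jump_total h s \<omega>\<bar> \<le> \<kappa> * Gabs \<omega>"
proof -
  obtain N where N: "\<forall>n\<ge>N. t < T (Suc n) \<omega>" using good_finite_jumps[OF \<omega>] by blast
  have "\<bar>jump_total h s \<omega>\<bar> \<le> (\<Sum>n<N. \<bar>indicator {..s} (T (Suc n) \<omega>) * h (T (Suc n) \<omega>) (Z n \<omega>) (Z (Suc n) \<omega>)\<bar>)"
    unfolding jump_total_finite[where N = N and \<omega> = \<omega>, OF N s] by (rule sum_abs)
  also have "\<dots> \<le> (\<Sum>n<N. \<kappa> * (indicator {..t} (T (Suc n) \<omega>) * \<bar>g (T (Suc n) \<omega>) (Z n \<omega>) (Z (Suc n) \<omega>)\<bar>))"
  proof (rule sum_mono)
    fix n
    have "\<bar>h (T (Suc n) \<omega>) (Z n \<omega>) (Z (Suc n) \<omega>)\<bar> \<le> \<kappa> * \<bar>g (T (Suc n) \<omega>) (Z n \<omega>) (Z (Suc n) \<omega>)\<bar>"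
      by (intro le Z_space goodD \<omega>)
    then show "\<bar>indicator {..s} (T (Suc n) \<omega>) * h (T (Suc n) \<omega>) (Z n \<omega>) (Z (Suc n) \<omega>)\<bar> \<le>
      \<kappa> * (indicator {..t} (T (Suc n) \<omega>) * \<bar>g (T (Suc n) \<omega>) (Z n \<omega>) (Z (Suc n) \<omega>)\<bar>)"
      using s by (auto simp: indicator_def abs_mult)
  qed
  also have "\<dots> = \<kappa> * Gabs \<omega>"
    unfolding jump_total_finite[where N = N and \<omega> = \<omega>, OF N order_refl] by (simp only: sum_distrib_left)
  finally show ?thesis .
qed

lemma Gabs_nonneg: "good \<omega> \<Longrightarrow> 0 \<le> Gabs \<omega>"
  using abs_jump_total_le[of \<omega> t "\<lambda>_ _ _. 0" 1] by (simp add: jump_total_def)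

lemma set_integrable_bounded_beta:
  assumes \<omega>: "good \<omega>" and m: "(\<lambda>w. f w) \<in> borel_measurable borel"
    and b: "\<And>w. \<bar>f w\<bar> \<le> c * beta w (X w \<omega>)" and s: "s \<le> t"
  shows "set_integrable lborel {0..s} f" "\<bar>LINT w:{0..s}|lborel. f w\<bar> \<le> c * A \<omega>"
proof -
  have iA: "set_integrable lborel {0..t} (\<lambda>w. c * beta w (X w \<omega>))"
    using \<omega> by (auto simp: good_def)
  have le: "\<bar>indicator {0..s} w * f w\<bar> \<le> indicator {0..t} w * (c * beta w (X w \<omega>))" for w
  proof -
    have "0 \<le> c * beta w (X w \<omega>)" using b[of w] by linarith
    then show ?thesis using b[of w] s by (auto simp: indicator_def)
  qed
  have i: "integrable lborel (\<lambda>w. indicator {0..s} w * f w)"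
  proof (rule Bochner_Integration.integrable_bound)
    show "integrable lborel (\<lambda>w. indicator {0..t} w * (c * beta w (X w \<omega>)))"
      using iA by (simp add: set_integrable_def)
    show "(\<lambda>w. indicator {0..s} w * f w) \<in> borel_measurable lborel" using m by measurable
    show "AE w in lborel. norm (indicator {0..s} w * f w) \<le> norm (indicator {0..t} w * (c * beta w (X w \<omega>)))"
    proof (rule AE_I2)
      fix w
      show "norm (indicator {0..s} w * f w) \<le> norm (indicator {0..t} w * (c * beta w (X w \<omega>)))"
        using le[of w] unfolding real_norm_def by linarith
    qed
  qed
  then show "set_integrable lborel {0..s} f" by (simp add: set_integrable_def)
  have "\<bar>LINT w:{0..s}|lborel. f w\<bar> \<le> (\<integral>w. \<bar>indicator {0..s} w * f w\<bar> \<partial>lborel)"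
    unfolding set_lebesgue_integral_def by simp
  also have "\<dots> \<le> (\<integral>w. indicator {0..t} w * (c * beta w (X w \<omega>)) \<partial>lborel)"
    using i iA le by (intro integral_mono) (auto simp: set_integrable_def)
  also have "\<dots> = c * A \<omega>" unfolding A_def by (simp add: set_lebesgue_integral_def mult.left_commute)
  finally show "\<bar>LINT w:{0..s}|lborel. f w\<bar> \<le> c * A \<omega>" .
qed

lemma measurable_excess_path:
  assumes h: "tilt S r h H" and \<omega>: "\<omega> \<in> space P"
  shows "(\<lambda>w. excess_rate r h w (X w \<omega>)) \<in> borel_measurable borel"
proof -
  interpret H: girsanov P S t r \<pi> T Z h H by (rule girsanov_tilt[OF h])
  show ?thesis using \<omega> by measurable
qed

lemma log_density_eq: "log_density r h T Z s \<omega> = jump_total h s \<omega> - (LINT w:{0..s}|lborel. excess_rate r h w (X w \<omega>))"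
  by (simp add: log_density_def jump_total_def)

text \<open>The condition \<open>\<kappa> \<le> 1\<close> replaces the factor exp(\<kappa> K) by exp
  K, so that one variable \<open>R\<close> serves for all tilts.\<close>

lemma abs_log_density_le:
  assumes h: "tilt S r h H" and le: "\<And>s x y. x \<in> space S \<Longrightarrow> y \<in> space S \<Longrightarrow> \<bar>h s x y\<bar> \<le> \<kappa> * \<bar>g s x y\<bar>"
    and \<kappa>: "0 \<le> \<kappa>" "\<kappa> \<le> 1" and \<omega>: "good \<omega>" and s: "s \<le> t"
  shows "\<bar>log_density r h T Z s \<omega>\<bar> \<le> \<kappa> * R \<omega>"
    "\<bar>LINT w:{0..s}|lborel. excess_rate r h w (X w \<omega>)\<bar> \<le> \<kappa> * exp K * A \<omega>"
proof -
  have "\<kappa> * exp (\<kappa> * K) \<le> \<kappa> * exp K"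
    using \<kappa> K_nonneg by (intro mult_left_mono) (auto simp: mult_left_le_one_le)
  then have b: "\<bar>excess_rate r h w (X w \<omega>)\<bar> \<le> \<kappa> * exp K * beta w (X w \<omega>)" for w
    using abs_excess_rate_le[OF h, of w "X w \<omega>" \<kappa>] le[OF jump_path_space[OF goodD[OF \<omega>]]] \<kappa>
      jump_path_space[OF goodD[OF \<omega>]] mult_right_mono[OF _ beta_nonneg[of w "X w \<omega>"]]
    by (meson order_trans)
  show 2: "\<bar>LINT w:{0..s}|lborel. excess_rate r h w (X w \<omega>)\<bar> \<le> \<kappa> * exp K * A \<omega>"
    by (rule set_integrable_bounded_beta(2)[OF \<omega> measurable_excess_path[OF h goodD[OF \<omega>]] b s])
  show "\<bar>log_density r h T Z s \<omega>\<bar> \<le> \<kappa> * R \<omega>"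
    unfolding log_density_eq R_def
    using abs_jump_total_le[OF \<omega> s le] 2 by (simp add: distrib_left mult.assoc)
qed

lemma lg_le: "\<bar>lg lam s x y\<bar> \<le> \<bar>lam\<bar> * \<bar>g s x y\<bar>" by (simp add: abs_mult)

text \<open>For the tilt 2\<theta>|g| the density has expectation at most 1 by
  \<open>supermartingale\<close>, and its logarithm equals 2\<theta> \<open>Gabs\<close> up to an
  error of at most 2\<theta> exp(K) \<open>A\<close>. So \<theta> \<open>R\<close> is at most the
  mean of this logarithm and of \<theta>0 \<open>A\<close>, hence at most their maximum, and the
  exponential of a maximum is at most the sum of the exponentials. The factor 2 thus takes the place
  of the Cauchy-Schwarz inequality.\<close>

lemma exponential_moment:
  obtains \<theta> where "0 < \<theta>" "\<theta> \<le> 1" "(\<integral>\<^sup>+\<omega>. ennreal (exp (\<theta> * R \<omega>)) \<partial>P) < \<top>"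
proof -
  obtain \<theta>0 where \<theta>0: "0 < \<theta>0" and fin: "(\<integral>\<^sup>+\<omega>. ennreal (exp (\<theta>0 * enn2real (\<integral>\<^sup>+s\<in>{0..t}. abs_contract r (g s) (X s \<omega>) \<partial>lborel))) \<partial>P) < \<top>"
    using cond_C by (auto simp: condition_C_def Let_def)
  \<comment> \<open>2\<theta> \<le> 1 is the condition on \<open>\<kappa>\<close> in the estimates.
    The 4 covers two contributions 2\<theta> exp(K) \<open>A\<close>: one from the drift of the
    density, one from the definition of \<open>R\<close>.\<close>
  define \<theta> where "\<theta> = min (1 / 2) (\<theta>0 / (4 * exp K))"
  have \<theta>: "0 < \<theta>" "2 * \<theta> \<le> 1" "4 * \<theta> * exp K \<le> \<theta>0"
    using \<theta>0 by (auto simp: \<theta>_def min_def field_simps)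
  let ?h = "\<lambda>s x y. (2 * \<theta>) * \<bar>g s x y\<bar>"
  have h: "tilt S r ?h (2 * \<theta> * K)" using \<theta> by (intro tilt_abs) simp
  interpret H: girsanov P S t r \<pi> T Z ?h "2 * \<theta> * K" by (rule girsanov_tilt[OF h])
  let ?L = "\<lambda>\<omega>. log_density r ?h T Z t \<omega>"
  have "(\<integral>\<^sup>+\<omega>. ennreal (exp (\<theta> * R \<omega>)) \<partial>P) \<le> (\<integral>\<^sup>+\<omega>. (if alive T t \<omega> then ennreal (exp (?L \<omega>)) else 0) +
      ennreal (exp (\<theta>0 * enn2real (\<integral>\<^sup>+s\<in>{0..t}. abs_contract r (g s) (X s \<omega>) \<partial>lborel))) \<partial>P)"
  proof (rule nn_integral_mono_AE)
    show "AE \<omega> in P. ennreal (exp (\<theta> * R \<omega>)) \<le> (if alive T t \<omega> then ennreal (exp (?L \<omega>)) else 0) +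
      ennreal (exp (\<theta>0 * enn2real (\<integral>\<^sup>+s\<in>{0..t}. abs_contract r (g s) (X s \<omega>) \<partial>lborel)))"
      using AE_good
    proof eventually_elim
      case (elim \<omega>)
      let ?I = "LINT w:{0..t}|lborel. excess_rate r ?h w (X w \<omega>)"
      obtain N where N: "\<forall>n\<ge>N. t < T (Suc n) \<omega>" using good_finite_jumps[OF elim] by blast
      have "?L \<omega> = 2 * \<theta> * Gabs \<omega> - ?I"
        unfolding log_density_eq jump_total_finite[where N = N and \<omega> = \<omega>, OF N order_refl] by (simp only: sum_distrib_left ac_simps)
      moreover have "?I \<le> 2 * \<theta> * exp K * A \<omega>"
        using abs_log_density_le(2)[OF h _ _ \<theta>(2) elim order_refl] \<theta> by (simp add: abs_mult)
      ultimately have "2 * \<theta> * R \<omega> \<le> ?L \<omega> + 4 * \<theta> * exp K * A \<omega>"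
        by (simp add: R_def algebra_simps)
      also have "4 * \<theta> * exp K * A \<omega> \<le> \<theta>0 * A \<omega>"
        using \<theta>(3) by (rule mult_right_mono) (rule A_nonneg)
      finally have le: "\<theta> * R \<omega> \<le> max (?L \<omega>) (\<theta>0 * A \<omega>)" by (auto simp: max_def)
      have "exp (\<theta> * R \<omega>) \<le> exp (max (?L \<omega>) (\<theta>0 * A \<omega>))" using le by simp
      also have "\<dots> \<le> exp (?L \<omega>) + exp (\<theta>0 * A \<omega>)" by (auto simp: max_def add_increasing add_increasing2)
      finally have "ennreal (exp (\<theta> * R \<omega>)) \<le> ennreal (exp (?L \<omega>)) + ennreal (exp (\<theta>0 * A \<omega>))"
        by (simp add: ennreal_plus[symmetric] del: ennreal_plus)
      then show ?case using elim by (simp add: good_A[OF elim] A_nonneg) (simp add: good_def)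
    qed
  qed
  also have "\<dots> = (\<integral>\<^sup>+\<omega>. (if alive T t \<omega> then ennreal (exp (?L \<omega>)) else 0) \<partial>P) +
      (\<integral>\<^sup>+\<omega>. ennreal (exp (\<theta>0 * enn2real (\<integral>\<^sup>+s\<in>{0..t}. abs_contract r (g s) (X s \<omega>) \<partial>lborel))) \<partial>P)"
  proof (rule nn_integral_add)
    show "(\<lambda>\<omega>. ennreal (exp (\<theta>0 * enn2real (\<integral>\<^sup>+s\<in>{0..t}. abs_contract r (g s) (X s \<omega>) \<partial>lborel)))) \<in> borel_measurable P"
      by measurable
    show "(\<lambda>\<omega>. if alive T t \<omega> then ennreal (exp (?L \<omega>)) else 0) \<in> borel_measurable P"
      using H.measurable_log_density[of "\<lambda>_. t" P "\<lambda>\<omega>. \<omega>"] by measurable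
  qed
  also have "\<dots> < \<top>"
    using H.supermartingale t_pos fin by (auto simp: less_top[symmetric] top_unique)
  finally show ?thesis using that[of \<theta>] \<theta> by simp
qed

text \<open>For \<open>|\<lambda>| \<le> l\<close> the variable \<open>W l\<close> dominates the densities \<open>D \<lambda> s\<close>, the quotients
  \<open>(D \<lambda> s - 1) / \<lambda>\<close> and, up to a factor \<open>2\<close>, their derivative at \<open>0\<close>, uniformly in \<open>s \<le> t\<close>.\<close>

definition W :: "real \<Rightarrow> 'w \<Rightarrow> real" where
  "W l \<omega> = (1 / l) * exp (2 * l * R \<omega>)"

lemma measurable_W [measurable]: "W l \<in> borel_measurable P"
  unfolding W_def by measurable

lemma W_nonneg: "0 < l \<Longrightarrow> 0 \<le> W l \<omega>" by (simp add: W_def)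

text \<open>The q-th power of \<open>W l\<close> is a constant times exp(2 l q \<open>R\<close>). A
  small \<open>l\<close> makes this integrable for the exponent q that belongs to
  \<open>p\<close>.\<close>

lemma Lp_bound_W:
  assumes p: "(1::ennreal) < p"
  obtains l C where "0 < l" "l \<le> 1" "C < \<top>" "(\<integral>\<^sup>+\<omega>. ennreal (W l \<omega>) \<partial>P) < \<top>"
    "\<And>f. f \<in> borel_measurable P \<Longrightarrow> (\<integral>\<^sup>+\<omega>. f \<omega> * ennreal (W l \<omega>) \<partial>P) \<le> Lp_norm P p f * C"
proof -
  obtain q :: real where q: "1 \<le> q"
    and hb: "\<And>(N :: 'w measure) f W. f \<in> borel_measurable N \<Longrightarrow> W \<in> borel_measurable N \<Longrightarrow> (\<And>x. 0 \<le> W x) \<Longrightarrow>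
      (\<integral>\<^sup>+x. f x * ennreal (W x) \<partial>N) \<le> Lp_norm N p f * (1 + (\<integral>\<^sup>+x. ennreal (W x powr q) \<partial>N))"
    by (rule nn_integral_Lp_bound[OF p]) blast
  obtain \<theta> where \<theta>: "0 < \<theta>" "\<theta> \<le> 1" and fin: "(\<integral>\<^sup>+\<omega>. ennreal (exp (\<theta> * R \<omega>)) \<partial>P) < \<top>"
    by (rule exponential_moment)
  \<comment> \<open>Chosen so that 2 l q = \<theta>.\<close>
  define l where "l = \<theta> / (2 * q)"
  have "\<theta> / (2 * q) \<le> \<theta> / 1" using \<theta> q by (intro divide_left_mono) auto
  then have l: "0 < l" "l \<le> 1" using \<theta> q by (auto simp: l_def)
  have fin2: "(\<integral>\<^sup>+\<omega>. ennreal (W l \<omega> powr q) \<partial>P) < \<top>"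
  proof -
    have "W l \<omega> powr q = (1 / l) powr q * exp (\<theta> * R \<omega>)" for \<omega>
    proof -
      have "W l \<omega> powr q = (1 / l) powr q * exp (2 * l * R \<omega>) powr q"
        unfolding W_def by (rule powr_mult)
      also have "exp (2 * l * R \<omega>) powr q = exp (\<theta> * R \<omega>)"
        using q by (simp add: powr_def l_def field_simps)
      finally show ?thesis .
    qed
    then have "(\<integral>\<^sup>+\<omega>. ennreal (W l \<omega> powr q) \<partial>P) = ennreal ((1 / l) powr q) * (\<integral>\<^sup>+\<omega>. ennreal (exp (\<theta> * R \<omega>)) \<partial>P)"
      by (simp add: ennreal_mult nn_integral_cmult)
    then show ?thesis using fin by (simp add: ennreal_mult_less_top)
  qed
  have "(\<integral>\<^sup>+\<omega>. ennreal (W l \<omega>) \<partial>P) \<le> (\<integral>\<^sup>+\<omega>. 1 + ennreal (W l \<omega> powr q) \<partial>P)"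
  proof (rule nn_integral_mono)
    fix \<omega>
    have "W l \<omega> \<le> 1 + W l \<omega> powr q"
    proof (cases "W l \<omega> \<le> 1")
      case False
      then have "W l \<omega> powr 1 \<le> W l \<omega> powr q" using q by (intro powr_mono) auto
      then show ?thesis using False by simp
    qed (simp add: add_increasing2)
    then have "ennreal (W l \<omega>) \<le> ennreal (1 + W l \<omega> powr q)" by (rule ennreal_leI)
    then show "ennreal (W l \<omega>) \<le> 1 + ennreal (W l \<omega> powr q)" by simp
  qed
  also have "\<dots> = 1 + (\<integral>\<^sup>+\<omega>. ennreal (W l \<omega> powr q) \<partial>P)"
    by (subst nn_integral_add) (auto simp: emeasure_space_1)
  also have "\<dots> < \<top>" using fin2 by simp
  finally have fin1: "(\<integral>\<^sup>+\<omega>. ennreal (W l \<omega>) \<partial>P) < \<top>" .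
  show ?thesis
  proof (rule that[OF l _ fin1])
    show "1 + (\<integral>\<^sup>+\<omega>. ennreal (W l \<omega> powr q) \<partial>P) < \<top>" using fin2 by simp
    show "(\<integral>\<^sup>+\<omega>. f \<omega> * ennreal (W l \<omega>) \<partial>P) \<le> Lp_norm P p f * (1 + (\<integral>\<^sup>+\<omega>. ennreal (W l \<omega> powr q) \<partial>P))"
      if "f \<in> borel_measurable P" for f
      using that l by (intro hb W_nonneg) auto
  qed
qed

definition D :: "real \<Rightarrow> real \<Rightarrow> 'w \<Rightarrow> real" where
  "D lam s \<omega> = exp (log_density r (lg lam) T Z s \<omega>)"

lemma measurable_D [measurable (raw)]:
  assumes [measurable]: "f \<in> borel_measurable N" "h \<in> measurable N P"
  shows "(\<lambda>w. D lam (f w) (h w)) \<in> borel_measurable N"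
proof -
  interpret H: girsanov P S t r \<pi> T Z "lg lam" "\<bar>lam\<bar> * K" by (rule girsanov_tilt[OF tilt_lg])
  show ?thesis unfolding D_def by measurable
qed

lemma R_nonneg: "good \<omega> \<Longrightarrow> 0 \<le> R \<omega>"
  by (simp add: R_def Gabs_nonneg A_nonneg)

text \<open>From l \<open>R\<close> \<le> exp(l \<open>R\<close>): a factor \<open>R\<close> costs a
  factor 1/l and one further exponential exp(l \<open>R\<close>). This explains both the 1/l and the
  2 in \<open>W\<close>.\<close>

lemma D_bounds:
  assumes l: "0 < l" "l \<le> 1" and \<omega>: "good \<omega>"
  shows "1 \<le> W l \<omega>" "Gabs \<omega> \<le> W l \<omega>" "A \<omega> \<le> W l \<omega>"
    "\<bar>lam\<bar> \<le> l \<Longrightarrow> s \<le> t \<Longrightarrow> D lam s \<omega> \<le> W l \<omega>"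
    "\<bar>lam\<bar> \<le> l \<Longrightarrow> s \<le> t \<Longrightarrow> \<bar>D lam s \<omega> - 1\<bar> \<le> \<bar>lam\<bar> * W l \<omega>"
proof -
  let ?R = "R \<omega>"
  have R: "0 \<le> ?R" by (rule R_nonneg[OF \<omega>])
  have il: "1 \<le> 1 / l" using l by simp
  have e: "l * ?R \<le> exp (l * ?R)" using exp_ge_add_one_self[of "l * ?R"] by linarith
  have e1: "1 \<le> exp (2 * l * ?R)" using R l by simp
  show "1 \<le> W l \<omega>" unfolding W_def using mult_mono[OF il e1] l by simp
  have "?R = (1 / l) * (l * ?R)" using l by simp
  also have "\<dots> \<le> (1 / l) * exp (2 * l * ?R)"
    using e R l by (intro mult_left_mono order_trans[OF e]) auto
  finally have RW: "?R \<le> W l \<omega>" by (simp add: W_def)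
  then show "Gabs \<omega> \<le> W l \<omega>" using mult_nonneg_nonneg[OF exp_ge_zero A_nonneg, of K \<omega>] by (simp add: R_def)
  have "1 * A \<omega> \<le> exp K * A \<omega>" using K_nonneg A_nonneg by (intro mult_right_mono) auto
  then show "A \<omega> \<le> W l \<omega>" using RW Gabs_nonneg[OF \<omega>] by (simp add: R_def)
  assume lam: "\<bar>lam\<bar> \<le> l" and s: "s \<le> t"
  let ?L = "log_density r (lg lam) T Z s \<omega>"
  have L: "\<bar>?L\<bar> \<le> \<bar>lam\<bar> * ?R"
    using lam l by (intro abs_log_density_le(1)[OF tilt_lg lg_le _ _ \<omega> s]) auto
  have L2: "\<bar>lam\<bar> * ?R \<le> l * ?R" using lam R by (rule mult_right_mono)
  have "D lam s \<omega> \<le> exp (2 * l * ?R)"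
    unfolding D_def using L L2 R l by (simp add: abs_le_iff)
  also have "\<dots> \<le> W l \<omega>" unfolding W_def using il mult_right_mono[OF il, of "exp (2 * l * ?R)"] by simp
  finally show "D lam s \<omega> \<le> W l \<omega>" .
  have "\<bar>D lam s \<omega> - 1\<bar> \<le> \<bar>?L\<bar> * exp \<bar>?L\<bar>" unfolding D_def by (rule abs_exp_minus_one_le)
  also have "\<dots> \<le> (\<bar>lam\<bar> * ?R) * exp (l * ?R)" using L L2 R by (intro mult_mono) auto
  also have "\<dots> = \<bar>lam\<bar> * ((1 / l) * (l * ?R) * exp (l * ?R))" using l by simp
  also have "\<dots> \<le> \<bar>lam\<bar> * ((1 / l) * exp (l * ?R) * exp (l * ?R))"
    using e l by (intro mult_left_mono mult_right_mono) auto
  also have "\<dots> = \<bar>lam\<bar> * W l \<omega>" by (simp add: W_def exp_add[symmetric] mult.assoc)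
  finally show "\<bar>D lam s \<omega> - 1\<bar> \<le> \<bar>lam\<bar> * W l \<omega>" .
qed

section \<open>Passage to the perturbed processes\<close>

text \<open>An explosion up to \<open>t\<close> implies \<open>T' lam (Suc n) \<le> t\<close> for
  every \<open>n\<close>. The probability of this event is an expectation of the density over
  \<open>T (Suc n) \<le> t\<close>, at most that of \<open>W l\<close>, and it tends to 0 by
  dominated convergence as \<open>P\<close> does not explode.\<close>

lemma AE_alive_perturbed:
  assumes l: "0 < l" "l \<le> 1" and W1: "(\<integral>\<^sup>+\<omega>. ennreal (W l \<omega>) \<partial>P) < \<top>" and lam: "\<bar>lam\<bar> \<le> l"
  shows "AE \<omega> in M lam. alive (T' lam) t \<omega>"
proof -
  interpret H: girsanov P S t r \<pi> T Z "lg lam" "\<bar>lam\<bar> * K" by (rule girsanov_tilt[OF tilt_lg])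
  interpret M: tilted_jump "M lam" S t r "lg lam" "\<bar>lam\<bar> * K" \<pi> "T' lam" "Z' lam" by (rule perturbed_tilted)
  let ?N = "{\<omega> \<in> space (M lam). \<not> alive (T' lam) t \<omega>}"
  have Nm: "?N \<in> sets (M lam)" by measurable
  have le: "emeasure (M lam) ?N \<le> (\<integral>\<^sup>+\<omega>. indicator {..t} (T (Suc n) \<omega>) * ennreal (W l \<omega>) \<partial>P)" for n
  proof -
    have "emeasure (M lam) ?N = (\<integral>\<^sup>+\<omega>. indicator ?N \<omega> \<partial>M lam)" using Nm by simp
    also have "\<dots> \<le> (\<integral>\<^sup>+\<omega>. indicator {..t} (T' lam (Suc n) \<omega>) * (\<lambda>_. 1) (T' lam (Suc n) \<omega>, Z' lam (Suc n) \<omega>) \<partial>M lam)"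
      by (intro nn_integral_mono) (auto simp: alive_def not_less split: split_indicator)
    also have "\<dots> = (\<integral>\<^sup>+\<omega>. indicator {..t} (T (Suc n) \<omega>) * (H.dens (Suc n) \<omega> * (\<lambda>_. 1) (T (Suc n) \<omega>, Z (Suc n) \<omega>)) \<partial>P)"
      by (rule H.girsanov_chain[OF perturbed_tilted]) auto
    also have "\<dots> \<le> (\<integral>\<^sup>+\<omega>. indicator {..t} (T (Suc n) \<omega>) * ennreal (W l \<omega>) \<partial>P)"
    proof (rule nn_integral_mono_AE)
      show "AE \<omega> in P. indicator {..t} (T (Suc n) \<omega>) * (H.dens (Suc n) \<omega> * 1) \<le> indicator {..t} (T (Suc n) \<omega>) * ennreal (W l \<omega>)"
        using AE_good
      proof eventually_elim
        case (elim \<omega>)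
        show ?case
        proof (cases "T (Suc n) \<omega> \<le> t")
          case True
          \<comment> \<open>At the jump time itself the new holding interval has length 0, so the
            density of the chain is the path density at that time.\<close>
          have "H.drift (Z (Suc n) \<omega>) (T (Suc n) \<omega>) (T (Suc n) \<omega>) = 1"
          proof -
            have "(LINT w:{a..a}|lborel. f w) = 0" for a :: real and f :: "real \<Rightarrow> real"
              unfolding set_lebesgue_integral_def
              by (rule integral_eq_zero_AE) (rule AE_mp[OF AE_lborel_singleton[of a]], auto)
            then show ?thesis by (simp add: H.drift_def)
          qed
          then have "H.dens (Suc n) \<omega> = ennreal (D lam (T (Suc n) \<omega>) \<omega>)"
            using H.exp_log_density[OF goodD[OF elim] order_refl T_Suc[OF goodD[OF elim]], of "Suc n"]
            by (simp add: D_def)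
          then show ?thesis
            using D_bounds(4)[OF l elim lam True] True by (simp add: ennreal_leI)
        qed simp
      qed
    qed
    finally show ?thesis .
  qed
  have "(\<lambda>n. \<integral>\<^sup>+\<omega>. indicator {..t} (T (Suc n) \<omega>) * ennreal (W l \<omega>) \<partial>P) \<longlonglongrightarrow> (\<integral>\<^sup>+\<omega>. 0 \<partial>P)"
  proof (rule nn_integral_dominated_convergence[where w = "\<lambda>\<omega>. ennreal (W l \<omega>)"])
    show "AE \<omega> in P. indicator {..t} (T (Suc n) \<omega>) * ennreal (W l \<omega>) \<le> ennreal (W l \<omega>)" for n
      by (auto split: split_indicator)
    show "AE \<omega> in P. (\<lambda>n. indicator {..t} (T (Suc n) \<omega>) * ennreal (W l \<omega>)) \<longlonglongrightarrow> 0"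
      using AE_good
    proof eventually_elim
      case (elim \<omega>)
      obtain N where N: "\<forall>n\<ge>N. t < T (Suc n) \<omega>" using good_finite_jumps[OF elim] by blast
      have "\<forall>\<^sub>F n in sequentially. 0 = indicator {..t} (T (Suc n) \<omega>) * ennreal (W l \<omega>)"
        unfolding eventually_sequentially by (rule exI[of _ N]) (use N in auto)
      then show ?case by (rule Lim_transform_eventually[OF tendsto_const])
    qed
  qed (use W1 in auto)
  then have "emeasure (M lam) ?N \<le> 0"
    using le by (intro LIMSEQ_le_const[of _ 0]) auto
  then show ?thesis
    using Nm by (intro AE_I[of _ _ ?N]) auto
qed

text \<open>\<open>girsanov_path\<close> without the cut-off: both processes are almost surely alive
  up to \<open>t\<close>.\<close>

lemma measure_change:
  assumes l: "0 < l" "l \<le> 1" and W1: "(\<integral>\<^sup>+\<omega>. ennreal (W l \<omega>) \<partial>P) < \<top>" and lam: "\<bar>lam\<bar> \<le> l"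
    and f: "f \<in> borel_measurable S" and s: "s \<in> {0..t}"
  shows "(\<integral>\<^sup>+\<omega>. f (X' lam s \<omega>) \<partial>M lam) = (\<integral>\<^sup>+\<omega>. f (X s \<omega>) * ennreal (D lam s \<omega>) \<partial>P)"
proof -
  interpret H: girsanov P S t r \<pi> T Z "lg lam" "\<bar>lam\<bar> * K" by (rule girsanov_tilt[OF tilt_lg])
  have "(\<integral>\<^sup>+\<omega>. f (X' lam s \<omega>) \<partial>M lam) = (\<integral>\<^sup>+\<omega>. (if alive (T' lam) s \<omega> then f (X' lam s \<omega>) else 0) \<partial>M lam)"
  proof (rule nn_integral_cong_AE)
    show "AE \<omega> in M lam. f (X' lam s \<omega>) = (if alive (T' lam) s \<omega> then f (X' lam s \<omega>) else 0)"
      using AE_alive_perturbed[OF l W1 lam]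
    proof eventually_elim
      case (elim \<omega>)
      then obtain n where "t < T' lam (Suc n) \<omega>" by (auto simp: alive_def)
      then have "alive (T' lam) s \<omega>" using s unfolding alive_def by (intro exI[of _ n]) auto
      then show ?case by simp
    qed
  qed
  also have "\<dots> = (\<integral>\<^sup>+\<omega>. (if alive T s \<omega> then f (X s \<omega>) * ennreal (exp (log_density r (lg lam) T Z s \<omega>)) else 0) \<partial>P)"
    by (rule H.girsanov_path[OF perturbed_tilted f s])
  also have "\<dots> = (\<integral>\<^sup>+\<omega>. f (X s \<omega>) * ennreal (D lam s \<omega>) \<partial>P)"
    by (rule nn_integral_cong_AE) (use AE_alive in eventually_elim, simp add: D_def)
  finally show ?thesis .
qed

end

section \<open>The derivative of the density\<close>

lemma measurable_ident_restrict_lborel [measurable]: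
  "(\<lambda>s. s) \<in> borel_measurable (restrict_space lborel \<Omega>)"
  by (rule measurable_restrict_space1) simp

context response
begin

definition Mart :: "real \<Rightarrow> 'w \<Rightarrow> real" where
  "Mart s \<omega> = jump_total g s \<omega> - (LINT u:{0..s}|lborel. contract r (g u) (X u \<omega>))"

lemma measurable_Mart [measurable (raw)]:
  assumes [measurable]: "f \<in> borel_measurable N" "h \<in> measurable N P"
  shows "(\<lambda>w. Mart (f w) (h w)) \<in> borel_measurable N"
  unfolding Mart_def set_lebesgue_integral_def by measurable

lemma abs_contract_g_le: "x \<in> space S \<Longrightarrow> \<bar>contract r (g s) x\<bar> \<le> beta s x"
  unfolding contract_def beta_def by (rule integral_abs_bound)

lemma measurable_drift_path: "\<omega> \<in> space P \<Longrightarrow> (\<lambda>u. contract r (g u) (X u \<omega>)) \<in> borel_measurable borel"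
  by measurable

lemma measurable_beta_path: "\<omega> \<in> space P \<Longrightarrow> (\<lambda>s. beta s (X s \<omega>)) \<in> borel_measurable borel"
  by measurable

lemma drift_integral:
  assumes \<omega>: "good \<omega>" and s: "s \<le> t"
  shows "set_integrable lborel {0..s} (\<lambda>u. contract r (g u) (X u \<omega>))"
    "\<bar>LINT u:{0..s}|lborel. contract r (g u) (X u \<omega>)\<bar> \<le> A \<omega>"
  using set_integrable_bounded_beta[OF \<omega> measurable_drift_path[OF goodD[OF \<omega>]], of 1 s]
    abs_contract_g_le[OF jump_path_space[OF goodD[OF \<omega>]]] s by auto

lemma abs_Mart_le: 
  assumes \<omega>: "good \<omega>" and s: "s \<le> t"
  shows "\<bar>Mart s \<omega>\<bar> \<le> Gabs \<omega> + A \<omega>"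
  using drift_integral(2)[OF \<omega> s] abs_jump_total_le[OF \<omega> s, of g 1] unfolding Mart_def by auto

lemma abs_exp_diff_le:
  assumes l: "\<bar>lam\<bar> \<le> 1" and y: "\<bar>y\<bar> \<le> K"
  shows "\<bar>exp (lam * y) - 1\<bar> \<le> \<bar>lam\<bar> * (exp K * \<bar>y\<bar>)"
proof -
  have "\<bar>lam * y\<bar> \<le> 1 * K" unfolding abs_mult using l y by (intro mult_mono) auto
  then have "\<bar>lam * y\<bar> * exp \<bar>lam * y\<bar> \<le> \<bar>lam * y\<bar> * exp K" by (intro mult_left_mono) auto
  with abs_exp_minus_one_le[of "lam * y"] show ?thesis by (simp add: abs_mult ac_simps)
qed

lemma excess_rate_deriv:
  assumes x: "x \<in> space S"
  shows "((\<lambda>lam. excess_rate r (lg lam) s x) has_real_derivative contract r (g s) x) (at 0)"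
proof -
  have gm: "g s x \<in> borel_measurable (r x)" by (rule g.measurable_tilt_r[OF x])
  have "((\<lambda>lam. \<integral>y. exp (lam * g s x y) \<partial>r x) has_real_derivative (\<integral>y. g s x y \<partial>r x)) (at 0)"
  proof (rule has_derivative_integral_dominated(3)[OF zero_less_one])
    show "integrable (r x) (\<lambda>y. exp (0 * g s x y))"
      using finite_measure.integrable_const[OF finite_measure_r[OF x], of "1::real"] by simp
    show "integrable (r x) (\<lambda>y. exp K * \<bar>g s x y\<bar>)" using integrable_g[OF x] by simp
    show "AE y in r x. \<bar>exp (lam * g s x y) - exp (0 * g s x y)\<bar> \<le> \<bar>lam\<bar> * (exp K * \<bar>g s x y\<bar>)" if "\<bar>lam\<bar> \<le> 1" for lam
      using abs_exp_diff_le[OF that g.tilt_bound[OF x]] x by (intro AE_I2) simp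
    show "AE y in r x. ((\<lambda>lam. exp (lam * g s x y)) has_real_derivative g s x y) (at 0)"
      by (intro AE_I2) (auto intro!: derivative_eq_intros)
  qed (use gm in measurable)
  then have "((\<lambda>lam. (\<integral>y. exp (lam * g s x y) \<partial>r x) - rate r (\<lambda>_ _ _. 0) s x) has_real_derivative (\<integral>y. g s x y \<partial>r x) - 0) (at 0)"
    by (intro DERIV_diff DERIV_const)
  then show ?thesis by (simp add: excess_rate_def rate_def contract_def)
qed

lemma excess_rate_0: "excess_rate r (lg 0) s x = 0"
  by (simp add: excess_rate_def)

lemma D_0: "D 0 s \<omega> = 1"
  by (simp add: D_def log_density_eq jump_total_def excess_rate_def set_lebesgue_integral_def)

text \<open>On a good path the jump part of the logarithm is a finite sum and hence linear in
  lambda. The drift part is differentiated under the time integral, dominated by a multiple of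
  \<open>beta\<close> along the path.\<close>

lemma D_deriv:
  assumes \<omega>: "good \<omega>" and s: "s \<le> t"
  shows "((\<lambda>lam. D lam s \<omega>) has_real_derivative Mart s \<omega>) (at 0)"
proof -
  note \<omega>P = goodD[OF \<omega>]
  obtain N where N: "\<forall>n\<ge>N. t < T (Suc n) \<omega>" using good_finite_jumps[OF \<omega>] by blast
  have jt: "jump_total (lg lam) s \<omega> = lam * jump_total g s \<omega>" for lam
    unfolding jump_total_finite[where N = N and \<omega> = \<omega>, OF N s] by (simp only: sum_distrib_left ac_simps)
  have iA: "integrable lborel (\<lambda>w. indicator {0..t} w * (exp K * beta w (X w \<omega>)))"
    using \<omega> integrable_mult_right[of "exp K" lborel "\<lambda>w. indicator {0..t} w * beta w (X w \<omega>)"]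
    by (simp add: good_def set_integrable_def mult.left_commute)
  have ex: "(\<lambda>w. excess_rate r (lg lam) w (X w \<omega>)) \<in> borel_measurable lborel" for lam
    using measurable_excess_path[OF tilt_lg \<omega>P, of lam] by simp
  have "((\<lambda>lam. \<integral>w. indicator {0..s} w * excess_rate r (lg lam) w (X w \<omega>) \<partial>lborel) has_real_derivative
      (\<integral>w. indicator {0..s} w * contract r (g w) (X w \<omega>) \<partial>lborel)) (at 0)"
  proof (rule has_derivative_integral_dominated(3)[OF zero_less_one])
    show "(\<lambda>w. indicator {0..s} w * excess_rate r (lg lam) w (X w \<omega>)) \<in> borel_measurable lborel" for lam
      by (intro borel_measurable_times borel_measurable_indicator ex) simp
    show "integrable lborel (\<lambda>w. indicator {0..s} w * excess_rate r (lg 0) w (X w \<omega>))"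
      by (simp only: excess_rate_0 mult_zero_right integrable_zero)
    show "AE w in lborel. \<bar>indicator {0..s} w * excess_rate r (lg lam) w (X w \<omega>) - indicator {0..s} w * excess_rate r (lg 0) w (X w \<omega>)\<bar>
        \<le> \<bar>lam\<bar> * (indicator {0..t} w * (exp K * beta w (X w \<omega>)))" if lam: "\<bar>lam\<bar> \<le> 1" for lam
    proof (rule AE_I2)
      fix w
      have x: "X w \<omega> \<in> space S" by (rule jump_path_space[OF \<omega>P])
      have "\<bar>excess_rate r (lg lam) w (X w \<omega>)\<bar> \<le> \<bar>lam\<bar> * exp (\<bar>lam\<bar> * K) * beta w (X w \<omega>)"
        by (rule abs_excess_rate_le[OF tilt_lg lg_le x]) simp
      also have "\<dots> \<le> \<bar>lam\<bar> * exp K * beta w (X w \<omega>)"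
        using lam K_nonneg beta_nonneg mult_right_mono[OF lam K_nonneg] by (intro mult_right_mono mult_left_mono) auto
      finally have "\<bar>excess_rate r (lg lam) w (X w \<omega>)\<bar> \<le> \<bar>lam\<bar> * (exp K * beta w (X w \<omega>))" by (simp only: mult.assoc)
      moreover have "0 \<le> \<bar>lam\<bar> * (exp K * beta w (X w \<omega>))" using beta_nonneg by simp
      ultimately show "\<bar>indicator {0..s} w * excess_rate r (lg lam) w (X w \<omega>) - indicator {0..s} w * excess_rate r (lg 0) w (X w \<omega>)\<bar>
        \<le> \<bar>lam\<bar> * (indicator {0..t} w * (exp K * beta w (X w \<omega>)))"
        unfolding excess_rate_0 using s by (auto simp: indicator_def)
    qed
    show "AE w in lborel. ((\<lambda>lam. indicator {0..s} w * excess_rate r (lg lam) w (X w \<omega>)) has_real_derivative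
        indicator {0..s} w * contract r (g w) (X w \<omega>)) (at 0)"
      by (intro AE_I2 DERIV_cmult excess_rate_deriv jump_path_space \<omega>P)
    show "(\<lambda>w. indicator {0..s} w * contract r (g w) (X w \<omega>)) \<in> borel_measurable lborel"
      using measurable_drift_path[OF \<omega>P] by (intro borel_measurable_times borel_measurable_indicator) simp_all
  qed (rule iA)
  then have "((\<lambda>lam. lam * jump_total g s \<omega> - (\<integral>w. indicator {0..s} w * excess_rate r (lg lam) w (X w \<omega>) \<partial>lborel)) has_real_derivative
      1 * jump_total g s \<omega> - (\<integral>w. indicator {0..s} w * contract r (g w) (X w \<omega>) \<partial>lborel)) (at 0)"
    by (intro DERIV_diff DERIV_cmult_right DERIV_ident)
  then have "((\<lambda>lam. log_density r (lg lam) T Z s \<omega>) has_real_derivative Mart s \<omega>) (at 0)"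
    by (simp add: log_density_eq jt Mart_def set_lebesgue_integral_def)
  from DERIV_fun_exp[OF this] show ?thesis
    using D_0[of s \<omega>] by (simp add: D_def)
qed

section \<open>Compensation by the reversed kernel\<close>

definition star :: "(real \<Rightarrow> 'a \<Rightarrow> 'a \<Rightarrow> real) \<Rightarrow> real \<Rightarrow> 'a \<Rightarrow> real" where
  "star h s x = contract rstar (\<lambda>x y. h s y x) x"

lemma integrable_star:
  assumes h: "tilt S r h H" and x: "x \<in> space S"
  shows "integrable (rstar x) (\<lambda>y. h s y x)"
proof -
  interpret h: tilt S r h H by (rule h)
  have "(\<lambda>y. h s y x) \<in> borel_measurable S" using x by measurable
  then show ?thesis
    using x h.tilt_bound by (intro finite_measure.integrable_const_bound[OF rev.finite_measure_r, where B = H] rev.measurable_r AE_I2) auto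
qed

lemma measurable_star:
  assumes h: "tilt S r h H" and [measurable]: "f \<in> borel_measurable N" "k \<in> measurable N S"
  shows "(\<lambda>w. star h (f w) (k w)) \<in> borel_measurable N"
proof -
  interpret h: tilt S r h H by (rule h)
  show ?thesis unfolding star_def by measurable
qed

text \<open>Almost every path has finitely many jumps up to \<open>t\<close>, so the sum in
  \<open>jump_total\<close> may be taken out of the expectation term by term, which gives the series
  of \<open>reversed_levy_system\<close>.\<close>

lemma reversed_jump_total:
  assumes h: "tilt S r h H" and h0: "\<And>s x y. 0 \<le> h s x y" and v: "v \<in> borel_measurable S" and u: "u \<in> {0..t}"
  shows "(\<integral>\<^sup>+\<omega>. ennreal (jump_total h u \<omega>) * v (X u \<omega>) \<partial>P) =
    (\<integral>\<^sup>+s. indicator {0..u} s * (\<integral>\<^sup>+\<omega>. ennreal (star h s (X s \<omega>)) * v (X u \<omega>) \<partial>P) \<partial>lborel)"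
proof -
  note [measurable] = v
  interpret h: tilt S r h H by (rule h)
  have "(\<integral>\<^sup>+\<omega>. ennreal (jump_total h u \<omega>) * v (X u \<omega>) \<partial>P) =
      (\<integral>\<^sup>+\<omega>. (\<Sum>n. indicator {..u} (T (Suc n) \<omega>) * (\<lambda>(s, x, y). ennreal (h s x y)) (T (Suc n) \<omega>, Z n \<omega>, Z (Suc n) \<omega>) * v (X u \<omega>)) \<partial>P)"
  proof (rule nn_integral_cong_AE)
    show "AE \<omega> in P. ennreal (jump_total h u \<omega>) * v (X u \<omega>) =
      (\<Sum>n. indicator {..u} (T (Suc n) \<omega>) * (\<lambda>(s, x, y). ennreal (h s x y)) (T (Suc n) \<omega>, Z n \<omega>, Z (Suc n) \<omega>) * v (X u \<omega>))"
      using AE_good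
    proof eventually_elim
      case (elim \<omega>)
      obtain N where N: "\<forall>n\<ge>N. t < T (Suc n) \<omega>" using good_finite_jumps[OF elim] by blast
      have ut: "u \<le> t" using u by simp
      have "(\<Sum>n. indicator {..u} (T (Suc n) \<omega>) * ennreal (h (T (Suc n) \<omega>) (Z n \<omega>) (Z (Suc n) \<omega>)) * v (X u \<omega>)) =
          (\<Sum>n<N. indicator {..u} (T (Suc n) \<omega>) * ennreal (h (T (Suc n) \<omega>) (Z n \<omega>) (Z (Suc n) \<omega>)) * v (X u \<omega>))"
      proof (rule suminf_finite)
        fix n assume "n \<notin> {..<N}"
        then have "N \<le> n" by simp
        with N have "t < T (Suc n) \<omega>" by blast
        then have "u < T (Suc n) \<omega>" using ut by linarith
        then show "indicator {..u} (T (Suc n) \<omega>) * ennreal (h (T (Suc n) \<omega>) (Z n \<omega>) (Z (Suc n) \<omega>)) * v (X u \<omega>) = 0" by simp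
      qed simp
      also have "\<dots> = (\<Sum>n<N. ennreal (indicator {..u} (T (Suc n) \<omega>) * h (T (Suc n) \<omega>) (Z n \<omega>) (Z (Suc n) \<omega>))) * v (X u \<omega>)"
        unfolding sum_distrib_right by (intro sum.cong) (auto simp: indicator_def)
      also have "\<dots> = ennreal (jump_total h u \<omega>) * v (X u \<omega>)"
        unfolding jump_total_finite[where N = N and \<omega> = \<omega>, OF N ut] by (subst sum_ennreal) (auto simp: h0)
      finally show ?case by simp
    qed
  qed
  also have "\<dots> = (\<Sum>n. \<integral>\<^sup>+\<omega>. indicator {..u} (T (Suc n) \<omega>) * (\<lambda>(s, x, y). ennreal (h s x y)) (T (Suc n) \<omega>, Z n \<omega>, Z (Suc n) \<omega>) * v (X u \<omega>) \<partial>P)"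
    by (rule nn_integral_suminf) measurable
  also have "\<dots> = (\<integral>\<^sup>+s. indicator {0..u} s * (\<integral>\<^sup>+\<omega>. (\<integral>\<^sup>+x. (\<lambda>(s, x, y). ennreal (h s x y)) (s, x, X s \<omega>) \<partial>rstar (X s \<omega>)) * v (X u \<omega>) \<partial>P) \<partial>lborel)"
    by (rule reversed_levy_system[OF _ v u]) measurable
  also have "\<dots> = (\<integral>\<^sup>+s. indicator {0..u} s * (\<integral>\<^sup>+\<omega>. ennreal (star h s (X s \<omega>)) * v (X u \<omega>) \<partial>P) \<partial>lborel)"
  proof -
    have "(\<integral>\<^sup>+x. ennreal (h s x (X s \<omega>)) \<partial>rstar (X s \<omega>)) = ennreal (star h s (X s \<omega>))" if "\<omega> \<in> space P" for s \<omega>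
      unfolding star_def contract_def
      by (rule nn_integral_eq_integral) (auto intro!: integrable_star[OF h] jump_path_space that h0)
    then show ?thesis by (auto intro!: nn_integral_cong arg_cong2[where f = "(*)"])
  qed
  finally show ?thesis .
qed

abbreviation "L u \<equiv> restrict_space lborel {0..u::real}"

lemma finite_measure_L: "finite_measure (L u)"
  by (rule finite_measureI) (simp add: emeasure_restrict_space space_restrict_space emeasure_lborel_Icc_eq)

lemma pair_L_P: "pair_sigma_finite (L u) P"
proof -
  interpret L: finite_measure "L u" by (rule finite_measure_L)
  show ?thesis by unfold_locales
qed

lemma nn_integral_L: "(\<integral>\<^sup>+s. f s \<partial>L u) = (\<integral>\<^sup>+s. indicator {0..u} s * f s \<partial>lborel)"
  by (simp add: nn_integral_restrict_space mult.commute)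

lemma measurable_fst_L [measurable]: "fst \<in> borel_measurable (L u \<Otimes>\<^sub>M N)"
  by (rule measurable_compose[OF measurable_fst measurable_ident_restrict_lborel])

lemma nn_integral_L_P:
  assumes "f \<in> borel_measurable (L u \<Otimes>\<^sub>M P)"
  shows "(\<integral>\<^sup>+z. f z \<partial>(L u \<Otimes>\<^sub>M P)) = (\<integral>\<^sup>+s. indicator {0..u} s * (\<integral>\<^sup>+\<omega>. f (s, \<omega>) \<partial>P) \<partial>lborel)"
  using nn_integral_fst[OF assms] by (simp add: nn_integral_L)

lemma L_integral: "(\<integral>s. f s \<partial>L u) = (LINT s:{0..u}|lborel. f s)" for f :: "real \<Rightarrow> real"
  by (simp add: integral_restrict_space set_lebesgue_integral_def)

lemma AE_space_L: "AE s in L u. s \<in> {0..u}"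
  by (rule AE_I2) (simp add: space_restrict_space)

text \<open>The compensation identity, with integrability of both sides included through a common
  value. In this form it passes to differences, in \<open>v\<close> as well as in
  \<open>h\<close>.\<close>

definition rev_eq :: "real \<Rightarrow> ('a \<Rightarrow> real) \<Rightarrow> (real \<Rightarrow> 'a \<Rightarrow> 'a \<Rightarrow> real) \<Rightarrow> bool" where
  "rev_eq u v h \<longleftrightarrow> (\<exists>c. has_bochner_integral P (\<lambda>\<omega>. v (X u \<omega>) * jump_total h u \<omega>) c \<and>
     has_bochner_integral (L u \<Otimes>\<^sub>M P) (\<lambda>(s, \<omega>). v (X u \<omega>) * star h s (X s \<omega>)) c)"

lemma measurable_jump_total:
  assumes "tilt S r h H" shows "jump_total h u \<in> borel_measurable P"
proof -
  interpret h: tilt S r h H by (rule assms)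
  show ?thesis unfolding jump_total_def by measurable
qed

text \<open>For nonnegative data this is \<open>reversed_jump_total\<close>; the common value is
  finite since the sum over the jumps is at most \<open>Gabs\<close>, hence at most
  \<open>W l\<close>.\<close>

lemma rev_eq_nonneg:
  assumes h: "tilt S r h H" and h0: "\<And>s x y. 0 \<le> h s x y" and hg: "\<And>s x y. x \<in> space S \<Longrightarrow> y \<in> space S \<Longrightarrow> \<bar>h s x y\<bar> \<le> \<bar>g s x y\<bar>"
    and v: "v \<in> borel_measurable S" and v0: "\<And>x. 0 \<le> v x" and u: "u \<in> {0..t}"
    and l: "0 < l" "l \<le> 1" and fin: "(\<integral>\<^sup>+\<omega>. ennreal (\<bar>v (X u \<omega>)\<bar> * W l \<omega>) \<partial>P) < \<top>"
  shows "rev_eq u v h"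
proof -
  note [measurable] = v measurable_jump_total[OF h]
  note [measurable (raw)] = measurable_star[OF h]
  interpret LP: pair_sigma_finite "L u" P by (rule pair_L_P)
  have jt0: "AE \<omega> in P. 0 \<le> jump_total h u \<omega>" and jtW: "AE \<omega> in P. jump_total h u \<omega> \<le> W l \<omega>"
  proof -
    show "AE \<omega> in P. 0 \<le> jump_total h u \<omega>"
      using AE_good
    proof eventually_elim
      case (elim \<omega>)
      obtain N where N: "\<forall>n\<ge>N. t < T (Suc n) \<omega>" using good_finite_jumps[OF elim] by blast
      show ?case using u unfolding jump_total_finite[where N = N and \<omega> = \<omega>, OF N, of u h]
        by (subst jump_total_finite[where N = N and \<omega> = \<omega>, OF N]) (auto intro!: sum_nonneg simp: h0)
    qed
    show "AE \<omega> in P. jump_total h u \<omega> \<le> W l \<omega>"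
      using AE_good
    proof eventually_elim
      case (elim \<omega>)
      show ?case
        using abs_jump_total_le[OF elim, of u h 1] u hg D_bounds(2)[OF l elim] by (auto simp: abs_le_iff)
    qed
  qed
  define c where "c = enn2real (\<integral>\<^sup>+\<omega>. ennreal (v (X u \<omega>) * jump_total h u \<omega>) \<partial>P)"
  have "(\<integral>\<^sup>+\<omega>. ennreal (v (X u \<omega>) * jump_total h u \<omega>) \<partial>P) \<le> (\<integral>\<^sup>+\<omega>. ennreal (\<bar>v (X u \<omega>)\<bar> * W l \<omega>) \<partial>P)"
    using jtW by (intro nn_integral_mono_AE) (auto elim!: eventually_mono intro!: ennreal_leI mult_left_mono simp: v0)
  then have "(\<integral>\<^sup>+\<omega>. ennreal (v (X u \<omega>) * jump_total h u \<omega>) \<partial>P) < \<top>" using fin by (rule order_le_less_trans)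
  then have c: "(\<integral>\<^sup>+\<omega>. ennreal (v (X u \<omega>) * jump_total h u \<omega>) \<partial>P) = ennreal c" "0 \<le> c"
    by (auto simp: c_def)
  have 1: "has_bochner_integral P (\<lambda>\<omega>. v (X u \<omega>) * jump_total h u \<omega>) c"
    using jt0 c v0 by (intro has_bochner_integral_nn_integral) (auto elim!: eventually_mono)
  have star0: "0 \<le> star h s x" for s x
    unfolding star_def contract_def by (rule integral_nonneg_AE) (simp add: h0)
  have "(\<integral>\<^sup>+z. ennreal (case z of (s, \<omega>) \<Rightarrow> v (X u \<omega>) * star h s (X s \<omega>)) \<partial>(L u \<Otimes>\<^sub>M P)) =
      (\<integral>\<^sup>+s. indicator {0..u} s * (\<integral>\<^sup>+\<omega>. ennreal (v (X u \<omega>) * star h s (X s \<omega>)) \<partial>P) \<partial>lborel)"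
    by (subst nn_integral_L_P) auto
  also have "\<dots> = (\<integral>\<^sup>+s. indicator {0..u} s * (\<integral>\<^sup>+\<omega>. ennreal (star h s (X s \<omega>)) * ennreal (v (X u \<omega>)) \<partial>P) \<partial>lborel)"
    by (intro nn_integral_cong arg_cong2[where f = "(*)"] refl) (simp add: ennreal_mult' v0 star0 ennreal_mult mult.commute)
  also have "\<dots> = (\<integral>\<^sup>+\<omega>. ennreal (jump_total h u \<omega>) * ennreal (v (X u \<omega>)) \<partial>P)"
    by (rule reversed_jump_total[OF h h0 _ u, symmetric]) measurable
  also have "\<dots> = (\<integral>\<^sup>+\<omega>. ennreal (v (X u \<omega>) * jump_total h u \<omega>) \<partial>P)"
    using jt0 by (intro nn_integral_cong_AE) (auto elim!: eventually_mono simp: ennreal_mult[symmetric] v0 mult.commute)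
  also have "\<dots> = ennreal c" by (rule c)
  finally have "has_bochner_integral (L u \<Otimes>\<^sub>M P) (\<lambda>(s, \<omega>). v (X u \<omega>) * star h s (X s \<omega>)) c"
    using c v0 star0 by (intro has_bochner_integral_nn_integral) (auto intro!: AE_I2)
  with 1 show ?thesis unfolding rev_eq_def by blast
qed

lemma rev_eq_diff_v:
  assumes "rev_eq u v1 h" "rev_eq u v2 h" shows "rev_eq u (\<lambda>x. v1 x - v2 x) h"
proof -
  obtain c1 c2 where c: "has_bochner_integral P (\<lambda>\<omega>. v1 (X u \<omega>) * jump_total h u \<omega>) c1"
    "has_bochner_integral (L u \<Otimes>\<^sub>M P) (\<lambda>(s, \<omega>). v1 (X u \<omega>) * star h s (X s \<omega>)) c1"
    "has_bochner_integral P (\<lambda>\<omega>. v2 (X u \<omega>) * jump_total h u \<omega>) c2"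
    "has_bochner_integral (L u \<Otimes>\<^sub>M P) (\<lambda>(s, \<omega>). v2 (X u \<omega>) * star h s (X s \<omega>)) c2"
    using assms unfolding rev_eq_def by blast
  show ?thesis unfolding rev_eq_def
    using has_bochner_integral_diff[OF c(1,3)] has_bochner_integral_diff[OF c(2,4)]
    by (intro exI[of _ "c1 - c2"]) (simp add: left_diff_distrib case_prod_unfold)
qed

lemma rev_eq_diff_h:
  assumes e: "rev_eq u v h1" "rev_eq u v h2" and u: "u \<in> {0..t}" and h: "tilt S r h1 H1" "tilt S r h2 H2"
    and v: "v \<in> borel_measurable S"
  shows "rev_eq u v (\<lambda>s x y. h1 s x y - h2 s x y)"
proof -
  obtain c1 c2 where c: "has_bochner_integral P (\<lambda>\<omega>. v (X u \<omega>) * jump_total h1 u \<omega>) c1"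
    "has_bochner_integral (L u \<Otimes>\<^sub>M P) (\<lambda>(s, \<omega>). v (X u \<omega>) * star h1 s (X s \<omega>)) c1"
    "has_bochner_integral P (\<lambda>\<omega>. v (X u \<omega>) * jump_total h2 u \<omega>) c2"
    "has_bochner_integral (L u \<Otimes>\<^sub>M P) (\<lambda>(s, \<omega>). v (X u \<omega>) * star h2 s (X s \<omega>)) c2"
    using e unfolding rev_eq_def by blast
  note [measurable] = v measurable_jump_total[OF h(1)] measurable_jump_total[OF h(2)]
  have m: "(\<lambda>\<omega>. v (X u \<omega>) * jump_total (\<lambda>s x y. h1 s x y - h2 s x y) u \<omega>) \<in> borel_measurable P"
  proof -
    interpret h1: tilt S r h1 H1 by (rule h)
    interpret h2: tilt S r h2 H2 by (rule h)
    show ?thesis unfolding jump_total_def by measurable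
  qed
  have "AE \<omega> in P. v (X u \<omega>) * jump_total h1 u \<omega> - v (X u \<omega>) * jump_total h2 u \<omega> =
      v (X u \<omega>) * jump_total (\<lambda>s x y. h1 s x y - h2 s x y) u \<omega>"
    using AE_good
  proof eventually_elim
    case (elim \<omega>)
    obtain N where N: "\<forall>n\<ge>N. t < T (Suc n) \<omega>" using good_finite_jumps[OF elim] by blast
    have ut: "u \<le> t" using u by simp
    show ?case
      unfolding jump_total_finite[where N = N and \<omega> = \<omega>, OF N ut]
      by (simp only: right_diff_distrib sum_subtractf)
  qed
  then have 1: "has_bochner_integral P (\<lambda>\<omega>. v (X u \<omega>) * jump_total (\<lambda>s x y. h1 s x y - h2 s x y) u \<omega>) (c1 - c2)"
    by (intro has_bochner_integral_cong_AE[THEN iffD1, OF _ m _ has_bochner_integral_diff[OF c(1,3)]]) auto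
  have "star (\<lambda>s x y. h1 s x y - h2 s x y) s (X s \<omega>) = star h1 s (X s \<omega>) - star h2 s (X s \<omega>)"
    if "\<omega> \<in> space P" for s \<omega>
    unfolding star_def contract_def
    by (rule Bochner_Integration.integral_diff) (auto intro!: integrable_star h jump_path_space that)
  then have "has_bochner_integral (L u \<Otimes>\<^sub>M P) (\<lambda>(s, \<omega>). v (X u \<omega>) * star (\<lambda>s x y. h1 s x y - h2 s x y) s (X s \<omega>)) (c1 - c2)"
    by (intro has_bochner_integral_cong[THEN iffD1, OF refl _ refl has_bochner_integral_diff[OF c(2,4)]])
      (auto simp: space_pair_measure right_diff_distrib)
  with 1 show ?thesis unfolding rev_eq_def by blast
qed

text \<open>Four nonnegative instances, for the positive and negative parts of \<open>v\<close> and
  of \<open>g\<close>; each part is dominated by the modulus of the function it comes from.\<close>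

lemma rev_eq_g:
  assumes v: "v \<in> borel_measurable S" and u: "u \<in> {0..t}"
    and l: "0 < l" "l \<le> 1" and fin: "(\<integral>\<^sup>+\<omega>. ennreal (\<bar>v (X u \<omega>)\<bar> * W l \<omega>) \<partial>P) < \<top>"
  shows "rev_eq u v g"
proof -
  let ?gp = "\<lambda>s x y. max 0 (g s x y)" and ?gn = "\<lambda>s x y. max 0 (- g s x y)"
  let ?vp = "\<lambda>x. max 0 (v x)" and ?vn = "\<lambda>x. max 0 (- v x)"
  note [measurable] = v
  have gp: "tilt S r ?gp K"
  proof
    show "(\<lambda>(s, x, y). ?gp s x y) \<in> borel_measurable (borel \<Otimes>\<^sub>M S \<Otimes>\<^sub>M S)" by measurable
    show "\<bar>?gp s x y\<bar> \<le> K" if "x \<in> space S" "y \<in> space S" for s x y using g.tilt_bound[OF that, of s] by auto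
  qed
  have gn: "tilt S r ?gn K"
  proof
    show "(\<lambda>(s, x, y). ?gn s x y) \<in> borel_measurable (borel \<Otimes>\<^sub>M S \<Otimes>\<^sub>M S)" by measurable
    show "\<bar>?gn s x y\<bar> \<le> K" if "x \<in> space S" "y \<in> space S" for s x y using g.tilt_bound[OF that, of s] by auto
  qed
  have fv: "(\<integral>\<^sup>+\<omega>. ennreal (\<bar>w (X u \<omega>)\<bar> * W l \<omega>) \<partial>P) < \<top>" if "\<And>x. \<bar>w x\<bar> \<le> \<bar>v x\<bar>" for w
    by (rule order_le_less_trans[OF _ fin])
      (intro nn_integral_mono ennreal_leI mult_right_mono that W_nonneg l)
  have fvp: "(\<integral>\<^sup>+\<omega>. ennreal (\<bar>?vp (X u \<omega>)\<bar> * W l \<omega>) \<partial>P) < \<top>" by (rule fv) auto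
  have fvn: "(\<integral>\<^sup>+\<omega>. ennreal (\<bar>?vn (X u \<omega>)\<bar> * W l \<omega>) \<partial>P) < \<top>" by (rule fv) auto
  have eqv: "(\<lambda>x. ?vp x - ?vn x) = v" by (auto simp: max_def)
  have eqg: "(\<lambda>s x y. ?gp s x y - ?gn s x y) = g" by (auto simp: max_def fun_eq_iff)
  have p: "rev_eq u v ?gp"
    by (subst eqv[symmetric], rule rev_eq_diff_v)
      (rule rev_eq_nonneg[OF gp _ _ _ _ u l fvp] rev_eq_nonneg[OF gp _ _ _ _ u l fvn]; force)+
  have n: "rev_eq u v ?gn"
    by (subst eqv[symmetric], rule rev_eq_diff_v)
      (rule rev_eq_nonneg[OF gn _ _ _ _ u l fvp] rev_eq_nonneg[OF gn _ _ _ _ u l fvn]; force)+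
  show ?thesis using rev_eq_diff_h[OF p n u gp gn v] by (simp only: eqg)
qed

lemma psi_eq: "psi r rstar g s x = star g s x - contract r (g s) x"
  by (simp add: psi_def star_def)

lemma measurable_psi [measurable (raw)]:
  assumes [measurable]: "f \<in> borel_measurable N" "k \<in> measurable N S"
  shows "(\<lambda>w. psi r rstar g (f w) (k w)) \<in> borel_measurable N"
  unfolding psi_def by measurable

lemma nn_integral_beta_le: "good \<omega> \<Longrightarrow> u \<le> t \<Longrightarrow> (\<integral>\<^sup>+s. ennreal (indicator {0..u} s * beta s (X s \<omega>)) \<partial>lborel) \<le> ennreal (A \<omega>)"
  unfolding good_A[symmetric] abs_contract_path[OF goodD]
  by (intro nn_integral_mono ennreal_leI mult_right_mono beta_nonneg) (auto simp: indicator_def)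

text \<open>|psi| is at most the reversed contraction of |g| plus \<open>beta\<close>. Integrated
  over time against the weight, the first becomes the sum of |g| over the jumps, the second is at
  most \<open>A\<close>; each is dominated by \<open>W l\<close>, whence the factor 2.\<close>

lemma psi_bound:
  assumes v: "v \<in> borel_measurable S" and u: "u \<in> {0..t}" and l: "0 < l" "l \<le> 1"
  shows "(\<integral>\<^sup>+s. indicator {0..u} s * (\<integral>\<^sup>+\<omega>. v (X u \<omega>) * ennreal \<bar>psi r rstar g s (X s \<omega>)\<bar> \<partial>P) \<partial>lborel)
    \<le> 2 * (\<integral>\<^sup>+\<omega>. v (X u \<omega>) * ennreal (W l \<omega>) \<partial>P)"
proof -
  note [measurable] = v
  let ?h = "\<lambda>s x y. \<bar>g s x y\<bar>"
  have h: "tilt S r ?h K" using tilt_abs[of 1] by simp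
  note [measurable (raw)] = measurable_star[OF h]
  have sm: "(\<lambda>x. star ?h s x) \<in> borel_measurable S" for s by measurable
  have star0: "0 \<le> star ?h s x" for s x
    unfolding star_def contract_def by (rule integral_nonneg_AE) simp
  have "(\<integral>\<^sup>+s. indicator {0..u} s * (\<integral>\<^sup>+\<omega>. v (X u \<omega>) * ennreal \<bar>psi r rstar g s (X s \<omega>)\<bar> \<partial>P) \<partial>lborel) \<le>
      (\<integral>\<^sup>+s. indicator {0..u} s * (\<integral>\<^sup>+\<omega>. ennreal (star ?h s (X s \<omega>)) * v (X u \<omega>) \<partial>P) +
        indicator {0..u} s * (\<integral>\<^sup>+\<omega>. v (X u \<omega>) * ennreal (beta s (X s \<omega>)) \<partial>P) \<partial>lborel)"
  proof (rule nn_integral_mono)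
    fix s
    have "(\<integral>\<^sup>+\<omega>. v (X u \<omega>) * ennreal \<bar>psi r rstar g s (X s \<omega>)\<bar> \<partial>P) \<le>
        (\<integral>\<^sup>+\<omega>. ennreal (star ?h s (X s \<omega>)) * v (X u \<omega>) + v (X u \<omega>) * ennreal (beta s (X s \<omega>)) \<partial>P)"
    proof (rule nn_integral_mono)
      fix \<omega> assume "\<omega> \<in> space P"
      then have x: "X s \<omega> \<in> space S" by (rule jump_path_space)
      have "\<bar>star g s (X s \<omega>)\<bar> \<le> star ?h s (X s \<omega>)"
        unfolding star_def contract_def by (rule integral_abs_bound)
      then have "\<bar>psi r rstar g s (X s \<omega>)\<bar> \<le> star ?h s (X s \<omega>) + beta s (X s \<omega>)"
        using abs_contract_g_le[OF x, of s] unfolding psi_eq by linarith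
      then have "ennreal \<bar>psi r rstar g s (X s \<omega>)\<bar> \<le> ennreal (star ?h s (X s \<omega>)) + ennreal (beta s (X s \<omega>))"
        using star0 beta_nonneg by (simp add: ennreal_plus[symmetric] ennreal_leI del: ennreal_plus)
      then have "v (X u \<omega>) * ennreal \<bar>psi r rstar g s (X s \<omega>)\<bar> \<le> v (X u \<omega>) * (ennreal (star ?h s (X s \<omega>)) + ennreal (beta s (X s \<omega>)))"
        by (rule mult_left_mono) simp
      then show "v (X u \<omega>) * ennreal \<bar>psi r rstar g s (X s \<omega>)\<bar> \<le> ennreal (star ?h s (X s \<omega>)) * v (X u \<omega>) + v (X u \<omega>) * ennreal (beta s (X s \<omega>))"
        by (simp add: distrib_left mult.commute)
    qed
    also have "\<dots> = (\<integral>\<^sup>+\<omega>. ennreal (star ?h s (X s \<omega>)) * v (X u \<omega>) \<partial>P) + (\<integral>\<^sup>+\<omega>. v (X u \<omega>) * ennreal (beta s (X s \<omega>)) \<partial>P)"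
      by (rule nn_integral_add) (use sm in measurable)
    finally show "indicator {0..u} s * (\<integral>\<^sup>+\<omega>. v (X u \<omega>) * ennreal \<bar>psi r rstar g s (X s \<omega>)\<bar> \<partial>P) \<le>
      indicator {0..u} s * (\<integral>\<^sup>+\<omega>. ennreal (star ?h s (X s \<omega>)) * v (X u \<omega>) \<partial>P) + indicator {0..u} s * (\<integral>\<^sup>+\<omega>. v (X u \<omega>) * ennreal (beta s (X s \<omega>)) \<partial>P)"
      by (auto simp: indicator_def)
  qed
  also have "\<dots> = (\<integral>\<^sup>+s. indicator {0..u} s * (\<integral>\<^sup>+\<omega>. ennreal (star ?h s (X s \<omega>)) * v (X u \<omega>) \<partial>P) \<partial>lborel) +
      (\<integral>\<^sup>+s. indicator {0..u} s * (\<integral>\<^sup>+\<omega>. v (X u \<omega>) * ennreal (beta s (X s \<omega>)) \<partial>P) \<partial>lborel)"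
    by (rule nn_integral_add) measurable
  finally have 0: "(\<integral>\<^sup>+s. indicator {0..u} s * (\<integral>\<^sup>+\<omega>. v (X u \<omega>) * ennreal \<bar>psi r rstar g s (X s \<omega>)\<bar> \<partial>P) \<partial>lborel) \<le>
      (\<integral>\<^sup>+s. indicator {0..u} s * (\<integral>\<^sup>+\<omega>. ennreal (star ?h s (X s \<omega>)) * v (X u \<omega>) \<partial>P) \<partial>lborel) +
      (\<integral>\<^sup>+s. indicator {0..u} s * (\<integral>\<^sup>+\<omega>. v (X u \<omega>) * ennreal (beta s (X s \<omega>)) \<partial>P) \<partial>lborel)" .
  have "(\<integral>\<^sup>+s. indicator {0..u} s * (\<integral>\<^sup>+\<omega>. ennreal (star ?h s (X s \<omega>)) * v (X u \<omega>) \<partial>P) \<partial>lborel) =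
      (\<integral>\<^sup>+\<omega>. ennreal (jump_total ?h u \<omega>) * v (X u \<omega>) \<partial>P)"
    by (rule reversed_jump_total[OF h _ v u, symmetric]) simp
  also have "\<dots> \<le> (\<integral>\<^sup>+\<omega>. v (X u \<omega>) * ennreal (W l \<omega>) \<partial>P)"
  proof (rule nn_integral_mono_AE)
    show "AE \<omega> in P. ennreal (jump_total ?h u \<omega>) * v (X u \<omega>) \<le> v (X u \<omega>) * ennreal (W l \<omega>)"
      using AE_good
    proof eventually_elim
      case (elim \<omega>)
      have "jump_total ?h u \<omega> \<le> W l \<omega>"
        using abs_jump_total_le[OF elim, of u ?h 1] u D_bounds(2)[OF l elim] by (auto simp: abs_le_iff)
      then show ?case by (subst mult.commute) (intro mult_left_mono ennreal_leI, simp_all)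
    qed
  qed
  finally have 1: "(\<integral>\<^sup>+s. indicator {0..u} s * (\<integral>\<^sup>+\<omega>. ennreal (star ?h s (X s \<omega>)) * v (X u \<omega>) \<partial>P) \<partial>lborel) \<le>
      (\<integral>\<^sup>+\<omega>. v (X u \<omega>) * ennreal (W l \<omega>) \<partial>P)" .
  have 2: "(\<integral>\<^sup>+s. indicator {0..u} s * (\<integral>\<^sup>+\<omega>. v (X u \<omega>) * ennreal (beta s (X s \<omega>)) \<partial>P) \<partial>lborel) \<le> (\<integral>\<^sup>+\<omega>. v (X u \<omega>) * ennreal (W l \<omega>) \<partial>P)"
  proof -
    have "(\<integral>\<^sup>+s. indicator {0..u} s * (\<integral>\<^sup>+\<omega>. v (X u \<omega>) * ennreal (beta s (X s \<omega>)) \<partial>P) \<partial>lborel) =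
        (\<integral>\<^sup>+s. \<integral>\<^sup>+\<omega>. v (X u \<omega>) * ennreal (indicator {0..u} s * beta s (X s \<omega>)) \<partial>P \<partial>lborel)"
      by (intro nn_integral_cong) (auto simp: indicator_def)
    also have "\<dots> = (\<integral>\<^sup>+\<omega>. \<integral>\<^sup>+s. v (X u \<omega>) * ennreal (indicator {0..u} s * beta s (X s \<omega>)) \<partial>lborel \<partial>P)"
      by (rule lborel_M.Fubini'[symmetric]) measurable
    also have "\<dots> \<le> (\<integral>\<^sup>+\<omega>. v (X u \<omega>) * ennreal (W l \<omega>) \<partial>P)"
    proof (rule nn_integral_mono_AE)
      show "AE \<omega> in P. (\<integral>\<^sup>+s. v (X u \<omega>) * ennreal (indicator {0..u} s * beta s (X s \<omega>)) \<partial>lborel) \<le> v (X u \<omega>) * ennreal (W l \<omega>)"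
        using AE_good
      proof eventually_elim
        case (elim \<omega>)
        have bm: "(\<lambda>s. ennreal (indicator {0..u} s * beta s (X s \<omega>))) \<in> borel_measurable lborel"
          using measurable_beta_path[OF goodD[OF elim]]
          by (intro measurable_compose[OF _ measurable_ennreal] borel_measurable_times borel_measurable_indicator) simp_all
        have "(\<integral>\<^sup>+s. v (X u \<omega>) * ennreal (indicator {0..u} s * beta s (X s \<omega>)) \<partial>lborel) =
            v (X u \<omega>) * (\<integral>\<^sup>+s. ennreal (indicator {0..u} s * beta s (X s \<omega>)) \<partial>lborel)"
          by (rule nn_integral_cmult[OF bm])
        also have "\<dots> \<le> v (X u \<omega>) * ennreal (W l \<omega>)"
        proof (rule mult_left_mono)
          have "u \<le> t" using u by simp
          from nn_integral_beta_le[OF elim this]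
          show "(\<integral>\<^sup>+s. ennreal (indicator {0..u} s * beta s (X s \<omega>)) \<partial>lborel) \<le> ennreal (W l \<omega>)"
            by (rule order_trans) (intro ennreal_leI D_bounds(3)[OF l elim])
        qed simp
        finally show ?case .
      qed
    qed
    finally show ?thesis .
  qed
  show ?thesis unfolding mult_2 by (rule order_trans[OF 0 add_mono[OF 1 2]])
qed

text \<open>The jump part of \<open>Mart\<close> is replaced by the reversed contraction through
  \<open>rev_eq_g\<close>; subtracting the forward contraction leaves \<open>psi\<close>. The bound
  \<open>psi_bound\<close> gives the absolute convergence that Fubini's theorem needs.\<close>

lemma mart_identity:
  assumes v: "v \<in> borel_measurable S" and u: "u \<in> {0..t}"
    and l: "0 < l" "l \<le> 1" and fin: "(\<integral>\<^sup>+\<omega>. ennreal (\<bar>v (X u \<omega>)\<bar> * W l \<omega>) \<partial>P) < \<top>"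
  shows "integrable (L u \<Otimes>\<^sub>M P) (\<lambda>(s, \<omega>). v (X u \<omega>) * psi r rstar g s (X s \<omega>))" (is "integrable _ ?f")
    "(\<integral>\<omega>. v (X u \<omega>) * Mart u \<omega> \<partial>P) = (LINT s:{0..u}|lborel. (\<integral>\<omega>. v (X u \<omega>) * psi r rstar g s (X s \<omega>) \<partial>P))"
proof -
  note [measurable] = v
  interpret LP: pair_sigma_finite "L u" P by (rule pair_L_P)
  obtain c where c: "has_bochner_integral P (\<lambda>\<omega>. v (X u \<omega>) * jump_total g u \<omega>) c"
     "has_bochner_integral (L u \<Otimes>\<^sub>M P) (\<lambda>(s, \<omega>). v (X u \<omega>) * star g s (X s \<omega>)) c"
    using rev_eq_g[OF v u l fin] unfolding rev_eq_def by blast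
  let ?k = "\<lambda>(s, \<omega>). v (X u \<omega>) * contract r (g s) (X s \<omega>)"
  have "(\<integral>\<^sup>+z. ennreal (norm (?f z)) \<partial>(L u \<Otimes>\<^sub>M P)) = (\<integral>\<^sup>+s. indicator {0..u} s * (\<integral>\<^sup>+\<omega>. ennreal \<bar>v (X u \<omega>)\<bar> * ennreal \<bar>psi r rstar g s (X s \<omega>)\<bar> \<partial>P) \<partial>lborel)"
    by (subst nn_integral_L_P) (auto simp: abs_mult ennreal_mult)
  also have "\<dots> \<le> 2 * (\<integral>\<^sup>+\<omega>. ennreal \<bar>v (X u \<omega>)\<bar> * ennreal (W l \<omega>) \<partial>P)"
    by (rule psi_bound[OF _ u l]) measurable
  also have "\<dots> < \<top>" using fin W_nonneg[OF l(1)] by (simp add: ennreal_mult ennreal_mult_less_top)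
  finally show int: "integrable (L u \<Otimes>\<^sub>M P) ?f" by (intro integrableI_bounded) auto
  have ik: "integrable (L u \<Otimes>\<^sub>M P) ?k"
  proof -
    have "integrable (L u \<Otimes>\<^sub>M P) (\<lambda>z. (\<lambda>(s, \<omega>). v (X u \<omega>) * star g s (X s \<omega>)) z - ?f z)"
      by (intro Bochner_Integration.integrable_diff int integrable.intros[OF c(2)])
    then show ?thesis by (simp add: psi_eq case_prod_unfold right_diff_distrib)
  qed
  have k_eq: "(\<integral>z. ?k z \<partial>(L u \<Otimes>\<^sub>M P)) = (\<integral>\<omega>. v (X u \<omega>) * (LINT s:{0..u}|lborel. contract r (g s) (X s \<omega>)) \<partial>P)"
    and k_int: "integrable P (\<lambda>\<omega>. v (X u \<omega>) * (LINT s:{0..u}|lborel. contract r (g s) (X s \<omega>)))"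
    using LP.integral_snd[OF ik] LP.integrable_snd[OF ik] by (simp_all add: L_integral)
  have "(\<integral>\<omega>. v (X u \<omega>) * Mart u \<omega> \<partial>P) = (\<integral>\<omega>. v (X u \<omega>) * jump_total g u \<omega> - v (X u \<omega>) * (LINT s:{0..u}|lborel. contract r (g s) (X s \<omega>)) \<partial>P)"
    by (simp add: Mart_def right_diff_distrib)
  also have "\<dots> = c - (\<integral>z. ?k z \<partial>(L u \<Otimes>\<^sub>M P))"
    unfolding k_eq has_bochner_integral_integral_eq[OF c(1), symmetric]
    by (intro Bochner_Integration.integral_diff k_int integrable.intros[OF c(1)])
  also have "\<dots> = (\<integral>z. (\<lambda>(s, \<omega>). v (X u \<omega>) * star g s (X s \<omega>)) z - ?k z \<partial>(L u \<Otimes>\<^sub>M P))"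
    unfolding has_bochner_integral_integral_eq[OF c(2), symmetric]
    by (intro Bochner_Integration.integral_diff[symmetric] ik integrable.intros[OF c(2)])
  also have "\<dots> = (\<integral>z. ?f z \<partial>(L u \<Otimes>\<^sub>M P))"
    by (simp add: psi_eq case_prod_unfold right_diff_distrib)
  also have "\<dots> = (\<integral>s. (\<integral>\<omega>. v (X u \<omega>) * psi r rstar g s (X s \<omega>) \<partial>P) \<partial>L u)"
    using LP.integral_fst'[OF int] by simp
  finally show "(\<integral>\<omega>. v (X u \<omega>) * Mart u \<omega> \<partial>P) = (LINT s:{0..u}|lborel. (\<integral>\<omega>. v (X u \<omega>) * psi r rstar g s (X s \<omega>) \<partial>P))"
    by (simp add: L_integral)
qed

end

section \<open>Differentiation under the integral and sums over jumps\<close>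

text \<open>A product rule under the integral, with \<open>d\<close> in the role of the density and
  \<open>b\<close> in that of the observable, which may itself depend on lambda. The increment of
  the product splits into (b - b0) d and b0 (d - 1), bounded by |lambda| times
  \<open>C * (bb z * w z)\<close> and \<open>bb z * w z\<close>. An observable independent of lambda
  has C = 0.\<close>

lemma weighted_derivative:
  fixes d b :: "real \<Rightarrow> 'q \<Rightarrow> real"
  assumes l: "0 < l" and C: "0 \<le> C"
    and meas[measurable]: "\<And>lam. d lam \<in> borel_measurable Q" "\<And>lam. b lam \<in> borel_measurable Q"
      "m \<in> borel_measurable Q" "w \<in> borel_measurable Q" "b' \<in> borel_measurable Q" "bb \<in> borel_measurable Q"
    and d: "AE z in Q. (\<forall>lam. \<bar>lam\<bar> \<le> l \<longrightarrow> \<bar>d lam z - 1\<bar> \<le> \<bar>lam\<bar> * w z \<and> 0 \<le> d lam z \<and> d lam z \<le> w z) \<and>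
      1 \<le> w z \<and> \<bar>m z\<bar> \<le> 2 * w z \<and> ((\<lambda>lam. d lam z) has_real_derivative m z) (at 0)"
    and b: "AE z in Q. (\<forall>lam. \<bar>lam\<bar> \<le> l \<longrightarrow> \<bar>b lam z - b 0 z\<bar> \<le> \<bar>lam\<bar> * (C * bb z)) \<and> \<bar>b 0 z\<bar> \<le> bb z \<and>
      ((\<lambda>lam. b lam z) has_real_derivative b' z) (at 0)"
    and fin: "integrable Q (\<lambda>z. bb z * w z)"
  shows "\<And>lam. \<bar>lam\<bar> \<le> l \<Longrightarrow> integrable Q (\<lambda>z. b lam z * d lam z)" "integrable Q b'" "integrable Q (\<lambda>z. b 0 z * m z)"
    "((\<lambda>lam. \<integral>z. b lam z * d lam z \<partial>Q) has_real_derivative ((\<integral>z. b' z \<partial>Q) + (\<integral>z. b 0 z * m z \<partial>Q))) (at 0)"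
proof -
  have ibb: "integrable Q bb"
  proof (rule Bochner_Integration.integrable_bound[OF fin])
    show "AE z in Q. norm (bb z) \<le> norm (bb z * w z)"
      using d b
    proof eventually_elim
      case (elim z)
      then have "\<bar>bb z\<bar> * 1 \<le> \<bar>bb z\<bar> * \<bar>w z\<bar>" by (intro mult_left_mono) auto
      then show ?case by (simp add: abs_mult)
    qed
  qed simp
  have ib0: "integrable Q (b 0)"
  proof (rule Bochner_Integration.integrable_bound[OF ibb])
    show "AE z in Q. norm (b 0 z) \<le> norm (bb z)" using b by eventually_elim auto
  qed simp
  show im: "integrable Q (\<lambda>z. b 0 z * m z)"
  proof (rule Bochner_Integration.integrable_bound[OF integrable_mult_right[OF fin, of 2]])
    show "AE z in Q. norm (b 0 z * m z) \<le> norm (2 * (bb z * w z))"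
      using d b
    proof eventually_elim
      case (elim z)
      then have "\<bar>b 0 z\<bar> * \<bar>m z\<bar> \<le> bb z * (2 * w z)" by (intro mult_mono) auto
      then show ?case unfolding real_norm_def abs_mult[of "b 0 z"] by linarith
    qed
  qed simp
  show ib': "integrable Q b'"
  proof (rule has_derivative_integral_dominated(2)[where f = b, OF l meas(2) ib0 integrable_mult_right[OF ibb, of C]])
    show "AE z in Q. \<bar>b lam z - b 0 z\<bar> \<le> \<bar>lam\<bar> * (C * bb z)" if "\<bar>lam\<bar> \<le> l" for lam
      using b by eventually_elim (use that in blast)
    show "AE z in Q. ((\<lambda>lam. b lam z) has_real_derivative b' z) (at 0)" using b by eventually_elim blast
  qed simp
  have 0: "integrable Q (\<lambda>z. b 0 z * d 0 z)"
  proof (rule integrable_cong_AE_imp[OF ib0])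
    show "AE z in Q. b 0 z = b 0 z * d 0 z"
      using d
    proof eventually_elim
      case (elim z)
      then have "\<bar>d 0 z - 1\<bar> \<le> \<bar>0\<bar> * w z" using l by (metis abs_zero less_imp_le)
      then show ?case by simp
    qed
  qed simp
  have bound: "AE z in Q. \<bar>b lam z * d lam z - b 0 z * d 0 z\<bar> \<le> \<bar>lam\<bar> * ((C + 1) * (bb z * w z))" if lam: "\<bar>lam\<bar> \<le> l" for lam
    using d b
  proof eventually_elim
    case (elim z)
    \<comment> \<open>The Lipschitz bound at lambda = 0 forces this value.\<close>
    have d0: "d 0 z = 1"
    proof -
      have "\<bar>d 0 z - 1\<bar> \<le> \<bar>0\<bar> * w z" using l elim by (metis abs_zero less_imp_le)
      then show ?thesis by simp
    qed
    have dl: "\<bar>d lam z - 1\<bar> \<le> \<bar>lam\<bar> * w z" "0 \<le> d lam z" "d lam z \<le> w z" using elim lam by auto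
    have bl: "\<bar>b lam z - b 0 z\<bar> \<le> \<bar>lam\<bar> * (C * bb z)" "\<bar>b 0 z\<bar> \<le> bb z" using elim lam by auto
    have bb0: "0 \<le> bb z" using bl(2) by linarith
    have 1: "\<bar>b lam z - b 0 z\<bar> * \<bar>d lam z\<bar> \<le> (\<bar>lam\<bar> * (C * bb z)) * w z"
      using dl bl(1) C bb0 by (intro mult_mono) auto
    have 2: "\<bar>b 0 z\<bar> * \<bar>d lam z - 1\<bar> \<le> bb z * (\<bar>lam\<bar> * w z)"
      using dl bl bb0 by (intro mult_mono) auto
    have "b lam z * d lam z - b 0 z * d 0 z = (b lam z - b 0 z) * d lam z + b 0 z * (d lam z - 1)"
      by (simp add: d0 algebra_simps)
    then have "\<bar>b lam z * d lam z - b 0 z * d 0 z\<bar> \<le> \<bar>b lam z - b 0 z\<bar> * \<bar>d lam z\<bar> + \<bar>b 0 z\<bar> * \<bar>d lam z - 1\<bar>"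
      by (simp add: abs_mult[symmetric])
    also have "\<dots> \<le> (\<bar>lam\<bar> * (C * bb z)) * w z + bb z * (\<bar>lam\<bar> * w z)" using 1 2 by (rule add_mono)
    also have "\<dots> = \<bar>lam\<bar> * ((C + 1) * (bb z * w z))" by (simp add: algebra_simps)
    finally show ?case .
  qed
  have deriv: "AE z in Q. ((\<lambda>lam. b lam z * d lam z) has_real_derivative b' z + b 0 z * m z) (at 0)"
    using d b
  proof eventually_elim
    case (elim z)
    have "\<bar>d 0 z - 1\<bar> \<le> \<bar>0\<bar> * w z" using l elim by (metis abs_zero less_imp_le)
    then have d0: "d 0 z = 1" by simp
    have "((\<lambda>lam. b lam z * d lam z) has_real_derivative b' z * d 0 z + m z * b 0 z) (at 0)"
      using elim by (intro DERIV_mult) auto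
    then show ?case by (simp add: d0 mult.commute)
  qed
  have m1: "(\<lambda>z. b lam z * d lam z) \<in> borel_measurable Q" for lam by measurable
  have m2: "(\<lambda>z. b' z + b 0 z * m z) \<in> borel_measurable Q" by measurable
  note main = has_derivative_integral_dominated[where f = "\<lambda>lam z. b lam z * d lam z", OF l m1 0 integrable_mult_right[OF fin, of "C + 1"] bound deriv m2]
  show "integrable Q (\<lambda>z. b lam z * d lam z)" if "\<bar>lam\<bar> \<le> l" for lam by (rule main(1)) (use that in simp_all)
  show "((\<lambda>lam. \<integral>z. b lam z * d lam z \<partial>Q) has_real_derivative ((\<integral>z. b' z \<partial>Q) + (\<integral>z. b 0 z * m z \<partial>Q))) (at 0)"
    unfolding Bochner_Integration.integral_add[OF ib' im, symmetric] by (rule main(3))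
qed

text \<open>The identity for nonnegative functions says that two image measures coincide;
  integrability and Bochner integrals then transfer for functions of either sign.\<close>

lemma integral_of_measure_change:
  fixes b :: "'z \<Rightarrow> real" and d :: "'y \<Rightarrow> real"
  assumes Y1: "Y1 \<in> measurable N1 N" and Y2: "Y2 \<in> measurable N2 N" and d: "d \<in> borel_measurable N2" and d0: "\<And>z. 0 \<le> d z"
    and change: "\<And>F :: 'z \<Rightarrow> ennreal. F \<in> borel_measurable N \<Longrightarrow> (\<integral>\<^sup>+z. F (Y1 z) \<partial>N1) = (\<integral>\<^sup>+z. F (Y2 z) * ennreal (d z) \<partial>N2)"
    and b: "b \<in> borel_measurable N" and int: "integrable N2 (\<lambda>z. b (Y2 z) * d z)"
  shows "integrable N1 (\<lambda>z. b (Y1 z))" "(\<integral>z. b (Y1 z) \<partial>N1) = (\<integral>z. b (Y2 z) * d z \<partial>N2)"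
proof -
  note [measurable] = Y1 Y2 d b
  let ?\<nu> = "distr (density N2 (\<lambda>z. ennreal (d z))) N Y2"
  have eq: "distr N1 N Y1 = ?\<nu>"
  proof (rule measure_eqI)
    fix B assume "B \<in> sets (distr N1 N Y1)"
    then have [measurable]: "B \<in> sets N" by simp
    have "emeasure (distr N1 N Y1) B = (\<integral>\<^sup>+z. indicator B z \<partial>distr N1 N Y1)" by simp
    also have "\<dots> = (\<integral>\<^sup>+z. indicator B (Y1 z) \<partial>N1)" by (rule nn_integral_distr) measurable
    also have "\<dots> = (\<integral>\<^sup>+z. indicator B (Y2 z) * ennreal (d z) \<partial>N2)" by (rule change) measurable
    also have "\<dots> = (\<integral>\<^sup>+z. indicator B (Y2 z) \<partial>density N2 (\<lambda>z. ennreal (d z)))"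
      by (subst nn_integral_density) (auto simp: mult.commute)
    also have "\<dots> = (\<integral>\<^sup>+z. indicator B z \<partial>?\<nu>)" by (rule nn_integral_distr[symmetric]) measurable
    also have "\<dots> = emeasure ?\<nu> B" by simp
    finally show "emeasure (distr N1 N Y1) B = emeasure ?\<nu> B" .
  qed simp
  have i: "integrable (density N2 (\<lambda>z. ennreal (d z))) (\<lambda>z. b (Y2 z))"
    using int by (subst integrable_real_density) (auto simp: d0 mult.commute)
  then have "integrable ?\<nu> b" by (subst integrable_distr_eq) measurable
  then show "integrable N1 (\<lambda>z. b (Y1 z))" unfolding eq[symmetric] by (subst (asm) integrable_distr_eq) measurable
  have "(\<integral>z. b (Y1 z) \<partial>N1) = (\<integral>z. b z \<partial>distr N1 N Y1)" by (rule integral_distr[symmetric]) measurable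
  also have "\<dots> = (\<integral>z. b (Y2 z) \<partial>density N2 (\<lambda>z. ennreal (d z)))" unfolding eq by (rule integral_distr) measurable
  also have "\<dots> = (\<integral>z. b (Y2 z) * d z \<partial>N2)" by (subst integral_real_density) (auto simp: d0 mult.commute)
  finally show "(\<integral>z. b (Y1 z) \<partial>N1) = (\<integral>z. b (Y2 z) * d z \<partial>N2)" .
qed

section \<open>Reflection of time, and sums over the jumps of a path\<close>

text \<open>\<open>mart_identity\<close> produces \<open>psi\<close> at time s along the path,
  whereas the response formulas are written with u - s; the substitution s \<rightarrow> u - s links
  the two.\<close>

lemma reflect_nn_integral:
  fixes f :: "real \<Rightarrow> ennreal"
  assumes [measurable]: "f \<in> borel_measurable borel"
  shows "(\<integral>\<^sup>+s. indicator {0..u} s * f (u - s) \<partial>lborel) = (\<integral>\<^sup>+s. indicator {0..u} s * f s \<partial>lborel)"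
proof -
  have "(\<integral>\<^sup>+s. indicator {0..u} s * f s \<partial>lborel) = (\<integral>\<^sup>+s. indicator {0..u} (u + (-1) * s) * f (u + (-1) * s) \<partial>lborel)"
    by (subst nn_integral_real_affine[of _ "-1" u]) auto
  also have "\<dots> = (\<integral>\<^sup>+s. indicator {0..u} s * f (u - s) \<partial>lborel)"
    by (intro nn_integral_cong) (auto simp: indicator_def)
  finally show ?thesis by simp
qed

lemma reflect_integral:
  fixes f :: "real \<Rightarrow> real"
  shows "(LINT s:{0..u}|lborel. f (u - s)) = (LINT s:{0..u}|lborel. f s)"
proof -
  have "(LINT s:{0..u}|lborel. f s) = \<bar>-1\<bar> *\<^sub>R (\<integral>s. indicator {0..u} (u + (-1) * s) *\<^sub>R f (u + (-1) * s) \<partial>lborel)"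
    unfolding set_lebesgue_integral_def by (rule lborel_integral_real_affine) simp
  also have "\<dots> = (LINT s:{0..u}|lborel. f (u - s))"
    unfolding set_lebesgue_integral_def by (simp, intro Bochner_Integration.integral_cong) (auto simp: indicator_def)
  finally show ?thesis by simp
qed

lemma left_value_eq:
  assumes b: "b < s" and eq: "\<And>w. b < w \<Longrightarrow> w < s \<Longrightarrow> \<xi> w = x"
  shows "left_value \<xi> s = x"
  unfolding left_value_def
proof (rule the_equality)
  show ev: "\<forall>\<^sub>F w in at_left s. \<xi> w = x"
    using b eq by (auto simp: eventually_at_left_field)
  fix y assume "\<forall>\<^sub>F w in at_left s. \<xi> w = y"
  with ev have "\<forall>\<^sub>F w in at_left s. x = y" by eventually_elim simp
  then show "y = x" by (simp add: eventually_const_iff)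
qed

context tilted_jump
begin

lemma path_at_jump:
  assumes \<omega>: "\<omega> \<in> space M" and n: "T (Suc n) \<omega> \<le> t"
  shows "left_value (\<lambda>s. jump_path T Z s \<omega>) (T (Suc n) \<omega>) = Z n \<omega>" "jump_path T Z (T (Suc n) \<omega>) \<omega> = Z (Suc n) \<omega>"
    "Z (Suc n) \<omega> \<noteq> Z n \<omega>"
proof -
  show "left_value (\<lambda>s. jump_path T Z s \<omega>) (T (Suc n) \<omega>) = Z n \<omega>"
    by (rule left_value_eq[OF T_Suc[OF \<omega>]]) (rule jump_path_eq[OF \<omega>], auto)
  show "jump_path T Z (T (Suc n) \<omega>) \<omega> = Z (Suc n) \<omega>"
    by (rule jump_path_eq[OF \<omega> order_refl T_Suc[OF \<omega>]])
  show "Z (Suc n) \<omega> \<noteq> Z n \<omega>"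
    using n T_nonneg[OF \<omega>] by (intro Z_Suc[OF \<omega>]) simp
qed

text \<open>Between two jump times the path is constant, so left value and value agree there. At a
  jump time in the window they are \<open>Z n\<close> and \<open>Z (Suc n)\<close>, which differ by
  \<open>Z_Suc\<close>. Hence the times collected by \<open>jump_sum\<close> are exactly the
  \<open>T (Suc n)\<close> up to \<open>t\<close>.\<close>

lemma jump_sum_eq:
  assumes \<omega>: "\<omega> \<in> space M" and t: "0 \<le> t"
  shows "jump_sum t \<alpha> (\<lambda>s. jump_path T Z s \<omega>) =
    (if alive T t \<omega> then (\<Sum>n. indicator {..t} (T (Suc n) \<omega>) * \<alpha> (T (Suc n) \<omega>) (Z n \<omega>) (Z (Suc n) \<omega>)) else 0)"
proof -
  let ?J = "{s \<in> {0<..t}. left_value (\<lambda>s. jump_path T Z s \<omega>) s \<noteq> jump_path T Z s \<omega>}"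
  have inj: "inj (\<lambda>n. T (Suc n) \<omega>)"
    by (rule injI) (metis T_le_iff[OF \<omega>] Suc_inject order_antisym order_refl)
  have in_J: "T (Suc n) \<omega> \<in> ?J" if "T (Suc n) \<omega> \<le> t" for n
  proof -
    have "0 < T (Suc n) \<omega>" using T_nonneg[OF \<omega>, of n] T_Suc[OF \<omega>, of n] by linarith
    then show ?thesis using path_at_jump[OF \<omega> that] that by simp
  qed
  show ?thesis
  proof (cases "alive T t \<omega>")
    case True
    obtain N where N: "T N \<omega> \<le> t" "t < T (Suc N) \<omega>" by (rule alive_obtain[OF \<omega> t True])
    have le: "T (Suc n) \<omega> \<le> t \<longleftrightarrow> n < N" for n
    proof
      assume "T (Suc n) \<omega> \<le> t"
      then have "T (Suc n) \<omega> < T (Suc N) \<omega>" using N by simp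
      then show "n < N" by (simp add: T_less_iff[OF \<omega>])
    next
      assume "n < N"
      then have "T (Suc n) \<omega> \<le> T N \<omega>" by (simp add: T_le_iff[OF \<omega>])
      then show "T (Suc n) \<omega> \<le> t" using N by simp
    qed
    have J: "?J = (\<lambda>n. T (Suc n) \<omega>) ` {..<N}"
    proof (intro equalityI subsetI)
      fix s assume s: "s \<in> ?J"
      then have s': "0 \<le> s" "s \<le> t" "0 < s" by auto
      have "alive T s \<omega>" unfolding alive_def using N s' by (intro exI[of _ N]) simp
      then obtain m where m: "T m \<omega> \<le> s" "s < T (Suc m) \<omega>" by (rule alive_obtain[OF \<omega> s'(1)])
      have "T m \<omega> = s"
      proof (rule ccontr)
        assume "T m \<omega> \<noteq> s"
        then have lt: "T m \<omega> < s" using m by simp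
        have "left_value (\<lambda>s. jump_path T Z s \<omega>) s = Z m \<omega>"
          by (rule left_value_eq[OF lt]) (rule jump_path_eq[OF \<omega>], use m in auto)
        then show False using s jump_path_eq[OF \<omega> m] by simp
      qed
      moreover obtain k where "m = Suc k" using calculation s' T_0[OF \<omega>] by (cases m) auto
      ultimately show "s \<in> (\<lambda>n. T (Suc n) \<omega>) ` {..<N}" using s' le[of k] by auto
    next
      fix s assume "s \<in> (\<lambda>n. T (Suc n) \<omega>) ` {..<N}"
      then obtain n where n: "s = T (Suc n) \<omega>" "n < N" by auto
      then have "T (Suc n) \<omega> \<le> t" by (simp add: le)
      from in_J[OF this] show "s \<in> ?J" by (simp only: n)
    qed
    have "jump_sum t \<alpha> (\<lambda>s. jump_path T Z s \<omega>) = (\<Sum>n<N. \<alpha> (T (Suc n) \<omega>) (Z n \<omega>) (Z (Suc n) \<omega>))"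
      unfolding jump_sum_def J
    proof (subst sum.reindex)
      show "inj_on (\<lambda>n. T (Suc n) \<omega>) {..<N}" using inj by (rule inj_on_subset) simp
      show "sum ((\<lambda>s. \<alpha> s (left_value (\<lambda>s. jump_path T Z s \<omega>) s) (jump_path T Z s \<omega>)) \<circ> (\<lambda>n. T (Suc n) \<omega>)) {..<N} =
        (\<Sum>n<N. \<alpha> (T (Suc n) \<omega>) (Z n \<omega>) (Z (Suc n) \<omega>))"
      proof (rule sum.cong[OF refl])
        fix n assume "n \<in> {..<N}"
        then have "T (Suc n) \<omega> \<le> t" by (simp add: le)
        from path_at_jump[OF \<omega> this]
        show "((\<lambda>s. \<alpha> s (left_value (\<lambda>s. jump_path T Z s \<omega>) s) (jump_path T Z s \<omega>)) \<circ> (\<lambda>n. T (Suc n) \<omega>)) n =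
          \<alpha> (T (Suc n) \<omega>) (Z n \<omega>) (Z (Suc n) \<omega>)" by (simp only: comp_def)
      qed
    qed
    also have "\<dots> = (\<Sum>n<N. indicator {..t} (T (Suc n) \<omega>) * \<alpha> (T (Suc n) \<omega>) (Z n \<omega>) (Z (Suc n) \<omega>))"
      by (rule sum.cong) (simp_all add: le)
    also have "\<dots> = (\<Sum>n. indicator {..t} (T (Suc n) \<omega>) * \<alpha> (T (Suc n) \<omega>) (Z n \<omega>) (Z (Suc n) \<omega>))"
      by (rule suminf_finite[symmetric]) (simp_all add: le)
    finally show ?thesis using True by simp
  next
    \<comment> \<open>After an explosion there are infinitely many such times, and a sum over an
      infinite set is 0; this is the other branch of the claim.\<close>
    case False
    then have "T (Suc n) \<omega> \<le> t" for n by (simp add: alive_def not_less)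
    then have "range (\<lambda>n. T (Suc n) \<omega>) \<subseteq> ?J" using in_J by blast
    moreover have "infinite (range (\<lambda>n. T (Suc n) \<omega>))" using inj by (simp add: range_inj_infinite)
    ultimately have "infinite ?J" using infinite_super by blast
    then show ?thesis using False by (simp add: jump_sum_def)
  qed
qed

text \<open>\<open>levy_system\<close> expressed for the path functional. Absence of explosion up to
  \<open>t\<close> removes the cut-off and the convention for infinite sums at once.\<close>

lemma nn_integral_jump_sum:
  assumes \<alpha>: "(\<lambda>(s, x, y). \<alpha> s x y) \<in> borel_measurable (borel \<Otimes>\<^sub>M S \<Otimes>\<^sub>M S)" and \<alpha>0: "\<And>s x y. 0 \<le> \<alpha> s x y"
    and alive: "AE \<omega> in M. alive T t \<omega>" and t: "0 \<le> t"
  shows "(\<integral>\<^sup>+\<omega>. ennreal (jump_sum t \<alpha> (\<lambda>s. jump_path T Z s \<omega>)) \<partial>M) =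
    (\<integral>\<^sup>+s. indicator {0..t} s * (\<integral>\<^sup>+\<omega>. (\<integral>\<^sup>+y. ennreal (exp (\<gamma> s (jump_path T Z s \<omega>) y) * \<alpha> s (jump_path T Z s \<omega>) y) \<partial>r (jump_path T Z s \<omega>)) \<partial>M) \<partial>lborel)"
proof -
  note [measurable] = \<alpha>
  have am[measurable (raw)]: "(\<lambda>w. \<alpha> (f w) (g w) (h w)) \<in> borel_measurable N"
    if "f \<in> borel_measurable N" "g \<in> measurable N S" "h \<in> measurable N S" for f g h and N :: "'n measure"
    using measurable_compose[OF measurable_Pair[OF that(1) measurable_Pair[OF that(2,3)]] \<alpha>] by simp
  have "(\<integral>\<^sup>+\<omega>. ennreal (jump_sum t \<alpha> (\<lambda>s. jump_path T Z s \<omega>)) \<partial>M) =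
      (\<integral>\<^sup>+\<omega>. (\<Sum>n. indicator {..t} (T (Suc n) \<omega>) * (\<lambda>(s, x, y). ennreal (\<alpha> s x y)) (T (Suc n) \<omega>, Z n \<omega>, Z (Suc n) \<omega>)) \<partial>M)"
  proof (rule nn_integral_cong_AE)
    show "AE \<omega> in M. ennreal (jump_sum t \<alpha> (\<lambda>s. jump_path T Z s \<omega>)) =
      (\<Sum>n. indicator {..t} (T (Suc n) \<omega>) * (\<lambda>(s, x, y). ennreal (\<alpha> s x y)) (T (Suc n) \<omega>, Z n \<omega>, Z (Suc n) \<omega>))"
      using alive AE_space
    proof eventually_elim
      case (elim \<omega>)
      obtain N where N: "t < T (Suc N) \<omega>" using elim by (auto simp: alive_def)
      have z: "indicator {..t} (T (Suc n) \<omega>) * \<alpha> (T (Suc n) \<omega>) (Z n \<omega>) (Z (Suc n) \<omega>) = 0" if "n \<notin> {..<N}" for n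
      proof -
        have "T (Suc N) \<omega> \<le> T (Suc n) \<omega>" using that by (simp add: T_le_iff[OF elim(2)])
        then show ?thesis using N by simp
      qed
      have "ennreal (jump_sum t \<alpha> (\<lambda>s. jump_path T Z s \<omega>)) =
          ennreal (\<Sum>n<N. indicator {..t} (T (Suc n) \<omega>) * \<alpha> (T (Suc n) \<omega>) (Z n \<omega>) (Z (Suc n) \<omega>))"
        using elim(1) by (simp only: jump_sum_eq[OF elim(2) t] if_True) (subst suminf_finite[of "{..<N}"], auto simp: z)
      also have "\<dots> = (\<Sum>n<N. ennreal (indicator {..t} (T (Suc n) \<omega>) * \<alpha> (T (Suc n) \<omega>) (Z n \<omega>) (Z (Suc n) \<omega>)))"
        by (rule sum_ennreal[symmetric]) (simp add: \<alpha>0)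
      also have "\<dots> = (\<Sum>n. ennreal (indicator {..t} (T (Suc n) \<omega>) * \<alpha> (T (Suc n) \<omega>) (Z n \<omega>) (Z (Suc n) \<omega>)))"
      proof (rule suminf_finite[symmetric])
        fix n assume "n \<notin> {..<N}"
        from z[OF this] show "ennreal (indicator {..t} (T (Suc n) \<omega>) * \<alpha> (T (Suc n) \<omega>) (Z n \<omega>) (Z (Suc n) \<omega>)) = 0"
          by (simp only: ennreal_0)
      qed simp
      also have "\<dots> = (\<Sum>n. indicator {..t} (T (Suc n) \<omega>) * (\<lambda>(s, x, y). ennreal (\<alpha> s x y)) (T (Suc n) \<omega>, Z n \<omega>, Z (Suc n) \<omega>))"
        by (intro suminf_cong) (simp add: indicator_def)
      finally show ?case .
    qed
  qed
  also have "\<dots> = (\<Sum>n. \<integral>\<^sup>+\<omega>. indicator {..t} (T (Suc n) \<omega>) * (\<lambda>(s, x, y). ennreal (\<alpha> s x y)) (T (Suc n) \<omega>, Z n \<omega>, Z (Suc n) \<omega>) \<partial>M)"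
    by (rule nn_integral_suminf) measurable
  also have "\<dots> = (\<integral>\<^sup>+s. indicator {0..t} s * (\<integral>\<^sup>+\<omega>. (if alive T s \<omega> then
      \<integral>\<^sup>+y. ennreal (exp (\<gamma> s (jump_path T Z s \<omega>) y)) * (\<lambda>(s, x, y). ennreal (\<alpha> s x y)) (s, jump_path T Z s \<omega>, y) \<partial>r (jump_path T Z s \<omega>) else 0) \<partial>M) \<partial>lborel)"
    by (rule levy_system) (measurable, use t in simp)
  also have "\<dots> = (\<integral>\<^sup>+s. indicator {0..t} s * (\<integral>\<^sup>+\<omega>. (\<integral>\<^sup>+y. ennreal (exp (\<gamma> s (jump_path T Z s \<omega>) y) * \<alpha> s (jump_path T Z s \<omega>) y) \<partial>r (jump_path T Z s \<omega>)) \<partial>M) \<partial>lborel)"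
  proof (rule nn_integral_cong)
    fix s
    show "indicator {0..t} s * (\<integral>\<^sup>+\<omega>. (if alive T s \<omega> then
      \<integral>\<^sup>+y. ennreal (exp (\<gamma> s (jump_path T Z s \<omega>) y)) * (\<lambda>(s, x, y). ennreal (\<alpha> s x y)) (s, jump_path T Z s \<omega>, y) \<partial>r (jump_path T Z s \<omega>) else 0) \<partial>M) =
      indicator {0..t} s * (\<integral>\<^sup>+\<omega>. (\<integral>\<^sup>+y. ennreal (exp (\<gamma> s (jump_path T Z s \<omega>) y) * \<alpha> s (jump_path T Z s \<omega>) y) \<partial>r (jump_path T Z s \<omega>)) \<partial>M)"
    proof (cases "s \<in> {0..t}")
      case True
      have "(\<integral>\<^sup>+\<omega>. (if alive T s \<omega> then
        \<integral>\<^sup>+y. ennreal (exp (\<gamma> s (jump_path T Z s \<omega>) y)) * (\<lambda>(s, x, y). ennreal (\<alpha> s x y)) (s, jump_path T Z s \<omega>, y) \<partial>r (jump_path T Z s \<omega>) else 0) \<partial>M) =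
        (\<integral>\<^sup>+\<omega>. (\<integral>\<^sup>+y. ennreal (exp (\<gamma> s (jump_path T Z s \<omega>) y) * \<alpha> s (jump_path T Z s \<omega>) y) \<partial>r (jump_path T Z s \<omega>)) \<partial>M)"
      proof (rule nn_integral_cong_AE)
        show "AE \<omega> in M. (if alive T s \<omega> then
          \<integral>\<^sup>+y. ennreal (exp (\<gamma> s (jump_path T Z s \<omega>) y)) * (\<lambda>(s, x, y). ennreal (\<alpha> s x y)) (s, jump_path T Z s \<omega>, y) \<partial>r (jump_path T Z s \<omega>) else 0) =
          (\<integral>\<^sup>+y. ennreal (exp (\<gamma> s (jump_path T Z s \<omega>) y) * \<alpha> s (jump_path T Z s \<omega>) y) \<partial>r (jump_path T Z s \<omega>))"
          using alive
        proof eventually_elim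
          case (elim \<omega>)
          then obtain n where "t < T (Suc n) \<omega>" by (auto simp: alive_def)
          then have "alive T s \<omega>" using True unfolding alive_def by (intro exI[of _ n]) auto
          then show ?case by (simp add: ennreal_mult \<alpha>0)
        qed
      qed
      then show ?thesis by simp
    qed simp
  qed
  finally show ?thesis .
qed

end

section \<open>Linear response\<close>

lemma measurable_uncurry:
  assumes "(\<lambda>(s, x). f s x) \<in> measurable (A \<Otimes>\<^sub>M B) N" "h \<in> measurable C A" "k \<in> measurable C B"
  shows "(\<lambda>w. f (h w) (k w)) \<in> measurable C N"
  using measurable_compose[OF measurable_Pair[OF assms(2,3)] assms(1)] by simp

lemma has_linear_responseI:
  assumes l: "0 < l" and eq: "\<And>lam. \<bar>lam\<bar> \<le> l \<Longrightarrow> integrable (M lam) (Y lam) \<and> (\<integral>\<omega>. Y lam \<omega> \<partial>M lam) = \<Phi> lam"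
    and deriv: "(\<Phi> has_real_derivative c) (at 0)"
  shows "has_linear_response M Y c"
  unfolding has_linear_response_def
proof
  show "\<forall>\<^sub>F lam in nhds 0. integrable (M lam) (Y lam)"
    unfolding eventually_nhds_metric using l eq by (intro exI[of _ l]) auto
  show "((\<lambda>lam. \<integral>\<omega>. Y lam \<omega> \<partial>M lam) has_real_derivative c) (at 0)"
    by (rule has_field_derivative_transform_within[OF deriv l UNIV_I]) (use eq in auto)
qed

context response
begin

abbreviation "pg \<equiv> psi r rstar g"

section \<open>Tools shared by the three response formulas\<close>

lemma stationary_pair_integral:
  fixes f :: "'a \<times> 'a \<Rightarrow> real"
  assumes [measurable]: "f \<in> borel_measurable (S \<Otimes>\<^sub>M S)" and ab: "0 \<le> a" "0 \<le> b" and h: "0 \<le> h"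
  shows "(\<integral>\<omega>. f (X (a + h) \<omega>, X (b + h) \<omega>) \<partial>P) = (\<integral>\<omega>. f (X a \<omega>, X b \<omega>) \<partial>P)"
proof -
  let ?d = "\<lambda>a b. distr P (S \<Otimes>\<^sub>M S) (\<lambda>\<omega>. (X a \<omega>, X b \<omega>))"
  have "?d (a + h) (b + h) = ?d a b"
  proof (rule measure_eqI)
    fix B assume "B \<in> sets (?d (a + h) (b + h))"
    then have [measurable]: "B \<in> sets (S \<Otimes>\<^sub>M S)" by simp
    have em: "emeasure (?d a b) B = (\<integral>\<^sup>+\<omega>. indicator B (X a \<omega>, X b \<omega>) \<partial>P)" for a b
    proof -
      have "emeasure (?d a b) B = (\<integral>\<^sup>+z. indicator B z \<partial>?d a b)" by simp
      also have "\<dots> = (\<integral>\<^sup>+\<omega>. indicator B (X a \<omega>, X b \<omega>) \<partial>P)" by (rule nn_integral_distr) measurable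
      finally show ?thesis .
    qed
    show "emeasure (?d (a + h) (b + h)) B = emeasure (?d a b) B"
      unfolding em by (rule stationary_pair[OF _ ab h]) measurable
  qed simp
  then have "(\<integral>z. f z \<partial>?d (a + h) (b + h)) = (\<integral>z. f z \<partial>?d a b)" by simp
  then show ?thesis by (simp add: integral_distr)
qed

text \<open>What \<open>weighted_derivative\<close> asks of the density, at one good path. The
  factor 2 arises because \<open>Mart\<close> is bounded by \<open>Gabs\<close> plus
  \<open>A\<close>, each at most \<open>W l\<close>.\<close>

lemma density_facts:
  assumes l: "0 < l" "l \<le> 1" and \<omega>: "good \<omega>" and s: "s \<le> t"
  shows "(\<forall>lam. \<bar>lam\<bar> \<le> l \<longrightarrow> \<bar>D lam s \<omega> - 1\<bar> \<le> \<bar>lam\<bar> * W l \<omega> \<and> 0 \<le> D lam s \<omega> \<and> D lam s \<omega> \<le> W l \<omega>) \<and>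
    1 \<le> W l \<omega> \<and> \<bar>Mart s \<omega>\<bar> \<le> 2 * W l \<omega> \<and> ((\<lambda>lam. D lam s \<omega>) has_real_derivative Mart s \<omega>) (at 0)"
  using D_bounds[OF l \<omega>] s abs_Mart_le[OF \<omega> s] D_deriv[OF \<omega> s] by (auto simp: D_def)

text \<open>\<open>good\<close> is known only up to a null set. A measurable null set
  \<open>N\<close> containing its complement makes the product rule for almost-everywhere statements
  applicable.\<close>

lemma AE_good_L: "u \<le> t \<Longrightarrow> AE z in L u \<Otimes>\<^sub>M P. fst z \<in> {0..u} \<and> good (snd z)"
proof -
  assume "u \<le> t"
  interpret LP: pair_sigma_finite "L u" P by (rule pair_L_P)
  obtain N where N: "{\<omega> \<in> space P. \<not> good \<omega>} \<subseteq> N" "emeasure P N = 0" "N \<in> sets P"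
    using AE_good by (rule AE_E)
  have "AE z in L u \<Otimes>\<^sub>M P. snd z \<notin> N"
  proof (rule LP.AE_pair_measure)
    show "{z \<in> space (L u \<Otimes>\<^sub>M P). snd z \<notin> N} \<in> sets (L u \<Otimes>\<^sub>M P)"
      using N(3) by measurable
    show "AE s in L u. AE \<omega> in P. snd (s, \<omega>) \<notin> N"
      using N by (auto intro!: AE_I2 AE_not_in simp: null_sets_def)
  qed
  then show ?thesis using AE_space
  proof eventually_elim
    case (elim z)
    then show ?case using N(1) by (auto simp: space_pair_measure space_restrict_space)
  qed
qed

lemma measurable_X_L [measurable]: "(\<lambda>z. X (fst z) (snd z)) \<in> measurable (L u \<Otimes>\<^sub>M P) S"
  by measurable

lemma measurable_X'_L: "(\<lambda>z. X' lam (fst z) (snd z)) \<in> measurable (L u \<Otimes>\<^sub>M M lam) S"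
proof -
  interpret M: tilted_jump "M lam" S t r "lg lam" "\<bar>lam\<bar> * K" \<pi> "T' lam" "Z' lam" by (rule perturbed_tilted)
  show ?thesis by measurable
qed

lemma measurable_X': "X' lam s \<in> measurable (M lam) S"
proof -
  interpret M: tilted_jump "M lam" S t r "lg lam" "\<bar>lam\<bar> * K" \<pi> "T' lam" "Z' lam" by (rule perturbed_tilted)
  show ?thesis by measurable
qed

lemma prob_space_M: "prob_space (M lam)"
  using perturbed[of lam] by (simp add: jump_process_def)

lemma pair_L_M: "pair_sigma_finite (L u) (M lam)"
proof -
  interpret L: finite_measure "L u" by (rule finite_measure_L)
  interpret M: prob_space "M lam" by (rule prob_space_M)
  show ?thesis by unfold_locales
qed

text \<open>\<open>measure_change\<close> integrated over the time window, so that time-dependent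
  observables are treated as functions on a product space.\<close>

lemma joint_change:
  assumes l: "0 < l" "l \<le> 1" and W1: "(\<integral>\<^sup>+\<omega>. ennreal (W l \<omega>) \<partial>P) < \<top>" and lam: "\<bar>lam\<bar> \<le> l"
    and F: "F \<in> borel_measurable (borel \<Otimes>\<^sub>M S)"
  shows "(\<integral>\<^sup>+z. F (fst z, X' lam (fst z) (snd z)) \<partial>(L t \<Otimes>\<^sub>M M lam)) =
    (\<integral>\<^sup>+z. F (fst z, X (fst z) (snd z)) * ennreal (D lam (fst z) (snd z)) \<partial>(L t \<Otimes>\<^sub>M P))"
proof -
  note [measurable] = F measurable_X'_L
  interpret LP: pair_sigma_finite "L t" P by (rule pair_L_P)
  interpret LM: pair_sigma_finite "L t" "M lam" by (rule pair_L_M)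
  have "(\<integral>\<^sup>+z. F (fst z, X' lam (fst z) (snd z)) \<partial>(L t \<Otimes>\<^sub>M M lam)) =
      (\<integral>\<^sup>+s. \<integral>\<^sup>+\<omega>. F (s, X' lam s \<omega>) \<partial>M lam \<partial>L t)"
    by (subst LM.M2.nn_integral_fst[symmetric]) auto
  also have "\<dots> = (\<integral>\<^sup>+s. \<integral>\<^sup>+\<omega>. F (s, X s \<omega>) * ennreal (D lam s \<omega>) \<partial>P \<partial>L t)"
  proof (rule nn_integral_cong)
    fix s assume "s \<in> space (L t)"
    then have "s \<in> {0..t}" by (simp add: space_restrict_space)
    then show "(\<integral>\<^sup>+\<omega>. F (s, X' lam s \<omega>) \<partial>M lam) = (\<integral>\<^sup>+\<omega>. F (s, X s \<omega>) * ennreal (D lam s \<omega>) \<partial>P)"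
      by (intro measure_change[OF l W1 lam]) measurable
  qed
  also have "\<dots> = (\<integral>\<^sup>+z. F (fst z, X (fst z) (snd z)) * ennreal (D lam (fst z) (snd z)) \<partial>(L t \<Otimes>\<^sub>M P))"
    by (subst nn_integral_fst[symmetric]) auto
  finally show ?thesis .
qed

lemma psi_reflected:
  assumes v: "v \<in> borel_measurable S" and u: "u \<in> {0..t}" and l: "0 < l" "l \<le> 1"
  shows "(\<integral>\<^sup>+s. indicator {0..u} s * (\<integral>\<^sup>+\<omega>. ennreal \<bar>v (X u \<omega>) * pg (u - s) (X (u - s) \<omega>)\<bar> \<partial>P) \<partial>lborel)
    \<le> 2 * (\<integral>\<^sup>+\<omega>. ennreal (\<bar>v (X u \<omega>)\<bar> * W l \<omega>) \<partial>P)"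
proof -
  note [measurable] = v
  have "(\<integral>\<^sup>+s. indicator {0..u} s * (\<integral>\<^sup>+\<omega>. ennreal \<bar>v (X u \<omega>) * pg (u - s) (X (u - s) \<omega>)\<bar> \<partial>P) \<partial>lborel) =
      (\<integral>\<^sup>+s. indicator {0..u} s * (\<integral>\<^sup>+\<omega>. ennreal \<bar>v (X u \<omega>) * pg s (X s \<omega>)\<bar> \<partial>P) \<partial>lborel)"
    by (rule reflect_nn_integral[where f = "\<lambda>s. \<integral>\<^sup>+\<omega>. ennreal \<bar>v (X u \<omega>) * pg s (X s \<omega>)\<bar> \<partial>P"]) measurable
  also have "\<dots> = (\<integral>\<^sup>+s. indicator {0..u} s * (\<integral>\<^sup>+\<omega>. ennreal \<bar>v (X u \<omega>)\<bar> * ennreal \<bar>pg s (X s \<omega>)\<bar> \<partial>P) \<partial>lborel)"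
    by (simp add: abs_mult ennreal_mult)
  also have "\<dots> \<le> 2 * (\<integral>\<^sup>+\<omega>. ennreal \<bar>v (X u \<omega>)\<bar> * ennreal (W l \<omega>) \<partial>P)"
    by (rule psi_bound[OF _ u l]) measurable
  also have "\<dots> = 2 * (\<integral>\<^sup>+\<omega>. ennreal (\<bar>v (X u \<omega>)\<bar> * W l \<omega>) \<partial>P)"
    using W_nonneg[OF l(1)] by (simp add: ennreal_mult)
  finally show ?thesis .
qed

text \<open>Both times on the left are shifted by s - u. This links the form of the formulas with
  the initial state to the form with the state at time s - u.\<close>

lemma shift_integral:
  assumes v: "v \<in> borel_measurable S" and su: "0 \<le> u" "u \<le> s"
  shows "(\<integral>\<omega>. v (X u \<omega>) * pg (s - u) (X 0 \<omega>) \<partial>P) = (\<integral>\<omega>. v (X s \<omega>) * pg (s - u) (X (s - u) \<omega>) \<partial>P)"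
  using stationary_pair_integral[of "\<lambda>(x, y). v x * pg (s - u) y" u 0 "s - u"] v su by simp

lemma shift_nn_integral:
  assumes v: "v \<in> borel_measurable S" and su: "0 \<le> u" "u \<le> s"
  shows "(\<integral>\<^sup>+\<omega>. ennreal \<bar>v (X u \<omega>) * pg (s - u) (X 0 \<omega>)\<bar> \<partial>P) = (\<integral>\<^sup>+\<omega>. ennreal \<bar>v (X s \<omega>) * pg (s - u) (X (s - u) \<omega>)\<bar> \<partial>P)"
  using stationary_pair[of "\<lambda>(x, y). ennreal \<bar>v x * pg (s - u) y\<bar>" u 0 "s - u"] v su by simp

section \<open>Response at a fixed time\<close>

text \<open>\<open>weighted_derivative\<close> for the observable v(X_t), constant in lambda, gives
  the expectation of v(X_t) times \<open>Mart\<close>; \<open>mart_identity\<close> and a reflection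
  of time bring it into the required form. Absolute convergence of the second form is inherited from
  the first by stationarity.\<close>

lemma response_at_time:
  assumes p: "(1::ennreal) < p" and v: "v \<in> borel_measurable S"
    and Lp: "Lp_norm P p (\<lambda>\<omega>. ennreal \<bar>v (X t \<omega>)\<bar>) < \<top>"
  shows "has_linear_response M (\<lambda>lam \<omega>. v (X' lam t \<omega>))
      (LINT s:{0..t}|lborel. (\<integral>\<omega>. v (X t \<omega>) * pg (t - s) (X (t - s) \<omega>) \<partial>P))"
    "time_integrable t P (\<lambda>s \<omega>. v (X t \<omega>) * pg (t - s) (X (t - s) \<omega>))"
    "time_integrable t P (\<lambda>s \<omega>. v (X s \<omega>) * pg (t - s) (X 0 \<omega>))"
proof -
  note [measurable] = v
  have tt: "t \<in> {0..t}" using t_pos by simp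
  obtain l C where l: "0 < l" "l \<le> 1" and C: "C < \<top>" and W1: "(\<integral>\<^sup>+\<omega>. ennreal (W l \<omega>) \<partial>P) < \<top>"
    and WC: "\<And>f. f \<in> borel_measurable P \<Longrightarrow> (\<integral>\<^sup>+\<omega>. f \<omega> * ennreal (W l \<omega>) \<partial>P) \<le> Lp_norm P p f * C"
    by (rule Lp_bound_W[OF p]) blast
  have "(\<integral>\<^sup>+\<omega>. ennreal \<bar>v (X t \<omega>)\<bar> * ennreal (W l \<omega>) \<partial>P) \<le> Lp_norm P p (\<lambda>\<omega>. ennreal \<bar>v (X t \<omega>)\<bar>) * C"
    by (rule WC) measurable
  also have "\<dots> < \<top>" using Lp C by (simp add: ennreal_mult_less_top)
  finally have fin: "(\<integral>\<^sup>+\<omega>. ennreal (\<bar>v (X t \<omega>)\<bar> * W l \<omega>) \<partial>P) < \<top>"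
    using W_nonneg[OF l(1)] by (simp add: ennreal_mult)
  have ibW: "integrable P (\<lambda>\<omega>. \<bar>v (X t \<omega>)\<bar> * W l \<omega>)"
    using fin W_nonneg[OF l(1)] by (intro integrableI_nonneg) auto
  note wd = weighted_derivative[where Q = P and d = "\<lambda>lam. D lam t" and b = "\<lambda>lam \<omega>. v (X t \<omega>)" and b' = "\<lambda>_. 0"
      and bb = "\<lambda>\<omega>. \<bar>v (X t \<omega>)\<bar>" and w = "W l" and m = "Mart t" and l = l and C = 0, OF l(1) order_refl]
  have d: "AE z in P. (\<forall>lam. \<bar>lam\<bar> \<le> l \<longrightarrow> \<bar>D lam t z - 1\<bar> \<le> \<bar>lam\<bar> * W l z \<and> 0 \<le> D lam t z \<and> D lam t z \<le> W l z) \<and>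
      1 \<le> W l z \<and> \<bar>Mart t z\<bar> \<le> 2 * W l z \<and> ((\<lambda>lam. D lam t z) has_real_derivative Mart t z) (at 0)"
    using AE_good by eventually_elim (rule density_facts[OF l _ order_refl])
  have b: "AE z in P. (\<forall>lam. \<bar>lam\<bar> \<le> l \<longrightarrow> \<bar>v (X t z) - v (X t z)\<bar> \<le> \<bar>lam\<bar> * (0 * \<bar>v (X t z)\<bar>)) \<and> \<bar>v (X t z)\<bar> \<le> \<bar>v (X t z)\<bar> \<and>
      ((\<lambda>lam. v (X t z)) has_real_derivative 0) (at 0)" by simp
  have 1: "integrable P (\<lambda>\<omega>. v (X t \<omega>) * D lam t \<omega>)" if "\<bar>lam\<bar> \<le> l" for lam
    by (rule wd(1)[OF _ _ _ _ _ _ d b ibW that]) measurable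
  have 2: "((\<lambda>lam. \<integral>\<omega>. v (X t \<omega>) * D lam t \<omega> \<partial>P) has_real_derivative ((\<integral>\<omega>. 0 \<partial>P) + (\<integral>\<omega>. v (X t \<omega>) * Mart t \<omega> \<partial>P))) (at 0)"
    by (rule wd(4)[OF _ _ _ _ _ _ d b ibW]) measurable
  have val: "(\<integral>\<omega>. v (X t \<omega>) * Mart t \<omega> \<partial>P) = (LINT s:{0..t}|lborel. (\<integral>\<omega>. v (X t \<omega>) * pg (t - s) (X (t - s) \<omega>) \<partial>P))"
    unfolding mart_identity(2)[OF v tt l fin]
    by (rule reflect_integral[symmetric, where f = "\<lambda>s. \<integral>\<omega>. v (X t \<omega>) * pg s (X s \<omega>) \<partial>P"])
  show "has_linear_response M (\<lambda>lam \<omega>. v (X' lam t \<omega>))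
      (LINT s:{0..t}|lborel. (\<integral>\<omega>. v (X t \<omega>) * pg (t - s) (X (t - s) \<omega>) \<partial>P))"
  proof (rule has_linear_responseI[OF l(1)])
    show "((\<lambda>lam. \<integral>\<omega>. v (X t \<omega>) * D lam t \<omega> \<partial>P) has_real_derivative
        (LINT s:{0..t}|lborel. (\<integral>\<omega>. v (X t \<omega>) * pg (t - s) (X (t - s) \<omega>) \<partial>P))) (at 0)"
      using 2 by (simp add: val)
    fix lam :: real assume lam: "\<bar>lam\<bar> \<le> l"
    have "D lam t \<in> borel_measurable P" by measurable
    from integral_of_measure_change[OF measurable_X' measurable_X this _ measure_change[OF l W1 lam _ tt] v 1[OF lam]]
    show "integrable (M lam) (\<lambda>\<omega>. v (X' lam t \<omega>)) \<and> (\<integral>\<omega>. v (X' lam t \<omega>) \<partial>M lam) = (\<integral>\<omega>. v (X t \<omega>) * D lam t \<omega> \<partial>P)"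
      by (simp add: D_def)
  qed
  have bnd: "(\<integral>\<^sup>+s. indicator {0..t} s * (\<integral>\<^sup>+\<omega>. ennreal \<bar>v (X t \<omega>) * pg (t - s) (X (t - s) \<omega>)\<bar> \<partial>P) \<partial>lborel) < \<top>"
    using psi_reflected[OF v tt l] fin by (auto intro: order_le_less_trans simp: ennreal_mult_less_top)
  show "time_integrable t P (\<lambda>s \<omega>. v (X t \<omega>) * pg (t - s) (X (t - s) \<omega>))"
    unfolding time_integrable_def
  proof (rule integrableI_bounded)
    show m: "(\<lambda>(s, \<omega>). v (X t \<omega>) * pg (t - s) (X (t - s) \<omega>)) \<in> borel_measurable (L t \<Otimes>\<^sub>M P)" by measurable
    show "(\<integral>\<^sup>+z. ennreal (norm (case z of (s, \<omega>) \<Rightarrow> v (X t \<omega>) * pg (t - s) (X (t - s) \<omega>))) \<partial>(L t \<Otimes>\<^sub>M P)) < \<infinity>"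
      using bnd by (subst nn_integral_L_P) auto
  qed
  show "time_integrable t P (\<lambda>s \<omega>. v (X s \<omega>) * pg (t - s) (X 0 \<omega>))"
    unfolding time_integrable_def
  proof (rule integrableI_bounded)
    show m: "(\<lambda>(s, \<omega>). v (X s \<omega>) * pg (t - s) (X 0 \<omega>)) \<in> borel_measurable (L t \<Otimes>\<^sub>M P)" by measurable
    have "(\<integral>\<^sup>+z. ennreal (norm (case z of (s, \<omega>) \<Rightarrow> v (X s \<omega>) * pg (t - s) (X 0 \<omega>))) \<partial>(L t \<Otimes>\<^sub>M P)) =
        (\<integral>\<^sup>+s. indicator {0..t} s * (\<integral>\<^sup>+\<omega>. ennreal \<bar>v (X s \<omega>) * pg (t - s) (X 0 \<omega>)\<bar> \<partial>P) \<partial>lborel)"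
      by (subst nn_integral_L_P) auto
    also have "\<dots> = (\<integral>\<^sup>+s. indicator {0..t} s * (\<integral>\<^sup>+\<omega>. ennreal \<bar>v (X t \<omega>) * pg (t - s) (X (t - s) \<omega>)\<bar> \<partial>P) \<partial>lborel)"
    proof (rule nn_integral_cong)
      fix s
      show "indicator {0..t} s * (\<integral>\<^sup>+\<omega>. ennreal \<bar>v (X s \<omega>) * pg (t - s) (X 0 \<omega>)\<bar> \<partial>P) =
        indicator {0..t} s * (\<integral>\<^sup>+\<omega>. ennreal \<bar>v (X t \<omega>) * pg (t - s) (X (t - s) \<omega>)\<bar> \<partial>P)"
        using shift_nn_integral[OF v, of s t] by (cases "s \<in> {0..t}") auto
    qed
    finally show "(\<integral>\<^sup>+z. ennreal (norm (case z of (s, \<omega>) \<Rightarrow> v (X s \<omega>) * pg (t - s) (X 0 \<omega>))) \<partial>(L t \<Otimes>\<^sub>M P)) < \<infinity>"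
      using bnd by simp
  qed
qed

section \<open>Response of time integrals\<close>

lemma triangle_integrableI:
  fixes f :: "real \<Rightarrow> real \<Rightarrow> 'w \<Rightarrow> real"
  assumes f: "(\<lambda>((s, u), \<omega>). f s u \<omega>) \<in> borel_measurable ((borel \<Otimes>\<^sub>M borel) \<Otimes>\<^sub>M P)"
    and fin: "(\<integral>\<^sup>+s. indicator {0..t} s * (\<integral>\<^sup>+u. indicator {0..s} u * (\<integral>\<^sup>+\<omega>. ennreal \<bar>f s u \<omega>\<bar> \<partial>P) \<partial>lborel) \<partial>lborel) < \<top>"
  shows "triangle_integrable t P f"
  unfolding triangle_integrable_def
proof (rule integrableI_bounded)
  let ?T = "{(s, u). 0 \<le> u \<and> u \<le> s \<and> s \<le> t}"
  let ?R = "restrict_space (lborel \<Otimes>\<^sub>M lborel) ?T"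
  have T: "?T \<in> sets (lborel \<Otimes>\<^sub>M lborel)"
  proof -
    have "?T = {z \<in> space (lborel \<Otimes>\<^sub>M lborel :: (real \<times> real) measure). 0 \<le> snd z \<and> snd z \<le> fst z \<and> fst z \<le> t}"
      by (auto simp: space_pair_measure)
    also have "\<dots> \<in> sets (lborel \<Otimes>\<^sub>M lborel)" by measurable
    finally show ?thesis .
  qed
  have id: "(\<lambda>z. z) \<in> measurable ?R (borel \<Otimes>\<^sub>M borel)"
    by (rule measurable_restrict_space1) (simp cong: measurable_cong_sets)
  have "(\<lambda>z. (fst z, snd z)) \<in> measurable (?R \<Otimes>\<^sub>M P) ((borel \<Otimes>\<^sub>M borel) \<Otimes>\<^sub>M P)"
    by (rule measurable_Pair[OF measurable_compose[OF measurable_fst id] measurable_snd])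
  from measurable_compose[OF this f]
  show m: "(\<lambda>((s, u), \<omega>). f s u \<omega>) \<in> borel_measurable (?R \<Otimes>\<^sub>M P)" by simp
  have fm: "(\<lambda>z. \<integral>\<^sup>+\<omega>. ennreal \<bar>f (fst z) (snd z) \<omega>\<bar> \<partial>P) \<in> borel_measurable (borel \<Otimes>\<^sub>M borel)"
    using f by (intro borel_measurable_nn_integral) (simp add: case_prod_unfold)
  have "(\<integral>\<^sup>+z. ennreal (norm ((\<lambda>((s, u), \<omega>). f s u \<omega>) z)) \<partial>(?R \<Otimes>\<^sub>M P)) =
      (\<integral>\<^sup>+z. \<integral>\<^sup>+\<omega>. ennreal \<bar>f (fst z) (snd z) \<omega>\<bar> \<partial>P \<partial>?R)"
    using m by (subst nn_integral_fst[symmetric]) (auto simp: case_prod_unfold)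
  also have "\<dots> = (\<integral>\<^sup>+z. (\<integral>\<^sup>+\<omega>. ennreal \<bar>f (fst z) (snd z) \<omega>\<bar> \<partial>P) * indicator ?T z \<partial>(lborel \<Otimes>\<^sub>M lborel))"
    using T by (subst nn_integral_restrict_space) (auto simp: space_pair_measure)
  also have "\<dots> = (\<integral>\<^sup>+s. \<integral>\<^sup>+u. (\<integral>\<^sup>+\<omega>. ennreal \<bar>f s u \<omega>\<bar> \<partial>P) * indicator ?T (s, u) \<partial>lborel \<partial>lborel)"
  proof -
    have "(\<lambda>z. (\<integral>\<^sup>+\<omega>. ennreal \<bar>f (fst z) (snd z) \<omega>\<bar> \<partial>P) * indicator ?T z) \<in> borel_measurable (lborel \<Otimes>\<^sub>M lborel)"
      using fm T by (intro borel_measurable_times_ennreal borel_measurable_indicator) (simp_all cong: measurable_cong_sets)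
    from lborel.nn_integral_fst[OF this] show ?thesis by simp
  qed
  also have "\<dots> = (\<integral>\<^sup>+s. indicator {0..t} s * (\<integral>\<^sup>+u. indicator {0..s} u * (\<integral>\<^sup>+\<omega>. ennreal \<bar>f s u \<omega>\<bar> \<partial>P) \<partial>lborel) \<partial>lborel)"
  proof (rule nn_integral_cong)
    fix s
    show "(\<integral>\<^sup>+u. (\<integral>\<^sup>+\<omega>. ennreal \<bar>f s u \<omega>\<bar> \<partial>P) * indicator ?T (s, u) \<partial>lborel) =
      indicator {0..t} s * (\<integral>\<^sup>+u. indicator {0..s} u * (\<integral>\<^sup>+\<omega>. ennreal \<bar>f s u \<omega>\<bar> \<partial>P) \<partial>lborel)"
    proof (cases "s \<in> {0..t}")
      case True
      then have "(\<integral>\<^sup>+u. (\<integral>\<^sup>+\<omega>. ennreal \<bar>f s u \<omega>\<bar> \<partial>P) * indicator ?T (s, u) \<partial>lborel) = (\<integral>\<^sup>+u. indicator {0..s} u * (\<integral>\<^sup>+\<omega>. ennreal \<bar>f s u \<omega>\<bar> \<partial>P) \<partial>lborel)"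
        by (intro nn_integral_cong) (auto simp: indicator_def)
      then show ?thesis using True by simp
    next
      case False
      then have "indicator ?T (s, u) = (0::ennreal)" for u by (auto simp: indicator_def)
      then show ?thesis using False by simp
    qed
  qed
  finally show "(\<integral>\<^sup>+z. ennreal (norm ((\<lambda>((s, u), \<omega>). f s u \<omega>) z)) \<partial>(?R \<Otimes>\<^sub>M P)) < \<infinity>"
    using fin by simp
qed

text \<open>\<open>mart_identity\<close> with u = s at each time s, integrated over the window. The
  bounds of \<open>psi_reflected\<close> at fixed \<open>s\<close> add up to absolute convergence on
  the triangle.\<close>

lemma triangle_response:
  assumes l: "0 < l" "l \<le> 1" and w: "(\<lambda>(s, x). w s x) \<in> borel_measurable (borel \<Otimes>\<^sub>M S)"
    and fin: "(\<integral>\<^sup>+z. ennreal (\<bar>w (fst z) (X (fst z) (snd z))\<bar> * W l (snd z)) \<partial>(L t \<Otimes>\<^sub>M P)) < \<top>"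
  shows "triangle_integrable t P (\<lambda>s u \<omega>. w s (X s \<omega>) * pg (s - u) (X (s - u) \<omega>))"
    "triangle_integrable t P (\<lambda>s u \<omega>. w s (X u \<omega>) * pg (s - u) (X 0 \<omega>))"
    "integrable (L t \<Otimes>\<^sub>M P) (\<lambda>z. w (fst z) (X (fst z) (snd z)) * Mart (fst z) (snd z)) \<Longrightarrow>
     (\<integral>z. w (fst z) (X (fst z) (snd z)) * Mart (fst z) (snd z) \<partial>(L t \<Otimes>\<^sub>M P)) =
     (LINT s:{0..t}|lborel. (LINT u:{0..s}|lborel. (\<integral>\<omega>. w s (X s \<omega>) * pg (s - u) (X (s - u) \<omega>) \<partial>P)))"
proof -
  note wm[measurable (raw)] = measurable_uncurry[OF w]
  interpret LP: pair_sigma_finite "L t" P by (rule pair_L_P)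
  have ws: "w s \<in> borel_measurable S" for s by measurable
  have fin': "(\<integral>\<^sup>+s. indicator {0..t} s * (\<integral>\<^sup>+\<omega>. ennreal (\<bar>w s (X s \<omega>)\<bar> * W l \<omega>) \<partial>P) \<partial>lborel) < \<top>"
    using fin by (subst (asm) nn_integral_L_P) auto
  have "(\<integral>\<^sup>+s. indicator {0..t} s * (\<integral>\<^sup>+u. indicator {0..s} u * (\<integral>\<^sup>+\<omega>. ennreal \<bar>w s (X s \<omega>) * pg (s - u) (X (s - u) \<omega>)\<bar> \<partial>P) \<partial>lborel) \<partial>lborel) \<le>
      (\<integral>\<^sup>+s. 2 * (indicator {0..t} s * (\<integral>\<^sup>+\<omega>. ennreal (\<bar>w s (X s \<omega>)\<bar> * W l \<omega>) \<partial>P)) \<partial>lborel)"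
  proof (rule nn_integral_mono)
    fix s
    show "indicator {0..t} s * (\<integral>\<^sup>+u. indicator {0..s} u * (\<integral>\<^sup>+\<omega>. ennreal \<bar>w s (X s \<omega>) * pg (s - u) (X (s - u) \<omega>)\<bar> \<partial>P) \<partial>lborel) \<le>
      2 * (indicator {0..t} s * (\<integral>\<^sup>+\<omega>. ennreal (\<bar>w s (X s \<omega>)\<bar> * W l \<omega>) \<partial>P))"
      using psi_reflected[OF ws _ l, of s s] by (cases "s \<in> {0..t}") auto
  qed
  also have "\<dots> = 2 * (\<integral>\<^sup>+s. indicator {0..t} s * (\<integral>\<^sup>+\<omega>. ennreal (\<bar>w s (X s \<omega>)\<bar> * W l \<omega>) \<partial>P) \<partial>lborel)"
    by (rule nn_integral_cmult) measurable
  also have "\<dots> < \<top>" using fin' by (simp add: ennreal_mult_less_top)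
  finally have bnd: "(\<integral>\<^sup>+s. indicator {0..t} s * (\<integral>\<^sup>+u. indicator {0..s} u * (\<integral>\<^sup>+\<omega>. ennreal \<bar>w s (X s \<omega>) * pg (s - u) (X (s - u) \<omega>)\<bar> \<partial>P) \<partial>lborel) \<partial>lborel) < \<top>" .
  show "triangle_integrable t P (\<lambda>s u \<omega>. w s (X s \<omega>) * pg (s - u) (X (s - u) \<omega>))"
  proof (rule triangle_integrableI[OF _ bnd])
    have "(\<lambda>z. w (fst (fst z)) (X (fst (fst z)) (snd z)) * pg (fst (fst z) - snd (fst z)) (X (fst (fst z) - snd (fst z)) (snd z)))
        \<in> borel_measurable ((borel \<Otimes>\<^sub>M borel) \<Otimes>\<^sub>M P)" by measurable
    then show "(\<lambda>((s, u), \<omega>). w s (X s \<omega>) * pg (s - u) (X (s - u) \<omega>)) \<in> borel_measurable ((borel \<Otimes>\<^sub>M borel) \<Otimes>\<^sub>M P)"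
      by (simp add: case_prod_unfold)
  qed
  have eq: "(\<integral>\<^sup>+s. indicator {0..t} s * (\<integral>\<^sup>+u. indicator {0..s} u * (\<integral>\<^sup>+\<omega>. ennreal \<bar>w s (X u \<omega>) * pg (s - u) (X 0 \<omega>)\<bar> \<partial>P) \<partial>lborel) \<partial>lborel) =
      (\<integral>\<^sup>+s. indicator {0..t} s * (\<integral>\<^sup>+u. indicator {0..s} u * (\<integral>\<^sup>+\<omega>. ennreal \<bar>w s (X s \<omega>) * pg (s - u) (X (s - u) \<omega>)\<bar> \<partial>P) \<partial>lborel) \<partial>lborel)"
  proof (rule nn_integral_cong, rule arg_cong2[where f = "(*)", OF refl], rule nn_integral_cong)
    fix s u
    show "indicator {0..s} u * (\<integral>\<^sup>+\<omega>. ennreal \<bar>w s (X u \<omega>) * pg (s - u) (X 0 \<omega>)\<bar> \<partial>P) =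
      indicator {0..s} u * (\<integral>\<^sup>+\<omega>. ennreal \<bar>w s (X s \<omega>) * pg (s - u) (X (s - u) \<omega>)\<bar> \<partial>P)"
      using shift_nn_integral[OF ws, of u s s] by (cases "u \<in> {0..s}") auto
  qed
  show "triangle_integrable t P (\<lambda>s u \<omega>. w s (X u \<omega>) * pg (s - u) (X 0 \<omega>))"
  proof (rule triangle_integrableI)
    have "(\<lambda>z. w (fst (fst z)) (X (snd (fst z)) (snd z)) * pg (fst (fst z) - snd (fst z)) (X 0 (snd z)))
        \<in> borel_measurable ((borel \<Otimes>\<^sub>M borel) \<Otimes>\<^sub>M P)" by measurable
    then show "(\<lambda>((s, u), \<omega>). w s (X u \<omega>) * pg (s - u) (X 0 \<omega>)) \<in> borel_measurable ((borel \<Otimes>\<^sub>M borel) \<Otimes>\<^sub>M P)"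
      by (simp add: case_prod_unfold)
  qed (simp only: eq bnd)
  assume int: "integrable (L t \<Otimes>\<^sub>M P) (\<lambda>z. w (fst z) (X (fst z) (snd z)) * Mart (fst z) (snd z))"
  have "(\<integral>z. w (fst z) (X (fst z) (snd z)) * Mart (fst z) (snd z) \<partial>(L t \<Otimes>\<^sub>M P)) =
      (\<integral>s. (\<integral>\<omega>. w s (X s \<omega>) * Mart s \<omega> \<partial>P) \<partial>L t)"
    using LP.integral_fst'[OF int] by simp
  also have "\<dots> = (\<integral>s. (LINT u:{0..s}|lborel. (\<integral>\<omega>. w s (X s \<omega>) * pg (s - u) (X (s - u) \<omega>) \<partial>P)) \<partial>L t)"
  proof (rule integral_cong_AE)
    have "(\<lambda>s. \<integral>\<omega>. w s (X s \<omega>) * Mart s \<omega> \<partial>P) \<in> borel_measurable borel" by measurable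
    then show "(\<lambda>s. \<integral>\<omega>. w s (X s \<omega>) * Mart s \<omega> \<partial>P) \<in> borel_measurable (L t)"
      by (rule measurable_compose[OF measurable_ident_restrict_lborel])
    have "(\<lambda>s. LINT u:{0..s}|lborel. (\<integral>\<omega>. w s (X s \<omega>) * pg (s - u) (X (s - u) \<omega>) \<partial>P)) \<in> borel_measurable borel"
      unfolding set_lebesgue_integral_def by measurable
    then show "(\<lambda>s. LINT u:{0..s}|lborel. (\<integral>\<omega>. w s (X s \<omega>) * pg (s - u) (X (s - u) \<omega>) \<partial>P)) \<in> borel_measurable (L t)"
      by (rule measurable_compose[OF measurable_ident_restrict_lborel])
    \<comment> \<open>The hypothesis is integrated over time, so \<open>mart_identity\<close> is
      available for almost every \<open>s\<close> only.\<close>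
    have "AE s in L t. (\<integral>\<^sup>+\<omega>. ennreal (\<bar>w s (X s \<omega>)\<bar> * W l \<omega>) \<partial>P) \<noteq> \<infinity>"
    proof (rule nn_integral_noteq_infinite)
      have "(\<lambda>s. \<integral>\<^sup>+\<omega>. ennreal (\<bar>w s (X s \<omega>)\<bar> * W l \<omega>) \<partial>P) \<in> borel_measurable borel" by measurable
      then show "(\<lambda>s. \<integral>\<^sup>+\<omega>. ennreal (\<bar>w s (X s \<omega>)\<bar> * W l \<omega>) \<partial>P) \<in> borel_measurable (L t)"
        by (rule measurable_compose[OF measurable_ident_restrict_lborel])
      show "(\<integral>\<^sup>+s. \<integral>\<^sup>+\<omega>. ennreal (\<bar>w s (X s \<omega>)\<bar> * W l \<omega>) \<partial>P \<partial>L t) \<noteq> \<infinity>"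
        using fin' by (simp add: nn_integral_L)
    qed
    then show "AE s in L t. (\<integral>\<omega>. w s (X s \<omega>) * Mart s \<omega> \<partial>P) = (LINT u:{0..s}|lborel. (\<integral>\<omega>. w s (X s \<omega>) * pg (s - u) (X (s - u) \<omega>) \<partial>P))"
      using AE_space_L
    proof eventually_elim
      case (elim s)
      then have "(\<integral>\<^sup>+\<omega>. ennreal (\<bar>w s (X s \<omega>)\<bar> * W l \<omega>) \<partial>P) < \<top>" by (simp add: less_top)
      from mart_identity(2)[OF ws elim(2) l this]
      show ?case using reflect_integral[of s "\<lambda>u. \<integral>\<omega>. w s (X s \<omega>) * pg u (X u \<omega>) \<partial>P"] by simp
    qed
  qed
  finally show "(\<integral>z. w (fst z) (X (fst z) (snd z)) * Mart (fst z) (snd z) \<partial>(L t \<Otimes>\<^sub>M P)) =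
     (LINT s:{0..t}|lborel. (LINT u:{0..s}|lborel. (\<integral>\<omega>. w s (X s \<omega>) * pg (s - u) (X (s - u) \<omega>) \<partial>P)))"
    by (simp only: L_integral)
qed

text \<open>The common core of the formulas for time integrals and for sums over jumps: an integrand
  that may depend on lambda, integrated over time and probability together. The derivative consists
  of the explicit dependence, through \<open>b'\<close>, and of the derivative of the density, which
  produces the term with \<open>psi\<close>.\<close>

lemma response_integral:
  fixes b :: "real \<Rightarrow> real \<Rightarrow> 'a \<Rightarrow> real"
  assumes l: "0 < l" "l \<le> 1" and W1: "(\<integral>\<^sup>+\<omega>. ennreal (W l \<omega>) \<partial>P) < \<top>" and C: "0 \<le> C"
    and bm: "\<And>lam. (\<lambda>(s, x). b lam s x) \<in> borel_measurable (borel \<Otimes>\<^sub>M S)"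
    and b'm: "(\<lambda>(s, x). b' s x) \<in> borel_measurable (borel \<Otimes>\<^sub>M S)"
    and bbm: "(\<lambda>(s, x). bb s x) \<in> borel_measurable (borel \<Otimes>\<^sub>M S)" and bb0: "\<And>s x. 0 \<le> bb s x"
    and bounds: "AE z in L t \<Otimes>\<^sub>M P. (\<forall>lam. \<bar>lam\<bar> \<le> l \<longrightarrow> \<bar>b lam (fst z) (X (fst z) (snd z)) - b 0 (fst z) (X (fst z) (snd z))\<bar> \<le> \<bar>lam\<bar> * (C * bb (fst z) (X (fst z) (snd z)))) \<and>
      \<bar>b 0 (fst z) (X (fst z) (snd z))\<bar> \<le> bb (fst z) (X (fst z) (snd z)) \<and>
      ((\<lambda>lam. b lam (fst z) (X (fst z) (snd z))) has_real_derivative b' (fst z) (X (fst z) (snd z))) (at 0)"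
    and fin: "(\<integral>\<^sup>+z. ennreal (bb (fst z) (X (fst z) (snd z)) * W l (snd z)) \<partial>(L t \<Otimes>\<^sub>M P)) < \<top>"
  shows "\<And>lam. \<bar>lam\<bar> \<le> l \<Longrightarrow> integrable (L t \<Otimes>\<^sub>M M lam) (\<lambda>z. b lam (fst z) (X' lam (fst z) (snd z)))"
    "((\<lambda>lam. \<integral>z. b lam (fst z) (X' lam (fst z) (snd z)) \<partial>(L t \<Otimes>\<^sub>M M lam)) has_real_derivative
      (LINT s:{0..t}|lborel. (\<integral>\<omega>. b' s (X s \<omega>) \<partial>P)) +
      (LINT s:{0..t}|lborel. (LINT u:{0..s}|lborel. (\<integral>\<omega>. b 0 s (X s \<omega>) * pg (s - u) (X (s - u) \<omega>) \<partial>P)))) (at 0)"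
    "time_integrable t P (\<lambda>s \<omega>. b' s (X s \<omega>))"
    "triangle_integrable t P (\<lambda>s u \<omega>. b 0 s (X s \<omega>) * pg (s - u) (X (s - u) \<omega>))"
    "triangle_integrable t P (\<lambda>s u \<omega>. b 0 s (X u \<omega>) * pg (s - u) (X 0 \<omega>))"
proof -
  note [measurable (raw)] = measurable_uncurry[OF bm] measurable_uncurry[OF b'm] measurable_uncurry[OF bbm]
  interpret LP: pair_sigma_finite "L t" P by (rule pair_L_P)
  let ?Q = "L t \<Otimes>\<^sub>M P"
  let ?X = "\<lambda>z. X (fst z) (snd z)"
  have d: "AE z in ?Q. (\<forall>lam. \<bar>lam\<bar> \<le> l \<longrightarrow> \<bar>D lam (fst z) (snd z) - 1\<bar> \<le> \<bar>lam\<bar> * W l (snd z) \<and> 0 \<le> D lam (fst z) (snd z) \<and> D lam (fst z) (snd z) \<le> W l (snd z)) \<and>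
      1 \<le> W l (snd z) \<and> \<bar>Mart (fst z) (snd z)\<bar> \<le> 2 * W l (snd z) \<and> ((\<lambda>lam. D lam (fst z) (snd z)) has_real_derivative Mart (fst z) (snd z)) (at 0)"
    using AE_good_L[OF order_refl]
  proof eventually_elim
    case (elim z)
    then have "fst z \<le> t" "good (snd z)" by auto
    then show ?case by (intro density_facts[OF l])
  qed
  have ibW: "integrable ?Q (\<lambda>z. bb (fst z) (?X z) * W l (snd z))"
    using fin W_nonneg[OF l(1)] bb0 by (intro integrableI_nonneg) auto
  note wd = weighted_derivative[where Q = ?Q and d = "\<lambda>lam z. D lam (fst z) (snd z)" and b = "\<lambda>lam z. b lam (fst z) (?X z)"
      and b' = "\<lambda>z. b' (fst z) (?X z)" and bb = "\<lambda>z. bb (fst z) (?X z)" and w = "\<lambda>z. W l (snd z)"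
      and m = "\<lambda>z. Mart (fst z) (snd z)" and l = l and C = C, OF l(1) C]
  have 1: "integrable ?Q (\<lambda>z. b lam (fst z) (?X z) * D lam (fst z) (snd z))" if "\<bar>lam\<bar> \<le> l" for lam
    by (rule wd(1)[OF _ _ _ _ _ _ d bounds ibW that]) measurable
  have 2: "integrable ?Q (\<lambda>z. b' (fst z) (?X z))"
    by (rule wd(2)[OF _ _ _ _ _ _ d bounds ibW]) measurable
  have 3: "integrable ?Q (\<lambda>z. b 0 (fst z) (?X z) * Mart (fst z) (snd z))"
    by (rule wd(3)[OF _ _ _ _ _ _ d bounds ibW]) measurable
  have 4: "((\<lambda>lam. \<integral>z. b lam (fst z) (?X z) * D lam (fst z) (snd z) \<partial>?Q) has_real_derivative
      ((\<integral>z. b' (fst z) (?X z) \<partial>?Q) + (\<integral>z. b 0 (fst z) (?X z) * Mart (fst z) (snd z) \<partial>?Q))) (at 0)"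
    by (rule wd(4)[OF _ _ _ _ _ _ d bounds ibW]) measurable
  show "time_integrable t P (\<lambda>s \<omega>. b' s (X s \<omega>))"
    using 2 by (simp add: time_integrable_def case_prod_unfold)
  have fin0: "(\<integral>\<^sup>+z. ennreal (\<bar>b 0 (fst z) (?X z)\<bar> * W l (snd z)) \<partial>?Q) < \<top>"
  proof (rule order_le_less_trans[OF nn_integral_mono_AE fin])
    show "AE z in ?Q. ennreal (\<bar>b 0 (fst z) (?X z)\<bar> * W l (snd z)) \<le> ennreal (bb (fst z) (?X z) * W l (snd z))"
      using bounds by eventually_elim (auto intro!: ennreal_leI mult_right_mono W_nonneg l)
  qed
  note tr = triangle_response[OF l bm fin0]
  show "triangle_integrable t P (\<lambda>s u \<omega>. b 0 s (X s \<omega>) * pg (s - u) (X (s - u) \<omega>))" by (rule tr(1))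
  show "triangle_integrable t P (\<lambda>s u \<omega>. b 0 s (X u \<omega>) * pg (s - u) (X 0 \<omega>))" by (rule tr(2))
  have change: "integrable (L t \<Otimes>\<^sub>M M lam) (\<lambda>z. b lam (fst z) (X' lam (fst z) (snd z)))"
    "(\<integral>z. b lam (fst z) (X' lam (fst z) (snd z)) \<partial>(L t \<Otimes>\<^sub>M M lam)) = (\<integral>z. b lam (fst z) (?X z) * D lam (fst z) (snd z) \<partial>?Q)"
    if lam: "\<bar>lam\<bar> \<le> l" for lam
  proof -
    have Y1: "(\<lambda>z. (fst z, X' lam (fst z) (snd z))) \<in> measurable (L t \<Otimes>\<^sub>M M lam) (borel \<Otimes>\<^sub>M S)"
      using measurable_X'_L by (intro measurable_Pair) auto
    have Y2: "(\<lambda>z. (fst z, ?X z)) \<in> measurable ?Q (borel \<Otimes>\<^sub>M S)" by measurable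
    have Dm: "(\<lambda>z. D lam (fst z) (snd z)) \<in> borel_measurable ?Q" by measurable
    have D0: "0 \<le> D lam (fst z) (snd z)" for z by (simp add: D_def)
    have i: "integrable ?Q (\<lambda>z. (\<lambda>(s, x). b lam s x) (fst z, ?X z) * D lam (fst z) (snd z))" using 1[OF lam] by simp
    from integral_of_measure_change[OF Y1 Y2 Dm D0 joint_change[OF l W1 lam] bm i]
    show "integrable (L t \<Otimes>\<^sub>M M lam) (\<lambda>z. b lam (fst z) (X' lam (fst z) (snd z)))"
      "(\<integral>z. b lam (fst z) (X' lam (fst z) (snd z)) \<partial>(L t \<Otimes>\<^sub>M M lam)) = (\<integral>z. b lam (fst z) (?X z) * D lam (fst z) (snd z) \<partial>?Q)"
      by simp_all
  qed
  show "\<And>lam. \<bar>lam\<bar> \<le> l \<Longrightarrow> integrable (L t \<Otimes>\<^sub>M M lam) (\<lambda>z. b lam (fst z) (X' lam (fst z) (snd z)))" by (rule change(1))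
  have val: "(\<integral>z. b' (fst z) (?X z) \<partial>?Q) = (LINT s:{0..t}|lborel. (\<integral>\<omega>. b' s (X s \<omega>) \<partial>P))"
    unfolding L_integral[symmetric] using LP.integral_fst'[OF 2] by simp
  show "((\<lambda>lam. \<integral>z. b lam (fst z) (X' lam (fst z) (snd z)) \<partial>(L t \<Otimes>\<^sub>M M lam)) has_real_derivative
      (LINT s:{0..t}|lborel. (\<integral>\<omega>. b' s (X s \<omega>) \<partial>P)) +
      (LINT s:{0..t}|lborel. (LINT u:{0..s}|lborel. (\<integral>\<omega>. b 0 s (X s \<omega>) * pg (s - u) (X (s - u) \<omega>) \<partial>P)))) (at 0)"
    unfolding val[symmetric] tr(3)[OF 3, symmetric]
    by (rule has_field_derivative_transform_within[OF 4 l(1) UNIV_I]) (use change(2) in auto)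
qed

end

lemma jump_sum_nonneg: "(\<And>s x y. 0 \<le> \<alpha> s x y) \<Longrightarrow> 0 \<le> jump_sum t \<alpha> \<xi>"
  unfolding jump_sum_def by (rule sum_nonneg)

lemma jump_sum_diff: "jump_sum t (\<lambda>s x y. \<alpha> s x y - \<beta> s x y) \<xi> = jump_sum t \<alpha> \<xi> - jump_sum t \<beta> \<xi>"
  unfolding jump_sum_def by (rule sum_subtractf)

lemma measurable_uncurry3:
  assumes "(\<lambda>(s, x, y). f s x y) \<in> measurable (A \<Otimes>\<^sub>M B \<Otimes>\<^sub>M B') N" "h \<in> measurable C A" "k \<in> measurable C B" "k' \<in> measurable C B'"
  shows "(\<lambda>w. f (h w) (k w) (k' w)) \<in> measurable C N"
  using measurable_compose[OF measurable_Pair[OF assms(2) measurable_Pair[OF assms(3,4)]] assms(1)] by simp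

context response
begin

text \<open>Here the integrand does not depend on lambda, so \<open>response_integral\<close> is
  applied with derivative 0 and C = 0. The hypothesis on the norms at fixed times gives
  integrability against \<open>W l\<close> on the product space.\<close>

lemma response_additive:
  assumes p: "(1::ennreal) < p" and w: "(\<lambda>(s, x). w s x) \<in> borel_measurable (borel \<Otimes>\<^sub>M S)"
    and Lp: "(\<integral>\<^sup>+s\<in>{0..t}. Lp_norm P p (\<lambda>\<omega>. ennreal \<bar>w s (X s \<omega>)\<bar>) \<partial>lborel) < \<top>"
  shows "\<forall>\<^sub>F lam in nhds 0. time_integrable t (M lam) (\<lambda>s \<omega>. w s (X' lam s \<omega>))"
    "has_linear_response M (\<lambda>lam \<omega>. LINT s:{0..t}|lborel. w s (X' lam s \<omega>))
      (LINT s:{0..t}|lborel. (LINT u:{0..s}|lborel. (\<integral>\<omega>. w s (X s \<omega>) * pg (s - u) (X (s - u) \<omega>) \<partial>P)))"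
    "triangle_integrable t P (\<lambda>s u \<omega>. w s (X s \<omega>) * pg (s - u) (X (s - u) \<omega>))"
    "triangle_integrable t P (\<lambda>s u \<omega>. w s (X u \<omega>) * pg (s - u) (X 0 \<omega>))"
proof -
  note [measurable (raw)] = measurable_uncurry[OF w]
  obtain l C where l: "0 < l" "l \<le> 1" and C: "C < \<top>" and W1: "(\<integral>\<^sup>+\<omega>. ennreal (W l \<omega>) \<partial>P) < \<top>"
    and WC: "\<And>f. f \<in> borel_measurable P \<Longrightarrow> (\<integral>\<^sup>+\<omega>. f \<omega> * ennreal (W l \<omega>) \<partial>P) \<le> Lp_norm P p f * C"
    by (rule Lp_bound_W[OF p]) blast
  obtain c where c: "C = ennreal c" "0 \<le> c" using C by (cases C) auto
  define \<phi> where "\<phi> s = indicator {0..t} s * (\<integral>\<^sup>+\<omega>. ennreal (\<bar>w s (X s \<omega>)\<bar> * W l \<omega>) \<partial>P)" for s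
  have \<phi>m: "\<phi> \<in> borel_measurable lborel" unfolding \<phi>_def by measurable
  \<comment> \<open>The norm has not been shown to be measurable in \<open>s\<close>, so a constant
    cannot be pulled out of its integral. It is moved to the measurable side instead; c + 1 rather
    than c makes the division legitimate when c = 0.\<close>
  have "ennreal (1 / (c + 1)) * (\<integral>\<^sup>+s. \<phi> s \<partial>lborel) = (\<integral>\<^sup>+s. ennreal (1 / (c + 1)) * \<phi> s \<partial>lborel)"
    by (rule nn_integral_cmult[symmetric, OF \<phi>m])
  also have "\<dots> \<le> (\<integral>\<^sup>+s\<in>{0..t}. Lp_norm P p (\<lambda>\<omega>. ennreal \<bar>w s (X s \<omega>)\<bar>) \<partial>lborel)"
  proof (rule nn_integral_mono)
    fix s
    let ?N = "Lp_norm P p (\<lambda>\<omega>. ennreal \<bar>w s (X s \<omega>)\<bar>)"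
    have "(\<integral>\<^sup>+\<omega>. ennreal (\<bar>w s (X s \<omega>)\<bar> * W l \<omega>) \<partial>P) = (\<integral>\<^sup>+\<omega>. ennreal \<bar>w s (X s \<omega>)\<bar> * ennreal (W l \<omega>) \<partial>P)"
      using W_nonneg[OF l(1)] by (simp add: ennreal_mult)
    also have "\<dots> \<le> ?N * C" by (rule WC) measurable
    also have "\<dots> \<le> ?N * ennreal (c + 1)" unfolding c(1) using c(2) by (intro mult_left_mono ennreal_leI) auto
    finally have "ennreal (1 / (c + 1)) * (\<integral>\<^sup>+\<omega>. ennreal (\<bar>w s (X s \<omega>)\<bar> * W l \<omega>) \<partial>P) \<le> ennreal (1 / (c + 1)) * (?N * ennreal (c + 1))"
      by (rule mult_left_mono) simp
    also have "\<dots> = (ennreal (1 / (c + 1)) * ennreal (c + 1)) * ?N" by (simp only: ac_simps)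
    also have "ennreal (1 / (c + 1)) * ennreal (c + 1) = 1" using c(2) by (simp add: ennreal_mult[symmetric] del: ennreal_plus)
    finally show "ennreal (1 / (c + 1)) * \<phi> s \<le> ?N * indicator {0..t} s"
      unfolding \<phi>_def by (auto simp: indicator_def)
  qed
  finally have "ennreal (1 / (c + 1)) * (\<integral>\<^sup>+s. \<phi> s \<partial>lborel) < \<top>" using Lp by (rule order_le_less_trans)
  then have \<phi>fin: "(\<integral>\<^sup>+s. \<phi> s \<partial>lborel) < \<top>"
    using c(2) by (auto simp: ennreal_mult_less_top)
  have fin: "(\<integral>\<^sup>+z. ennreal (\<bar>w (fst z) (X (fst z) (snd z))\<bar> * W l (snd z)) \<partial>(L t \<Otimes>\<^sub>M P)) < \<top>"
    using \<phi>fin unfolding \<phi>_def by (subst nn_integral_L_P) auto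
  have bb: "(\<lambda>(s, x). \<bar>w s x\<bar>) \<in> borel_measurable (borel \<Otimes>\<^sub>M S)" by measurable
  note R = response_integral[where b = "\<lambda>_. w" and b' = "\<lambda>_ _. 0" and bb = "\<lambda>s x. \<bar>w s x\<bar>", OF l W1 order_refl w _ bb abs_ge_zero _ fin]
  have int: "integrable (L t \<Otimes>\<^sub>M M lam) (\<lambda>(s, \<omega>). w s (X' lam s \<omega>))" if "\<bar>lam\<bar> \<le> l" for lam
    using R(1)[OF _ _ that] by (simp add: case_prod_unfold)
  show "\<forall>\<^sub>F lam in nhds 0. time_integrable t (M lam) (\<lambda>s \<omega>. w s (X' lam s \<omega>))"
    unfolding eventually_nhds_metric time_integrable_def using l int by (intro exI[of _ l]) auto
  show "has_linear_response M (\<lambda>lam \<omega>. LINT s:{0..t}|lborel. w s (X' lam s \<omega>))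
      (LINT s:{0..t}|lborel. (LINT u:{0..s}|lborel. (\<integral>\<omega>. w s (X s \<omega>) * pg (s - u) (X (s - u) \<omega>) \<partial>P)))"
  proof (rule has_linear_responseI[OF l(1)])
    show "((\<lambda>lam. \<integral>z. w (fst z) (X' lam (fst z) (snd z)) \<partial>(L t \<Otimes>\<^sub>M M lam)) has_real_derivative
      (LINT s:{0..t}|lborel. (LINT u:{0..s}|lborel. (\<integral>\<omega>. w s (X s \<omega>) * pg (s - u) (X (s - u) \<omega>) \<partial>P)))) (at 0)"
      using R(2) by (simp add: set_lebesgue_integral_def)
    fix lam :: real assume lam: "\<bar>lam\<bar> \<le> l"
    interpret LM: pair_sigma_finite "L t" "M lam" by (rule pair_L_M)
    show "integrable (M lam) (\<lambda>\<omega>. LINT s:{0..t}|lborel. w s (X' lam s \<omega>)) \<and>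
      (\<integral>\<omega>. (LINT s:{0..t}|lborel. w s (X' lam s \<omega>)) \<partial>M lam) = (\<integral>z. w (fst z) (X' lam (fst z) (snd z)) \<partial>(L t \<Otimes>\<^sub>M M lam))"
      using LM.integrable_snd[OF int[OF lam]] LM.integral_snd[OF int[OF lam]]
      by (simp add: L_integral case_prod_unfold)
  qed
  show "triangle_integrable t P (\<lambda>s u \<omega>. w s (X s \<omega>) * pg (s - u) (X (s - u) \<omega>))" by (rule R(4)) auto
  show "triangle_integrable t P (\<lambda>s u \<omega>. w s (X u \<omega>) * pg (s - u) (X 0 \<omega>))" by (rule R(5)) auto
qed

section \<open>Response of sums over jumps\<close>

text \<open>The compensator density of the sum over the jumps of the perturbed process: the
  contraction with the perturbed instead of the unperturbed rates.\<close>

definition tilted_contract :: "real \<Rightarrow> (real \<Rightarrow> 'a \<Rightarrow> 'a \<Rightarrow> real) \<Rightarrow> real \<Rightarrow> 'a \<Rightarrow> real" where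
  "tilted_contract lam \<alpha> s x = contract r (\<lambda>x y. \<alpha> s x y * exp (lam * g s x y)) x"

lemma measurable_tilted_contract:
  assumes "(\<lambda>(s, x, y). \<alpha> s x y) \<in> borel_measurable (borel \<Otimes>\<^sub>M S \<Otimes>\<^sub>M S)"
  shows "(\<lambda>(s, x). tilted_contract lam \<alpha> s x) \<in> borel_measurable (borel \<Otimes>\<^sub>M S)"
proof -
  note [measurable (raw)] = measurable_uncurry3[OF assms]
  show ?thesis unfolding tilted_contract_def by measurable
qed

lemma measurable_jump_sum:
  assumes \<alpha>: "(\<lambda>(s, x, y). \<alpha> s x y) \<in> borel_measurable (borel \<Otimes>\<^sub>M S \<Otimes>\<^sub>M S)"
  shows "(\<lambda>\<omega>. jump_sum t \<alpha> (\<lambda>s. X' lam s \<omega>)) \<in> borel_measurable (M lam)"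
proof -
  interpret M: tilted_jump "M lam" S t r "lg lam" "\<bar>lam\<bar> * K" \<pi> "T' lam" "Z' lam" by (rule perturbed_tilted)
  note [measurable (raw)] = measurable_uncurry3[OF \<alpha>]
  have "(\<lambda>\<omega>. if alive (T' lam) t \<omega> then (\<Sum>n. indicator {..t} (T' lam (Suc n) \<omega>) * \<alpha> (T' lam (Suc n) \<omega>) (Z' lam n \<omega>) (Z' lam (Suc n) \<omega>)) else 0)
      \<in> borel_measurable (M lam)" by measurable
  then show ?thesis
    by (rule measurable_cong[THEN iffD2, rotated]) (rule M.jump_sum_eq, use t_pos in auto)
qed

text \<open>For nonnegative \<open>\<alpha>\<close> the Levy system of the perturbed process
  rewrites the expected sum over the jumps as a time integral. The last claim, integrability at
  almost every point, later allows \<open>tilted_contract\<close> to be split into positive and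
  negative parts.\<close>

lemma levy_integral:
  assumes l: "0 < l" "l \<le> 1" and W1: "(\<integral>\<^sup>+\<omega>. ennreal (W l \<omega>) \<partial>P) < \<top>" and lam: "\<bar>lam\<bar> \<le> l"
    and \<alpha>: "(\<lambda>(s, x, y). \<alpha> s x y) \<in> borel_measurable (borel \<Otimes>\<^sub>M S \<Otimes>\<^sub>M S)" and \<alpha>0: "\<And>s x y. 0 \<le> \<alpha> s x y"
    and fin: "(\<integral>\<^sup>+z. abs_contract r (\<alpha> (fst z)) (X (fst z) (snd z)) * ennreal (W l (snd z)) \<partial>(L t \<Otimes>\<^sub>M P)) < \<top>"
  shows "integrable (M lam) (\<lambda>\<omega>. jump_sum t \<alpha> (\<lambda>s. X' lam s \<omega>))"
    "integrable (L t \<Otimes>\<^sub>M M lam) (\<lambda>z. tilted_contract lam \<alpha> (fst z) (X' lam (fst z) (snd z)))"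
    "(\<integral>\<omega>. jump_sum t \<alpha> (\<lambda>s. X' lam s \<omega>) \<partial>M lam) = (\<integral>z. tilted_contract lam \<alpha> (fst z) (X' lam (fst z) (snd z)) \<partial>(L t \<Otimes>\<^sub>M M lam))"
    "AE z in L t \<Otimes>\<^sub>M M lam. integrable (r (X' lam (fst z) (snd z)))
      (\<lambda>y. \<alpha> (fst z) (X' lam (fst z) (snd z)) y * exp (lam * g (fst z) (X' lam (fst z) (snd z)) y))"
proof -
  interpret M: tilted_jump "M lam" S t r "lg lam" "\<bar>lam\<bar> * K" \<pi> "T' lam" "Z' lam" by (rule perturbed_tilted)
  interpret LM: pair_sigma_finite "L t" "M lam" by (rule pair_L_M)
  note am[measurable (raw)] = measurable_uncurry3[OF \<alpha>]
  note [measurable] = measurable_X'_L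
  define \<Phi> where "\<Phi> s x = (\<integral>\<^sup>+y. ennreal (exp (lam * g s x y) * \<alpha> s x y) \<partial>r x)" for s x
  have \<Phi>m: "(\<lambda>(s, x). \<Phi> s x) \<in> borel_measurable (borel \<Otimes>\<^sub>M S)" unfolding \<Phi>_def by measurable
  note [measurable (raw)] = measurable_uncurry[OF \<Phi>m]
  have \<Phi>int: "(\<integral>\<^sup>+\<omega>. ennreal (jump_sum t \<alpha> (\<lambda>s. X' lam s \<omega>)) \<partial>M lam) = (\<integral>\<^sup>+z. \<Phi> (fst z) (X' lam (fst z) (snd z)) \<partial>(L t \<Otimes>\<^sub>M M lam))"
  proof -
    have "(\<integral>\<^sup>+\<omega>. ennreal (jump_sum t \<alpha> (\<lambda>s. X' lam s \<omega>)) \<partial>M lam) =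
        (\<integral>\<^sup>+s. indicator {0..t} s * (\<integral>\<^sup>+\<omega>. \<Phi> s (X' lam s \<omega>) \<partial>M lam) \<partial>lborel)"
      unfolding \<Phi>_def using t_pos by (intro M.nn_integral_jump_sum[OF \<alpha> \<alpha>0 AE_alive_perturbed[OF l W1 lam]]) simp
    also have "\<dots> = (\<integral>\<^sup>+s. (\<integral>\<^sup>+\<omega>. \<Phi> s (X' lam s \<omega>) \<partial>M lam) \<partial>L t)" by (simp add: nn_integral_L)
    also have "\<dots> = (\<integral>\<^sup>+z. \<Phi> (fst z) (X' lam (fst z) (snd z)) \<partial>(L t \<Otimes>\<^sub>M M lam))"
      by (subst M.nn_integral_fst[symmetric]) auto
    finally show ?thesis .
  qed
  have am_r: "(\<lambda>y. \<alpha> s x y) \<in> borel_measurable (r x)" "g s x \<in> borel_measurable (r x)" if x: "x \<in> space S" for s x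
    by (rule measurable_r[OF x], rule am) (use x in simp_all, rule g.measurable_tilt_r[OF x])
  have \<Phi>le: "\<Phi> s x \<le> ennreal (exp K) * abs_contract r (\<alpha> s) x" if x: "x \<in> space S" for s x
  proof -
    note [measurable] = am_r[OF x]
    have "\<Phi> s x \<le> (\<integral>\<^sup>+y. ennreal (exp K) * ennreal \<bar>\<alpha> s x y\<bar> \<partial>r x)"
      unfolding \<Phi>_def
    proof (rule nn_integral_mono)
      fix y assume "y \<in> space (r x)"
      then have y: "y \<in> space S" using x by simp
      have "\<bar>lam * g s x y\<bar> \<le> 1 * K"
        unfolding abs_mult using lam l g.tilt_bound[OF x y] by (intro mult_mono) auto
      then have "exp (lam * g s x y) * \<alpha> s x y \<le> exp K * \<bar>\<alpha> s x y\<bar>" by (intro mult_mono) (auto simp: \<alpha>0)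
      then show "ennreal (exp (lam * g s x y) * \<alpha> s x y) \<le> ennreal (exp K) * ennreal \<bar>\<alpha> s x y\<bar>"
        by (simp add: ennreal_mult[symmetric] ennreal_leI)
    qed
    also have "\<dots> = ennreal (exp K) * abs_contract r (\<alpha> s) x"
      unfolding abs_contract_def by (rule nn_integral_cmult) measurable
    finally show ?thesis .
  qed
  \<comment> \<open>Finiteness is checked under the unperturbed law: the tilt costs at most a factor
    exp K and the density is at most \<open>W l\<close>.\<close>
  have \<Phi>fin: "(\<integral>\<^sup>+z. \<Phi> (fst z) (X' lam (fst z) (snd z)) \<partial>(L t \<Otimes>\<^sub>M M lam)) < \<top>"
  proof -
    have "(\<integral>\<^sup>+z. \<Phi> (fst z) (X' lam (fst z) (snd z)) \<partial>(L t \<Otimes>\<^sub>M M lam)) =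
        (\<integral>\<^sup>+z. \<Phi> (fst z) (X (fst z) (snd z)) * ennreal (D lam (fst z) (snd z)) \<partial>(L t \<Otimes>\<^sub>M P))"
      using joint_change[OF l W1 lam \<Phi>m] by simp
    also have "\<dots> \<le> (\<integral>\<^sup>+z. ennreal (exp K) * (abs_contract r (\<alpha> (fst z)) (X (fst z) (snd z)) * ennreal (W l (snd z))) \<partial>(L t \<Otimes>\<^sub>M P))"
    proof (rule nn_integral_mono_AE)
      show "AE z in L t \<Otimes>\<^sub>M P. \<Phi> (fst z) (X (fst z) (snd z)) * ennreal (D lam (fst z) (snd z)) \<le>
        ennreal (exp K) * (abs_contract r (\<alpha> (fst z)) (X (fst z) (snd z)) * ennreal (W l (snd z)))"
        using AE_good_L[OF order_refl]
      proof eventually_elim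
        case (elim z)
        have "\<Phi> (fst z) (X (fst z) (snd z)) * ennreal (D lam (fst z) (snd z)) \<le>
            (ennreal (exp K) * abs_contract r (\<alpha> (fst z)) (X (fst z) (snd z))) * ennreal (W l (snd z))"
          using elim lam by (intro mult_mono \<Phi>le jump_path_space goodD ennreal_leI D_bounds(4)[OF l]) auto
        then show ?case by (simp only: mult.assoc)
      qed
    qed
    also have "\<dots> = ennreal (exp K) * (\<integral>\<^sup>+z. abs_contract r (\<alpha> (fst z)) (X (fst z) (snd z)) * ennreal (W l (snd z)) \<partial>(L t \<Otimes>\<^sub>M P))"
      by (rule nn_integral_cmult) measurable
    also have "\<dots> < \<top>" using fin by (simp add: ennreal_mult_less_top)
    finally show ?thesis .
  qed
  have js0: "0 \<le> jump_sum t \<alpha> \<xi>" for \<xi> by (rule jump_sum_nonneg[OF \<alpha>0])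
  show "integrable (M lam) (\<lambda>\<omega>. jump_sum t \<alpha> (\<lambda>s. X' lam s \<omega>))"
    using \<Phi>fin by (intro integrableI_nonneg measurable_jump_sum[OF \<alpha>]) (auto simp: js0 \<Phi>int)
  \<comment> \<open>This includes points where the integral is infinite: both sides are 0 there by
    convention.\<close>
  have tc: "tilted_contract lam \<alpha> s x = enn2real (\<Phi> s x)" if x: "x \<in> space S" for s x
  proof -
    note [measurable] = am_r[OF x]
    show ?thesis
      unfolding tilted_contract_def contract_def \<Phi>_def
      by (subst integral_eq_nn_integral) (auto simp: \<alpha>0 mult.commute)
  qed
  have XS: "X' lam (fst z) (snd z) \<in> space S" if "z \<in> space (L t \<Otimes>\<^sub>M M lam)" for z
    using that by (intro M.jump_path_space) (auto simp: space_pair_measure)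
  have AEfin: "AE z in L t \<Otimes>\<^sub>M M lam. \<Phi> (fst z) (X' lam (fst z) (snd z)) \<noteq> \<infinity>"
    using \<Phi>fin by (intro nn_integral_noteq_infinite) auto
  show "AE z in L t \<Otimes>\<^sub>M M lam. integrable (r (X' lam (fst z) (snd z)))
      (\<lambda>y. \<alpha> (fst z) (X' lam (fst z) (snd z)) y * exp (lam * g (fst z) (X' lam (fst z) (snd z)) y))"
    using AEfin AE_space
  proof eventually_elim
    case (elim z)
    note [measurable] = am_r[OF XS[OF elim(2)]]
    show ?case
      using elim(1) by (intro integrableI_nonneg) (auto simp: \<alpha>0 \<Phi>_def mult.commute less_top)
  qed
  let ?f = "\<lambda>z. tilted_contract lam \<alpha> (fst z) (X' lam (fst z) (snd z))"
  have fm: "?f \<in> borel_measurable (L t \<Otimes>\<^sub>M M lam)"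
    by (rule measurable_uncurry[OF measurable_tilted_contract[OF \<alpha>]]) measurable
  have f\<Phi>: "AE z in L t \<Otimes>\<^sub>M M lam. ennreal (?f z) = \<Phi> (fst z) (X' lam (fst z) (snd z))"
    using AEfin AE_space by eventually_elim (simp add: tc[OF XS] less_top)
  have f0: "AE z in L t \<Otimes>\<^sub>M M lam. 0 \<le> ?f z"
    using AE_space by eventually_elim (simp add: tc[OF XS])
  have nnf: "(\<integral>\<^sup>+z. ennreal (?f z) \<partial>(L t \<Otimes>\<^sub>M M lam)) = (\<integral>\<^sup>+z. \<Phi> (fst z) (X' lam (fst z) (snd z)) \<partial>(L t \<Otimes>\<^sub>M M lam))"
    by (rule nn_integral_cong_AE[OF f\<Phi>])
  show "integrable (L t \<Otimes>\<^sub>M M lam) ?f"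
    using \<Phi>fin by (intro integrableI_nonneg fm f0) (simp add: nnf)
  show "(\<integral>\<omega>. jump_sum t \<alpha> (\<lambda>s. X' lam s \<omega>) \<partial>M lam) = (\<integral>z. ?f z \<partial>(L t \<Otimes>\<^sub>M M lam))"
    using integral_eq_nn_integral[OF measurable_jump_sum[OF \<alpha>], of lam] integral_eq_nn_integral[OF fm f0]
    by (simp add: js0 \<Phi>int nnf)
qed

text \<open>The pointwise hypotheses of \<open>response_integral\<close> for the integrand
  \<open>tilted_contract\<close>, with C = K exp K; one factor K bounds |g|, the exponential bounds
  the tilt for |lambda| \<le> 1.\<close>

lemma tilted_contract_bounds:
  assumes x: "x \<in> space S" and \<alpha>: "\<alpha> s x \<in> borel_measurable (r x)" and fin: "abs_contract r (\<alpha> s) x < \<top>"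
  shows "\<And>lam. \<bar>lam\<bar> \<le> 1 \<Longrightarrow> \<bar>tilted_contract lam \<alpha> s x - tilted_contract 0 \<alpha> s x\<bar> \<le> \<bar>lam\<bar> * ((K * exp K) * enn2real (abs_contract r (\<alpha> s) x))"
    "\<bar>tilted_contract 0 \<alpha> s x\<bar> \<le> enn2real (abs_contract r (\<alpha> s) x)"
    "((\<lambda>lam. tilted_contract lam \<alpha> s x) has_real_derivative contract r (\<lambda>x y. \<alpha> s x y * g s x y) x) (at 0)"
proof -
  note [measurable] = \<alpha> g.measurable_tilt_r[OF x, of s]
  have ia: "integrable (r x) (\<alpha> s x)"
    using fin by (intro integrableI_bounded) (auto simp: abs_contract_def)
  have abs_eq: "enn2real (abs_contract r (\<alpha> s) x) = (\<integral>y. \<bar>\<alpha> s x y\<bar> \<partial>r x)"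
    unfolding abs_contract_def by (subst integral_eq_nn_integral) auto
  have bnd: "\<bar>\<alpha> s x y * exp (lam * g s x y) - \<alpha> s x y * exp (0 * g s x y)\<bar> \<le> \<bar>lam\<bar> * (K * exp K * \<bar>\<alpha> s x y\<bar>)"
    if lam: "\<bar>lam\<bar> \<le> 1" and y: "y \<in> space S" for lam y
  proof -
    have g: "\<bar>g s x y\<bar> \<le> K" by (rule g.tilt_bound[OF x y])
    have "\<bar>\<alpha> s x y * exp (lam * g s x y) - \<alpha> s x y * exp (0 * g s x y)\<bar> = \<bar>\<alpha> s x y\<bar> * \<bar>exp (lam * g s x y) - 1\<bar>"
      by (simp add: abs_mult[symmetric] right_diff_distrib)
    also have "\<dots> \<le> \<bar>\<alpha> s x y\<bar> * (\<bar>lam\<bar> * (exp K * \<bar>g s x y\<bar>))"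
      using abs_exp_diff_le[OF lam g] by (rule mult_left_mono) simp
    also have "\<dots> \<le> \<bar>\<alpha> s x y\<bar> * (\<bar>lam\<bar> * (exp K * K))"
      using g by (intro mult_left_mono) auto
    finally show ?thesis by (simp only: ac_simps)
  qed
  have bndAE: "AE y in r x. \<bar>\<alpha> s x y * exp (lam * g s x y) - \<alpha> s x y * exp (0 * g s x y)\<bar> \<le> \<bar>lam\<bar> * (K * exp K * \<bar>\<alpha> s x y\<bar>)"
    if "\<bar>lam\<bar> \<le> 1" for lam using bnd[OF that] x by (intro AE_I2) simp
  have m: "(\<lambda>y. \<alpha> s x y * exp (lam * g s x y)) \<in> borel_measurable (r x)" for lam by measurable
  have i0: "integrable (r x) (\<lambda>y. \<alpha> s x y * exp (0 * g s x y))" using ia by simp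
  have iw: "integrable (r x) (\<lambda>y. K * exp K * \<bar>\<alpha> s x y\<bar>)" using ia by simp
  have der: "AE y in r x. ((\<lambda>lam. \<alpha> s x y * exp (lam * g s x y)) has_real_derivative \<alpha> s x y * g s x y) (at 0)"
    by (intro AE_I2) (auto intro!: derivative_eq_intros)
  have m': "(\<lambda>y. \<alpha> s x y * g s x y) \<in> borel_measurable (r x)" by measurable
  note dom = has_derivative_integral_dominated[where f = "\<lambda>lam y. \<alpha> s x y * exp (lam * g s x y)", OF zero_less_one m i0 iw bndAE der m']
  show "((\<lambda>lam. tilted_contract lam \<alpha> s x) has_real_derivative contract r (\<lambda>x y. \<alpha> s x y * g s x y) x) (at 0)"
    unfolding tilted_contract_def contract_def by (rule dom(3))
  show "\<bar>tilted_contract 0 \<alpha> s x\<bar> \<le> enn2real (abs_contract r (\<alpha> s) x)"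
    unfolding abs_eq tilted_contract_def contract_def by (simp add: integral_abs_bound)
  show "\<bar>tilted_contract lam \<alpha> s x - tilted_contract 0 \<alpha> s x\<bar> \<le> \<bar>lam\<bar> * ((K * exp K) * enn2real (abs_contract r (\<alpha> s) x))"
    if lam: "\<bar>lam\<bar> \<le> 1" for lam
  proof -
    have il: "integrable (r x) (\<lambda>y. \<alpha> s x y * exp (lam * g s x y))" by (rule dom(1)) (use lam in simp_all)
    have "\<bar>tilted_contract lam \<alpha> s x - tilted_contract 0 \<alpha> s x\<bar> =
        \<bar>\<integral>y. \<alpha> s x y * exp (lam * g s x y) - \<alpha> s x y * exp (0 * g s x y) \<partial>r x\<bar>"
      unfolding tilted_contract_def contract_def by (subst Bochner_Integration.integral_diff[OF il i0]) (rule refl)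
    also have "\<dots> \<le> (\<integral>y. \<bar>\<alpha> s x y * exp (lam * g s x y) - \<alpha> s x y * exp (0 * g s x y)\<bar> \<partial>r x)" by (rule integral_abs_bound)
    also have "\<dots> \<le> (\<integral>y. \<bar>lam\<bar> * (K * exp K * \<bar>\<alpha> s x y\<bar>) \<partial>r x)"
      by (rule integral_mono_AE[OF _ _ bndAE[OF lam]]) (use il i0 iw in auto)
    also have "\<dots> = \<bar>lam\<bar> * ((K * exp K) * enn2real (abs_contract r (\<alpha> s) x))" by (simp add: abs_eq)
    finally show ?thesis .
  qed
qed

text \<open>After \<open>levy_integral\<close> the observable is a time integral whose integrand
  depends on lambda through the rates. Its derivative at 0 is the contraction of \<alpha> g, the
  first term of the formula; the density contributes the second.\<close>

lemma response_jump_sum: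
  assumes p: "(1::ennreal) < p" and \<alpha>: "(\<lambda>(s, x, y). \<alpha> s x y) \<in> borel_measurable (borel \<Otimes>\<^sub>M S \<Otimes>\<^sub>M S)"
    and Lp: "Lp_norm P p (\<lambda>\<omega>. \<integral>\<^sup>+s\<in>{0..t}. abs_contract r (\<alpha> s) (X s \<omega>) \<partial>lborel) < \<top>"
  shows "has_linear_response M (\<lambda>lam \<omega>. jump_sum t \<alpha> (\<lambda>s. X' lam s \<omega>))
      ((LINT s:{0..t}|lborel. (\<integral>\<omega>. contract r (\<lambda>x y. \<alpha> s x y * g s x y) (X s \<omega>) \<partial>P)) +
       (LINT s:{0..t}|lborel. (LINT u:{0..s}|lborel. (\<integral>\<omega>. contract r (\<alpha> s) (X s \<omega>) * pg (s - u) (X (s - u) \<omega>) \<partial>P))))"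
    "time_integrable t P (\<lambda>s \<omega>. contract r (\<lambda>x y. \<alpha> s x y * g s x y) (X s \<omega>))"
    "triangle_integrable t P (\<lambda>s u \<omega>. contract r (\<alpha> s) (X s \<omega>) * pg (s - u) (X (s - u) \<omega>))"
    "triangle_integrable t P (\<lambda>s u \<omega>. contract r (\<alpha> s) (X u \<omega>) * pg (s - u) (X 0 \<omega>))"
proof -
  note am[measurable (raw)] = measurable_uncurry3[OF \<alpha>]
  interpret LP: pair_sigma_finite "L t" P by (rule pair_L_P)
  obtain l C where l: "0 < l" "l \<le> 1" and C: "C < \<top>" and W1: "(\<integral>\<^sup>+\<omega>. ennreal (W l \<omega>) \<partial>P) < \<top>"
    and WC: "\<And>f. f \<in> borel_measurable P \<Longrightarrow> (\<integral>\<^sup>+\<omega>. f \<omega> * ennreal (W l \<omega>) \<partial>P) \<le> Lp_norm P p f * C"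
    by (rule Lp_bound_W[OF p]) blast
  let ?I = "\<lambda>z. abs_contract r (\<alpha> (fst z)) (X (fst z) (snd z))"
  have Wp: "0 < W l \<omega>" for \<omega> using l by (simp add: W_def)
  \<comment> \<open>The hypothesis bounds the norm of the time integral. Tonelli's theorem puts time
    innermost, where \<open>W l\<close> is constant and can be pulled out.\<close>
  have fin: "(\<integral>\<^sup>+z. ?I z * ennreal (W l (snd z)) \<partial>(L t \<Otimes>\<^sub>M P)) < \<top>"
  proof -
    have "(\<integral>\<^sup>+z. ?I z * ennreal (W l (snd z)) \<partial>(L t \<Otimes>\<^sub>M P)) =
        (\<integral>\<^sup>+s. \<integral>\<^sup>+\<omega>. indicator {0..t} s * (abs_contract r (\<alpha> s) (X s \<omega>) * ennreal (W l \<omega>)) \<partial>P \<partial>lborel)"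
      by (subst nn_integral_L_P) (auto intro!: nn_integral_cong simp: indicator_def)
    also have "\<dots> = (\<integral>\<^sup>+\<omega>. \<integral>\<^sup>+s. indicator {0..t} s * (abs_contract r (\<alpha> s) (X s \<omega>) * ennreal (W l \<omega>)) \<partial>lborel \<partial>P)"
      by (rule lborel_M.Fubini'[symmetric]) measurable
    also have "\<dots> = (\<integral>\<^sup>+\<omega>. (\<integral>\<^sup>+s\<in>{0..t}. abs_contract r (\<alpha> s) (X s \<omega>) \<partial>lborel) * ennreal (W l \<omega>) \<partial>P)"
    proof (rule nn_integral_cong)
      fix \<omega> assume \<omega>: "\<omega> \<in> space P"
      have [measurable]: "(\<lambda>s. X s \<omega>) \<in> measurable lborel S"
        by (rule measurable_jump_path) (use \<omega> in simp_all)
      have m: "(\<lambda>s. abs_contract r (\<alpha> s) (X s \<omega>) * indicator {0..t} s) \<in> borel_measurable lborel"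
        by measurable
      have "(\<integral>\<^sup>+s. indicator {0..t} s * (abs_contract r (\<alpha> s) (X s \<omega>) * ennreal (W l \<omega>)) \<partial>lborel) =
          (\<integral>\<^sup>+s. abs_contract r (\<alpha> s) (X s \<omega>) * indicator {0..t} s * ennreal (W l \<omega>) \<partial>lborel)"
        by (intro nn_integral_cong) (simp only: ac_simps)
      also have "\<dots> = (\<integral>\<^sup>+s\<in>{0..t}. abs_contract r (\<alpha> s) (X s \<omega>) \<partial>lborel) * ennreal (W l \<omega>)"
        by (rule nn_integral_multc[OF m])
      finally show "(\<integral>\<^sup>+s. indicator {0..t} s * (abs_contract r (\<alpha> s) (X s \<omega>) * ennreal (W l \<omega>)) \<partial>lborel) =
        (\<integral>\<^sup>+s\<in>{0..t}. abs_contract r (\<alpha> s) (X s \<omega>) \<partial>lborel) * ennreal (W l \<omega>)" .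
    qed
    also have "\<dots> \<le> Lp_norm P p (\<lambda>\<omega>. \<integral>\<^sup>+s\<in>{0..t}. abs_contract r (\<alpha> s) (X s \<omega>) \<partial>lborel) * C"
      by (rule WC) measurable
    also have "\<dots> < \<top>" using Lp C by (simp add: ennreal_mult_less_top)
    finally show ?thesis .
  qed
  \<comment> \<open>As \<open>W l\<close> is strictly positive, finiteness of the product forces
    finiteness of the contraction.\<close>
  have AEI: "AE z in L t \<Otimes>\<^sub>M P. ?I z < \<top>"
  proof -
    have "AE z in L t \<Otimes>\<^sub>M P. ?I z * ennreal (W l (snd z)) \<noteq> \<infinity>"
      using fin by (intro nn_integral_noteq_infinite) auto
    then show ?thesis
    proof eventually_elim
      case (elim z)
      have "?I z \<noteq> \<top>"
      proof
        assume "?I z = \<top>"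
        with elim Wp[of "snd z"] show False by (simp add: ennreal_top_mult)
      qed
      then show ?case by (simp add: less_top)
    qed
  qed
  have tc0: "tilted_contract 0 \<alpha> s x = contract r (\<alpha> s) x" for s x
    by (simp add: tilted_contract_def contract_def)
  have bounds: "AE z in L t \<Otimes>\<^sub>M P. (\<forall>lam. \<bar>lam\<bar> \<le> l \<longrightarrow>
        \<bar>tilted_contract lam \<alpha> (fst z) (X (fst z) (snd z)) - tilted_contract 0 \<alpha> (fst z) (X (fst z) (snd z))\<bar> \<le> \<bar>lam\<bar> * ((K * exp K) * enn2real (?I z))) \<and>
      \<bar>tilted_contract 0 \<alpha> (fst z) (X (fst z) (snd z))\<bar> \<le> enn2real (?I z) \<and>
      ((\<lambda>lam. tilted_contract lam \<alpha> (fst z) (X (fst z) (snd z))) has_real_derivative contract r (\<lambda>x y. \<alpha> (fst z) x y * g (fst z) x y) (X (fst z) (snd z))) (at 0)"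
    using AEI AE_space
  proof eventually_elim
    case (elim z)
    have x: "X (fst z) (snd z) \<in> space S" using elim(2) by (intro jump_path_space) (auto simp: space_pair_measure)
    have "\<alpha> (fst z) (X (fst z) (snd z)) \<in> borel_measurable (r (X (fst z) (snd z)))"
      by (rule measurable_r[OF x], rule am) (use x in simp_all)
    from tilted_contract_bounds[where \<alpha> = \<alpha> and s = "fst z", OF x this elim(1)] l show ?case by auto
  qed
  have fin': "(\<integral>\<^sup>+z. ennreal (enn2real (?I z) * W l (snd z)) \<partial>(L t \<Otimes>\<^sub>M P)) < \<top>"
  proof (rule order_le_less_trans[OF nn_integral_mono_AE fin])
    show "AE z in L t \<Otimes>\<^sub>M P. ennreal (enn2real (?I z) * W l (snd z)) \<le> ?I z * ennreal (W l (snd z))"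
      using AEI by eventually_elim (simp add: ennreal_mult less_imp_le[OF Wp])
  qed
  have b'm: "(\<lambda>(s, x). contract r (\<lambda>x y. \<alpha> s x y * g s x y) x) \<in> borel_measurable (borel \<Otimes>\<^sub>M S)" by measurable
  have bbm: "(\<lambda>(s, x). enn2real (abs_contract r (\<alpha> s) x)) \<in> borel_measurable (borel \<Otimes>\<^sub>M S)" by measurable
  have KC: "0 \<le> K * exp K" using K_nonneg by simp
  note R = response_integral[where b = "\<lambda>lam. tilted_contract lam \<alpha>" and b' = "\<lambda>s. contract r (\<lambda>x y. \<alpha> s x y * g s x y)"
      and bb = "\<lambda>s x. enn2real (abs_contract r (\<alpha> s) x)", OF l W1 KC measurable_tilted_contract[OF \<alpha>] b'm bbm enn2real_nonneg bounds fin']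
  show "time_integrable t P (\<lambda>s \<omega>. contract r (\<lambda>x y. \<alpha> s x y * g s x y) (X s \<omega>))" by (rule R(3))
  show "triangle_integrable t P (\<lambda>s u \<omega>. contract r (\<alpha> s) (X s \<omega>) * pg (s - u) (X (s - u) \<omega>))"
    using R(4) by (simp only: tc0)
  show "triangle_integrable t P (\<lambda>s u \<omega>. contract r (\<alpha> s) (X u \<omega>) * pg (s - u) (X 0 \<omega>))"
    using R(5) by (simp only: tc0)
  show "has_linear_response M (\<lambda>lam \<omega>. jump_sum t \<alpha> (\<lambda>s. X' lam s \<omega>))
      ((LINT s:{0..t}|lborel. (\<integral>\<omega>. contract r (\<lambda>x y. \<alpha> s x y * g s x y) (X s \<omega>) \<partial>P)) +
       (LINT s:{0..t}|lborel. (LINT u:{0..s}|lborel. (\<integral>\<omega>. contract r (\<alpha> s) (X s \<omega>) * pg (s - u) (X (s - u) \<omega>) \<partial>P))))"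
  proof (rule has_linear_responseI[OF l(1) _ R(2)[unfolded tc0]])
    fix lam :: real assume lam: "\<bar>lam\<bar> \<le> l"
    \<comment> \<open>\<open>levy_integral\<close> needs a sign, so the two parts are treated
      separately and subtracted, first for the sums over jumps and then for the time
      integrals.\<close>
    let ?ap = "\<lambda>s x y. max 0 (\<alpha> s x y)" and ?an = "\<lambda>s x y. max 0 (- \<alpha> s x y)"
    let ?Q = "L t \<Otimes>\<^sub>M M lam"
    have ap: "(\<lambda>(s, x, y). ?ap s x y) \<in> borel_measurable (borel \<Otimes>\<^sub>M S \<Otimes>\<^sub>M S)"
      and an: "(\<lambda>(s, x, y). ?an s x y) \<in> borel_measurable (borel \<Otimes>\<^sub>M S \<Otimes>\<^sub>M S)" by measurable
    have finpm: "(\<integral>\<^sup>+z. abs_contract r (\<beta> (fst z)) (X (fst z) (snd z)) * ennreal (W l (snd z)) \<partial>(L t \<Otimes>\<^sub>M P)) < \<top>"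
      if "\<And>s x y. \<bar>\<beta> s x y\<bar> \<le> \<bar>\<alpha> s x y\<bar>" for \<beta>
      by (rule order_le_less_trans[OF _ fin]) (unfold abs_contract_def, intro nn_integral_mono mult_right_mono ennreal_leI that, simp)
    have finp: "(\<integral>\<^sup>+z. abs_contract r (?ap (fst z)) (X (fst z) (snd z)) * ennreal (W l (snd z)) \<partial>(L t \<Otimes>\<^sub>M P)) < \<top>"
      by (rule finpm) auto
    have finn: "(\<integral>\<^sup>+z. abs_contract r (?an (fst z)) (X (fst z) (snd z)) * ennreal (W l (snd z)) \<partial>(L t \<Otimes>\<^sub>M P)) < \<top>"
      by (rule finpm) auto
    note Lp = levy_integral[OF l W1 lam ap max.cobounded1 finp] and Ln = levy_integral[OF l W1 lam an max.cobounded1 finn]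
    have dec: "\<alpha> = (\<lambda>s x y. ?ap s x y - ?an s x y)" by (auto simp: fun_eq_iff max_def)
    have js: "jump_sum t \<alpha> \<xi> = jump_sum t ?ap \<xi> - jump_sum t ?an \<xi>" for \<xi>
      by (subst dec, rule jump_sum_diff)
    have "(\<integral>\<omega>. jump_sum t \<alpha> (\<lambda>s. X' lam s \<omega>) \<partial>M lam) =
        (\<integral>\<omega>. jump_sum t ?ap (\<lambda>s. X' lam s \<omega>) \<partial>M lam) - (\<integral>\<omega>. jump_sum t ?an (\<lambda>s. X' lam s \<omega>) \<partial>M lam)"
      unfolding js by (rule Bochner_Integration.integral_diff[OF Lp(1) Ln(1)])
    also have "\<dots> = (\<integral>z. tilted_contract lam ?ap (fst z) (X' lam (fst z) (snd z)) - tilted_contract lam ?an (fst z) (X' lam (fst z) (snd z)) \<partial>?Q)"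
      unfolding Lp(3) Ln(3) by (rule Bochner_Integration.integral_diff[OF Lp(2) Ln(2), symmetric])
    also have "\<dots> = (\<integral>z. tilted_contract lam \<alpha> (fst z) (X' lam (fst z) (snd z)) \<partial>?Q)"
    proof (rule integral_cong_AE)
      note mp = measurable_uncurry[OF measurable_tilted_contract[OF ap, of lam] measurable_fst_L measurable_X'_L]
        and mn = measurable_uncurry[OF measurable_tilted_contract[OF an, of lam] measurable_fst_L measurable_X'_L]
      show "(\<lambda>z. tilted_contract lam ?ap (fst z) (X' lam (fst z) (snd z)) - tilted_contract lam ?an (fst z) (X' lam (fst z) (snd z))) \<in> borel_measurable ?Q"
        by (rule borel_measurable_diff[OF mp mn])
      show "(\<lambda>z. tilted_contract lam \<alpha> (fst z) (X' lam (fst z) (snd z))) \<in> borel_measurable ?Q"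
        by (rule measurable_uncurry[OF measurable_tilted_contract[OF \<alpha>, of lam] measurable_fst_L measurable_X'_L])
      show "AE z in ?Q. tilted_contract lam ?ap (fst z) (X' lam (fst z) (snd z)) - tilted_contract lam ?an (fst z) (X' lam (fst z) (snd z)) =
          tilted_contract lam \<alpha> (fst z) (X' lam (fst z) (snd z))"
        using Lp(4) Ln(4)
      proof eventually_elim
        case (elim z)
        show ?case
          unfolding tilted_contract_def contract_def Bochner_Integration.integral_diff[OF elim, symmetric]
          by (rule Bochner_Integration.integral_cong[OF refl]) (simp add: max_def)
      qed
    qed
    finally have eq: "(\<integral>\<omega>. jump_sum t \<alpha> (\<lambda>s. X' lam s \<omega>) \<partial>M lam) = (\<integral>z. tilted_contract lam \<alpha> (fst z) (X' lam (fst z) (snd z)) \<partial>?Q)" .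
    have "integrable (M lam) (\<lambda>\<omega>. jump_sum t \<alpha> (\<lambda>s. X' lam s \<omega>))"
      unfolding js by (rule Bochner_Integration.integrable_diff[OF Lp(1) Ln(1)])
    with eq show "integrable (M lam) (\<lambda>\<omega>. jump_sum t \<alpha> (\<lambda>s. X' lam s \<omega>)) \<and>
      (\<integral>\<omega>. jump_sum t \<alpha> (\<lambda>s. X' lam s \<omega>) \<partial>M lam) = (\<integral>z. tilted_contract lam \<alpha> (fst z) (X' lam (fst z) (snd z)) \<partial>?Q)" by simp
  qed
qed

end

section \<open>Reduction to functions defined at all times\<close>

lemma measurable_extend_by_zero:
  fixes f :: "real \<times> 'z \<Rightarrow> real"
  assumes t: "0 \<le> t" and f: "f \<in> borel_measurable (restrict_space borel {0..t} \<Otimes>\<^sub>M N)"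
  shows "(\<lambda>(s, z). if s \<in> {0..t} then f (s, z) else 0) \<in> borel_measurable (borel \<Otimes>\<^sub>M N)"
proof -
  \<comment> \<open>Clamping maps the line measurably into the window, where measurability of
    \<open>f\<close> is available; outside the window the value is then overwritten by 0.\<close>
  have "(\<lambda>s. max 0 (min s t)) \<in> measurable borel (restrict_space borel {0..t})"
    using t by (intro measurable_restrict_space2) auto
  from measurable_compose[OF measurable_Pair[OF measurable_compose[OF measurable_fst this] measurable_snd] f]
  have [measurable]: "(\<lambda>z. f (max 0 (min (fst z) t), snd z)) \<in> borel_measurable (borel \<Otimes>\<^sub>M N)" .
  have "(\<lambda>z. if fst z \<in> {0..t} then f (max 0 (min (fst z) t), snd z) else 0) \<in> borel_measurable (borel \<Otimes>\<^sub>M N)"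
    by measurable
  also have "(\<lambda>z. if fst z \<in> {0..t} then f (max 0 (min (fst z) t), snd z) else 0) = (\<lambda>(s, z). if s \<in> {0..t} then f (s, z) else 0)"
    by (auto simp: fun_eq_iff max_def min_def)
  finally show ?thesis .
qed

text \<open>The axioms evaluate the rates only at times between 0 and a time of the window. So the
  window may be shrunk from the half-line to \<open>{0..t}\<close>, and the kernels may be replaced
  by any that agree with them on \<open>{0..t}\<close>.\<close>

lemma jump_process_restrict:
  assumes jp: "jump_process M S I q \<pi> T Z" and I: "{0..t} \<subseteq> I" and q: "\<And>s. s \<in> {0..t} \<Longrightarrow> q s = q' s"
  shows "jump_process M S {0..t} q' \<pi> T Z"
proof -
  interpret jump_process M S I q \<pi> T Z by (rule jp)
  have T0: "0 \<le> T n \<omega>" if "\<omega> \<in> space M" for n \<omega>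
  proof (induction n)
    case (Suc n)
    then show ?case using T_Suc[OF that, of n] by linarith
  qed (simp add: T_0[OF that])
  show ?thesis
  proof (intro jump_process.intro jump_process_axioms.intro measurable_T measurable_Z initial_law)
    show "prob_space M" by (rule prob_space_axioms)
    show "T 0 \<omega> = 0" if "\<omega> \<in> space M" for \<omega> by (rule T_0[OF that])
    show "T n \<omega> < T (Suc n) \<omega>" if "\<omega> \<in> space M" for n \<omega> by (rule T_Suc[OF that])
    show "Z (Suc n) \<omega> \<noteq> Z n \<omega>" if "\<omega> \<in> space M" "T (Suc n) \<omega> \<in> {0..t}" for n \<omega>
      using Z_Suc[OF that(1)] that(2) I by blast
    show "AE \<omega> in M. T n \<omega> \<le> u \<longrightarrow>
        real_cond_exp M (history M S T Z n) (indicator {\<omega>\<in>space M. u < T (Suc n) \<omega>}) \<omega> =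
        exp (- (LINT w:{T n \<omega>..u}|lborel. measure (q' w (Z n \<omega>)) (space S)))" if u: "u \<in> {0..t}" for n u
    proof -
      have "u \<in> I" using u I by blast
      from waiting_time[OF this, of n] AE_space show ?thesis
      proof eventually_elim
        case (elim \<omega>)
        have "(LINT w:{T n \<omega>..u}|lborel. measure (q w (Z n \<omega>)) (space S)) = (LINT w:{T n \<omega>..u}|lborel. measure (q' w (Z n \<omega>)) (space S))"
          using T0[OF elim(2), of n] u q by (intro set_lebesgue_integral_cong) auto
        with elim(1) show ?case by simp
      qed
    qed
    show "AE \<omega> in M. T (Suc n) \<omega> \<in> {0..t} \<longrightarrow>
        real_cond_exp M (pre_jump_history M S T Z n) (indicator {\<omega>\<in>space M. Z (Suc n) \<omega> \<in> C}) \<omega> =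
        measure (q' (T (Suc n) \<omega>) (Z n \<omega>)) C / measure (q' (T (Suc n) \<omega>) (Z n \<omega>)) (space S)" if "C \<in> sets S" for n C
      using jump_law[OF that, of n]
    proof eventually_elim
      case (elim \<omega>)
      show ?case
      proof
        assume Tn: "T (Suc n) \<omega> \<in> {0..t}"
        then have "T (Suc n) \<omega> \<in> I" using I by blast
        with elim q[OF Tn] show "real_cond_exp M (pre_jump_history M S T Z n) (indicator {\<omega>\<in>space M. Z (Suc n) \<omega> \<in> C}) \<omega> =
          measure (q' (T (Suc n) \<omega>) (Z n \<omega>)) C / measure (q' (T (Suc n) \<omega>) (Z n \<omega>)) (space S)" by simp
      qed
    qed
  qed
qed

text \<open>This and the next three lemmas exchange integrands that agree only on the window or on
  the triangle, as happens when a function is extended by zero.\<close>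

lemma set_integral_Icc_cong:
  fixes f f' :: "real \<Rightarrow> real"
  assumes "\<And>s. s \<in> {a..b} \<Longrightarrow> f s = f' s"
  shows "(LINT s:{a..b}|lborel. f s) = (LINT s:{a..b}|lborel. f' s)"
  using assms by (intro set_lebesgue_integral_cong) auto

lemma triangle_integral_cong:
  fixes f f' :: "real \<Rightarrow> real \<Rightarrow> real"
  assumes "\<And>s u. 0 \<le> u \<Longrightarrow> u \<le> s \<Longrightarrow> s \<le> t \<Longrightarrow> f s u = f' s u"
  shows "(LINT s:{0..t}|lborel. (LINT u:{0..s}|lborel. f s u)) = (LINT s:{0..t}|lborel. (LINT u:{0..s}|lborel. f' s u))"
  using assms by (intro set_integral_Icc_cong) auto

lemma time_integrable_cong:
  assumes "\<And>s \<omega>. s \<in> {0..t} \<Longrightarrow> \<omega> \<in> space N \<Longrightarrow> f s \<omega> = f' s \<omega>"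
  shows "time_integrable t N f \<longleftrightarrow> time_integrable t N f'"
  unfolding time_integrable_def
  by (rule Bochner_Integration.integrable_cong) (auto simp: space_pair_measure space_restrict_space assms)

lemma triangle_integrable_cong:
  assumes "\<And>s u \<omega>. 0 \<le> u \<Longrightarrow> u \<le> s \<Longrightarrow> s \<le> t \<Longrightarrow> \<omega> \<in> space N \<Longrightarrow> f s u \<omega> = f' s u \<omega>"
  shows "triangle_integrable t N f \<longleftrightarrow> triangle_integrable t N f'"
  unfolding triangle_integrable_def
  by (rule Bochner_Integration.integrable_cong) (auto simp: space_pair_measure space_restrict_space assms)

text \<open>The lemmas above work with functions given at all times. The proof replaces
  \<open>g\<close>, \<open>v\<close> and \<open>\<alpha>\<close> by their extensions by zero;
  processes and formulas read them only inside the window. What remains is stationarity, which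
  passes between the forms of a formula, and the factorisation of \<open>psi\<close> in the
  decoupled case.\<close>

theorem theorem3p6:
  fixes S :: "'a measure" and \<pi> :: "'a measure"
    and r rstar :: "'a \<Rightarrow> 'a measure"
    and t :: real and g :: "real \<Rightarrow> 'a \<Rightarrow> 'a \<Rightarrow> real"
    and P :: "'w measure" and T :: "nat \<Rightarrow> 'w \<Rightarrow> real" and Z :: "nat \<Rightarrow> 'w \<Rightarrow> 'a"
    and M :: "real \<Rightarrow> 'v measure"
    and T' :: "real \<Rightarrow> nat \<Rightarrow> 'v \<Rightarrow> real" and Z' :: "real \<Rightarrow> nat \<Rightarrow> 'v \<Rightarrow> 'a"
    and X :: "real \<Rightarrow> 'w \<Rightarrow> 'a" and X' :: "real \<Rightarrow> real \<Rightarrow> 'v \<Rightarrow> 'a"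
    and \<psi> :: "real \<Rightarrow> 'a \<Rightarrow> real"
  defines "X \<equiv> jump_path T Z"
    and "X' \<equiv> (\<lambda>lam. jump_path (T' lam) (Z' lam))"
    and "\<psi> \<equiv> psi r rstar g"
  assumes singletons: "\<And>x. x \<in> space S \<Longrightarrow> {x} \<in> sets S"
    and kernel: "jump_kernel S r"
    and unperturbed: "jump_process P S {0..} (\<lambda>_. r) \<pi> T Z"
    and nonexpl: "nonexplosive P T"
    and invariant: "stationary P S X"
    and kernel_star: "jump_kernel S rstar"
    and reversal: "reversed_kernel S \<pi> r rstar"
    and t_pos: "0 < t"
    and g_measurable: "(\<lambda>(s, x, y). g s x y) \<in>
          borel_measurable (restrict_space borel {0..t} \<Otimes>\<^sub>M S \<Otimes>\<^sub>M S)"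
    and g_bounded: "\<exists>K. \<forall>s\<in>{0..t}. \<forall>x\<in>space S. \<forall>y\<in>space S. \<bar>g s x y\<bar> \<le> K"
    and g_C: "condition_C P X r t g"
    and perturbed: "\<And>lam. jump_process (M lam) S {0..t} (tilted_kernel r g lam) \<pi> (T' lam) (Z' lam)"
  shows
    "(\<forall>(p::ennreal) (v :: 'a \<Rightarrow> real).
        1 < p \<longrightarrow> v \<in> borel_measurable S \<longrightarrow>
        Lp_norm P p (\<lambda>\<omega>. ennreal \<bar>v (X t \<omega>)\<bar>) < \<top> \<longrightarrow>
        has_linear_response M (\<lambda>lam \<omega>. v (X' lam t \<omega>))
          (LINT s:{0..t}|lborel. (\<integral>\<omega>. v (X t \<omega>) * \<psi> (t - s) (X (t - s) \<omega>) \<partial>P)) \<and>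
        time_integrable t P (\<lambda>s \<omega>. v (X t \<omega>) * \<psi> (t - s) (X (t - s) \<omega>)) \<and>
        has_linear_response M (\<lambda>lam \<omega>. v (X' lam t \<omega>))
          (LINT s:{0..t}|lborel. (\<integral>\<omega>. v (X s \<omega>) * \<psi> (t - s) (X 0 \<omega>) \<partial>P)) \<and>
        time_integrable t P (\<lambda>s \<omega>. v (X s \<omega>) * \<psi> (t - s) (X 0 \<omega>)) \<and>
        (\<forall>(\<tau> :: real \<Rightarrow> real) (E :: 'a \<Rightarrow> 'a \<Rightarrow> real).
           (\<forall>s\<in>{0..t}. \<forall>x\<in>space S. \<forall>y\<in>space S. g s x y = \<tau> s * E x y) \<longrightarrow>
           has_linear_response M (\<lambda>lam \<omega>. v (X' lam t \<omega>))
             (LINT s:{0..t}|lborel. \<tau> (t - s) *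
                (\<integral>\<omega>. v (X s \<omega>) * (contract rstar (\<lambda>x y. E y x) (X 0 \<omega>) - contract r E (X 0 \<omega>)) \<partial>P)) \<and>
           time_integrable t P (\<lambda>s \<omega>. \<tau> (t - s) *
             (v (X s \<omega>) * (contract rstar (\<lambda>x y. E y x) (X 0 \<omega>) - contract r E (X 0 \<omega>))))))
     \<and>
     (\<forall>(p::ennreal) (v :: real \<Rightarrow> 'a \<Rightarrow> real).
        1 < p \<longrightarrow>
        (\<lambda>(s, x). v s x) \<in> borel_measurable (restrict_space borel {0..t} \<Otimes>\<^sub>M S) \<longrightarrow>
        (\<integral>\<^sup>+s\<in>{0..t}. Lp_norm P p (\<lambda>\<omega>. ennreal \<bar>v s (X s \<omega>)\<bar>) \<partial>lborel) < \<top> \<longrightarrow>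
        (\<forall>\<^sub>F lam in nhds 0. time_integrable t (M lam) (\<lambda>s \<omega>. v s (X' lam s \<omega>))) \<and>
        has_linear_response M (\<lambda>lam \<omega>. LINT s:{0..t}|lborel. v s (X' lam s \<omega>))
          (LINT s:{0..t}|lborel. (LINT u:{0..s}|lborel.
             (\<integral>\<omega>. v s (X s \<omega>) * \<psi> (s - u) (X (s - u) \<omega>) \<partial>P))) \<and>
        triangle_integrable t P (\<lambda>s u \<omega>. v s (X s \<omega>) * \<psi> (s - u) (X (s - u) \<omega>)) \<and>
        (\<forall>(\<tau> :: real \<Rightarrow> real) (E :: 'a \<Rightarrow> 'a \<Rightarrow> real).
           (\<forall>s\<in>{0..t}. \<forall>x\<in>space S. \<forall>y\<in>space S. g s x y = \<tau> s * E x y) \<longrightarrow>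
           has_linear_response M (\<lambda>lam \<omega>. LINT s:{0..t}|lborel. v s (X' lam s \<omega>))
             (LINT s:{0..t}|lborel. (LINT u:{0..s}|lborel. \<tau> (s - u) *
                (\<integral>\<omega>. v s (X u \<omega>) * (contract rstar (\<lambda>x y. E y x) (X 0 \<omega>) - contract r E (X 0 \<omega>)) \<partial>P))) \<and>
           triangle_integrable t P (\<lambda>s u \<omega>. \<tau> (s - u) *
             (v s (X u \<omega>) * (contract rstar (\<lambda>x y. E y x) (X 0 \<omega>) - contract r E (X 0 \<omega>))))))
     \<and>
     (\<forall>(p::ennreal) (\<alpha> :: real \<Rightarrow> 'a \<Rightarrow> 'a \<Rightarrow> real).
        1 < p \<longrightarrow>
        (\<lambda>(s, x, y). \<alpha> s x y) \<in> borel_measurable (restrict_space borel {0..t} \<Otimes>\<^sub>M S \<Otimes>\<^sub>M S) \<longrightarrow>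
        Lp_norm P p (\<lambda>\<omega>. ennreal (jump_sum t (\<lambda>s x y. \<bar>\<alpha> s x y\<bar>) (\<lambda>s. X s \<omega>))) < \<top> \<longrightarrow>
        Lp_norm P p (\<lambda>\<omega>. \<integral>\<^sup>+s\<in>{0..t}. abs_contract r (\<alpha> s) (X s \<omega>) \<partial>lborel) < \<top> \<longrightarrow>
        has_linear_response M (\<lambda>lam \<omega>. jump_sum t \<alpha> (\<lambda>s. X' lam s \<omega>))
          ((LINT s:{0..t}|lborel. (\<integral>\<omega>. contract r (\<lambda>x y. \<alpha> s x y * g s x y) (X s \<omega>) \<partial>P)) +
           (LINT s:{0..t}|lborel. (LINT u:{0..s}|lborel.
             (\<integral>\<omega>. contract r (\<alpha> s) (X s \<omega>) * \<psi> (s - u) (X (s - u) \<omega>) \<partial>P)))) \<and>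
        time_integrable t P (\<lambda>s \<omega>. contract r (\<lambda>x y. \<alpha> s x y * g s x y) (X s \<omega>)) \<and>
        triangle_integrable t P (\<lambda>s u \<omega>. contract r (\<alpha> s) (X s \<omega>) * \<psi> (s - u) (X (s - u) \<omega>)) \<and>
        (\<forall>(\<tau> :: real \<Rightarrow> real) (E :: 'a \<Rightarrow> 'a \<Rightarrow> real).
           (\<forall>s\<in>{0..t}. \<forall>x\<in>space S. \<forall>y\<in>space S. g s x y = \<tau> s * E x y) \<longrightarrow>
           has_linear_response M (\<lambda>lam \<omega>. jump_sum t \<alpha> (\<lambda>s. X' lam s \<omega>))
             ((LINT s:{0..t}|lborel. \<tau> s *
                (\<integral>\<omega>. contract r (\<lambda>x y. \<alpha> s x y * E x y) (X s \<omega>) \<partial>P)) +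
              (LINT s:{0..t}|lborel. (LINT u:{0..s}|lborel. \<tau> (s - u) *
                (\<integral>\<omega>. contract r (\<alpha> s) (X u \<omega>) *
                   (contract rstar (\<lambda>x y. E y x) (X 0 \<omega>) - contract r E (X 0 \<omega>)) \<partial>P)))) \<and>
           time_integrable t P (\<lambda>s \<omega>. \<tau> s * contract r (\<lambda>x y. \<alpha> s x y * E x y) (X s \<omega>)) \<and>
           triangle_integrable t P (\<lambda>s u \<omega>. \<tau> (s - u) *
             (contract r (\<alpha> s) (X u \<omega>) *
                (contract rstar (\<lambda>x y. E y x) (X 0 \<omega>) - contract r E (X 0 \<omega>))))))"
proof -
  note X_def = assms(1) and X'_def = assms(2) and \<psi>_def = assms(3)
  \<comment> \<open>The extension by zero keeps the bound and gives measurability on the whole line,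
    as the locale \<open>tilt\<close> demands.\<close>
  define g' where "g' = (\<lambda>s x y. if s \<in> {0..t} then g s x y else 0)"
  have g'_eq: "g' s = g s" if "s \<in> {0..t}" for s using that by (auto simp: g'_def)
  obtain K0 where K0: "\<And>s x y. s \<in> {0..t} \<Longrightarrow> x \<in> space S \<Longrightarrow> y \<in> space S \<Longrightarrow> \<bar>g s x y\<bar> \<le> K0"
    using g_bounded by blast
  define K where "K = \<bar>K0\<bar>"
  \<comment> \<open>Tilting by 0 is taking the density exp 0 = 1, which leaves \<open>r\<close>
    unchanged; this makes the unperturbed process an instance of \<open>tilted_jump\<close>.\<close>
  have P0: "jump_process P S {0..t} (tilted_kernel r (\<lambda>_ _ _. 0) 1) \<pi> T Z"
    by (rule jump_process_restrict[OF unperturbed]) (auto simp: tilted_kernel_def fun_eq_iff density_1)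
  have tilt0: "tilt S r (\<lambda>_ _ _. 0) 0"
    using kernel by (simp add: tilt_def rate_kernel_def tilt_axioms_def)
  have tiltg: "tilt S r g' K"
  proof (intro tilt.intro rate_kernel.intro tilt_axioms.intro kernel)
    show "(\<lambda>(s, x, y). g' s x y) \<in> borel_measurable (borel \<Otimes>\<^sub>M S \<Otimes>\<^sub>M S)"
    proof -
      have "(\<lambda>(s, x, y). g' s x y) = (\<lambda>(s, z). if s \<in> {0..t} then (\<lambda>(s, x, y). g s x y) (s, z) else 0)"
        by (auto simp: g'_def fun_eq_iff)
      then show ?thesis using measurable_extend_by_zero[OF less_imp_le[OF t_pos] g_measurable] by (simp only:)
    qed
    show "\<bar>g' s x y\<bar> \<le> K" if "x \<in> space S" "y \<in> space S" for s x y
      using K0[OF _ that, of s] by (auto simp: g'_def K_def)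
  qed
  have C': "condition_C P (jump_path T Z) r t g'"
  proof -
    have "(\<integral>\<^sup>+s\<in>{0..t}. abs_contract r (g s) (jump_path T Z s \<omega>) \<partial>lborel) = (\<integral>\<^sup>+s\<in>{0..t}. abs_contract r (g' s) (jump_path T Z s \<omega>) \<partial>lborel)" for \<omega>
      by (intro nn_integral_cong) (auto simp: indicator_def g'_eq)
    then show ?thesis using g_C unfolding condition_C_def X_def by simp
  qed
  have pert: "jump_process (M lam) S {0..t} (tilted_kernel r g' lam) \<pi> (T' lam) (Z' lam)" for lam
    by (rule jump_process_restrict[OF perturbed]) (auto simp: tilted_kernel_def fun_eq_iff g'_eq)
  interpret R: response P S t r \<pi> T Z rstar g' K M T' Z'
    by (intro response.intro stationary_jump.intro tilted_jump.intro stationary_jump_axioms.intro response_axioms.intro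
        rate_kernel.intro P0 tilt0 tiltg kernel_star reversal nonexpl t_pos C' pert invariant[unfolded X_def])
  have X'_eq: "jump_path (T' lam) (Z' lam) = X' lam" for lam by (simp add: X'_def)
  have \<psi>_eq: "\<psi> s x = psi r rstar g' s x" if "s \<in> {0..t}" for s x
    using that by (simp add: \<psi>_def psi_def g'_eq)
  have Xs: "X s \<omega> \<in> space S" if "\<omega> \<in> space P" for s \<omega>
    unfolding X_def by (rule R.jump_path_space[OF that])
  \<comment> \<open>\<open>\<tau>\<close> and \<open>E\<close> are arbitrary functions with the
    given product. The constant \<open>\<tau> s\<close> leaves a Bochner integral even where
    \<open>E\<close> is not integrable, as both sides are then 0 by convention.\<close>
  have dec: "psi r rstar g' s x = \<tau> s * (contract rstar (\<lambda>x y. E y x) x - contract r E x)"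
    if E: "\<forall>s\<in>{0..t}. \<forall>x\<in>space S. \<forall>y\<in>space S. g s x y = \<tau> s * E x y" and s: "s \<in> {0..t}" and x: "x \<in> space S"
    for \<tau> E s x
  proof -
    have "(\<integral>y. g' s y x \<partial>rstar x) = (\<integral>y. \<tau> s * E y x \<partial>rstar x)"
      by (rule Bochner_Integration.integral_cong[OF refl]) (use E s x in \<open>simp add: g'_eq\<close>)
    moreover have "(\<integral>y. g' s x y \<partial>r x) = (\<integral>y. \<tau> s * E x y \<partial>r x)"
      by (rule Bochner_Integration.integral_cong[OF refl]) (use E s x in \<open>simp add: g'_eq\<close>)
    ultimately show ?thesis by (simp add: psi_def contract_def right_diff_distrib)
  qed
  have part1: "has_linear_response M (\<lambda>lam \<omega>. v (X' lam t \<omega>))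
          (LINT s:{0..t}|lborel. (\<integral>\<omega>. v (X t \<omega>) * \<psi> (t - s) (X (t - s) \<omega>) \<partial>P)) \<and>
        time_integrable t P (\<lambda>s \<omega>. v (X t \<omega>) * \<psi> (t - s) (X (t - s) \<omega>)) \<and>
        has_linear_response M (\<lambda>lam \<omega>. v (X' lam t \<omega>))
          (LINT s:{0..t}|lborel. (\<integral>\<omega>. v (X s \<omega>) * \<psi> (t - s) (X 0 \<omega>) \<partial>P)) \<and>
        time_integrable t P (\<lambda>s \<omega>. v (X s \<omega>) * \<psi> (t - s) (X 0 \<omega>)) \<and>
        (\<forall>(\<tau> :: real \<Rightarrow> real) (E :: 'a \<Rightarrow> 'a \<Rightarrow> real).
           (\<forall>s\<in>{0..t}. \<forall>x\<in>space S. \<forall>y\<in>space S. g s x y = \<tau> s * E x y) \<longrightarrow>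
           has_linear_response M (\<lambda>lam \<omega>. v (X' lam t \<omega>))
             (LINT s:{0..t}|lborel. \<tau> (t - s) *
                (\<integral>\<omega>. v (X s \<omega>) * (contract rstar (\<lambda>x y. E y x) (X 0 \<omega>) - contract r E (X 0 \<omega>)) \<partial>P)) \<and>
           time_integrable t P (\<lambda>s \<omega>. \<tau> (t - s) *
             (v (X s \<omega>) * (contract rstar (\<lambda>x y. E y x) (X 0 \<omega>) - contract r E (X 0 \<omega>)))))"
    if p: "1 < p" and v: "v \<in> borel_measurable S" and Lp: "Lp_norm P p (\<lambda>\<omega>. ennreal \<bar>v (X t \<omega>)\<bar>) < \<top>"
    for p :: ennreal and v :: "'a \<Rightarrow> real"
  proof -
    note A = R.response_at_time[OF p v Lp[unfolded X_def], folded X_def, unfolded X'_eq]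
    note shift = R.shift_integral[OF v, folded X_def]
    \<comment> \<open>The form with the initial state is the hub: the first form reaches it by a
      shift, and the decoupled one by factoring out the time dependence.\<close>
    have hlr: "has_linear_response M (\<lambda>lam \<omega>. v (X' lam t \<omega>)) c"
      if "c = (LINT s:{0..t}|lborel. (\<integral>\<omega>. v (X s \<omega>) * psi r rstar g' (t - s) (X 0 \<omega>) \<partial>P))" for c
    proof -
      have "c = (LINT s:{0..t}|lborel. (\<integral>\<omega>. v (X t \<omega>) * psi r rstar g' (t - s) (X (t - s) \<omega>) \<partial>P))"
        unfolding that by (rule set_integral_Icc_cong) (simp add: shift)
      then show ?thesis using A(1) by simp
    qed
    show ?thesis
    proof (intro conjI allI impI)
      show "has_linear_response M (\<lambda>lam \<omega>. v (X' lam t \<omega>)) (LINT s:{0..t}|lborel. (\<integral>\<omega>. v (X t \<omega>) * \<psi> (t - s) (X (t - s) \<omega>) \<partial>P))"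
        by (rule hlr, rule set_integral_Icc_cong) (simp add: shift \<psi>_eq)
      show "time_integrable t P (\<lambda>s \<omega>. v (X t \<omega>) * \<psi> (t - s) (X (t - s) \<omega>))"
        by (rule time_integrable_cong[THEN iffD1, OF _ A(2)]) (simp add: \<psi>_eq)
      show "has_linear_response M (\<lambda>lam \<omega>. v (X' lam t \<omega>)) (LINT s:{0..t}|lborel. (\<integral>\<omega>. v (X s \<omega>) * \<psi> (t - s) (X 0 \<omega>) \<partial>P))"
        by (rule hlr, rule set_integral_Icc_cong) (simp add: \<psi>_eq)
      show "time_integrable t P (\<lambda>s \<omega>. v (X s \<omega>) * \<psi> (t - s) (X 0 \<omega>))"
        by (rule time_integrable_cong[THEN iffD1, OF _ A(3)]) (simp add: \<psi>_eq)
      fix \<tau> :: "real \<Rightarrow> real" and E :: "'a \<Rightarrow> 'a \<Rightarrow> real"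
      assume E: "\<forall>s\<in>{0..t}. \<forall>x\<in>space S. \<forall>y\<in>space S. g s x y = \<tau> s * E x y"
      have pt: "\<tau> (t - s) * (v (X s \<omega>) * (contract rstar (\<lambda>x y. E y x) (X 0 \<omega>) - contract r E (X 0 \<omega>))) =
          v (X s \<omega>) * psi r rstar g' (t - s) (X 0 \<omega>)" if "s \<in> {0..t}" "\<omega> \<in> space P" for s \<omega>
        using dec[OF E, of "t - s" "X 0 \<omega>"] that Xs by simp
      show "has_linear_response M (\<lambda>lam \<omega>. v (X' lam t \<omega>)) (LINT s:{0..t}|lborel. \<tau> (t - s) *
          (\<integral>\<omega>. v (X s \<omega>) * (contract rstar (\<lambda>x y. E y x) (X 0 \<omega>) - contract r E (X 0 \<omega>)) \<partial>P))"
        by (rule hlr, rule set_integral_Icc_cong, subst integral_mult_right_zero[symmetric], rule Bochner_Integration.integral_cong[OF refl], rule pt)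
      show "time_integrable t P (\<lambda>s \<omega>. \<tau> (t - s) * (v (X s \<omega>) * (contract rstar (\<lambda>x y. E y x) (X 0 \<omega>) - contract r E (X 0 \<omega>))))"
        by (rule time_integrable_cong[THEN iffD1, OF _ A(3)]) (simp add: pt)
    qed
  qed
  \<comment> \<open>The passage between the forms of the triangle integral, for both remaining
    parts: \<open>w\<close> will be the observable itself for time integrals and the contraction of
    \<open>\<alpha>\<close> for sums over jumps, with \<open>w'\<close> its version extended by
    zero.\<close>
  have tri: "triangle_integrable t P (\<lambda>s u \<omega>. w s (X s \<omega>) * \<psi> (s - u) (X (s - u) \<omega>)) \<and>
      (LINT s:{0..t}|lborel. (LINT u:{0..s}|lborel. (\<integral>\<omega>. w s (X s \<omega>) * \<psi> (s - u) (X (s - u) \<omega>) \<partial>P))) =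
        (LINT s:{0..t}|lborel. (LINT u:{0..s}|lborel. (\<integral>\<omega>. w' s (X s \<omega>) * psi r rstar g' (s - u) (X (s - u) \<omega>) \<partial>P))) \<and>
      (\<forall>(\<tau> :: real \<Rightarrow> real) (E :: 'a \<Rightarrow> 'a \<Rightarrow> real).
         (\<forall>s\<in>{0..t}. \<forall>x\<in>space S. \<forall>y\<in>space S. g s x y = \<tau> s * E x y) \<longrightarrow>
         triangle_integrable t P (\<lambda>s u \<omega>. \<tau> (s - u) * (w s (X u \<omega>) * (contract rstar (\<lambda>x y. E y x) (X 0 \<omega>) - contract r E (X 0 \<omega>)))) \<and>
         (LINT s:{0..t}|lborel. (LINT u:{0..s}|lborel. \<tau> (s - u) *
            (\<integral>\<omega>. w s (X u \<omega>) * (contract rstar (\<lambda>x y. E y x) (X 0 \<omega>) - contract r E (X 0 \<omega>)) \<partial>P))) =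
         (LINT s:{0..t}|lborel. (LINT u:{0..s}|lborel. (\<integral>\<omega>. w' s (X s \<omega>) * psi r rstar g' (s - u) (X (s - u) \<omega>) \<partial>P))))"
    if t1: "triangle_integrable t P (\<lambda>s u \<omega>. w' s (X s \<omega>) * psi r rstar g' (s - u) (X (s - u) \<omega>))"
      and t2: "triangle_integrable t P (\<lambda>s u \<omega>. w' s (X u \<omega>) * psi r rstar g' (s - u) (X 0 \<omega>))"
      and ww: "\<And>s. s \<in> {0..t} \<Longrightarrow> w s = w' s" and wm: "\<And>s. w' s \<in> borel_measurable S"
    for w w' :: "real \<Rightarrow> 'a \<Rightarrow> real"
  proof (intro conjI allI impI)
    show "triangle_integrable t P (\<lambda>s u \<omega>. w s (X s \<omega>) * \<psi> (s - u) (X (s - u) \<omega>))"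
      by (rule triangle_integrable_cong[THEN iffD1, OF _ t1]) (simp add: \<psi>_eq ww)
    show "(LINT s:{0..t}|lborel. (LINT u:{0..s}|lborel. (\<integral>\<omega>. w s (X s \<omega>) * \<psi> (s - u) (X (s - u) \<omega>) \<partial>P))) =
        (LINT s:{0..t}|lborel. (LINT u:{0..s}|lborel. (\<integral>\<omega>. w' s (X s \<omega>) * psi r rstar g' (s - u) (X (s - u) \<omega>) \<partial>P)))"
      by (rule triangle_integral_cong) (simp add: \<psi>_eq ww)
    fix \<tau> :: "real \<Rightarrow> real" and E :: "'a \<Rightarrow> 'a \<Rightarrow> real"
    assume E: "\<forall>s\<in>{0..t}. \<forall>x\<in>space S. \<forall>y\<in>space S. g s x y = \<tau> s * E x y"
    have pt: "\<tau> (s - u) * (w s (X u \<omega>) * (contract rstar (\<lambda>x y. E y x) (X 0 \<omega>) - contract r E (X 0 \<omega>))) =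
        w' s (X u \<omega>) * psi r rstar g' (s - u) (X 0 \<omega>)" if "0 \<le> u" "u \<le> s" "s \<le> t" "\<omega> \<in> space P" for s u \<omega>
      using dec[OF E, of "s - u" "X 0 \<omega>"] that Xs ww[of s] by simp
    show "triangle_integrable t P (\<lambda>s u \<omega>. \<tau> (s - u) * (w s (X u \<omega>) * (contract rstar (\<lambda>x y. E y x) (X 0 \<omega>) - contract r E (X 0 \<omega>))))"
      by (rule triangle_integrable_cong[THEN iffD1, OF _ t2]) (simp add: pt)
    show "(LINT s:{0..t}|lborel. (LINT u:{0..s}|lborel. \<tau> (s - u) *
            (\<integral>\<omega>. w s (X u \<omega>) * (contract rstar (\<lambda>x y. E y x) (X 0 \<omega>) - contract r E (X 0 \<omega>)) \<partial>P))) =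
         (LINT s:{0..t}|lborel. (LINT u:{0..s}|lborel. (\<integral>\<omega>. w' s (X s \<omega>) * psi r rstar g' (s - u) (X (s - u) \<omega>) \<partial>P)))"
    proof (rule triangle_integral_cong)
      fix s u assume su: "0 \<le> u" "u \<le> s" "s \<le> t"
      have "\<tau> (s - u) * (\<integral>\<omega>. w s (X u \<omega>) * (contract rstar (\<lambda>x y. E y x) (X 0 \<omega>) - contract r E (X 0 \<omega>)) \<partial>P) =
          (\<integral>\<omega>. w' s (X u \<omega>) * psi r rstar g' (s - u) (X 0 \<omega>) \<partial>P)"
        by (subst integral_mult_right_zero[symmetric], rule Bochner_Integration.integral_cong[OF refl], rule pt[OF su])
      also have "\<dots> = (\<integral>\<omega>. w' s (X s \<omega>) * psi r rstar g' (s - u) (X (s - u) \<omega>) \<partial>P)"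
        unfolding X_def by (rule R.shift_integral[OF wm su(1,2)])
      finally show "\<tau> (s - u) * (\<integral>\<omega>. w s (X u \<omega>) * (contract rstar (\<lambda>x y. E y x) (X 0 \<omega>) - contract r E (X 0 \<omega>)) \<partial>P) =
          (\<integral>\<omega>. w' s (X s \<omega>) * psi r rstar g' (s - u) (X (s - u) \<omega>) \<partial>P)" .
    qed
  qed
  have part2: "(\<forall>\<^sub>F lam in nhds 0. time_integrable t (M lam) (\<lambda>s \<omega>. v s (X' lam s \<omega>))) \<and>
        has_linear_response M (\<lambda>lam \<omega>. LINT s:{0..t}|lborel. v s (X' lam s \<omega>))
          (LINT s:{0..t}|lborel. (LINT u:{0..s}|lborel.
             (\<integral>\<omega>. v s (X s \<omega>) * \<psi> (s - u) (X (s - u) \<omega>) \<partial>P))) \<and>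
        triangle_integrable t P (\<lambda>s u \<omega>. v s (X s \<omega>) * \<psi> (s - u) (X (s - u) \<omega>)) \<and>
        (\<forall>(\<tau> :: real \<Rightarrow> real) (E :: 'a \<Rightarrow> 'a \<Rightarrow> real).
           (\<forall>s\<in>{0..t}. \<forall>x\<in>space S. \<forall>y\<in>space S. g s x y = \<tau> s * E x y) \<longrightarrow>
           has_linear_response M (\<lambda>lam \<omega>. LINT s:{0..t}|lborel. v s (X' lam s \<omega>))
             (LINT s:{0..t}|lborel. (LINT u:{0..s}|lborel. \<tau> (s - u) *
                (\<integral>\<omega>. v s (X u \<omega>) * (contract rstar (\<lambda>x y. E y x) (X 0 \<omega>) - contract r E (X 0 \<omega>)) \<partial>P))) \<and>
           triangle_integrable t P (\<lambda>s u \<omega>. \<tau> (s - u) *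
             (v s (X u \<omega>) * (contract rstar (\<lambda>x y. E y x) (X 0 \<omega>) - contract r E (X 0 \<omega>)))))"
    if p: "1 < p" and v: "(\<lambda>(s, x). v s x) \<in> borel_measurable (restrict_space borel {0..t} \<Otimes>\<^sub>M S)"
      and Lp: "(\<integral>\<^sup>+s\<in>{0..t}. Lp_norm P p (\<lambda>\<omega>. ennreal \<bar>v s (X s \<omega>)\<bar>) \<partial>lborel) < \<top>"
    for p :: ennreal and v :: "real \<Rightarrow> 'a \<Rightarrow> real"
  proof -
    define w where "w = (\<lambda>s x. if s \<in> {0..t} then v s x else 0)"
    have vw: "v s = w s" if "s \<in> {0..t}" for s using that by (auto simp: w_def)
    have wm: "(\<lambda>(s, x). w s x) \<in> borel_measurable (borel \<Otimes>\<^sub>M S)"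
    proof -
      have "(\<lambda>(s, x). w s x) = (\<lambda>(s, z). if s \<in> {0..t} then (\<lambda>(s, x). v s x) (s, z) else 0)"
        by (auto simp: w_def fun_eq_iff)
      then show ?thesis using measurable_extend_by_zero[OF less_imp_le[OF t_pos] v] by (simp only:)
    qed
    have ws: "w s \<in> borel_measurable S" for s
      by (rule measurable_uncurry[OF wm, of "\<lambda>_. s" S "\<lambda>x. x"]) simp_all
    have Lp': "(\<integral>\<^sup>+s\<in>{0..t}. Lp_norm P p (\<lambda>\<omega>. ennreal \<bar>w s (X s \<omega>)\<bar>) \<partial>lborel) < \<top>"
    proof -
      have "(\<integral>\<^sup>+s\<in>{0..t}. Lp_norm P p (\<lambda>\<omega>. ennreal \<bar>w s (X s \<omega>)\<bar>) \<partial>lborel) = (\<integral>\<^sup>+s\<in>{0..t}. Lp_norm P p (\<lambda>\<omega>. ennreal \<bar>v s (X s \<omega>)\<bar>) \<partial>lborel)"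
        by (intro nn_integral_cong) (auto simp: indicator_def vw)
      then show ?thesis using Lp by simp
    qed
    note A = R.response_additive[OF p wm Lp'[unfolded X_def], folded X_def, unfolded X'_eq]
    note B = tri[OF A(3,4) vw ws]
    have Y: "(\<lambda>lam \<omega>. LINT s:{0..t}|lborel. v s (X' lam s \<omega>)) = (\<lambda>lam \<omega>. LINT s:{0..t}|lborel. w s (X' lam s \<omega>))"
      by (intro ext set_integral_Icc_cong) (simp add: vw)
    have ev: "\<forall>\<^sub>F lam in nhds 0. time_integrable t (M lam) (\<lambda>s \<omega>. v s (X' lam s \<omega>))"
      using A(1) by eventually_elim (subst time_integrable_cong, auto simp: vw)
    show ?thesis using ev A(2) B unfolding Y by simp
  qed
  have part3: "has_linear_response M (\<lambda>lam \<omega>. jump_sum t \<alpha> (\<lambda>s. X' lam s \<omega>))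
          ((LINT s:{0..t}|lborel. (\<integral>\<omega>. contract r (\<lambda>x y. \<alpha> s x y * g s x y) (X s \<omega>) \<partial>P)) +
           (LINT s:{0..t}|lborel. (LINT u:{0..s}|lborel.
             (\<integral>\<omega>. contract r (\<alpha> s) (X s \<omega>) * \<psi> (s - u) (X (s - u) \<omega>) \<partial>P)))) \<and>
        time_integrable t P (\<lambda>s \<omega>. contract r (\<lambda>x y. \<alpha> s x y * g s x y) (X s \<omega>)) \<and>
        triangle_integrable t P (\<lambda>s u \<omega>. contract r (\<alpha> s) (X s \<omega>) * \<psi> (s - u) (X (s - u) \<omega>)) \<and>
        (\<forall>(\<tau> :: real \<Rightarrow> real) (E :: 'a \<Rightarrow> 'a \<Rightarrow> real).
           (\<forall>s\<in>{0..t}. \<forall>x\<in>space S. \<forall>y\<in>space S. g s x y = \<tau> s * E x y) \<longrightarrow>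
           has_linear_response M (\<lambda>lam \<omega>. jump_sum t \<alpha> (\<lambda>s. X' lam s \<omega>))
             ((LINT s:{0..t}|lborel. \<tau> s *
                (\<integral>\<omega>. contract r (\<lambda>x y. \<alpha> s x y * E x y) (X s \<omega>) \<partial>P)) +
              (LINT s:{0..t}|lborel. (LINT u:{0..s}|lborel. \<tau> (s - u) *
                (\<integral>\<omega>. contract r (\<alpha> s) (X u \<omega>) *
                   (contract rstar (\<lambda>x y. E y x) (X 0 \<omega>) - contract r E (X 0 \<omega>)) \<partial>P)))) \<and>
           time_integrable t P (\<lambda>s \<omega>. \<tau> s * contract r (\<lambda>x y. \<alpha> s x y * E x y) (X s \<omega>)) \<and>
           triangle_integrable t P (\<lambda>s u \<omega>. \<tau> (s - u) *
             (contract r (\<alpha> s) (X u \<omega>) *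
                (contract rstar (\<lambda>x y. E y x) (X 0 \<omega>) - contract r E (X 0 \<omega>)))))"
    if p: "1 < p" and \<alpha>: "(\<lambda>(s, x, y). \<alpha> s x y) \<in> borel_measurable (restrict_space borel {0..t} \<Otimes>\<^sub>M S \<Otimes>\<^sub>M S)"
      and Lp: "Lp_norm P p (\<lambda>\<omega>. \<integral>\<^sup>+s\<in>{0..t}. abs_contract r (\<alpha> s) (X s \<omega>) \<partial>lborel) < \<top>"
    for p :: ennreal and \<alpha> :: "real \<Rightarrow> 'a \<Rightarrow> 'a \<Rightarrow> real"
  proof -
    define a where "a = (\<lambda>s x y. if s \<in> {0..t} then \<alpha> s x y else 0)"
    have eq: "\<alpha> s = a s" if "s \<in> {0..t}" for s using that by (auto simp: a_def)
    have am: "(\<lambda>(s, x, y). a s x y) \<in> borel_measurable (borel \<Otimes>\<^sub>M S \<Otimes>\<^sub>M S)"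
    proof -
      have "(\<lambda>(s, x, y). a s x y) = (\<lambda>(s, z). if s \<in> {0..t} then (\<lambda>(s, x, y). \<alpha> s x y) (s, z) else 0)"
        by (auto simp: a_def fun_eq_iff)
      then show ?thesis using measurable_extend_by_zero[OF less_imp_le[OF t_pos] \<alpha>] by (simp only:)
    qed
    have cm: "contract r (a s) \<in> borel_measurable S" for s
    proof -
      note [measurable (raw)] = measurable_uncurry3[OF am]
      show ?thesis using R.borel_measurable_contract[of "\<lambda>_. a s" "\<lambda>x. x" S] by measurable
    qed
    have Lp': "Lp_norm P p (\<lambda>\<omega>. \<integral>\<^sup>+s\<in>{0..t}. abs_contract r (a s) (X s \<omega>) \<partial>lborel) < \<top>"
    proof -
      have "(\<integral>\<^sup>+s\<in>{0..t}. abs_contract r (a s) (X s \<omega>) \<partial>lborel) = (\<integral>\<^sup>+s\<in>{0..t}. abs_contract r (\<alpha> s) (X s \<omega>) \<partial>lborel)" for \<omega>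
        by (intro nn_integral_cong) (auto simp: indicator_def eq)
      then show ?thesis using Lp by simp
    qed
    note A = R.response_jump_sum[OF p am Lp'[unfolded X_def], folded X_def, unfolded X'_eq]
    have cc: "contract r (\<alpha> s) = contract r (a s)" if "s \<in> {0..t}" for s using eq[OF that] by simp
    note B = tri[OF A(3,4) cc cm]
    have Y: "jump_sum t \<alpha> \<xi> = jump_sum t a \<xi>" for \<xi>
      unfolding jump_sum_def by (rule sum.cong) (auto simp: eq)
    have c1: "contract r (\<lambda>x y. \<alpha> s x y * g s x y) = contract r (\<lambda>x y. a s x y * g' s x y)" if "s \<in> {0..t}" for s
      using eq[OF that] g'_eq[OF that] by simp
    have i1: "(LINT s:{0..t}|lborel. (\<integral>\<omega>. contract r (\<lambda>x y. \<alpha> s x y * g s x y) (X s \<omega>) \<partial>P)) =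
        (LINT s:{0..t}|lborel. (\<integral>\<omega>. contract r (\<lambda>x y. a s x y * g' s x y) (X s \<omega>) \<partial>P))"
      by (rule set_integral_Icc_cong) (simp add: c1)
    have ti: "time_integrable t P (\<lambda>s \<omega>. contract r (\<lambda>x y. \<alpha> s x y * g s x y) (X s \<omega>))"
      by (rule time_integrable_cong[THEN iffD1, OF _ A(2)]) (simp add: c1)
    have decoupled: "(LINT s:{0..t}|lborel. \<tau> s * (\<integral>\<omega>. contract r (\<lambda>x y. \<alpha> s x y * E x y) (X s \<omega>) \<partial>P)) =
        (LINT s:{0..t}|lborel. (\<integral>\<omega>. contract r (\<lambda>x y. a s x y * g' s x y) (X s \<omega>) \<partial>P)) \<and>
        time_integrable t P (\<lambda>s \<omega>. \<tau> s * contract r (\<lambda>x y. \<alpha> s x y * E x y) (X s \<omega>))"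
      if E: "\<forall>s\<in>{0..t}. \<forall>x\<in>space S. \<forall>y\<in>space S. g s x y = \<tau> s * E x y" for \<tau> E
    proof
      have pt: "\<tau> s * contract r (\<lambda>x y. \<alpha> s x y * E x y) (X s \<omega>) = contract r (\<lambda>x y. a s x y * g' s x y) (X s \<omega>)"
        if s: "s \<in> {0..t}" and \<omega>: "\<omega> \<in> space P" for s \<omega>
      proof -
        have "(\<integral>y. \<tau> s * (\<alpha> s (X s \<omega>) y * E (X s \<omega>) y) \<partial>r (X s \<omega>)) = (\<integral>y. a s (X s \<omega>) y * g' s (X s \<omega>) y \<partial>r (X s \<omega>))"
          by (rule Bochner_Integration.integral_cong[OF refl]) (use E s Xs[OF \<omega>] in \<open>simp add: g'_eq eq[symmetric]\<close>)
        then show ?thesis by (simp add: contract_def)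
      qed
      show "(LINT s:{0..t}|lborel. \<tau> s * (\<integral>\<omega>. contract r (\<lambda>x y. \<alpha> s x y * E x y) (X s \<omega>) \<partial>P)) =
        (LINT s:{0..t}|lborel. (\<integral>\<omega>. contract r (\<lambda>x y. a s x y * g' s x y) (X s \<omega>) \<partial>P))"
        by (rule set_integral_Icc_cong, subst integral_mult_right_zero[symmetric], rule Bochner_Integration.integral_cong[OF refl], rule pt)
      show "time_integrable t P (\<lambda>s \<omega>. \<tau> s * contract r (\<lambda>x y. \<alpha> s x y * E x y) (X s \<omega>))"
        by (rule time_integrable_cong[THEN iffD1, OF _ A(2)]) (simp add: pt)
    qed
    show ?thesis using A(1) B ti decoupled unfolding Y i1 by simp
  qed
  show ?thesis using part1 part2 part3 by (intro conjI allI impI) blast+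
qed

end
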